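(* Let $s\in L_{2,loc}(\mathbb{R}_+)$ be complex-valued and let $L_0$ be the minimal operator constructed from $s$. Suppose there exist two complex-valued functions $f,g\in L_{2,unif}(\mathbb{R}_+)$, a number $d>0$ and real numbers $\alpha,\beta$ with $0\le\beta-\alpha<\pi$, $|\alpha|<\pi$, $|\beta|<\pi$, such that for all $x,t\in\mathbb{R}_+$ with $0\le x-t\le d$ $$\arg\bigl(s(x)+f(x)-s(t)-g(t)\bigr)\in[\alpha,\beta].$$ Then $L_0$ is strictly sectorial. Moreover, in this case $L_0$ has extensions with compact resolvents if and only if $$\forall a>0\quad \lim_{x\to+\infty}\int_x^{x+a}\int_x^{x+a}|s(\xi)-s(\eta)|^2\,d\xi\,d\eta=+\infty .$$
   Context: $\mathbb{R}_+=[0,+\infty)$; the subscript "loc" means the property holds on every segment $[0,R]$. Minimal operator constructed from a complex-valued $s\in L_{2,loc}(\mathbb{R}_+)$: for $y\in AC_{loc}(\mathbb{R}_+)$ put $y^{[1]}=y'-sy$, and if $y^{[1]}\in AC_{loc}(\mathbb{R}_+)$ put $l(y)=-(y^{[1]})'-sy^{[1]}-s^2y$ (a regularization of $-y''+s'y$). Let $$\mathscr{D}_0=\{y\in L_2(\mathbb{R}_+): y,y^{[1]}\in AC_{loc}(\mathbb{R}_+),\ l(y)\in L_2(\mathbb{R}_+),\ y(0)=y^{[1]}(0)=0,\ \operatorname{supp}y\text{ compact}\}.$$ The minimal operator $L_0$ acts in $L_2(\mathbb{R}_+)$ by $L_0y=l(y)$ on the domain $\mathscr{D}_0$. "$L_0$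 has extensions with compact resolvents" means that there is a linear operator $L$ in $L_2(\mathbb{R}_+)$ extending $L_0$ with non-empty resolvent set and with $(L-\lambda)^{-1}$ compact for $\lambda$ in the resolvent set. For $z_0\in\mathbb{C}$ let $\Lambda_{\alpha,\beta}(z_0)=\{z_0+z: z\in\mathbb{C},\ \arg z\in[\alpha,\beta]\}$, where $\arg z\in[\alpha,\beta]$ means $z=re^{i\varphi}$ with some $r\ge0$, $\varphi\in[\alpha,\beta]$ (so $z=0$ is allowed). An operator $L$ with domain $\mathscr{D}(L)$ is strictly sectorial if there are $z_0\in\mathbb{C}$ and $\alpha,\beta$ with $0\le\beta-\alpha<\pi$ such that $(Ly,y)\in\Lambda_{\alpha,\beta}(z_0)$ for all $y\in\mathscr{D}(L)$, $\|y\|=1$. $\sigma\in L_{p,unif}(\mathbb{R}_+)$ ($p\ge1$) means $\sigma\in L_{p,loc}(\mathbb{R}_+)$ and $\sup_{x\in\mathbb{R}_+}\int_x^{x+1}|\sigma(\xi)|^p\,d\xi<+\infty$. *)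

theory Defs
  imports "HOL-Analysis.Analysis"
begin

section \<open>Function classes on the half-line\<close>

definition L2_on :: "real set \<Rightarrow> (real \<Rightarrow> complex) \<Rightarrow> bool" where
  "L2_on S f \<longleftrightarrow> f \<in> borel_measurable (lebesgue_on S) \<and>
     integrable (lebesgue_on S) (\<lambda>x. (cmod (f x))\<^sup>2)"

definition L2_loc :: "(real \<Rightarrow> complex) \<Rightarrow> bool" where
  "L2_loc f \<longleftrightarrow> (\<forall>R\<ge>0. L2_on {0..R} f)"

definition L2_unif :: "(real \<Rightarrow> complex) \<Rightarrow> bool" where
  "L2_unif f \<longleftrightarrow> L2_loc f \<and>
     bdd_above ((\<lambda>x. \<integral>t. (cmod (f t))\<^sup>2 \<partial>lebesgue_on {x..x+1}) ` {0..})"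

text \<open>Absolute continuity on a segment. A pair \<open>(u, v)\<close> in \<open>D\<close> stands for the subinterval
  \<open>[u, v]\<close>; the subintervals may share end points only.\<close>

definition AC_on :: "real \<Rightarrow> real \<Rightarrow> (real \<Rightarrow> complex) \<Rightarrow> bool" where
  "AC_on a b y \<longleftrightarrow> (\<forall>e>0. \<exists>d>0. \<forall>D. finite D \<longrightarrow>
     (\<forall>(u, v)\<in>D. a \<le> u \<and> u \<le> v \<and> v \<le> b) \<longrightarrow>
     pairwise (\<lambda>(u, v) (u', v'). disjnt {u<..<v} {u'<..<v'}) D \<longrightarrow>
     (\<Sum>(u, v)\<in>D. v - u) < d \<longrightarrow>
     (\<Sum>(u, v)\<in>D. cmod (y v - y u)) < e)"

definition AC_loc :: "(real \<Rightarrow> complex) \<Rightarrow> bool" where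
  "AC_loc y \<longleftrightarrow> (\<forall>R\<ge>0. AC_on 0 R y)"

section \<open>The Hilbert space \<open>L\<^sub>2\<close> of the half-line\<close>

lemma L2_on_zero: "L2_on S (\<lambda>x. 0)"
  by (simp add: L2_on_def)

lemma L2_on_add:
  assumes "L2_on S f" "L2_on S g"
  shows "L2_on S (\<lambda>x. f x + g x)"
proof -
  have fg [measurable]: "f \<in> borel_measurable (lebesgue_on S)" "g \<in> borel_measurable (lebesgue_on S)"
    using assms by (simp_all add: L2_on_def)
  have "integrable (lebesgue_on S) (\<lambda>x. (cmod (f x + g x))\<^sup>2)"
  proof (rule Bochner_Integration.integrable_bound)
    show "integrable (lebesgue_on S) (\<lambda>x. 2 * (cmod (f x))\<^sup>2 + 2 * (cmod (g x))\<^sup>2)"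
      using assms by (simp add: L2_on_def)
    have "(cmod (f x + g x))\<^sup>2 \<le> 2 * (cmod (f x))\<^sup>2 + 2 * (cmod (g x))\<^sup>2" for x
    proof -
      have "(cmod (f x + g x))\<^sup>2 \<le> (cmod (f x) + cmod (g x))\<^sup>2"
        by (intro power_mono norm_triangle_ineq) simp
      also have "\<dots> \<le> 2 * (cmod (f x))\<^sup>2 + 2 * (cmod (g x))\<^sup>2"
        using zero_le_power2 [of "cmod (f x) - cmod (g x)"]
        by (simp add: power2_eq_square algebra_simps)
      finally show ?thesis .
    qed
    then show "AE x in lebesgue_on S. norm ((cmod (f x + g x))\<^sup>2)
        \<le> norm (2 * (cmod (f x))\<^sup>2 + 2 * (cmod (g x))\<^sup>2)"
      by simp
  qed measurable
  then show ?thesis by (simp add: L2_on_def)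
qed

lemma L2_on_cmult:
  assumes "L2_on S f"
  shows "L2_on S (\<lambda>x. c * f x)"
  using assms by (auto simp: L2_on_def norm_mult power_mult_distrib)

lemma integrable_L2_product:
  assumes "L2_on S f" "L2_on S g"
  shows "integrable (lebesgue_on S) (\<lambda>x. f x * cnj (g x))"
proof (rule Bochner_Integration.integrable_bound)
  have fg [measurable]: "f \<in> borel_measurable (lebesgue_on S)" "g \<in> borel_measurable (lebesgue_on S)"
    using assms by (simp_all add: L2_on_def)
  have [measurable]: "cnj \<in> borel_measurable borel"
    by (intro borel_measurable_continuous_onI continuous_intros)
  show "(\<lambda>x. f x * cnj (g x)) \<in> borel_measurable (lebesgue_on S)" by measurable
  show "integrable (lebesgue_on S) (\<lambda>x. (cmod (f x))\<^sup>2 + (cmod (g x))\<^sup>2)"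
    using assms by (simp add: L2_on_def)
  have "cmod (f x) * cmod (g x) \<le> (cmod (f x))\<^sup>2 + (cmod (g x))\<^sup>2" for x
    using sum_squares_bound [of "cmod (f x)" "cmod (g x)"]
      mult_nonneg_nonneg [OF norm_ge_zero [of "f x"] norm_ge_zero [of "g x"]] by linarith
  then show "AE x in lebesgue_on S. norm (f x * cnj (g x))
      \<le> norm ((cmod (f x))\<^sup>2 + (cmod (g x))\<^sup>2)"
    by (simp add: norm_mult)
qed

quotient_type l2 = "real \<Rightarrow> complex" / partial:
  "\<lambda>f g. L2_on {0..} f \<and> L2_on {0..} g \<and> (AE x in lebesgue_on {0..}. f x = g x)"
proof (rule part_equivpI)
  show "\<exists>f::real \<Rightarrow> complex. L2_on {0..} f \<and> L2_on {0..} f \<and> (AE x in lebesgue_on {0..}. f x = f x)"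
    using L2_on_zero by auto
qed (auto intro!: sympI transpI elim: AE_mp)

lift_definition scaleC_l2 :: "complex \<Rightarrow> l2 \<Rightarrow> l2" is "\<lambda>c f x. c * f x"
  by (auto intro: L2_on_cmult elim: AE_mp)

lift_definition cinner_l2 :: "l2 \<Rightarrow> l2 \<Rightarrow> complex" is
  "\<lambda>f g. \<integral>x. f x * cnj (g x) \<partial>lebesgue_on {0..}"
proof -
  fix f f' g g' :: "real \<Rightarrow> complex"
  assume a: "L2_on {0..} f \<and> L2_on {0..} f' \<and> (AE x in lebesgue_on {0..}. f x = f' x)"
    and b: "L2_on {0..} g \<and> L2_on {0..} g' \<and> (AE x in lebesgue_on {0..}. g x = g' x)"
  have "AE x in lebesgue_on {0..}. f x * cnj (g x) = f' x * cnj (g' x)"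
    using a b by (auto elim: AE_mp)
  moreover have "(\<lambda>x. f x * cnj (g x)) \<in> borel_measurable (lebesgue_on {0..})"
      "(\<lambda>x. f' x * cnj (g' x)) \<in> borel_measurable (lebesgue_on {0..})"
    using a b integrable_L2_product borel_measurable_integrable by blast+
  ultimately show "(\<integral>x. f x * cnj (g x) \<partial>lebesgue_on {0..}) = (\<integral>x. f' x * cnj (g' x) \<partial>lebesgue_on {0..})"
    by (intro integral_cong_AE) auto
qed

instantiation l2 :: real_vector
begin

lift_definition zero_l2 :: l2 is "\<lambda>x. 0"
  by (simp add: L2_on_zero)

lift_definition plus_l2 :: "l2 \<Rightarrow> l2 \<Rightarrow> l2" is "\<lambda>f g x. f x + g x"
  by (auto intro: L2_on_add elim: AE_mp)

definition "uminus_l2 (f::l2) = scaleC_l2 (-1) f"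
definition "minus_l2 (f::l2) g = f + scaleC_l2 (-1) g"
definition "scaleR_l2 r (f::l2) = scaleC_l2 (of_real r) f"

instance
proof
  fix x y z :: l2 and a b :: real
  show "x + y + z = x + (y + z)"
    by transfer (simp add: L2_on_add add.assoc)
  show "x + y = y + x"
    by transfer (simp add: L2_on_add add.commute)
  show "0 + x = x"
    by transfer simp
  show "- x + x = 0"
    unfolding uminus_l2_def by transfer (simp add: L2_on_zero)
  show "x - y = x + - y"
    by (simp add: minus_l2_def uminus_l2_def)
  show "a *\<^sub>R (x + y) = a *\<^sub>R x + a *\<^sub>R y"
    unfolding scaleR_l2_def
    by transfer (intro conjI L2_on_add L2_on_cmult AE_I2; simp add: distrib_left)
  show "(a + b) *\<^sub>R x = a *\<^sub>R x + b *\<^sub>R x"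
    unfolding scaleR_l2_def
    by transfer (intro conjI L2_on_add L2_on_cmult AE_I2; simp add: distrib_right)
  show "a *\<^sub>R b *\<^sub>R x = (a * b) *\<^sub>R x"
    unfolding scaleR_l2_def
    by transfer (intro conjI L2_on_add L2_on_cmult AE_I2; simp)
  show "1 *\<^sub>R x = x"
    unfolding scaleR_l2_def by transfer simp
qed

end

lemma cinner_l2_self:
  "cinner_l2 x x = of_real (Re (cinner_l2 x x)) \<and> 0 \<le> Re (cinner_l2 x x) \<and>
   (Re (cinner_l2 x x) = 0 \<longleftrightarrow> x = 0)"
proof transfer
  fix f :: "real \<Rightarrow> complex"
  assume "L2_on {0..} f \<and> L2_on {0..} f \<and> (AE x in lebesgue_on {0..}. f x = f x)"
  then have f: "L2_on {0..} f" by simp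
  let ?I = "\<integral>x. (cmod (f x))\<^sup>2 \<partial>lebesgue_on {0..}"
  have eq: "(\<integral>x. f x * cnj (f x) \<partial>lebesgue_on {0..}) = of_real ?I"
    by (simp only: complex_norm_square [symmetric] integral_complex_of_real)
  have "?I = 0 \<longleftrightarrow> (AE x in lebesgue_on {0..}. (cmod (f x))\<^sup>2 = 0)"
    using f by (intro integral_nonneg_eq_0_iff_AE) (auto simp: L2_on_def)
  then have "?I = 0 \<longleftrightarrow> (AE x in lebesgue_on {0..}. f x = 0)" by simp
  moreover have "0 \<le> ?I" by simp
  ultimately show "(\<integral>x. f x * cnj (f x) \<partial>lebesgue_on {0..}) =
      of_real (Re (\<integral>x. f x * cnj (f x) \<partial>lebesgue_on {0..})) \<and>
      0 \<le> Re (\<integral>x. f x * cnj (f x) \<partial>lebesgue_on {0..}) \<and>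
      (Re (\<integral>x. f x * cnj (f x) \<partial>lebesgue_on {0..}) = 0 \<longleftrightarrow>
        L2_on {0..} f \<and> L2_on {0..} (\<lambda>x. 0) \<and> (AE x in lebesgue_on {0..}. f x = 0))"
    unfolding eq using f L2_on_zero by simp
qed

lemma cinner_l2_commute: "cinner_l2 x y = cnj (cinner_l2 y x)"
proof transfer
  fix f g :: "real \<Rightarrow> complex"
  have "cnj (\<integral>x. g x * cnj (f x) \<partial>lebesgue_on {0..}) = (\<integral>x. cnj (g x * cnj (f x)) \<partial>lebesgue_on {0..})"
    by (rule Bochner_Integration.integral_cnj [symmetric])
  then show "(\<integral>x. f x * cnj (g x) \<partial>lebesgue_on {0..}) = cnj (\<integral>x. g x * cnj (f x) \<partial>lebesgue_on {0..})"
    by (simp add: mult.commute)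
qed

lemma cinner_l2_add_left: "cinner_l2 (x + y) z = cinner_l2 x z + cinner_l2 y z"
  by transfer (simp add: distrib_right integrable_L2_product)

lemma cinner_l2_scaleC_left: "cinner_l2 (scaleC_l2 c x) y = c * cinner_l2 x y"
  by transfer (simp add: mult.assoc)

instantiation l2 :: real_inner
begin

definition "inner_l2 f g = Re (cinner_l2 f g)"
definition "norm_l2 f = sqrt (Re (cinner_l2 f f))"
definition "sgn_l2 (f::l2) = f /\<^sub>R norm f"
definition "dist_l2 (f::l2) g = norm (f - g)"
definition [code del]:
  "(uniformity :: (l2 \<times> l2) filter) = (INF e\<in>{0 <..}. principal {(x, y). dist x y < e})"
definition [code del]:
  "open (U :: l2 set) \<longleftrightarrow> (\<forall>x\<in>U. eventually (\<lambda>(x', y). x' = x \<longrightarrow> y \<in> U) uniformity)"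

instance
proof
  fix x y z :: l2 and a :: real
  show "sgn x = x /\<^sub>R norm x"
    by (simp add: sgn_l2_def)
  show "dist x y = norm (x - y)"
    by (simp add: dist_l2_def)
  show "inner x y = inner y x"
    unfolding inner_l2_def by (subst cinner_l2_commute) simp
  show "inner (x + y) z = inner x z + inner y z"
    by (simp add: inner_l2_def cinner_l2_add_left)
  show "inner (a *\<^sub>R x) y = a * inner x y"
    by (simp add: inner_l2_def scaleR_l2_def cinner_l2_scaleC_left)
  show "0 \<le> inner x x" "inner x x = 0 \<longleftrightarrow> x = 0"
    using cinner_l2_self [of x] by (simp_all add: inner_l2_def)
  show "norm x = sqrt (inner x x)"
    by (simp add: norm_l2_def inner_l2_def)
qed (simp_all add: uniformity_l2_def open_l2_def)

end

section \<open>Unbounded operators in \<open>L\<^sub>2\<close>\<close>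

text \<open>An operator, possibly with a non-dense domain, is represented by its graph; its domain is
  \<open>Domain L\<close>, and \<open>L\<close> is extended by \<open>M\<close> iff \<open>L \<subseteq> M\<close>.\<close>

definition linear_operator :: "(l2 \<times> l2) set \<Rightarrow> bool" where
  "linear_operator L \<longleftrightarrow> single_valued L \<and> (0, 0) \<in> L \<and>
     (\<forall>(x, u)\<in>L. \<forall>(y, v)\<in>L. (x + y, u + v) \<in> L) \<and>
     (\<forall>c. \<forall>(x, u)\<in>L. (scaleC_l2 c x, scaleC_l2 c u) \<in> L)"

definition shift_operator :: "(l2 \<times> l2) set \<Rightarrow> complex \<Rightarrow> (l2 \<times> l2) set" where
  "shift_operator L z = {(y, w - scaleC_l2 z y) | y w. (y, w) \<in> L}"

text \<open>\<open>R\<close> is the everywhere defined bounded inverse of \<open>L - z\<close>. Its complex linearity is inherited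
  from \<open>L\<close>.\<close>

definition is_resolvent :: "(l2 \<times> l2) set \<Rightarrow> complex \<Rightarrow> (l2 \<Rightarrow> l2) \<Rightarrow> bool" where
  "is_resolvent L z R \<longleftrightarrow> bounded_linear R \<and> (shift_operator L z)\<inverse> = {(v, R v) | v. True}"

definition resolvent_set :: "(l2 \<times> l2) set \<Rightarrow> complex set" where
  "resolvent_set L = {z. \<exists>R. is_resolvent L z R}"

definition compact_map :: "(l2 \<Rightarrow> l2) \<Rightarrow> bool" where
  "compact_map R \<longleftrightarrow> (\<forall>B. bounded B \<longrightarrow> compact (closure (R ` B)))"

definition has_compact_resolvent :: "(l2 \<times> l2) set \<Rightarrow> bool" where
  "has_compact_resolvent L \<longleftrightarrow> resolvent_set L \<noteq> {} \<and>
     (\<forall>z\<in>resolvent_set L. \<forall>R. is_resolvent L z R \<longrightarrow> compact_map R)"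

definition has_extension_with_compact_resolvent :: "(l2 \<times> l2) set \<Rightarrow> bool" where
  "has_extension_with_compact_resolvent L \<longleftrightarrow>
     (\<exists>M. linear_operator M \<and> L \<subseteq> M \<and> has_compact_resolvent M)"

text \<open>\<open>arg 0\<close> is allowed to be any number.\<close>

definition arg_in :: "complex \<Rightarrow> real \<Rightarrow> real \<Rightarrow> bool" where
  "arg_in z \<alpha> \<beta> \<longleftrightarrow> (\<exists>r \<phi>. 0 \<le> r \<and> \<phi> \<in> {\<alpha>..\<beta>} \<and> z = rcis r \<phi>)"

definition sector :: "real \<Rightarrow> real \<Rightarrow> complex \<Rightarrow> complex set" where
  "sector \<alpha> \<beta> z0 = {z0 + z | z. arg_in z \<alpha> \<beta>}"

definition strictly_sectorial :: "(l2 \<times> l2) set \<Rightarrow> bool" where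
  "strictly_sectorial L \<longleftrightarrow> (\<exists>z0 \<alpha> \<beta>. 0 \<le> \<beta> - \<alpha> \<and> \<beta> - \<alpha> < pi \<and>
     (\<forall>(y, w)\<in>L. norm y = 1 \<longrightarrow> cinner_l2 w y \<in> sector \<alpha> \<beta> z0))"

section \<open>The minimal operator\<close>

text \<open>\<open>u\<close> is the locally absolutely continuous representative of the quasi-derivative
  \<open>y' - s y\<close>, which is itself determined almost everywhere only.\<close>

definition quasi_derivative ::
    "(real \<Rightarrow> complex) \<Rightarrow> (real \<Rightarrow> complex) \<Rightarrow> (real \<Rightarrow> complex) \<Rightarrow> bool" where
  "quasi_derivative s y u \<longleftrightarrow> AC_loc y \<and> AC_loc u \<and>
     (AE x in lebesgue_on {0..}. \<exists>y'. (y has_vector_derivative y') (at x) \<and> u x = y' - s x * y x)"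

text \<open>\<open>w\<close> is \<open>l(y)\<close>, where \<open>u\<close> is the quasi-derivative of \<open>y\<close>.\<close>

definition quasi_differential_expression ::
    "(real \<Rightarrow> complex) \<Rightarrow> (real \<Rightarrow> complex) \<Rightarrow> (real \<Rightarrow> complex) \<Rightarrow> (real \<Rightarrow> complex) \<Rightarrow> bool" where
  "quasi_differential_expression s y u w \<longleftrightarrow> quasi_derivative s y u \<and>
     (AE x in lebesgue_on {0..}. \<exists>u'. (u has_vector_derivative u') (at x) \<and>
        w x = - u' - s x * u x - (s x)\<^sup>2 * y x)"

text \<open>The support is taken in the half-line; values of functions on the negative axis never
  matter.\<close>

definition minimal_operator :: "(real \<Rightarrow> complex) \<Rightarrow> (l2 \<times> l2) set" where
  "minimal_operator s = {(abs_l2 y, abs_l2 w) | y u w.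
     L2_on {0..} y \<and> L2_on {0..} w \<and> quasi_differential_expression s y u w \<and>
     y 0 = 0 \<and> u 0 = 0 \<and> compact (closure {x \<in> {0..}. y x \<noteq> 0})}"

end

theory Submission
  imports Defs
begin

text \<open>Integration by parts turns \<open>(L\<^sub>0 y, y)\<close> into the quadratic form
  \<open>q(y) = \<integral>|y'|\<^sup>2 - \<integral>s (|y|\<^sup>2)'\<close>, so everything depends on the second term. A rotation by
  \<open>e = cis (-\<gamma>)\<close> brings the sector of the hypothesis, enlarged so as to contain the direction of the
  positive half-axis, into a sector symmetric about that axis, of half-angle less than
  \<open>pi / 2\<close>. Such a sector lies in the wedge where the two real functionals
  \<open>T Re z \<plusminus> Im z\<close> are nonnegative. Hence the hypothesis says that the two real functions
  \<open>S = T Re (e s) \<plusminus> Im (e s)\<close> increase over distances up to \<open>d\<close>, up to errors bounded by \<open>|f|\<close>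
  and \<open>|g|\<close>. On an interval of length \<open>d\<close> such a function is an increasing function
  (a running supremum) plus an error dominated by \<open>|f| + |g|\<close>. For an increasing \<open>m\<close> and
  \<open>\<phi> = |y|\<^sup>2 \<ge> 0\<close> vanishing at the ends, \<open>\<integral>m \<phi>' = -\<integral>\<phi> dm\<close> is at most \<open>0\<close>, and more precisely at
  most minus the rise of \<open>m\<close> on a subinterval times the minimum of \<open>\<phi>\<close> there. The error is controlled
  by uniform square integrability and by Sobolev's inequality on short cells, and the windows are glued by the
  partition of unity \<open>cos\<^sup>2 + sin\<^sup>2 = 1\<close> (\<open>form_estimate\<close>). The two signs together give
  \<open>|Im e q(y)| + c \<parallel>y'\<parallel>\<^sup>2 \<le> T Re e q(y) + C \<parallel>y\<parallel>\<^sup>2\<close> (\<open>form_sectorial\<close>), which is strict sectoriality.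

  For the extension, the Friedrichs construction is carried out on the space of test functions,
  which is not complete for the form norm. A Lax--Milgram iteration
  produces approximate solutions of \<open>e q(y, v) + C\<^sub>1 (y, v) = e (k, v)\<close> with arbitrarily small residual
  (\<open>approximate_solution\<close>). These converge in \<open>L\<^sub>2\<close>, and the limit \<open>R k\<close> is a bounded
  linear function of \<open>k\<close>. It is injective because the form is closable (\<open>resolves_injective\<close>).
  So \<open>R\<close> is a resolvent of an operator, and this operator extends \<open>L\<^sub>0\<close>.

  If the oscillation integrals tend to infinity, then so do the rises of the two monotone parts, because they
  and the \<open>L\<^sub>2\<close>-bounded errors determine \<open>s\<close> up to a constant on each cell
  (\<open>oscillation_le_rise\<close>). The rises are weights in the lower bound of the form, so functions
  of bounded form norm have uniformly small tails. On bounded intervals they are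
  equicontinuous in the mean, hence the form balls are totally bounded and \<open>R\<close> is compact
  (\<open>form_balls_compact\<close>).

  Conversely, if the oscillation stays bounded along a sequence of intervals going to infinity, the pigeonhole
  principle gives subintervals of one fixed small length on which \<open>s\<close> is close in \<open>L\<^sub>2\<close> to a constant. There the
  equation \<open>l(\<phi>) = 0\<close> has a solution with \<open>|\<phi> - 1| \<le> 1 / 3\<close>, and cutting it off by a squared
  sine yields elements of the domain of \<open>L\<^sub>0\<close> with disjoint supports whose norms are bounded and bounded
  away from zero and whose images are bounded (\<open>bump_in_minimal_operator\<close>). No
  resolvent of an extension can then be compact.\<close>

section \<open>Absolute continuity and primitives\<close>

lemma negligible_open_cover:
  fixes N :: "real set"
  assumes "negligible N" "e > 0"
  obtains U where "open U" "N \<subseteq> U" "U \<in> lmeasurable" "measure lebesgue U < e"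
proof -
  have N: "N \<in> lmeasurable" "N \<in> sets lebesgue" "measure lebesgue N = 0"
    using assms negligible_iff_measure by (auto simp: fmeasurableD)
  obtain T where T: "open T" "N \<subseteq> T" "(T - N) \<in> lmeasurable" "emeasure lebesgue (T - N) < ennreal e"
    using sets_lebesgue_outer_open[OF N(2) assms(2)] by blast
  have eq: "(T - N) \<union> N = T" using T by auto
  have "(T - N) \<union> N \<in> lmeasurable" using T(3) N(1) by (rule fmeasurable.Un)
  then have "T \<in> lmeasurable" unfolding eq .
  moreover have "measure lebesgue ((T - N) \<union> N) \<le> measure lebesgue (T - N) + measure lebesgue N"
    using T(3) N(1) by (intro measure_Un_le fmeasurableD)
  then have "measure lebesgue T \<le> measure lebesgue (T - N)" unfolding eq N(3) by simp
  moreover have "measure lebesgue (T - N) < e"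
    using T(3,4) assms(2) by (simp add: emeasure_eq_measure2 ennreal_less_iff)
  ultimately show ?thesis using that[OF T(1,2)] by linarith
qed

text \<open>The families of segments over which absolute continuity is tested, named so that they can be
  built from tagged divisions.\<close>

definition nonoverlapping :: "real \<Rightarrow> real \<Rightarrow> (real \<times> real) set \<Rightarrow> bool" where
  "nonoverlapping a b D \<longleftrightarrow> finite D \<and> (\<forall>(u, v)\<in>D. a \<le> u \<and> u \<le> v \<and> v \<le> b) \<and>
     pairwise (\<lambda>(u, v) (u', v'). disjnt {u<..<v} {u'<..<v'}) D"

lemma AC_on_nonoverlapping:
  "AC_on a b y \<longleftrightarrow> (\<forall>e>0. \<exists>d>0. \<forall>D. nonoverlapping a b D \<longrightarrow> (\<Sum>(u, v)\<in>D. v - u) < d \<longrightarrow>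
     (\<Sum>(u, v)\<in>D. cmod (y v - y u)) < e)"
  unfolding AC_on_def nonoverlapping_def by (simp only: imp_conjL)

lemma AC_on_mono:
  assumes "AC_on a b y" "a \<le> c" "d \<le> b"
  shows "AC_on c d y"
proof -
  have "nonoverlapping a b D" if "nonoverlapping c d D" for D
    using that assms(2,3) unfolding nonoverlapping_def by (auto intro: order_trans)
  then show ?thesis using assms(1) unfolding AC_on_nonoverlapping by metis
qed

text \<open>Choose a gauge that is differentiability-fine off the exceptional set \<open>N\<close> and stays inside an open
  set of small measure on \<open>N\<close>. In a fine division the cells tagged off \<open>N\<close> contribute little to the
  difference of the Riemann sum and \<open>y b - y a\<close> by differentiability, the cells tagged in
  \<open>N\<close> by absolute continuity.\<close>

lemma AC_on_has_integral_derivative: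
  assumes ac: "AC_on a b y" and ab: "a \<le> b" and N: "negligible N"
    and der: "\<And>x. x \<in> {a..b} - N \<Longrightarrow> (y has_vector_derivative g x) (at x)"
  shows "(g has_integral (y b - y a)) {a..b}"
proof -
  define g0 where "g0 = (\<lambda>x. if x \<in> N then 0 else g x)"
  have "(g0 has_integral (y b - y a)) {a..b}"
    unfolding has_integral_real
  proof (intro allI impI)
    fix e :: real assume e: "e > 0"
    define e1 where "e1 = e / 2 / (b - a + 1)"
    have e1: "e1 > 0" using e ab by (simp add: e1_def)
    obtain d where d: "d > 0" and dD: "\<And>D. nonoverlapping a b D \<Longrightarrow>
        (\<Sum>(u, v)\<in>D. v - u) < d \<Longrightarrow> (\<Sum>(u, v)\<in>D. cmod (y v - y u)) < e / 2"
      using ac[unfolded AC_on_nonoverlapping, rule_format, of "e / 2"] e by auto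
    obtain U where U: "open U" "N \<subseteq> U" "U \<in> lmeasurable" "measure lebesgue U < d"
      using negligible_open_cover[OF N d] .
    have "\<exists>\<delta>>0. x \<in> {a..b} - N \<longrightarrow> (\<forall>z. \<bar>z - x\<bar> < \<delta> \<longrightarrow> cmod (y z - y x - (z - x) *\<^sub>R g x) \<le> e1 * \<bar>z - x\<bar>)" for x
    proof (cases "x \<in> {a..b} - N")
      case True
      then show ?thesis
        using der[OF True] e1 unfolding has_vector_derivative_def has_derivative_at_alt by auto
    qed (auto intro: exI[of _ 1])
    then obtain \<delta> where \<delta>: "\<And>x. \<delta> x > 0"
      "\<And>x z. x \<in> {a..b} - N \<Longrightarrow> \<bar>z - x\<bar> < \<delta> x \<Longrightarrow> cmod (y z - y x - (z - x) *\<^sub>R g x) \<le> e1 * \<bar>z - x\<bar>"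
      by metis
    define \<gamma> where "\<gamma> = (\<lambda>x. if x \<in> N then U else ball x (\<delta> x))"
    have gauge: "gauge \<gamma>" unfolding gauge_def \<gamma>_def using U \<delta> by auto
    have sum_close: "norm ((\<Sum>(x, k)\<in>p. measure lborel k *\<^sub>R g0 x) - (y b - y a)) < e"
      if p: "p tagged_division_of {a..b}" and fine: "\<gamma> fine p" for p
    proof -
      note pD = tagged_division_ofD[OF p]
      have k: "\<exists>u v. k = {u..v} \<and> u \<le> v \<and> a \<le> u \<and> v \<le> b \<and> Inf k = u \<and> Sup k = v \<and> measure lborel k = v - u \<and> x \<in> {u..v}"
        if xk: "(x, k) \<in> p" for x k
      proof -
        obtain u v where uv: "k = {u..v}" using pD(4)[OF xk] by (auto simp: box_real)
        have "x \<in> k" "k \<subseteq> {a..b}" using pD xk by auto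
        then show ?thesis using uv by (intro exI[of _ u] exI[of _ v]) auto
      qed
      define p1 where "p1 = {(x, k) \<in> p. x \<notin> N}"
      define p2 where "p2 = {(x, k) \<in> p. x \<in> N}"
      have pp: "p = p1 \<union> p2" "p1 \<inter> p2 = {}" "finite p1" "finite p2"
        using pD(1) by (auto simp: p1_def p2_def intro: finite_subset)
      have s1: "(\<Sum>(x, k)\<in>p. y (Sup k) - y (Inf k)) = y b - y a"
        by (rule additive_tagged_division_1[OF ab p])
      have s2: "(\<Sum>(x, k)\<in>p. Sup k - Inf k) = b - a"
        by (rule additive_tagged_division_1[OF ab p, of "\<lambda>x. x"])
      have est1: "cmod (measure lborel k *\<^sub>R g0 x - (y (Sup k) - y (Inf k))) \<le> e1 * (Sup k - Inf k)" if "(x, k) \<in> p1" for x k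
      proof -
        have xk: "(x, k) \<in> p" "x \<notin> N" using that by (auto simp: p1_def)
        obtain u v where uv: "k = {u..v}" "u \<le> v" "a \<le> u" "v \<le> b" "Inf k = u" "Sup k = v" "measure lborel k = v - u" "x \<in> {u..v}"
          using k[OF xk(1)] by blast
        have sub: "k \<subseteq> ball x (\<delta> x)" using fineD[OF fine xk(1)] xk(2) by (simp add: \<gamma>_def)
        then have "u \<in> ball x (\<delta> x)" "v \<in> ball x (\<delta> x)"
          using uv(1,2) by (metis atLeastAtMost_iff order_refl subsetD)+
        then have d: "\<bar>u - x\<bar> < \<delta> x" "\<bar>v - x\<bar> < \<delta> x" by (auto simp: dist_real_def)
        have xx: "x \<in> {a..b} - N" using uv xk by auto
        have "measure lborel k *\<^sub>R g0 x - (y v - y u) = (y u - y x - (u - x) *\<^sub>R g x) - (y v - y x - (v - x) *\<^sub>R g x)"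
          using uv xk by (simp add: g0_def algebra_simps)
        also have "cmod \<dots> \<le> e1 * \<bar>u - x\<bar> + e1 * \<bar>v - x\<bar>"
          by (rule order_trans[OF norm_triangle_ineq4 add_mono[OF \<delta>(2)[OF xx d(1)] \<delta>(2)[OF xx d(2)]]])
        also have "\<dots> = e1 * (v - u)" using uv by (simp add: algebra_simps)
        finally show ?thesis using uv by simp
      qed
      have sub2: "0 \<le> Sup k - Inf k" if "(x, k) \<in> p" for x k using k[OF that] by auto
      have "cmod (\<Sum>(x, k)\<in>p1. measure lborel k *\<^sub>R g0 x - (y (Sup k) - y (Inf k))) \<le> (\<Sum>(x, k)\<in>p1. e1 * (Sup k - Inf k))"
        using est1 by (intro sum_norm_le) auto
      also have "\<dots> = e1 * (\<Sum>(x, k)\<in>p1. (Sup k - Inf k))"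
        by (simp add: sum_distrib_left split_def)
      also have "\<dots> \<le> e1 * (\<Sum>(x, k)\<in>p. (Sup k - Inf k))"
        using pp pD(1) sub2 e1 by (intro mult_left_mono sum_mono2) (auto simp: p2_def)
      also have "\<dots> = e1 * (b - a)" using s2 by simp
      also have "\<dots> < e / 2" using e ab e1 by (simp add: e1_def field_simps)
      finally have E1: "cmod (\<Sum>(x, k)\<in>p1. measure lborel k *\<^sub>R g0 x - (y (Sup k) - y (Inf k))) < e / 2" .
      (* Distinct tags may share a degenerate cell, so passing from cells to pairs of end points is injective
         only up to pairs that contribute nothing. *)
      define h where "h = (\<lambda>(x::real, k::real set). (Inf k, Sup k))"
      define D where "D = h ` p2"
      have inj: "h z = h w \<longrightarrow> fst (h z) = snd (h z)" if zw: "z \<in> p2" "w \<in> p2" "z \<noteq> w" for z w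
      proof
        assume eq: "h z = h w"
        obtain x k x' k' where z: "z = (x, k)" "w = (x', k')" by (metis surj_pair)
        have zp: "(x, k) \<in> p" "(x', k') \<in> p" using zw z by (auto simp: p2_def)
        obtain u v where uv: "k = {u..v}" "u \<le> v" "Inf k = u" "Sup k = v" using k[OF zp(1)] by blast
        obtain u' v' where uv': "k' = {u'..v'}" "u' \<le> v'" "Inf k' = u'" "Sup k' = v'" using k[OF zp(2)] by blast
        have "k = k'" using eq z uv uv' by (simp add: h_def)
        moreover have "interior k \<inter> interior k' = {}" using pD(5)[OF zp] zw z by auto
        ultimately have "interior {u..v} = {}" using uv by simp
        then have "u = v" using uv by (simp add: interior_atLeastAtMost_real)
        then show "fst (h z) = snd (h z)" using z uv by (simp add: h_def)
      qed
      have Dfin: "finite D" using pp D_def by auto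
      have Din: "\<forall>(u, v)\<in>D. a \<le> u \<and> u \<le> v \<and> v \<le> b"
      proof clarify
        fix u v assume "(u, v) \<in> D"
        then obtain x k' where "(x, k') \<in> p" "u = Inf k'" "v = Sup k'" by (auto simp: D_def h_def p2_def)
        then show "a \<le> u \<and> u \<le> v \<and> v \<le> b" using k by metis
      qed
      have Ddisj: "disjnt {u<..<v} {u'<..<v'}"
        if D: "(u, v) \<in> D" "(u', v') \<in> D" and ne: "(u, v) \<noteq> (u', v')" for u v u' v'
      proof -
        obtain x k1 where 1: "(x, k1) \<in> p" "u = Inf k1" "v = Sup k1" using D by (auto simp: D_def h_def p2_def)
        obtain x' k2 where 2: "(x', k2) \<in> p" "u' = Inf k2" "v' = Sup k2" using D by (auto simp: D_def h_def p2_def)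
        have kk: "k1 = {u..v}" "k2 = {u'..v'}" using k[OF 1(1)] k[OF 2(1)] 1 2 by auto
        have "(x, k1) \<noteq> (x', k2)" using ne 1 2 by auto
        then have "interior k1 \<inter> interior k2 = {}" using pD(5)[OF 1(1) 2(1)] by auto
        then show "disjnt {u<..<v} {u'<..<v'}" unfolding disjnt_def kk by (simp add: interior_atLeastAtMost_real)
      qed
      have Dpw: "pairwise (\<lambda>(u, v) (u', v'). disjnt {u<..<v} {u'<..<v'}) D"
        using Ddisj by (simp add: pairwise_def split_def prod_eq_iff)
      have DU: "{u<..<v} \<subseteq> U" if uvD: "(u, v) \<in> D" for u v
      proof -
        obtain x k1 where 1: "(x, k1) \<in> p" "x \<in> N" "u = Inf k1" "v = Sup k1" using uvD by (auto simp: D_def h_def p2_def)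
        have "k1 \<subseteq> U" using fineD[OF fine 1(1)] 1(2) by (simp add: \<gamma>_def)
        moreover have "k1 = {u..v}" using k[OF 1(1)] 1 by auto
        ultimately show ?thesis by auto
      qed
      have "(\<Sum>(u, v)\<in>D. v - u) = (\<Sum>i\<in>D. measure lebesgue ((\<lambda>(u, v). {u<..<v}) i))"
        using Din by (intro sum.cong) auto
      also have "\<dots> = measure lebesgue (\<Union>i\<in>D. (\<lambda>(u, v). {u<..<v}) i)"
      proof (rule measure_finite_Union[symmetric, OF Dfin])
        show "disjoint_family_on (\<lambda>(u, v). {u<..<v}) D"
          using Dpw unfolding disjoint_family_on_def pairwise_def disjnt_def by fast
        show "emeasure lebesgue ((\<lambda>(u, v). {u<..<v}) i) \<noteq> \<infinity>" if "i \<in> D" for i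
          using Din that by (auto simp: ennreal_neq_top)
      qed auto
      also have "\<dots> \<le> measure lebesgue U"
        using DU U by (intro measure_mono_fmeasurable) (auto intro!: sets.finite_UN Dfin)
      also have "\<dots> < d" by fact
      finally have "(\<Sum>(u, v)\<in>D. cmod (y v - y u)) < e / 2" 
        by (intro dD) (simp add: nonoverlapping_def Dfin Din Dpw)
      moreover have "(\<Sum>(u, v)\<in>D. cmod (y v - y u)) = (\<Sum>(x, k)\<in>p2. cmod (y (Sup k) - y (Inf k)))"
      proof -
        define F where "F = (\<lambda>z::real \<times> real. cmod (y (snd z) - y (fst z)))"
        have "sum F (h ` p2) = sum (F \<circ> h) p2"
        proof (rule sum.reindex_nontrivial[OF pp(4)])
          show "F (h z) = 0" if "z \<in> p2" "w \<in> p2" "z \<noteq> w" "h z = h w" for z w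
            using inj[OF that(1-3)] that(4) by (simp add: F_def)
        qed
        then show ?thesis by (simp add: D_def F_def h_def split_def o_def)
      qed
      ultimately have E2: "(\<Sum>(x, k)\<in>p2. cmod (y (Sup k) - y (Inf k))) < e / 2" by simp
      have "cmod (\<Sum>(x, k)\<in>p2. measure lborel k *\<^sub>R g0 x - (y (Sup k) - y (Inf k))) \<le> (\<Sum>(x, k)\<in>p2. cmod (y (Sup k) - y (Inf k)))"
        by (intro sum_norm_le) (auto simp: p2_def g0_def norm_minus_commute)
      with E2 have E2': "cmod (\<Sum>(x, k)\<in>p2. measure lborel k *\<^sub>R g0 x - (y (Sup k) - y (Inf k))) < e / 2" by simp
      have "(\<Sum>(x, k)\<in>p. measure lborel k *\<^sub>R g0 x) - (y b - y a) = (\<Sum>(x, k)\<in>p. measure lborel k *\<^sub>R g0 x - (y (Sup k) - y (Inf k)))"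
        unfolding s1[symmetric] by (simp add: sum_subtractf split_def)
      also have "\<dots> = (\<Sum>(x, k)\<in>p1. measure lborel k *\<^sub>R g0 x - (y (Sup k) - y (Inf k))) + (\<Sum>(x, k)\<in>p2. measure lborel k *\<^sub>R g0 x - (y (Sup k) - y (Inf k)))"
        unfolding pp(1) by (rule sum.union_disjoint) (use pp in auto)
      also have "cmod \<dots> < e"
        using norm_triangle_lt[OF add_strict_mono[OF E1 E2']] by simp
      finally show ?thesis .
    qed
    show "\<exists>\<gamma>. gauge \<gamma> \<and> (\<forall>p. p tagged_division_of {a..b} \<and> \<gamma> fine p \<longrightarrow>
        norm ((\<Sum>(x, k)\<in>p. measure lborel k *\<^sub>R g0 x) - (y b - y a)) < e)"
      using gauge sum_close by (intro exI[of _ \<gamma>] conjI allI impI) simp_all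
  qed
  then show ?thesis
    by (rule has_integral_spike[OF N, rotated]) (auto simp: g0_def)
qed

text \<open>Local absolute continuity in the form used below: a function together with an integrable representative of
  its derivative. By \<open>primitive_onI_AC\<close> and \<open>primitive_on_imp_AC_on\<close> it is equivalent to the definition by
  \<open>\<epsilon>\<close> and \<open>\<delta>\<close>, and it is preserved by algebraic operations for simpler reasons.\<close>

definition primitive_on :: "real \<Rightarrow> real \<Rightarrow> (real \<Rightarrow> complex) \<Rightarrow> (real \<Rightarrow> complex) \<Rightarrow> bool" where
  "primitive_on a b g y \<longleftrightarrow> g absolutely_integrable_on {a..b} \<and>
     (\<forall>x\<in>{a..b}. (g has_integral (y x - y a)) {a..x})"

lemma primitive_onI_AC:
  assumes ac: "AC_on a b y" and N: "negligible N" and g: "g absolutely_integrable_on {a..b}"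
    and der: "\<And>x. x \<in> {a..b} - N \<Longrightarrow> (y has_vector_derivative g x) (at x)"
  shows "primitive_on a b g y"
  unfolding primitive_on_def
proof (intro conjI ballI g)
  fix x assume x: "x \<in> {a..b}"
  have "AC_on a x y" by (rule AC_on_mono[OF ac]) (use x in auto)
  then show "(g has_integral (y x - y a)) {a..x}"
    by (rule AC_on_has_integral_derivative[OF _ _ N]) (use x der in auto)
qed

lemma has_integral_imp_right_derivative:
  fixes f :: "real \<Rightarrow> complex"
  assumes "\<And>a b. f integrable_on {a..b}"
  obtains N where "negligible N"
    "\<forall>x e. x \<notin> N \<longrightarrow> 0 < e \<longrightarrow>
       (\<exists>d>0. \<forall>h. 0 < h \<and> h < d \<longrightarrow> norm (integral {x..x + h} f - h *\<^sub>R f x) \<le> e * h)"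
proof -
  obtain N where N: "negligible N" "\<And>x e. \<lbrakk>x \<notin> N; 0 < e\<rbrakk> \<Longrightarrow>
       \<exists>d>0. \<forall>h. 0 < h \<and> h < d \<longrightarrow> norm (integral {x..x + h} f /\<^sub>R h - f x) < e"
    using integrable_ccontinuous_explicit[of f] assms by (auto simp: box_real)
  show ?thesis
  proof (rule that[OF N(1)], intro allI impI)
    fix x e :: real assume "x \<notin> N" "0 < e"
    then obtain d where d: "d > 0" "\<forall>h. 0 < h \<and> h < d \<longrightarrow> norm (integral {x..x + h} f /\<^sub>R h - f x) < e"
      using N(2) by blast
    have "norm (integral {x..x + h} f - h *\<^sub>R f x) \<le> e * h" if h: "0 < h" "h < d" for h
    proof -
      have "integral {x..x + h} f - h *\<^sub>R f x = h *\<^sub>R (integral {x..x + h} f /\<^sub>R h - f x)"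
        using h by (simp add: algebra_simps)
      then have "norm (integral {x..x + h} f - h *\<^sub>R f x) = h * norm (integral {x..x + h} f /\<^sub>R h - f x)"
        using h by (simp del: scaleR_right_diff_distrib)
      also have "\<dots> \<le> h * e" using d h by (intro mult_left_mono) (auto intro: less_imp_le)
      finally show ?thesis by (simp add: mult.commute)
    qed
    then show "\<exists>d>0. \<forall>h. 0 < h \<and> h < d \<longrightarrow> norm (integral {x..x + h} f - h *\<^sub>R f x) \<le> e * h" using d by blast
  qed
qed

text \<open>Lebesgue differentiation from the right is applied to \<open>g\<close> and to its reflection, which gives the left
  derivative.\<close>

lemma primitive_has_derivative_AE:
  assumes P: "primitive_on a b g y"
  obtains N where "negligible N" "\<forall>x\<in>{a..b} - N. x \<in> {a<..<b} \<and> (y has_vector_derivative g x) (at x)"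
proof -
  define f where "f = (\<lambda>x. if x \<in> {a..b} then g x else 0)"
  have "f integrable_on UNIV"
    using P unfolding primitive_on_def f_def integrable_restrict_UNIV absolutely_integrable_on_def by blast
  then have fi: "f integrable_on {c..d}" for c d
    by (rule integrable_on_subinterval) auto
  have fi': "(\<lambda>x. f (- x)) integrable_on {c..d}" for c d
    using fi[of "-d" "-c"] Henstock_Kurzweil_Integration.integrable_reflect_real[where f=f and a="-d" and b="-c"] by simp
  obtain N1 where N1: "negligible N1" "\<forall>x e. x \<notin> N1 \<longrightarrow> 0 < e \<longrightarrow>
       (\<exists>d>0. \<forall>h. 0 < h \<and> h < d \<longrightarrow> norm (integral {x..x + h} f - h *\<^sub>R f x) \<le> e * h)"
    by (rule has_integral_imp_right_derivative[of f, OF fi]) blast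
  obtain N2 where N2: "negligible N2" "\<forall>x e. x \<notin> N2 \<longrightarrow> 0 < e \<longrightarrow>
       (\<exists>d>0. \<forall>h. 0 < h \<and> h < d \<longrightarrow> norm (integral {x..x + h} (\<lambda>x. f (- x)) - h *\<^sub>R f (- x)) \<le> e * h)"
    by (rule has_integral_imp_right_derivative[of "\<lambda>x. f (- x)", OF fi']) blast
  define N where "N = N1 \<union> uminus ` N2 \<union> {a, b}"
  have "negligible (uminus ` N2)"
    by (rule negligible_differentiable_image_negligible[OF _ N2(1)]) (auto intro!: derivative_intros simp: differentiable_on_def)
  then have "negligible N" unfolding N_def using N1 by (auto intro!: negligible_Un negligible_finite)
  moreover have "\<forall>x\<in>{a..b} - N. x \<in> {a<..<b} \<and> (y has_vector_derivative g x) (at x)"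
  proof (intro ballI conjI)
    fix x assume x: "x \<in> {a..b} - N"
    show xab: "x \<in> {a<..<b}" using x by (auto simp: N_def)
    have xN: "x \<notin> N1" "- x \<notin> N2" using x by (auto simp: N_def image_iff)
    have yint: "y v - y u = integral {u..v} f" if uv: "a \<le> u" "u \<le> v" "v \<le> b" for u v
    proof -
      have 1: "(g has_integral y u - y a) {a..u}" "(g has_integral y v - y a) {a..v}"
        using P uv unfolding primitive_on_def by auto
      have "g integrable_on {a..v}" using 1 by blast
      then have "integral {a..u} g + integral {u..v} g = integral {a..v} g"
        using uv by (intro Henstock_Kurzweil_Integration.integral_combine) auto
      then have "y v - y u = integral {u..v} g" using 1[THEN integral_unique] by (simp add: algebra_simps)
      also have "\<dots> = integral {u..v} f" using uv by (intro integral_cong) (auto simp: f_def)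
      finally show ?thesis .
    qed
    have fx: "f x = g x" using xab by (auto simp: f_def)
    show "(y has_vector_derivative g x) (at x)"
      unfolding has_vector_derivative_def has_derivative_at_alt
    proof (intro conjI allI impI)
      show "bounded_linear (\<lambda>xa. xa *\<^sub>R g x)" by (rule bounded_linear_scaleR_left)
      fix e :: real assume e: "0 < e"
      obtain d1 where d1: "d1 > 0" "\<And>h. 0 < h \<and> h < d1 \<Longrightarrow> norm (integral {x..x + h} f - h *\<^sub>R f x) \<le> e * h"
        using N1(2)[rule_format, OF xN(1) e] by auto
      obtain d2 where d2: "d2 > 0" "\<And>h. 0 < h \<and> h < d2 \<Longrightarrow> norm (integral {- x..- x + h} (\<lambda>x. f (- x)) - h *\<^sub>R f (- (- x))) \<le> e * h"
        using N2(2)[rule_format, OF xN(2) e] by auto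
      define d where "d = Min {d1, d2, x - a, b - x}"
      have d: "d > 0" "d \<le> d1" "d \<le> d2" "d \<le> x - a" "d \<le> b - x" using d1 d2 xab by (auto simp: d_def)
      show "\<exists>d>0. \<forall>z. norm (z - x) < d \<longrightarrow> norm (y z - y x - (z - x) *\<^sub>R g x) \<le> e * norm (z - x)"
      proof (intro exI[of _ d] conjI d(1) allI impI)
        fix z assume z: "norm (z - x) < d"
        consider "z = x" | "z > x" | "z < x" by linarith
        then show "norm (y z - y x - (z - x) *\<^sub>R g x) \<le> e * norm (z - x)"
        proof cases
          case 2
          have "norm (integral {x..x + (z - x)} f - (z - x) *\<^sub>R f x) \<le> e * (z - x)"
            by (rule d1) (use 2 z d in auto)
          moreover have "y z - y x = integral {x..z} f" by (rule yint) (use 2 z d xab in auto)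
          ultimately show ?thesis using 2 fx by simp
        next
          case 3
          have "norm (integral {- x..- x + (x - z)} (\<lambda>x. f (- x)) - (x - z) *\<^sub>R f (- (- x))) \<le> e * (x - z)"
            by (rule d2) (use 3 z d in auto)
          moreover have "integral {- x..- x + (x - z)} (\<lambda>x. f (- x)) = integral {z..x} f"
            using Henstock_Kurzweil_Integration.integral_reflect_real[where f=f and a=z and b=x] by simp
          moreover have "y x - y z = integral {z..x} f" by (rule yint) (use 3 z d xab in auto)
          ultimately have "norm (y x - y z - (x - z) *\<^sub>R g x) \<le> e * (x - z)" using fx by simp
          moreover have "y z - y x - (z - x) *\<^sub>R g x = - (y x - y z - (x - z) *\<^sub>R g x)" by (simp add: algebra_simps)
          ultimately show ?thesis using 3 by (metis abs_minus_commute abs_of_pos diff_gt_0_iff_gt norm_minus_cancel real_norm_def)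
        qed auto
      qed
    qed
  qed
  ultimately show ?thesis by (rule that)
qed

lemma primitive_on_diff:
  assumes "primitive_on a b g y" "a \<le> u" "u \<le> v" "v \<le> b"
  shows "(g has_integral (y v - y u)) {u..v}"
proof -
  have 1: "(g has_integral y u - y a) {a..u}" "(g has_integral y v - y a) {a..v}"
    using assms unfolding primitive_on_def by auto
  have gi: "g integrable_on {a..v}" using 1 by blast
  then have "integral {a..u} g + integral {u..v} g = integral {a..v} g"
    using assms by (intro Henstock_Kurzweil_Integration.integral_combine) auto
  then have "integral {u..v} g = y v - y u" using 1[THEN integral_unique] by (simp add: algebra_simps)
  moreover have "g integrable_on {u..v}" by (rule integrable_on_subinterval[OF gi]) (use assms in auto)
  ultimately show ?thesis by (simp add: has_integral_iff)
qed

lemma primitive_on_subinterval: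
  assumes "primitive_on a b g y" "a \<le> c" "d \<le> b"
  shows "primitive_on c d g y"
  unfolding primitive_on_def
proof (intro conjI ballI)
  show "g absolutely_integrable_on {c..d}"
    by (rule absolutely_integrable_on_subinterval) (use assms in \<open>auto simp: primitive_on_def\<close>)
  show "(g has_integral y x - y c) {c..x}" if "x \<in> {c..d}" for x
    by (rule primitive_on_diff[OF assms(1)]) (use that assms in auto)
qed

lemma primitive_on_add:
  "primitive_on a b g y \<Longrightarrow> primitive_on a b h v \<Longrightarrow> primitive_on a b (\<lambda>x. g x + h x) (\<lambda>x. y x + v x)"
  unfolding primitive_on_def
  by (auto simp: add_diff_add intro: set_integral_add has_integral_add)

lemma primitive_on_cmult:
  "primitive_on a b g y \<Longrightarrow> primitive_on a b (\<lambda>x. c * g x) (\<lambda>x. c * y x)"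
  unfolding primitive_on_def right_diff_distrib[symmetric]
  by (auto intro: has_integral_mult_right)

lemma primitive_on_cnj:
  assumes "primitive_on a b g y"
  shows "primitive_on a b (\<lambda>x. cnj (g x)) (\<lambda>x. cnj (y x))"
  unfolding primitive_on_def complex_cnj_diff[symmetric]
proof (intro conjI ballI)
  have "g absolutely_integrable_on {a..b}" using assms by (simp add: primitive_on_def)
  then show "(\<lambda>x. cnj (g x)) absolutely_integrable_on {a..b}"
    using absolutely_integrable_linear[OF _ bounded_linear_cnj] by (fastforce simp: o_def)
  show "((\<lambda>x. cnj (g x)) has_integral cnj (y x - y a)) {a..x}" if "x \<in> {a..b}" for x
    using assms that has_integral_cnj[of g "y x - y a" "{a..x}"] by (simp add: primitive_on_def o_def)
qed

lemma primitive_on_smooth: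
  assumes der: "\<And>x. x \<in> {a..b} \<Longrightarrow> (y has_vector_derivative g x) (at x)"
    and cont: "continuous_on {a..b} g"
  shows "primitive_on a b g y"
  unfolding primitive_on_def
proof (intro conjI ballI)
  show "g absolutely_integrable_on {a..b}" by (rule absolutely_integrable_continuous_real[OF cont])
  show "(g has_integral y x - y a) {a..x}" if "x \<in> {a..b}" for x
    by (rule fundamental_theorem_of_calculus) (use that der in \<open>auto intro: has_vector_derivative_at_within\<close>)
qed

lemma primitive_on_continuous:
  assumes "primitive_on a b g y"
  shows "continuous_on {a..b} y"
proof -
  have "g integrable_on {a..b}"
    using assms by (auto simp: primitive_on_def absolutely_integrable_on_def)
  then have "continuous_on {a..b} (\<lambda>x. y a + integral {a..x} g)"
    by (intro continuous_intros indefinite_integral_continuous_1)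
  moreover have "y a + integral {a..x} g = y x" if "x \<in> {a..b}" for x
    using assms that by (auto simp: primitive_on_def dest!: bspec[of _ _ x] integral_unique)
  ultimately show ?thesis by (rule continuous_on_eq)
qed

lemma continuous_on_bounded_interval:
  fixes y :: "real \<Rightarrow> complex"
  assumes "continuous_on {a..b} y"
  obtains C where "C > 0" "\<And>x. x \<in> {a..b} \<Longrightarrow> cmod (y x) \<le> C"
proof -
  have "bounded (y ` {a..b})" using assms by (intro compact_imp_bounded compact_continuous_image) auto
  then show ?thesis using that unfolding bounded_pos by auto
qed

lemma AC_on_mult:
  assumes f: "AC_on a b f" and g: "AC_on a b g"
    and bf: "\<And>x. x \<in> {a..b} \<Longrightarrow> cmod (f x) \<le> C" and bg: "\<And>x. x \<in> {a..b} \<Longrightarrow> cmod (g x) \<le> C" and C: "C > 0"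
  shows "AC_on a b (\<lambda>x. f x * g x)"
  unfolding AC_on_nonoverlapping
proof (intro allI impI)
  fix e :: real assume e: "e > 0"
  have e': "e / 2 / C > 0" using e C by simp
  obtain d1 where d1: "d1 > 0" "\<And>D. nonoverlapping a b D \<Longrightarrow> (\<Sum>(u, v)\<in>D. v - u) < d1 \<Longrightarrow> (\<Sum>(u, v)\<in>D. cmod (f v - f u)) < e / 2 / C"
    using f[unfolded AC_on_nonoverlapping, rule_format, OF e'] by auto
  obtain d2 where d2: "d2 > 0" "\<And>D. nonoverlapping a b D \<Longrightarrow> (\<Sum>(u, v)\<in>D. v - u) < d2 \<Longrightarrow> (\<Sum>(u, v)\<in>D. cmod (g v - g u)) < e / 2 / C"
    using g[unfolded AC_on_nonoverlapping, rule_format, OF e'] by auto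
  show "\<exists>d>0. \<forall>D. nonoverlapping a b D \<longrightarrow> (\<Sum>(u, v)\<in>D. v - u) < d \<longrightarrow> (\<Sum>(u, v)\<in>D. cmod (f v * g v - f u * g u)) < e"
  proof (intro exI[of _ "min d1 d2"] conjI allI impI)
    show "min d1 d2 > 0" using d1 d2 by auto
    fix D assume D: "nonoverlapping a b D" and len: "(\<Sum>(u, v)\<in>D. v - u) < min d1 d2"
    have "(\<Sum>(u, v)\<in>D. cmod (f v * g v - f u * g u)) \<le> (\<Sum>(u, v)\<in>D. C * cmod (f v - f u) + C * cmod (g v - g u))"
    proof (rule sum_mono, clarify)
      fix u v assume "(u, v) \<in> D"
      then have uv: "u \<in> {a..b}" "v \<in> {a..b}" using D unfolding nonoverlapping_def by fastforce+
      have "f v * g v - f u * g u = (f v - f u) * g v + f u * (g v - g u)" by (simp add: algebra_simps)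
      also have "cmod \<dots> \<le> cmod (f v - f u) * cmod (g v) + cmod (f u) * cmod (g v - g u)"
        by (metis norm_mult norm_triangle_ineq)
      also have "\<dots> \<le> cmod (f v - f u) * C + C * cmod (g v - g u)"
        using bf[OF uv(1)] bg[OF uv(2)] by (intro add_mono mult_left_mono mult_right_mono) auto
      finally show "cmod (f v * g v - f u * g u) \<le> C * cmod (f v - f u) + C * cmod (g v - g u)"
        by (simp add: mult.commute)
    qed
    also have "\<dots> = C * (\<Sum>(u, v)\<in>D. cmod (f v - f u)) + C * (\<Sum>(u, v)\<in>D. cmod (g v - g u))"
      by (simp add: split_def sum.distrib sum_distrib_left)
    also have "\<dots> < C * (e / 2 / C) + C * (e / 2 / C)"
      using d1(2)[OF D] d2(2)[OF D] len C by (intro add_strict_mono mult_strict_left_mono) auto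
    also have "\<dots> = e" using C by simp
    finally show "(\<Sum>(u, v)\<in>D. cmod (f v * g v - f u * g u)) < e" .
  qed
qed

lemma absolutely_integrable_tail_small:
  fixes g :: "real \<Rightarrow> complex"
  assumes g: "g absolutely_integrable_on {a..b}" and e: "e > 0"
  obtains n :: nat where "(\<lambda>x. if cmod (g x) \<le> n then 0 else cmod (g x)) integrable_on {a..b}"
    "integral {a..b} (\<lambda>x. if cmod (g x) \<le> n then 0 else cmod (g x)) < e"
proof -
  let ?M = "lebesgue_on {a..b}"
  let ?G = "\<lambda>n::nat. \<lambda>x. if cmod (g x) \<le> n then 0 else cmod (g x)"
  have gi: "integrable ?M g" using g by (intro absolutely_integrable_imp_integrable) auto
  then have [measurable]: "g \<in> borel_measurable ?M" by auto
  have lim: "(\<lambda>n. integral\<^sup>L ?M (?G n)) \<longlonglongrightarrow> integral\<^sup>L ?M (\<lambda>x. 0::real)"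
  proof (rule integral_dominated_convergence[where w = "\<lambda>x. cmod (g x)"])
    have "(\<lambda>n. ?G n x) \<longlonglongrightarrow> 0" for x
    proof (rule tendsto_eventually)
      show "\<forall>\<^sub>F n in sequentially. ?G n x = 0"
        using eventually_ge_at_top[of "nat \<lceil>cmod (g x)\<rceil>"] by eventually_elim (simp add: nat_ceiling_le_eq)
    qed
    then show "AE x in ?M. (\<lambda>n. ?G n x) \<longlonglongrightarrow> 0" by simp
  qed (use gi in \<open>auto\<close>)
  have Gi: "integrable ?M (?G n)" for n
    by (rule Bochner_Integration.integrable_bound[OF integrable_norm[OF gi]]) auto
  have "\<forall>\<^sub>F n in sequentially. integral\<^sup>L ?M (?G n) < e"
    using lim e by (intro order_tendstoD) auto
  then obtain n where n: "integral\<^sup>L ?M (?G n) < e" by (auto simp: eventually_sequentially)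
  show ?thesis
    by (rule that[of n]) (use n Gi in \<open>auto simp: lebesgue_integral_eq_integral intro: integrable_on_lebesgue_on\<close>)
qed

text \<open>Split \<open>|g|\<close> into a part bounded by \<open>n\<close>, whose integral over segments of total length \<open>\<delta>\<close> is at most
  \<open>n \<delta>\<close>, and a part whose integral over the whole of \<open>[a, b]\<close> is small.\<close>

lemma primitive_on_imp_AC_on:
  assumes P: "primitive_on a b g y"
  shows "AC_on a b y"
  unfolding AC_on_nonoverlapping
proof (intro allI impI)
  fix e :: real assume e: "e > 0"
  have g: "g absolutely_integrable_on {a..b}" using P by (simp add: primitive_on_def)
  obtain n :: nat where Gi: "(\<lambda>x. if cmod (g x) \<le> n then 0 else cmod (g x)) integrable_on {a..b}"
    and Gn: "integral {a..b} (\<lambda>x. if cmod (g x) \<le> n then 0 else cmod (g x)) < e / 2"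
    using absolutely_integrable_tail_small[OF g, of "e / 2"] e by auto
  define G where "G = (\<lambda>x. if cmod (g x) \<le> n then 0 else cmod (g x))"
  note Gi = Gi[folded G_def] and Gn = Gn[folded G_def]
  have G0: "0 \<le> G x" "cmod (g x) \<le> G x + n" for x by (auto simp: G_def)
  have ki: "(\<lambda>x. cmod (g x)) integrable_on {a..b}" using g by (simp add: absolutely_integrable_on_def)
  show "\<exists>d>0. \<forall>D. nonoverlapping a b D \<longrightarrow> (\<Sum>(u, v)\<in>D. v - u) < d \<longrightarrow> (\<Sum>(u, v)\<in>D. cmod (y v - y u)) < e"
  proof (intro exI[of _ "e / 2 / (real n + 1)"] conjI allI impI)
    show "e / 2 / (real n + 1) > 0" using e by simp
    fix D assume D: "nonoverlapping a b D" and len: "(\<Sum>(u, v)\<in>D. v - u) < e / 2 / (real n + 1)"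
    have fin: "finite D" and Dle: "\<And>u v. (u, v) \<in> D \<Longrightarrow> a \<le> u \<and> u \<le> v \<and> v \<le> b"
      and disj: "\<And>u v u' v'. (u, v) \<in> D \<Longrightarrow> (u', v') \<in> D \<Longrightarrow> (u, v) \<noteq> (u', v') \<Longrightarrow> {u<..<v} \<inter> {u'<..<v'} = {}"
      using D unfolding nonoverlapping_def pairwise_def disjnt_def by fast+
    define I where "I = (\<lambda>(u::real, v) x. if x \<in> {u<..<v} then 1 else 0 :: real)"
    have restr: "(\<lambda>x. I p x * k x) integrable_on {a..b} \<and> integral {a..b} (\<lambda>x. I p x * k x) = integral {fst p..snd p} k"
      if p: "p \<in> D" and k: "k integrable_on {a..b}" for p and k :: "real \<Rightarrow> real"
    proof -
      obtain u v where uv: "p = (u, v)" by (cases p)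
      have le: "a \<le> u" "u \<le> v" "v \<le> b" using Dle[of u v] p uv by auto
      have ii: "k integrable_on {u..v}" by (rule integrable_on_subinterval[OF k]) (use le in auto)
      have eq: "(\<lambda>x. I p x * k x) = (\<lambda>x. if x \<in> {u<..<v} then k x else 0)"
        by (auto simp: I_def uv)
      have "((\<lambda>x. if x \<in> {u<..<v} then k x else 0) has_integral (integral {u..v} k)) {a..b}"
      proof -
        have "(k has_integral (integral {u..v} k)) {u<..<v}"
          using integrable_integral[OF ii] by (simp add: has_integral_Icc_iff_Ioo)
        then show ?thesis
          using has_integral_restrict[of "{u<..<v}" "{a..b}" k] le by (force)
      qed
      then show ?thesis using uv eq by (auto simp: has_integral_iff)
    qed
    have Ii: "(\<lambda>x. I p x) integrable_on {a..b}" if "p \<in> D" for p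
      using restr[OF that, of "\<lambda>x. 1"] by (simp add: integrable_on_const)
    have Iv: "integral {a..b} (\<lambda>x. I p x) = snd p - fst p" if "p \<in> D" for p
      using restr[OF that, of "\<lambda>x. 1"] Dle[of "fst p" "snd p"] that by (simp add: integrable_on_const)
    have "(\<Sum>(u, v)\<in>D. cmod (y v - y u)) \<le> (\<Sum>p\<in>D. integral {a..b} (\<lambda>x. I p x * cmod (g x)))"
    proof (rule sum_mono, clarify)
      fix u v assume uv: "(u, v) \<in> D"
      have "y v - y u = integral {u..v} g"
        using primitive_on_diff[OF P, of u v] Dle[OF uv] by (simp add: integral_unique)
      also have "cmod \<dots> \<le> integral {u..v} (\<lambda>x. cmod (g x))"
        by (rule integral_norm_bound_integral)
           (use Dle[OF uv] primitive_on_subinterval[OF P, of u v] in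
            \<open>auto simp: primitive_on_def absolutely_integrable_on_def\<close>)
      also have "\<dots> = integral {a..b} (\<lambda>x. I (u, v) x * cmod (g x))" using restr[OF uv ki] by simp
      finally show "cmod (y v - y u) \<le> integral {a..b} (\<lambda>x. I (u, v) x * cmod (g x))" .
    qed
    also have "\<dots> = integral {a..b} (\<lambda>x. \<Sum>p\<in>D. I p x * cmod (g x))"
      using restr ki fin by (subst integral_sum) auto
    also have "\<dots> \<le> integral {a..b} (\<lambda>x. G x + n * (\<Sum>p\<in>D. I p x))"
    proof (rule integral_le)
      show "(\<lambda>x. \<Sum>p\<in>D. I p x * cmod (g x)) integrable_on {a..b}"
        using restr ki by (intro integrable_sum fin) auto
      show "(\<lambda>x. G x + n * (\<Sum>p\<in>D. I p x)) integrable_on {a..b}"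
        by (rule integrable_add[OF Gi integrable_on_mult_right[OF integrable_sum[OF fin Ii]]])
      fix x assume "x \<in> {a..b}"
      show "(\<Sum>p\<in>D. I p x * cmod (g x)) \<le> G x + n * (\<Sum>p\<in>D. I p x)"
      proof (cases "\<exists>p\<in>D. I p x \<noteq> 0")
        case True
        then obtain p where p: "p \<in> D" "I p x \<noteq> 0" by blast
        have z: "I q x = 0" if "q \<in> D" "q \<noteq> p" for q
          using p that disj[of "fst p" "snd p" "fst q" "snd q"] by (auto simp: I_def split_def split: if_splits)
        have one: "I p x = 1" using p by (auto simp: I_def split_def split: if_splits)
        have k: "(\<Sum>p\<in>D. I p x * k) = k" for k :: real
          using sum.remove[OF fin p(1), of "\<lambda>p. I p x * k"] z one by simp
        show ?thesis using G0(2)[of x] k[of "cmod (g x)"] k[of 1] by simp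
      next
        case False
        then have "\<And>p. p \<in> D \<Longrightarrow> I p x = 0" by blast
        then show ?thesis using G0 by simp
      qed
    qed
    also have "\<dots> = integral {a..b} G + integral {a..b} (\<lambda>x. n * (\<Sum>p\<in>D. I p x))"
      by (rule Henstock_Kurzweil_Integration.integral_add[OF Gi integrable_on_mult_right[OF integrable_sum[OF fin Ii]]])
    also have "integral {a..b} (\<lambda>x. n * (\<Sum>p\<in>D. I p x)) = n * (\<Sum>p\<in>D. integral {a..b} (\<lambda>x. I p x))"
      by (simp only: Henstock_Kurzweil_Integration.integral_mult_right integral_sum[OF fin Ii])
    also have "(\<Sum>p\<in>D. integral {a..b} (\<lambda>x. I p x)) = (\<Sum>(u, v)\<in>D. v - u)"
      using Iv by (simp add: split_def)
    also have "integral {a..b} G + n * (\<Sum>(u, v)\<in>D. v - u) \<le> integral {a..b} G + n * (e / 2 / (real n + 1))"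
      using len by (intro add_left_mono mult_left_mono) auto
    also have "\<dots> < e / 2 + e / 2"
    proof (rule add_less_le_mono[OF Gn])
      show "real n * (e / 2 / (real n + 1)) \<le> e / 2" using e by (simp add: field_simps)
    qed
    finally show "(\<Sum>(u, v)\<in>D. cmod (y v - y u)) < e" by simp
  qed
qed

lemma absolutely_integrable_mult_continuous:
  fixes g v :: "real \<Rightarrow> complex"
  assumes g: "g absolutely_integrable_on {a..b}" and v: "continuous_on {a..b} v"
  shows "(\<lambda>x. g x * v x) absolutely_integrable_on {a..b}"
proof -
  have "(\<lambda>x. v x * g x) absolutely_integrable_on {a..b}"
  proof (rule absolutely_integrable_bounded_measurable_product[where h = "(*)" and f = v and g = g])
    show "bilinear ((*) :: complex \<Rightarrow> complex \<Rightarrow> complex)" by (rule bilinear_times)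
    show "v \<in> borel_measurable (lebesgue_on {a..b})"
      by (rule continuous_imp_measurable_on_sets_lebesgue[OF v]) auto
    show "bounded (v ` {a..b})" using v by (intro compact_imp_bounded compact_continuous_image) auto
  qed (use g in auto)
  then show ?thesis by (simp add: mult.commute)
qed

text \<open>Integration by parts. The product is absolutely continuous, so it suffices to know its derivative almost
  everywhere.\<close>

lemma primitive_on_mult:
  assumes y: "primitive_on a b g y" and v: "primitive_on a b h v"
  shows "primitive_on a b (\<lambda>x. g x * v x + y x * h x) (\<lambda>x. y x * v x)"
proof -
  obtain N1 where N1: "negligible N1" "\<forall>x\<in>{a..b} - N1. x \<in> {a<..<b} \<and> (y has_vector_derivative g x) (at x)"
    by (rule primitive_has_derivative_AE[OF y]) blast
  obtain N2 where N2: "negligible N2" "\<forall>x\<in>{a..b} - N2. x \<in> {a<..<b} \<and> (v has_vector_derivative h x) (at x)"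
    by (rule primitive_has_derivative_AE[OF v]) blast
  note cy = primitive_on_continuous[OF y] and cv = primitive_on_continuous[OF v]
  obtain C1 where C1: "C1 > 0" "\<And>x. x \<in> {a..b} \<Longrightarrow> cmod (y x) \<le> C1" by (rule continuous_on_bounded_interval[OF cy]) blast
  obtain C2 where C2: "C2 > 0" "\<And>x. x \<in> {a..b} \<Longrightarrow> cmod (v x) \<le> C2" by (rule continuous_on_bounded_interval[OF cv]) blast
  show ?thesis
  proof (rule primitive_onI_AC[where N = "N1 \<union> N2"])
    show "AC_on a b (\<lambda>x. y x * v x)"
      by (rule AC_on_mult[OF primitive_on_imp_AC_on[OF y] primitive_on_imp_AC_on[OF v], of "max C1 C2"])
         (use C1 C2 in \<open>auto simp: le_max_iff_disj\<close>)
    show "negligible (N1 \<union> N2)" using N1 N2 by (intro negligible_Un)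
    have "(\<lambda>x. g x * v x) absolutely_integrable_on {a..b}" "(\<lambda>x. h x * y x) absolutely_integrable_on {a..b}"
      using y v cy cv by (auto intro!: absolutely_integrable_mult_continuous simp: primitive_on_def)
    then show "(\<lambda>x. g x * v x + y x * h x) absolutely_integrable_on {a..b}"
      by (simp add: mult.commute set_integral_add(1))
    show "((\<lambda>x. y x * v x) has_vector_derivative g x * v x + y x * h x) (at x)" if "x \<in> {a..b} - (N1 \<union> N2)" for x
    proof -
      have "x \<in> {a..b} - N1" "x \<in> {a..b} - N2" using that by auto
      then have "(y has_vector_derivative g x) (at x)" "(v has_vector_derivative h x) (at x)"
        using N1(2) N2(2) by auto
      from has_vector_derivative_mult[OF this]
      show ?thesis by (subst add.commute)
    qed
  qed
qed

lemma primitive_on_zero: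
  assumes P: "primitive_on a b g y" and c: "\<And>x. x \<in> {a..b} \<Longrightarrow> y x = c"
  obtains N where "negligible N" "\<forall>x\<in>{a..b} - N. g x = 0"
proof -
  obtain N where N: "negligible N" "\<forall>x\<in>{a..b} - N. x \<in> {a<..<b} \<and> (y has_vector_derivative g x) (at x)"
    by (rule primitive_has_derivative_AE[OF P]) blast
  have "g x = 0" if x: "x \<in> {a..b} - N" for x
  proof -
    have xab: "x \<in> {a<..<b}" using N(2) x by blast
    have "((\<lambda>x. c) has_vector_derivative g x) (at x)"
      by (rule has_vector_derivative_transform_within_open[of y _ x "{a<..<b}"]) (use N(2) x xab c in auto)
    then show ?thesis by (rule vector_derivative_unique_at[OF _ has_vector_derivative_const])
  qed
  then show ?thesis by (intro that[OF N(1)] ballI)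
qed

section \<open>The space \<open>L\<^sub>2\<close>: representatives, Cauchy--Schwarz, completeness\<close>

lemma L2_on_measurable: "L2_on S f \<Longrightarrow> f \<in> borel_measurable (lebesgue_on S)"
  and L2_on_integrable: "L2_on S f \<Longrightarrow> integrable (lebesgue_on S) (\<lambda>x. (cmod (f x))\<^sup>2)"
  by (simp_all add: L2_on_def)

lemma L2_on_diff: "L2_on S f \<Longrightarrow> L2_on S g \<Longrightarrow> L2_on S (\<lambda>x. f x - g x)"
  using L2_on_add[of S f "\<lambda>x. - 1 * g x"] L2_on_cmult[of S g "-1"] by simp

lemma L2_on_bound:
  assumes "f \<in> borel_measurable (lebesgue_on S)" "integrable (lebesgue_on S) h"
    "\<And>x. x \<in> S \<Longrightarrow> (cmod (f x))\<^sup>2 \<le> h x"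
  shows "L2_on S f"
  unfolding L2_on_def
proof (intro conjI assms(1))
  have [measurable]: "f \<in> borel_measurable (lebesgue_on S)" by fact
  have "\<And>x. x \<in> space (lebesgue_on S) \<Longrightarrow> norm ((cmod (f x))\<^sup>2) \<le> norm (h x)"
    using assms(3) by (fastforce simp: space_restrict_space)
  then show "integrable (lebesgue_on S) (\<lambda>x. (cmod (f x))\<^sup>2)"
    by (intro Bochner_Integration.integrable_bound[OF assms(2)]) (auto intro: AE_I2)
qed

lemma L2_on_subset:
  assumes "L2_on S f" "T \<subseteq> S" "S \<in> sets lebesgue" "T \<in> sets lebesgue"
  shows "L2_on T f"
proof -
  have "set_integrable lebesgue S (\<lambda>x. (cmod (f x))\<^sup>2)"
    using assms by (simp add: L2_on_def set_integrable_def integrable_restrict_space)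
  then have "set_integrable lebesgue T (\<lambda>x. (cmod (f x))\<^sup>2)"
    by (rule set_integrable_subset) (use assms in auto)
  moreover have "f \<in> borel_measurable (lebesgue_on T)"
    by (rule measurable_restrict_mono) (use assms in \<open>auto simp: L2_on_def\<close>)
  ultimately show ?thesis
    using assms by (simp add: L2_on_def set_integrable_def integrable_restrict_space)
qed

lemma L2_on_cong:
  assumes "L2_on S f" "\<And>x. x \<in> S \<Longrightarrow> f x = g x"
  shows "L2_on S g"
proof -
  have "\<And>x. x \<in> space (lebesgue_on S) \<Longrightarrow> f x = g x" using assms(2) by (simp add: space_restrict_space)
  then show ?thesis
    using assms(1) unfolding L2_on_def
    by (metis (mono_tags, lifting) measurable_cong Bochner_Integration.integrable_cong)
qed

lemma L2_on_mult_bounded: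
  assumes f: "L2_on S f" and g: "g \<in> borel_measurable (lebesgue_on S)"
    and b: "\<And>x. x \<in> S \<Longrightarrow> cmod (g x) \<le> C"
  shows "L2_on S (\<lambda>x. f x * g x)"
proof (rule L2_on_bound)
  have [measurable]: "f \<in> borel_measurable (lebesgue_on S)" "g \<in> borel_measurable (lebesgue_on S)"
    using f g by (auto simp: L2_on_def)
  show "(\<lambda>x. f x * g x) \<in> borel_measurable (lebesgue_on S)" by measurable
  show "integrable (lebesgue_on S) (\<lambda>x. C\<^sup>2 * (cmod (f x))\<^sup>2)" using f by (simp add: L2_on_def)
  fix x assume "x \<in> S"
  then have "(cmod (g x))\<^sup>2 \<le> C\<^sup>2" using b by (intro power_mono) auto
  then show "(cmod (f x * g x))\<^sup>2 \<le> C\<^sup>2 * (cmod (f x))\<^sup>2"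
    using mult_right_mono[of "(cmod (g x))\<^sup>2" "C\<^sup>2" "(cmod (f x))\<^sup>2"]
    by (simp add: norm_mult power_mult_distrib mult.commute)
qed

lemma L2_on_continuous:
  fixes y :: "real \<Rightarrow> complex"
  assumes "continuous_on {a..b} y"
  shows "L2_on {a..b} y"
  unfolding L2_on_def
proof
  show "y \<in> borel_measurable (lebesgue_on {a..b})"
    by (rule continuous_imp_measurable_on_sets_lebesgue[OF assms]) auto
  have "(\<lambda>x. (cmod (y x))\<^sup>2) absolutely_integrable_on {a..b}"
    by (intro absolutely_integrable_continuous_real continuous_intros assms)
  then show "integrable (lebesgue_on {a..b}) (\<lambda>x. (cmod (y x))\<^sup>2)"
    by (intro absolutely_integrable_imp_integrable) auto
qed

lemma L2_on_cnj: "L2_on S f \<Longrightarrow> L2_on S (\<lambda>x. cnj (f x))"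
proof -
  have [measurable]: "cnj \<in> borel_measurable borel"
    by (intro borel_measurable_continuous_onI continuous_intros)
  assume "L2_on S f"
  then show ?thesis by (auto simp: L2_on_def)
qed

lemma L2_on_mult_integrable:
  assumes "L2_on S f" "L2_on S g"
  shows "integrable (lebesgue_on S) (\<lambda>x. f x * g x)"
  using integrable_L2_product[OF assms(1) L2_on_cnj[OF assms(2)]] by simp

lemma L2_on_interval_integrable:
  assumes "L2_on {a..b::real} f"
  shows "f absolutely_integrable_on {a..b}"
proof -
  have "L2_on {a..b} (\<lambda>x. 1)" by (rule L2_on_continuous) auto
  from L2_on_mult_integrable[OF assms this] show ?thesis
    by (simp add: set_integrable_def integrable_restrict_space)
qed

lemma integrable_imp_absolutely_integrable:
  fixes f :: "real \<Rightarrow> 'a::euclidean_space"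
  shows "integrable (lebesgue_on {a..b}) f \<Longrightarrow> f absolutely_integrable_on {a..b}"
  by (simp add: set_integrable_def integrable_restrict_space)

lemma measurable_halfline:
  fixes f :: "real \<Rightarrow> complex"
  assumes "\<And>R. R \<ge> 0 \<Longrightarrow> f \<in> borel_measurable (lebesgue_on {0..R})"
  shows "f \<in> borel_measurable (lebesgue_on {0..})"
proof (rule measurable_piecewise_restrict)
  let ?C = "range (\<lambda>n::nat. {0..real n})"
  show "countable ?C" by auto
  show "space (lebesgue_on {0..}) \<subseteq> \<Union> ?C"
    by (auto simp: space_restrict_space intro: real_arch_simple)
  fix \<Omega> assume "\<Omega> \<in> ?C"
  then obtain n :: nat where n: "\<Omega> = {0..real n}" by auto
  show "\<Omega> \<inter> space (lebesgue_on {0..}) \<in> sets (lebesgue_on {0..})"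
    by (auto simp: n space_restrict_space sets_restrict_space)
  have "restrict_space (lebesgue_on {0..}) \<Omega> = lebesgue_on {0..real n}"
    unfolding n by (subst restrict_restrict_space) (auto intro!: arg_cong[where f = "restrict_space lebesgue"])
  then show "f \<in> restrict_space (lebesgue_on {0..}) \<Omega> \<rightarrow>\<^sub>M borel" using assms[of "real n"] by simp
qed

subsection \<open>Equivalence classes\<close>

lemma abs_l2_eq_iff:
  "L2_on {0..} f \<Longrightarrow> L2_on {0..} g \<Longrightarrow> abs_l2 f = abs_l2 g \<longleftrightarrow> (AE x in lebesgue_on {0..}. f x = g x)"
  using Quotient_rel[OF Quotient_l2, of f g] by auto

lemma l2_cases:
  obtains f where "L2_on {0..} f" "x = abs_l2 f"
  using Quotient_rep_reflp[OF Quotient_l2, of x] Quotient_abs_rep[OF Quotient_l2, of x] by metis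

lemma rep_abs_l2:
  assumes "L2_on {0..} f"
  shows "L2_on {0..} (rep_l2 (abs_l2 f))" "AE x in lebesgue_on {0..}. rep_l2 (abs_l2 f) x = f x"
  using Quotient_rep_abs[OF Quotient_l2, of f] assms by auto

lemma cinner_abs_l2:
  "L2_on {0..} f \<Longrightarrow> L2_on {0..} g \<Longrightarrow>
    cinner_l2 (abs_l2 f) (abs_l2 g) = (\<integral>x. f x * cnj (g x) \<partial>lebesgue_on {0..})"
  by (rule cinner_l2.abs_eq) auto

lemma plus_abs_l2:
  "L2_on {0..} f \<Longrightarrow> L2_on {0..} g \<Longrightarrow> abs_l2 f + abs_l2 g = abs_l2 (\<lambda>x. f x + g x)"
  by (rule plus_l2.abs_eq) auto

lemma scaleC_abs_l2: "L2_on {0..} f \<Longrightarrow> scaleC_l2 c (abs_l2 f) = abs_l2 (\<lambda>x. c * f x)"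
  by (rule scaleC_l2.abs_eq) auto

lemma minus_abs_l2:
  "L2_on {0..} f \<Longrightarrow> L2_on {0..} g \<Longrightarrow> abs_l2 f - abs_l2 g = abs_l2 (\<lambda>x. f x - g x)"
  by (simp add: minus_l2_def scaleC_abs_l2 plus_abs_l2 L2_on_cmult[of _ _ "-1", simplified])

lemma norm_abs_l2_square:
  assumes "L2_on {0..} f"
  shows "(norm (abs_l2 f))\<^sup>2 = (\<integral>x. (cmod (f x))\<^sup>2 \<partial>lebesgue_on {0..})"
proof -
  have "(norm (abs_l2 f))\<^sup>2 = Re (cinner_l2 (abs_l2 f) (abs_l2 f))"
    using cinner_l2_self[of "abs_l2 f"] by (simp add: norm_l2_def)
  also have "cinner_l2 (abs_l2 f) (abs_l2 f) = of_real (\<integral>x. (cmod (f x))\<^sup>2 \<partial>lebesgue_on {0..})"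
    using assms by (simp only: cinner_abs_l2 complex_norm_square [symmetric] integral_complex_of_real)
  finally show ?thesis by simp
qed

lemma cinner_self_norm: "cinner_l2 x x = of_real ((norm x)\<^sup>2)"
  using cinner_l2_self[of x] by (simp add: norm_l2_def)

lemma scaleC_l2_scaleC: "scaleC_l2 a (scaleC_l2 b x) = scaleC_l2 (a * b) x"
  by (rule l2_cases[of x]) (simp add: scaleC_abs_l2 L2_on_cmult mult.assoc)

lemma scaleC_l2_add: "scaleC_l2 a (x + y) = scaleC_l2 a x + scaleC_l2 a y"
  by (rule l2_cases[of x], rule l2_cases[of y])
     (simp add: scaleC_abs_l2 plus_abs_l2 L2_on_cmult L2_on_add distrib_left)

lemma scaleC_l2_add_left: "scaleC_l2 (a + b) x = scaleC_l2 a x + scaleC_l2 b x"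
  by (rule l2_cases[of x]) (simp add: scaleC_abs_l2 plus_abs_l2 L2_on_cmult distrib_right)

lemma scaleC_l2_of_real: "scaleC_l2 (of_real r) x = r *\<^sub>R x"
  by (simp add: scaleR_l2_def)

lemma scaleC_l2_zero: "scaleC_l2 0 x = 0"
  using scaleC_l2_of_real[of 0 x] by simp

lemma scaleC_l2_diff: "scaleC_l2 a (x - y) = scaleC_l2 a x - scaleC_l2 a y"
  by (simp add: minus_l2_def scaleC_l2_add scaleC_l2_scaleC mult.commute)

lemma cinner_l2_scaleC_right: "cinner_l2 x (scaleC_l2 c y) = cnj c * cinner_l2 x y"
  by (metis cinner_l2_commute cinner_l2_scaleC_left complex_cnj_mult complex_cnj_cnj)

lemma cinner_l2_add_right: "cinner_l2 x (y + z) = cinner_l2 x y + cinner_l2 x z"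
  by (metis cinner_l2_commute cinner_l2_add_left complex_cnj_add)

lemma norm_scaleC_l2: "norm (scaleC_l2 c x) = cmod c * norm x"
proof -
  have "complex_of_real ((norm (scaleC_l2 c x))\<^sup>2) = (c * cnj c) * of_real ((norm x)\<^sup>2)"
    unfolding cinner_self_norm[symmetric]
    by (simp add: cinner_l2_scaleC_left cinner_l2_scaleC_right mult.assoc)
  also have "c * cnj c = of_real ((cmod c)\<^sup>2)" by (rule complex_norm_square[symmetric])
  also have "of_real ((cmod c)\<^sup>2) * of_real ((norm x)\<^sup>2) = complex_of_real ((cmod c * norm x)\<^sup>2)"
    by (simp add: power_mult_distrib)
  finally have "complex_of_real ((norm (scaleC_l2 c x))\<^sup>2) = of_real ((cmod c * norm x)\<^sup>2)" .
  then have "(norm (scaleC_l2 c x))\<^sup>2 = (cmod c * norm x)\<^sup>2" by (simp only: of_real_eq_iff)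
  then show ?thesis by (simp add: power2_eq_iff_nonneg)
qed

lemma cinner_l2_bound: "cmod (cinner_l2 x y) \<le> norm x * norm y"
proof (cases "cinner_l2 x y = 0")
  case False
  define c where "c = cnj (sgn (cinner_l2 x y))"
  have c: "cmod c = 1" using False by (simp add: c_def norm_sgn)
  have "c * cinner_l2 x y = of_real (cmod (cinner_l2 x y))"
    using False by (simp add: c_def sgn_eq complex_norm_square[symmetric] power2_eq_square field_simps flip: complex_norm_square)
  then have "cmod (cinner_l2 x y) = inner (scaleC_l2 c x) y"
    by (simp add: inner_l2_def cinner_l2_scaleC_left)
  also have "\<dots> \<le> norm (scaleC_l2 c x) * norm y" by (rule norm_cauchy_schwarz)
  finally show ?thesis by (simp add: norm_scaleC_l2 c)
qed simp

text \<open>The weights \<open>4 ^ k\<close> make \<open>\<Sum>4\<^sup>k |f\<^sub>k\<^sub>+\<^sub>1 - f\<^sub>k|\<^sup>2\<close> integrable, so that almost everywhere the increments are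
  dominated by a geometric series of ratio \<open>1 / 2\<close>.\<close>

lemma L2_fast_Cauchy_AE_convergent:
  fixes f :: "nat \<Rightarrow> real \<Rightarrow> complex"
  assumes f: "\<And>k. L2_on S (f k)"
    and fast: "\<And>k. (\<integral>x. (cmod (f (Suc k) x - f k x))\<^sup>2 \<partial>lebesgue_on S) \<le> (1/8) ^ k"
  shows "AE x in lebesgue_on S. convergent (\<lambda>k. f k x)"
proof -
  let ?M = "lebesgue_on S"
  have [measurable]: "f k \<in> borel_measurable ?M" for k using f by (simp add: L2_on_def)
  define d where "d = (\<lambda>k x. 4 ^ k * (cmod (f (Suc k) x - f k x))\<^sup>2)"
  have dm [measurable]: "d k \<in> borel_measurable ?M" for k unfolding d_def by measurable
  have di: "integrable ?M (d k)" for k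
    unfolding d_def using L2_on_integrable[OF L2_on_diff[OF f f]] by auto
  have "(\<integral>\<^sup>+ x. (\<Sum>k. ennreal (d k x)) \<partial>?M) = (\<Sum>k. \<integral>\<^sup>+ x. ennreal (d k x) \<partial>?M)"
    by (rule nn_integral_suminf) auto
  also have "\<dots> \<le> (\<Sum>k. ennreal ((1/2) ^ k))"
  proof (rule suminf_le)
    fix k
    have "(\<integral>\<^sup>+ x. ennreal (d k x) \<partial>?M) = ennreal (\<integral>x. d k x \<partial>?M)"
      by (rule nn_integral_eq_integral[OF di]) (auto simp: d_def)
    also have "(\<integral>x. d k x \<partial>?M) \<le> 4 ^ k * (1/8) ^ k"
      unfolding d_def using fast[of k] by simp
    also have "(4::real) ^ k * (1/8) ^ k = (1/2) ^ k" by (simp add: power_mult_distrib[symmetric])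
    finally show "(\<integral>\<^sup>+ x. ennreal (d k x) \<partial>?M) \<le> ennreal ((1/2) ^ k)" by (simp add: ennreal_leI)
  qed auto
  also have "\<dots> = ennreal (\<Sum>k. (1/2) ^ k)"
    by (rule suminf_ennreal2) (auto intro: summable_geometric)
  finally have "(\<integral>\<^sup>+ x. (\<Sum>k. ennreal (d k x)) \<partial>?M) \<noteq> \<infinity>"
    by (metis ennreal_less_top infinity_ennreal_def leD)
  then have "AE x in ?M. (\<Sum>k. ennreal (d k x)) \<noteq> \<infinity>"
    by (intro nn_integral_noteq_infinite) auto
  then show ?thesis
  proof (rule AE_mp, intro AE_I2 impI)
    fix x assume fin: "(\<Sum>k. ennreal (d k x)) \<noteq> \<infinity>"
    have "summable (\<lambda>k. d k x)"
      by (rule summable_suminf_not_top) (use fin in \<open>auto simp: d_def\<close>)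
    then have "bounded (range (\<lambda>k. d k x))"
      using summable_LIMSEQ_zero convergent_imp_bounded by (auto simp: convergent_def)
    then obtain C where C: "C > 0" "\<And>k. norm (d k x) \<le> C" unfolding bounded_pos by auto
    have "summable (\<lambda>k. f (Suc k) x - f k x)"
    proof (rule summable_comparison_test)
      show "summable (\<lambda>k. sqrt C * (1/2) ^ k)" by (intro summable_mult summable_geometric) auto
      have "cmod (f (Suc k) x - f k x) \<le> sqrt C * (1/2) ^ k" for k
      proof -
        have "(2 ^ k * cmod (f (Suc k) x - f k x))\<^sup>2 = d k x"
          by (simp add: d_def power_mult_distrib power_even_eq[symmetric] power_mult[symmetric] flip: power_even_eq)
             (simp add: mult.commute[of k] power_mult)
        also have "\<dots> \<le> C" using C(2)[of k] by simp
        finally have "2 ^ k * cmod (f (Suc k) x - f k x) \<le> sqrt C" by (rule real_le_rsqrt)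
        then show ?thesis by (simp add: power_one_over field_simps)
      qed
      then show "\<exists>N. \<forall>k\<ge>N. norm (f (Suc k) x - f k x) \<le> sqrt C * (1/2) ^ k" by auto
    qed
    then have "(\<lambda>n. \<Sum>k<n. f (Suc k) x - f k x) \<longlonglongrightarrow> (\<Sum>k. f (Suc k) x - f k x)" by (rule summable_LIMSEQ)
    then have "(\<lambda>n. f n x - f 0 x) \<longlonglongrightarrow> (\<Sum>k. f (Suc k) x - f k x)"
      by (simp only: sum_lessThan_telescope[of "\<lambda>k. f k x"])
    from tendsto_add[OF this tendsto_const[of "f 0 x"]] show "convergent (\<lambda>k. f k x)"
      by (auto simp: convergent_def)
  qed
qed

lemma L2_Fatou:
  fixes f :: "nat \<Rightarrow> real \<Rightarrow> complex"
  assumes f: "\<And>k. L2_on S (f k)" and F: "F \<in> borel_measurable (lebesgue_on S)"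
    and lim: "AE x in lebesgue_on S. (\<lambda>k. f k x) \<longlonglongrightarrow> F x"
    and bound: "\<forall>\<^sub>F k in sequentially. (\<integral>x. (cmod (f k x))\<^sup>2 \<partial>lebesgue_on S) \<le> C"
  shows "L2_on S F" "(\<integral>x. (cmod (F x))\<^sup>2 \<partial>lebesgue_on S) \<le> C"
proof -
  let ?M = "lebesgue_on S"
  have [measurable]: "f k \<in> borel_measurable ?M" for k using f by (simp add: L2_on_def)
  note F[measurable]
  obtain k0 where "(\<integral>x. (cmod (f k0 x))\<^sup>2 \<partial>?M) \<le> C" using bound by (auto simp: eventually_sequentially)
  moreover have "0 \<le> (\<integral>x. (cmod (f k0 x))\<^sup>2 \<partial>?M)" by simp
  ultimately have C: "C \<ge> 0" by linarith
  have "(\<integral>\<^sup>+ x. ennreal ((cmod (F x))\<^sup>2) \<partial>?M) = (\<integral>\<^sup>+ x. liminf (\<lambda>k. ennreal ((cmod (f k x))\<^sup>2)) \<partial>?M)"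
  proof (rule nn_integral_cong_AE, use lim in \<open>rule AE_mp\<close>, intro AE_I2 impI)
    fix x assume "(\<lambda>k. f k x) \<longlonglongrightarrow> F x"
    then have "(\<lambda>k. ennreal ((cmod (f k x))\<^sup>2)) \<longlonglongrightarrow> ennreal ((cmod (F x))\<^sup>2)"
      by (intro tendsto_intros) auto
    then show "ennreal ((cmod (F x))\<^sup>2) = liminf (\<lambda>k. ennreal ((cmod (f k x))\<^sup>2))"
      by (metis lim_imp_Liminf sequentially_bot)
  qed
  also have "\<dots> \<le> liminf (\<lambda>k. \<integral>\<^sup>+ x. ennreal ((cmod (f k x))\<^sup>2) \<partial>?M)"
    by (rule nn_integral_liminf) auto
  also have "\<dots> \<le> ennreal C"
  proof (rule Liminf_le)
    show "\<forall>\<^sub>F k in sequentially. (\<integral>\<^sup>+ x. ennreal ((cmod (f k x))\<^sup>2) \<partial>?M) \<le> ennreal C"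
      using bound
    proof eventually_elim
      case (elim k)
      have "(\<integral>\<^sup>+ x. ennreal ((cmod (f k x))\<^sup>2) \<partial>?M) = ennreal (\<integral>x. (cmod (f k x))\<^sup>2 \<partial>?M)"
        by (rule nn_integral_eq_integral[OF L2_on_integrable[OF f]]) auto
      then show ?case using elim by (simp add: ennreal_leI)
    qed
  qed auto
  finally have le: "(\<integral>\<^sup>+ x. ennreal ((cmod (F x))\<^sup>2) \<partial>?M) \<le> ennreal C" .
  then have i: "integrable ?M (\<lambda>x. (cmod (F x))\<^sup>2)"
    by (intro integrableI_bounded) (auto intro: le_less_trans)
  then show "L2_on S F" using F by (simp add: L2_on_def)
  have "(\<integral>\<^sup>+ x. ennreal ((cmod (F x))\<^sup>2) \<partial>?M) = ennreal (\<integral>x. (cmod (F x))\<^sup>2 \<partial>?M)"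
    by (rule nn_integral_eq_integral[OF i]) auto
  then show "(\<integral>x. (cmod (F x))\<^sup>2 \<partial>?M) \<le> C" using le C by simp
qed

instance l2 :: complete_space
proof
  fix X :: "nat \<Rightarrow> l2" assume X: "Cauchy X"
  have "\<exists>N. \<forall>m\<ge>N. \<forall>n\<ge>N. dist (X m) (X n) < (1/3) ^ k" for k :: nat
    using X unfolding Cauchy_def by simp
  then obtain N where N: "\<And>k m n. m \<ge> N k \<Longrightarrow> n \<ge> N k \<Longrightarrow> dist (X m) (X n) < (1/3) ^ k" by metis
  (* A strictly increasing majorant of N. *)
  define r where "r = (\<lambda>k. k + (\<Sum>i\<le>k. N i))"
  have r: "strict_mono r" by (rule strict_monoI_Suc) (simp add: r_def)
  have rN: "r k \<ge> N k" for k
    using member_le_sum[of k "{..k}" N] by (simp add: r_def trans_le_add2)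
  have "\<exists>f. L2_on {0..} f \<and> X (r k) = abs_l2 f" for k by (rule l2_cases[of "X (r k)"]) auto
  then obtain f where f: "\<And>k. L2_on {0..} (f k)" "\<And>k. X (r k) = abs_l2 (f k)" by metis
  have dist: "(\<integral>x. (cmod (f m x - f n x))\<^sup>2 \<partial>lebesgue_on {0..}) = (dist (X (r m)) (X (r n)))\<^sup>2" for m n
    by (simp add: dist_norm f minus_abs_l2 norm_abs_l2_square L2_on_diff)
  have "AE x in lebesgue_on {0..}. convergent (\<lambda>k. f k x)"
  proof (rule L2_fast_Cauchy_AE_convergent[OF f(1)])
    fix k
    have "r (Suc k) \<ge> r k" using r by (simp add: strict_mono_less_eq)
    then have "dist (X (r (Suc k))) (X (r k)) < (1/3) ^ k" using rN[of k] by (intro N) auto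
    then have "(dist (X (r (Suc k))) (X (r k)))\<^sup>2 \<le> ((1/3) ^ k)\<^sup>2" by (intro power_mono) auto
    also have "((1/3) ^ k)\<^sup>2 = (1/9::real) ^ k" by (simp add: power2_eq_square power_mult_distrib[symmetric])
    also have "\<dots> \<le> (1/8) ^ k" by (intro power_mono) auto
    finally show "(\<integral>x. (cmod (f (Suc k) x - f k x))\<^sup>2 \<partial>lebesgue_on {0..}) \<le> (1/8) ^ k" by (simp add: dist)
  qed
  then have lim: "AE x in lebesgue_on {0..}. (\<lambda>k. f k x) \<longlonglongrightarrow> lim (\<lambda>k. f k x)"
    by (rule AE_mp) (auto simp: convergent_LIMSEQ_iff)
  define F where "F = (\<lambda>x. lim (\<lambda>k. f k x))"
  have [measurable]: "f k \<in> borel_measurable (lebesgue_on {0..})" for k using f by (simp add: L2_on_def)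
  have Fm [measurable]: "F \<in> borel_measurable (lebesgue_on {0..})" unfolding F_def by measurable
  have est: "L2_on {0..} (\<lambda>x. f m x - F x) \<and> (\<integral>x. (cmod (f m x - F x))\<^sup>2 \<partial>lebesgue_on {0..}) \<le> ((1/3) ^ m)\<^sup>2" for m
  proof -
    have l: "AE x in lebesgue_on {0..}. (\<lambda>k. f m x - f k x) \<longlonglongrightarrow> f m x - F x"
      using lim by (rule AE_mp) (auto simp: F_def intro!: tendsto_intros)
    have b: "\<forall>\<^sub>F k in sequentially. (\<integral>x. (cmod (f m x - f k x))\<^sup>2 \<partial>lebesgue_on {0..}) \<le> ((1/3) ^ m)\<^sup>2"
      using eventually_ge_at_top[of m]
    proof eventually_elim
      case (elim k)
      then have "r m \<le> r k" using r by (simp add: strict_mono_less_eq)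
      then have "dist (X (r m)) (X (r k)) < (1/3) ^ m" using rN[of m] by (intro N) auto
      then show ?case unfolding dist by (intro power_mono) auto
    qed
    show ?thesis
      using L2_Fatou[OF L2_on_diff[OF f(1) f(1)] _ l b] by auto
  qed
  have F: "L2_on {0..} F"
    using L2_on_diff[OF f(1)[of 0] conjunct1[OF est[of 0]]] by simp
  have "norm (X (r m) - abs_l2 F) \<le> (1/3) ^ m" for m
  proof -
    have "(norm (X (r m) - abs_l2 F))\<^sup>2 \<le> ((1/3) ^ m)\<^sup>2"
      using est[of m] by (simp add: f F minus_abs_l2 norm_abs_l2_square L2_on_diff)
    then show ?thesis by (rule power2_le_imp_le) auto
  qed
  then have "\<forall>\<^sub>F m in sequentially. norm (X (r m) - abs_l2 F) \<le> (1/3) ^ m" by simp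
  moreover have "(\<lambda>m. (1/3::real) ^ m) \<longlonglongrightarrow> 0" by (rule LIMSEQ_realpow_zero) auto
  ultimately have "(\<lambda>m. X (r m) - abs_l2 F) \<longlonglongrightarrow> 0" by (rule Lim_null_comparison)
  then have "(X \<circ> r) \<longlonglongrightarrow> abs_l2 F" unfolding o_def by (simp add: LIM_zero_iff)
  then show "convergent X"
    using Cauchy_converges_subseq[OF X r] by (auto simp: convergent_def)
qed

section \<open>Almost increasing coefficients\<close>

lemma L2_on_mult_continuous:
  assumes "L2_on {a..b} f" "continuous_on {a..b} v"
  shows "L2_on {a..b} (\<lambda>x. f x * v x)"
proof -
  obtain C where "\<And>x. x \<in> {a..b} \<Longrightarrow> cmod (v x) \<le> C"
    by (rule continuous_on_bounded_interval[OF assms(2)]) auto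
  then show ?thesis
    by (intro L2_on_mult_bounded[OF assms(1)] continuous_imp_measurable_on_sets_lebesgue assms) auto
qed

lemma real_L2_mult_integrable_on:
  assumes "L2_on {a..b} (\<lambda>x. complex_of_real (f x))" "L2_on {a..b} (\<lambda>x. complex_of_real (h x))"
  shows "(\<lambda>x. f x * h x) integrable_on {a..b}" "(\<lambda>x. \<bar>f x\<bar> * \<bar>h x\<bar>) integrable_on {a..b}"
proof -
  have "integrable (lebesgue_on {a..b}) (\<lambda>x. complex_of_real (f x) * complex_of_real (h x))"
    by (rule L2_on_mult_integrable[OF assms])
  then have i: "integrable (lebesgue_on {a..b}) (\<lambda>x. complex_of_real (f x * h x))" by simp
  then have "integrable (lebesgue_on {a..b}) (\<lambda>x. f x * h x)"
    by (simp only: complex_of_real_integrable_eq)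
  then show "(\<lambda>x. f x * h x) integrable_on {a..b}" by (auto intro: integrable_on_lebesgue_on)
  from integrable_norm[OF i] have "integrable (lebesgue_on {a..b}) (\<lambda>x. \<bar>f x\<bar> * \<bar>h x\<bar>)"
    by (simp add: norm_mult abs_mult)
  then show "(\<lambda>x. \<bar>f x\<bar> * \<bar>h x\<bar>) integrable_on {a..b}" by (auto intro: integrable_on_lebesgue_on)
qed

lemma L2_on_square_integrable_on:
  assumes "L2_on {a..b} f"
  shows "(\<lambda>x. (cmod (f x))\<^sup>2) integrable_on {a..b}"
  using L2_on_integrable[OF assms] by (auto intro: integrable_on_lebesgue_on)

lemma real_primitive_has_integral:
  assumes "primitive_on p q (\<lambda>x. complex_of_real (\<psi> x)) (\<lambda>x. complex_of_real (\<phi> x))"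
    "p \<le> u" "u \<le> v" "v \<le> q"
  shows "(\<psi> has_integral (\<phi> v - \<phi> u)) {u..v}"
  using has_integral_Re[OF primitive_on_diff[OF assms]] by simp

text \<open>The integral is \<open>-\<integral>\<phi> dm\<close>, and only the increase of \<open>m\<close> over \<open>[l, r]\<close> is kept. The second mean value
  theorem, applied separately on \<open>[p, l]\<close>, \<open>[l, r]\<close> and \<open>[r, q]\<close>, replaces Stieltjes integration.\<close>

lemma monotone_weight_integral:
  fixes m :: "real \<Rightarrow> real"
  assumes prim: "primitive_on p q (\<lambda>x. complex_of_real (\<psi> x)) (\<lambda>x. complex_of_real (\<phi> x))"
    and ends: "\<phi> p = 0" "\<phi> q = 0" and nonneg: "\<And>x. x \<in> {p..q} \<Longrightarrow> 0 \<le> \<phi> x"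
    and mono: "\<And>x y. p \<le> x \<Longrightarrow> x \<le> y \<Longrightarrow> y \<le> q \<Longrightarrow> m x \<le> m y"
    and lr: "p \<le> l" "l \<le> r" "r \<le> q" and \<mu>: "\<And>x. x \<in> {l..r} \<Longrightarrow> \<mu> \<le> \<phi> x"
  shows "(\<lambda>x. m x * \<psi> x) integrable_on {p..q}"
    "integral {p..q} (\<lambda>x. m x * \<psi> x) \<le> - (\<mu> * (m r - m l))"
proof -
  have piece: "\<exists>c\<in>{u..v}. ((\<lambda>x. m x * \<psi> x) has_integral (m u * (\<phi> c - \<phi> u) + m v * (\<phi> v - \<phi> c))) {u..v}"
    if uv: "p \<le> u" "u \<le> v" "v \<le> q" for u v
  proof -
    have hi: "(\<psi> has_integral (\<phi> y - \<phi> x)) {x..y}" if "u \<le> x" "x \<le> y" "y \<le> v" for x y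
      by (rule real_primitive_has_integral[OF prim]) (use uv that in auto)
    have "\<psi> integrable_on {u..v}" using hi[of u v] uv by blast
    then obtain c where c: "c \<in> {u..v}"
      "((\<lambda>x. m x * \<psi> x) has_integral (m u * integral {u..c} \<psi> + m v * integral {c..v} \<psi>)) {u..v}"
      by (rule second_mean_value_theorem_full[where g = m]) (use uv mono in auto)
    have "integral {u..c} \<psi> = \<phi> c - \<phi> u" "integral {c..v} \<psi> = \<phi> v - \<phi> c"
      using hi[of u c] hi[of c v] c(1) by (auto simp: integral_unique)
    then show ?thesis using c by auto
  qed
  obtain c1 where c1: "c1 \<in> {p..l}" "((\<lambda>x. m x * \<psi> x) has_integral (m p * (\<phi> c1 - \<phi> p) + m l * (\<phi> l - \<phi> c1))) {p..l}"
    using piece[of p l] lr by auto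
  obtain c2 where c2: "c2 \<in> {l..r}" "((\<lambda>x. m x * \<psi> x) has_integral (m l * (\<phi> c2 - \<phi> l) + m r * (\<phi> r - \<phi> c2))) {l..r}"
    using piece[of l r] lr by auto
  obtain c3 where c3: "c3 \<in> {r..q}" "((\<lambda>x. m x * \<psi> x) has_integral (m r * (\<phi> c3 - \<phi> r) + m q * (\<phi> q - \<phi> c3))) {r..q}"
    using piece[of r q] lr by auto
  have *: "((\<lambda>x. m x * \<psi> x) has_integral ((m p * (\<phi> c1 - \<phi> p) + m l * (\<phi> l - \<phi> c1)) +
      ((m l * (\<phi> c2 - \<phi> l) + m r * (\<phi> r - \<phi> c2)) + (m r * (\<phi> c3 - \<phi> r) + m q * (\<phi> q - \<phi> c3))))) {p..q}"
    by (rule has_integral_combine[OF _ _ c1(2) has_integral_combine[OF _ _ c2(2) c3(2)]]) (use lr in auto)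
  then show "(\<lambda>x. m x * \<psi> x) integrable_on {p..q}" by blast
  have "integral {p..q} (\<lambda>x. m x * \<psi> x) = - ((m l - m p) * \<phi> c1) - (m r - m l) * \<phi> c2 - (m q - m r) * \<phi> c3"
    using * ends by (simp add: integral_unique algebra_simps)
  moreover have "0 \<le> (m l - m p) * \<phi> c1" "0 \<le> (m q - m r) * \<phi> c3"
    using mono[of p l] mono[of r q] nonneg[of c1] nonneg[of c3] c1 c3 lr by auto
  moreover have "(m r - m l) * \<mu> \<le> (m r - m l) * \<phi> c2"
    using mono[of l r] \<mu>[OF c2(1)] lr by (intro mult_left_mono) auto
  ultimately show "integral {p..q} (\<lambda>x. m x * \<psi> x) \<le> - (\<mu> * (m r - m l))"
    by (simp add: mult.commute)
qed

text \<open>The increment of \<open>y\<close> between two points of the cell is at most \<open>\<integral>|g|\<close>, to which the Cauchy--Schwarz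
  inequality applies.\<close>

lemma cell_pointwise_bound:
  assumes prim: "primitive_on c e g y" and g: "L2_on {c..e} g" and x: "x \<in> {c..e}" and t: "t \<in> {c..e}"
  shows "(cmod (y x))\<^sup>2 \<le> 2 * (cmod (y t))\<^sup>2 + 2 * (e - c) * integral {c..e} (\<lambda>x. (cmod (g x))\<^sup>2)"
proof -
  have gi: "g absolutely_integrable_on {c..e}" using prim by (simp add: primitive_on_def)
  then have ni: "(\<lambda>x. cmod (g x)) integrable_on {c..e}" by (simp add: absolutely_integrable_on_def)
  have si: "(\<lambda>x. (cmod (g x))\<^sup>2) integrable_on {c..e}" by (rule L2_on_square_integrable_on[OF g])
  define I where "I = integral {c..e} (\<lambda>x. cmod (g x))"
  have I0: "I \<ge> 0" unfolding I_def by (intro Henstock_Kurzweil_Integration.integral_nonneg ni) auto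
  have ordered: "cmod (y v - y u) \<le> I" if uv: "c \<le> u" "u \<le> v" "v \<le> e" for u v
  proof -
    have "cmod (y v - y u) = cmod (integral {u..v} g)"
      using primitive_on_diff[OF prim uv] by (simp add: integral_unique)
    also have "\<dots> \<le> integral {u..v} (\<lambda>x. cmod (g x))"
      using primitive_on_subinterval[OF prim uv(1) uv(3)]
      by (intro integral_norm_bound_integral) (auto simp: primitive_on_def absolutely_integrable_on_def)
    also have "\<dots> \<le> I" unfolding I_def
      by (rule integral_subset_le) (use uv ni in \<open>auto intro: integrable_on_subinterval\<close>)
    finally show ?thesis .
  qed
  have "cmod (y x) \<le> cmod (y t) + I"
  proof (cases "x \<le> t")
    case True
    then show ?thesis using ordered[of x t] x t norm_triangle_ineq3[of "y x" "y t"] by (simp add: norm_minus_commute)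
  next
    case False
    then show ?thesis using ordered[of t x] x t norm_triangle_ineq3[of "y x" "y t"] by (simp add: norm_minus_commute)
  qed
  then have "(cmod (y x))\<^sup>2 \<le> (cmod (y t) + I)\<^sup>2" by (intro power_mono) auto
  also have "\<dots> \<le> 2 * (cmod (y t))\<^sup>2 + 2 * I\<^sup>2"
    using zero_le_power2[of "cmod (y t) - I"] by (simp add: power2_eq_square algebra_simps)
  also have "I\<^sup>2 \<le> (e - c) * integral {c..e} (\<lambda>x. (cmod (g x))\<^sup>2)"
  proof (cases "c < e")
    case True
    (* The mean of |g|. Integrating (|g| - k)^2 >= 0 is the Cauchy--Schwarz inequality. *)
    define k where "k = I / (e - c)"
    have qi: "(\<lambda>x. (cmod (g x))\<^sup>2 + (- 2 * k) * cmod (g x) + k\<^sup>2) integrable_on {c..e}"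
      by (intro integrable_add si integrable_on_mult_right ni integrable_on_const) simp
    have "0 \<le> integral {c..e} (\<lambda>x. (cmod (g x))\<^sup>2 + (- 2 * k) * cmod (g x) + k\<^sup>2)"
    proof (rule Henstock_Kurzweil_Integration.integral_nonneg[OF qi])
      fix x
      show "0 \<le> (cmod (g x))\<^sup>2 + (- 2 * k) * cmod (g x) + k\<^sup>2"
        using zero_le_power2[of "cmod (g x) - k"] by (simp add: power2_diff algebra_simps)
    qed
    also have "\<dots> = integral {c..e} (\<lambda>x. (cmod (g x))\<^sup>2) + (- 2 * k) * I + (e - c) * k\<^sup>2"
      unfolding I_def
      by (subst Henstock_Kurzweil_Integration.integral_add, (intro integrable_add si integrable_on_mult_right ni integrable_on_const; simp)+)
         (subst Henstock_Kurzweil_Integration.integral_add, (intro si integrable_on_mult_right ni; simp)+,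
           use True in \<open>simp\<close>)
    finally have "0 \<le> integral {c..e} (\<lambda>x. (cmod (g x))\<^sup>2) - 2 * k * I + (e - c) * k\<^sup>2" by simp
    moreover have ek: "(e - c) * k = I" using True by (simp add: k_def)
    then have "(e - c) * k\<^sup>2 = I * k" by (simp add: power2_eq_square mult.assoc[symmetric])
    ultimately have "I * k \<le> integral {c..e} (\<lambda>x. (cmod (g x))\<^sup>2)" by simp
    then have "(e - c) * (I * k) \<le> (e - c) * integral {c..e} (\<lambda>x. (cmod (g x))\<^sup>2)"
      using True by (intro mult_left_mono) auto
    then show ?thesis using ek by (simp add: power2_eq_square mult.left_commute mult.assoc[symmetric])
  next
    case False
    then have "c = e" using x by auto
    then show ?thesis by (simp add: I_def)
  qed
  finally show ?thesis by (simp only: mult.assoc)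
qed

text \<open>One-dimensional Sobolev inequality with explicit dependence on the length of the cell: average
  \<open>cell_pointwise_bound\<close> over the second point.\<close>

lemma cell_sup_bound:
  assumes prim: "primitive_on c e g y" and g: "L2_on {c..e} g" and x: "x \<in> {c..e}" and ce: "c < e"
  shows "(cmod (y x))\<^sup>2 \<le> 2 / (e - c) * integral {c..e} (\<lambda>x. (cmod (y x))\<^sup>2) +
           2 * (e - c) * integral {c..e} (\<lambda>x. (cmod (g x))\<^sup>2)"
proof -
  define J where "J = integral {c..e} (\<lambda>x. (cmod (g x))\<^sup>2)"
  have yi: "(\<lambda>x. (cmod (y x))\<^sup>2) integrable_on {c..e}"
    by (intro L2_on_square_integrable_on L2_on_continuous primitive_on_continuous[OF prim])
  have "integral {c..e} (\<lambda>t. (cmod (y x))\<^sup>2) \<le> integral {c..e} (\<lambda>t. 2 * (cmod (y t))\<^sup>2 + 2 * (e - c) * J)"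
    using cell_pointwise_bound[OF prim g x]
    by (intro integral_le integrable_add integrable_on_mult_right yi integrable_on_const) (auto simp: J_def)
  also have "\<dots> = 2 * integral {c..e} (\<lambda>x. (cmod (y x))\<^sup>2) + (e - c) * (2 * (e - c) * J)"
    using ce yi by (subst Henstock_Kurzweil_Integration.integral_add) (auto intro!: integrable_on_mult_right integrable_on_const)
  finally have "(e - c) * (cmod (y x))\<^sup>2 \<le> 2 * integral {c..e} (\<lambda>x. (cmod (y x))\<^sup>2) + (e - c) * (2 * (e - c) * J)"
    using ce by simp
  then show ?thesis using ce by (simp add: J_def[symmetric] field_simps)
qed

text \<open>The bump of the window \<open>[(n - 1) a, (n + 1) a]\<close>, used only there. The formula continues it periodically,
  which makes two consecutive bumps add up to one everywhere.\<close>

definition cell_cut :: "real \<Rightarrow> nat \<Rightarrow> real \<Rightarrow> real" where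
  "cell_cut a n x = (cos (pi * (x - n * a) / (2 * a)))\<^sup>2"

definition cell_cut' :: "real \<Rightarrow> nat \<Rightarrow> real \<Rightarrow> real" where
  "cell_cut' a n x = - (pi / a) * cos (pi * (x - n * a) / (2 * a)) * sin (pi * (x - n * a) / (2 * a))"

lemma cell_cut_bounds: "0 \<le> cell_cut a n x" "cell_cut a n x \<le> 1"
  by (simp_all add: cell_cut_def abs_square_le_1)

lemma cell_cut'_bound:
  assumes "a > 0" shows "\<bar>cell_cut' a n x\<bar> \<le> 4 / a"
proof -
  have "\<bar>cell_cut' a n x\<bar> = pi / a * (\<bar>cos (pi * (x - n * a) / (2 * a))\<bar> * \<bar>sin (pi * (x - n * a) / (2 * a))\<bar>)"
    using assms by (simp add: cell_cut'_def abs_mult)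
  also have "\<dots> \<le> pi / a * 1"
    using assms by (intro mult_left_mono mult_le_one) auto
  also have "\<dots> \<le> 4 / a" using pi_less_4 assms by (simp add: divide_right_mono)
  finally show ?thesis .
qed

lemma cell_cut_sum:
  assumes "a > 0"
  shows "cell_cut a n x + cell_cut a (Suc n) x = 1" "cell_cut' a n x + cell_cut' a (Suc n) x = 0"
proof -
  define \<theta> where "\<theta> = pi * (x - n * a) / (2 * a)"
  have e: "pi * (x - real (Suc n) * a) / (2 * a) = - (pi / 2 - \<theta>)"
    using assms by (simp add: \<theta>_def field_simps)
  have cs: "cos (pi * (x - real (Suc n) * a) / (2 * a)) = sin \<theta>" "sin (pi * (x - real (Suc n) * a) / (2 * a)) = - cos \<theta>"
    unfolding e by (simp_all add: cos_diff sin_diff)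
  show "cell_cut a n x + cell_cut a (Suc n) x = 1"
    unfolding cell_cut_def cs by (simp add: \<theta>_def)
  show "cell_cut' a n x + cell_cut' a (Suc n) x = 0"
    unfolding cell_cut'_def cs by (simp add: \<theta>_def)
qed

lemma cell_cut_ends:
  assumes "a > 0"
  shows "cell_cut a n (n * a + a) = 0" "cell_cut a n (n * a - a) = 0"
  using assms by (simp_all add: cell_cut_def)

lemma cell_cut_ge_half:
  assumes a: "a > 0" and x: "\<bar>x - n * a\<bar> \<le> a / 2"
  shows "1 / 2 \<le> cell_cut a n x"
proof -
  define \<theta> where "\<theta> = pi * (x - n * a) / (2 * a)"
  have "\<bar>2 * \<theta>\<bar> = pi / a * \<bar>x - n * a\<bar>" using a by (simp add: \<theta>_def abs_mult)
  also have "\<dots> \<le> pi / a * (a / 2)" using x a by (intro mult_left_mono) auto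
  finally have "\<bar>2 * \<theta>\<bar> \<le> pi / 2" using a by simp
  then have "0 \<le> cos (2 * \<theta>)" by (intro cos_ge_zero) auto
  then show ?thesis unfolding cell_cut_def by (simp add: \<theta>_def[symmetric] cos_double_cos)
qed

lemma cell_cut_primitive:
  assumes "a > 0"
  shows "primitive_on p q (\<lambda>x. complex_of_real (cell_cut' a n x)) (\<lambda>x. complex_of_real (cell_cut a n x))"
proof (rule primitive_on_smooth)
  have "((\<lambda>x. cell_cut a n x) has_real_derivative cell_cut' a n x) (at x)" for x
    unfolding cell_cut_def cell_cut'_def using assms
    by (auto intro!: derivative_eq_intros simp: field_simps)
  then show "((\<lambda>x. complex_of_real (cell_cut a n x)) has_vector_derivative complex_of_real (cell_cut' a n x)) (at x)" for x
    by (auto intro!: has_vector_derivative_of_real simp: has_real_derivative_iff_has_vector_derivative)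
  show "continuous_on {p..q} (\<lambda>x. complex_of_real (cell_cut' a n x))"
    unfolding cell_cut'_def using assms by (intro continuous_intros) auto
qed

text \<open>\<open>S\<close> increases over distances at most \<open>d\<close> up to the errors \<open>F\<close> and \<open>G\<close>, which are uniformly
  square integrable.\<close>

locale almost_increasing =
  fixes S F G :: "real \<Rightarrow> real" and d P :: real
  assumes d: "d > 0"
    and incr: "\<And>x t. 0 \<le> t \<Longrightarrow> t \<le> x \<Longrightarrow> x - t \<le> d \<Longrightarrow> S t + G t \<le> S x + F x"
    and L2S: "\<And>R. L2_on {0..R} (\<lambda>x. complex_of_real (S x))"
    and L2\<rho>: "\<And>R. L2_on {0..R} (\<lambda>x. complex_of_real (\<bar>F x\<bar> + \<bar>G x\<bar>))"
    and P: "\<And>x. x \<ge> 0 \<Longrightarrow> integral {x..x+1} (\<lambda>x. (\<bar>F x\<bar> + \<bar>G x\<bar>)\<^sup>2) \<le> P"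
begin

definition \<rho> :: "real \<Rightarrow> real" where "\<rho> x = \<bar>F x\<bar> + \<bar>G x\<bar>"

lemma \<rho>_nonneg: "0 \<le> \<rho> x" by (simp add: \<rho>_def)

lemma L2_sub:
  assumes "0 \<le> p"
  shows "L2_on {p..q} (\<lambda>x. complex_of_real (S x))" "L2_on {p..q} (\<lambda>x. complex_of_real (\<rho> x))"
proof -
  show "L2_on {p..q} (\<lambda>x. complex_of_real (S x))"
    by (rule L2_on_subset[OF L2S[of q]]) (use assms in auto)
  show "L2_on {p..q} (\<lambda>x. complex_of_real (\<rho> x))"
    unfolding \<rho>_def by (rule L2_on_subset[OF L2\<rho>[of q]]) (use assms in auto)
qed

lemma P_nonneg: "0 \<le> P"
proof -
  have "(\<lambda>x. (\<bar>F x\<bar> + \<bar>G x\<bar>)\<^sup>2) integrable_on {0..1}"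
    using L2_on_square_integrable_on[OF L2\<rho>[of 1]] by (simp only: norm_of_real power2_abs)
  then have "0 \<le> integral {0..0+1} (\<lambda>x. (\<bar>F x\<bar> + \<bar>G x\<bar>)\<^sup>2)"
    by (intro Henstock_Kurzweil_Integration.integral_nonneg) auto
  then show ?thesis using P[of 0] by simp
qed

text \<open>The running supremum from \<open>p\<close> of \<open>S + G\<close>. It is increasing by construction and, on \<open>[p, p + d]\<close>, lies
  between \<open>S + G\<close> and \<open>S + F\<close>, so it differs from \<open>S\<close> by at most \<open>\<rho>\<close>.\<close>

definition monotone_part :: "real \<Rightarrow> real \<Rightarrow> real" where
  "monotone_part p x = Sup ((\<lambda>t. S t + G t) ` {p..x})"

lemma monotone_part:
  assumes p: "0 \<le> p"
  shows monotone_part_bounds: "p \<le> x \<Longrightarrow> x \<le> p + d \<Longrightarrow> S x + G x \<le> monotone_part p x \<and> monotone_part p x \<le> S x + F x"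
    and monotone_part_mono: "p \<le> x \<Longrightarrow> x \<le> y \<Longrightarrow> y \<le> p + d \<Longrightarrow> monotone_part p x \<le> monotone_part p y"
proof -
  have up: "S t + G t \<le> S x + F x" if "p \<le> t" "t \<le> x" "x \<le> p + d" for t x
    by (rule incr) (use that p in auto)
  have bdd: "bdd_above ((\<lambda>t. S t + G t) ` {p..x})" if "x \<le> p + d" for x
    using up[OF _ _ that] by (intro bdd_aboveI[of _ "S x + F x"]) auto
  show "S x + G x \<le> monotone_part p x \<and> monotone_part p x \<le> S x + F x" if "p \<le> x" "x \<le> p + d"
    unfolding monotone_part_def
    using that up bdd by (auto intro!: cSUP_upper cSUP_least)
  show "monotone_part p x \<le> monotone_part p y" if "p \<le> x" "x \<le> y" "y \<le> p + d"
    unfolding monotone_part_def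
    using that bdd by (intro cSUP_subset_mono) auto
qed

lemma window_estimate:
  assumes p: "0 \<le> p" "p \<le> q" "q \<le> p + d"
    and prim: "primitive_on p q (\<lambda>x. complex_of_real (\<psi> x)) (\<lambda>x. complex_of_real (\<phi> x))"
    and \<psi>: "L2_on {p..q} (\<lambda>x. complex_of_real (\<psi> x))"
    and ends: "\<phi> p = 0" "\<phi> q = 0" and nonneg: "\<And>x. x \<in> {p..q} \<Longrightarrow> 0 \<le> \<phi> x"
    and lr: "p \<le> l" "l \<le> r" "r \<le> q" and \<mu>: "\<And>x. x \<in> {l..r} \<Longrightarrow> \<mu> \<le> \<phi> x"
  shows "integral {p..q} (\<lambda>x. S x * \<psi> x) \<le>
    - (\<mu> * (monotone_part p r - monotone_part p l)) + integral {p..q} (\<lambda>x. \<rho> x * \<bar>\<psi> x\<bar>)"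
proof -
  let ?m = "monotone_part p"
  have mi: "(\<lambda>x. ?m x * \<psi> x) integrable_on {p..q}"
    and mb: "integral {p..q} (\<lambda>x. ?m x * \<psi> x) \<le> - (\<mu> * (?m r - ?m l))"
    using monotone_weight_integral[OF prim ends nonneg _ lr \<mu>, of ?m] monotone_part_mono[OF p(1)] p by auto
  have Si: "(\<lambda>x. S x * \<psi> x) integrable_on {p..q}"
    by (rule real_L2_mult_integrable_on[OF L2_sub(1)[OF p(1)] \<psi>])
  have \<rho>i: "(\<lambda>x. \<rho> x * \<bar>\<psi> x\<bar>) integrable_on {p..q}"
    using real_L2_mult_integrable_on(2)[OF L2_sub(2)[OF p(1)] \<psi>] \<rho>_nonneg by simp
  have "integral {p..q} (\<lambda>x. S x * \<psi> x) \<le> integral {p..q} (\<lambda>x. ?m x * \<psi> x + \<rho> x * \<bar>\<psi> x\<bar>)"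
  proof (rule integral_le[OF Si integrable_add[OF mi \<rho>i]])
    fix x assume x: "x \<in> {p..q}"
    have "S x + G x \<le> ?m x" "?m x \<le> S x + F x" using monotone_part_bounds[OF p(1), of x] x p by auto
    then have "\<bar>S x - ?m x\<bar> \<le> \<rho> x" by (auto simp: \<rho>_def)
    then have "(S x - ?m x) * \<psi> x \<le> \<rho> x * \<bar>\<psi> x\<bar>"
      by (metis abs_ge_self abs_ge_zero abs_mult mult_right_mono order_trans)
    then show "S x * \<psi> x \<le> ?m x * \<psi> x + \<rho> x * \<bar>\<psi> x\<bar>" by (simp add: algebra_simps)
  qed
  also have "\<dots> = integral {p..q} (\<lambda>x. ?m x * \<psi> x) + integral {p..q} (\<lambda>x. \<rho> x * \<bar>\<psi> x\<bar>)"
    by (rule Henstock_Kurzweil_Integration.integral_add[OF mi \<rho>i])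
  finally show ?thesis using mb by linarith
qed

text \<open>The growth of the monotone part of the window \<open>[n a - a, n a + a]\<close> over its middle half, where the bump of
  the window is at least \<open>1 / 2\<close>.\<close>

definition rise :: "real \<Rightarrow> nat \<Rightarrow> real" where
  "rise a n = monotone_part (n * a - a) (n * a + a / 2) - monotone_part (n * a - a) (n * a - a / 2)"

lemma rise_nonneg:
  assumes "a > 0" "2 * a \<le> d" "n \<ge> 1"
  shows "0 \<le> rise a n"
proof -
  have "0 \<le> n * a - a" using assms mult_right_mono[of 1 "real n" a] by simp
  then show ?thesis unfolding rise_def using monotone_part_mono[of "n * a - a" "n * a - a / 2" "n * a + a / 2"] assms by simp
qed

text \<open>\<open>window_estimate\<close> is applied to \<open>\<phi>\<close> times the bump of each window and the results are added. The bumps form a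
  partition of unity, so the left-hand sides add up to the full integral, while each cell
  lies in two windows, which doubles the error. The first window is only half a window; there \<open>\<phi>\<close> itself
  vanishes at the left end.\<close>

lemma patched_estimate:
  assumes a: "a > 0" "2 * a \<le> d"
    and prim: "\<And>b. primitive_on 0 b (\<lambda>x. complex_of_real (\<psi> x)) (\<lambda>x. complex_of_real (\<phi> x))"
    and \<psi>: "\<And>b. L2_on {0..b} (\<lambda>x. complex_of_real (\<psi> x))"
    and \<phi>0: "\<phi> 0 = 0" and nonneg: "\<And>x. x \<ge> 0 \<Longrightarrow> 0 \<le> \<phi> x"
    and supp: "\<And>x. x \<ge> N * a \<Longrightarrow> \<phi> x = 0 \<and> \<psi> x = 0"
    and \<mu>: "\<And>n x. n \<ge> 1 \<Longrightarrow> \<bar>x - n * a\<bar> \<le> a / 2 \<Longrightarrow> \<mu> n \<le> \<phi> x" and \<mu>0: "\<And>n. 0 \<le> \<mu> n"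
  shows "integral {0..N * a} (\<lambda>x. S x * \<psi> x) \<le>
    - (1/2) * (\<Sum>n=1..N. \<mu> n * rise a n) + 2 * integral {0..N * a} (\<lambda>x. \<rho> x * (\<bar>\<psi> x\<bar> + 4 / a * \<phi> x))"
proof -
  define \<psi>n where "\<psi>n = (\<lambda>n x. \<psi> x * cell_cut a n x + \<phi> x * cell_cut' a n x)"
  define \<kappa> where "\<kappa> = (\<lambda>x. \<rho> x * (\<bar>\<psi> x\<bar> + 4 / a * \<phi> x))"
  (* The contribution of window n on the cell number k, which is nonzero only for k = n - 1 and k = n;
     W n is the total of window n, and e and E are the corresponding errors. *)
  define c where "c = (\<lambda>n k. integral {real k * a..real (Suc k) * a} (\<lambda>x. S x * \<psi>n n x))"
  define e where "e = (\<lambda>k. integral {real k * a..real (Suc k) * a} \<kappa>)"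
  define W where "W = (\<lambda>n. if n = 0 then c 0 0 else c n (n - 1) + c n n)"
  define E where "E = (\<lambda>n. if n = 0 then e 0 else e (n - 1) + e n)"
  have prim': "primitive_on p q (\<lambda>x. complex_of_real (\<psi> x)) (\<lambda>x. complex_of_real (\<phi> x))" if "0 \<le> p" for p q
    by (rule primitive_on_subinterval[OF prim[of q]]) (use that in auto)
  have \<psi>': "L2_on {p..q} (\<lambda>x. complex_of_real (\<psi> x))" if "0 \<le> p" for p q
    by (rule L2_on_subset[OF \<psi>[of q]]) (use that in auto)
  have \<phi>': "L2_on {p..q} (\<lambda>x. complex_of_real (\<phi> x))" if "0 \<le> p" for p q
    by (intro L2_on_continuous primitive_on_continuous[OF prim'[OF that]])
  have primn: "primitive_on p q (\<lambda>x. complex_of_real (\<psi>n n x)) (\<lambda>x. complex_of_real (\<phi> x * cell_cut a n x))" if "0 \<le> p" for p q n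
    using primitive_on_mult[OF prim'[OF that] cell_cut_primitive[OF a(1), of p q n]]
    by (simp add: \<psi>n_def)
  have L2n: "L2_on {p..q} (\<lambda>x. complex_of_real (\<psi>n n x))" if p: "0 \<le> p" for p q n
  proof -
    have "L2_on {p..q} (\<lambda>x. complex_of_real (\<psi> x) * complex_of_real (cell_cut a n x))"
      by (intro L2_on_mult_continuous \<psi>' p primitive_on_continuous[OF cell_cut_primitive[OF a(1)]])
    moreover have "continuous_on {p..q} (\<lambda>x. complex_of_real (cell_cut' a n x))"
      unfolding cell_cut'_def using a by (intro continuous_intros) auto
    then have "L2_on {p..q} (\<lambda>x. complex_of_real (\<phi> x) * complex_of_real (cell_cut' a n x))"
      by (intro L2_on_mult_continuous \<phi>' p)
    ultimately show ?thesis using L2_on_add by (force simp: \<psi>n_def)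
  qed
  have Si: "(\<lambda>x. S x * \<psi>n n x) integrable_on {p..q}" if "0 \<le> p" for p q n
    by (rule real_L2_mult_integrable_on[OF L2_sub(1)[OF that] L2n[OF that]])
  have S\<psi>i: "(\<lambda>x. S x * \<psi> x) integrable_on {p..q}" if "0 \<le> p" for p q
    by (rule real_L2_mult_integrable_on[OF L2_sub(1)[OF that] \<psi>'[OF that]])
  have \<rho>i: "(\<lambda>x. \<rho> x * \<bar>\<psi>n n x\<bar>) integrable_on {p..q}" if "0 \<le> p" for p q n
    using real_L2_mult_integrable_on(2)[OF L2_sub(2)[OF that] L2n[OF that]] \<rho>_nonneg by simp
  have \<kappa>i: "\<kappa> integrable_on {p..q}" if p: "0 \<le> p" for p q
  proof -
    have "(\<lambda>x. \<rho> x * \<bar>\<psi> x\<bar> + 4 / a * (\<rho> x * \<phi> x)) integrable_on {p..q}"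
      using real_L2_mult_integrable_on(2)[OF L2_sub(2)[OF p] \<psi>'[OF p, of q]] \<rho>_nonneg
        real_L2_mult_integrable_on(1)[OF L2_sub(2)[OF p] \<phi>'[OF p, of q]]
      by (intro integrable_add integrable_on_mult_right) auto
    then show ?thesis by (simp add: \<kappa>_def algebra_simps)
  qed
  have \<psi>n_le: "\<rho> x * \<bar>\<psi>n n x\<bar> \<le> \<kappa> x" if "x \<ge> 0" for n x
  proof -
    have "\<bar>\<psi>n n x\<bar> \<le> \<bar>\<psi> x\<bar> * \<bar>cell_cut a n x\<bar> + \<bar>\<phi> x\<bar> * \<bar>cell_cut' a n x\<bar>"
      unfolding \<psi>n_def by (metis abs_mult abs_triangle_ineq)
    also have "\<dots> \<le> \<bar>\<psi> x\<bar> * 1 + \<bar>\<phi> x\<bar> * (4 / a)"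
      using cell_cut_bounds[of a n x] cell_cut'_bound[OF a(1)] by (intro add_mono mult_left_mono) auto
    finally show ?thesis
      unfolding \<kappa>_def using nonneg[OF that] \<rho>_nonneg by (intro mult_left_mono) (auto simp: mult.commute)
  qed
  have combine: "integral {real k * a..real (Suc k) * a} h + integral {real (Suc k) * a..real (Suc (Suc k)) * a} h
      = integral {real k * a..real (Suc (Suc k)) * a} h"
    if "h integrable_on {real k * a..real (Suc (Suc k)) * a}" for k and h :: "real \<Rightarrow> real"
    by (rule Henstock_Kurzweil_Integration.integral_combine) (use that a in \<open>auto intro: mult_right_mono\<close>)
  have ka: "0 \<le> real k * a" for k using a by simp
  have window: "W n \<le> - (1/2) * (if n = 0 then 0 else \<mu> n * rise a n) + E n" for n
  proof (cases "n = 0")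
    case True
    have "integral {0..a} (\<lambda>x. S x * \<psi>n 0 x) \<le> - (0 * (monotone_part 0 a - monotone_part 0 0)) + integral {0..a} (\<lambda>x. \<rho> x * \<bar>\<psi>n 0 x\<bar>)"
      by (rule window_estimate[where \<phi> = "\<lambda>x. \<phi> x * cell_cut a 0 x"])
         (use a primn L2n \<phi>0 cell_cut_ends(1)[OF a(1), of 0] nonneg cell_cut_bounds in auto)
    also have "integral {0..a} (\<lambda>x. \<rho> x * \<bar>\<psi>n 0 x\<bar>) \<le> integral {0..a} \<kappa>"
      by (rule integral_le) (use \<rho>i \<kappa>i \<psi>n_le in auto)
    finally show ?thesis using True by (simp add: W_def E_def c_def e_def)
  next
    case False
    then obtain j where n: "n = Suc j" by (cases n) auto
    have nj: "real n * a - a = real j * a" "real (Suc n) * a = real n * a + a" by (simp_all add: n algebra_simps)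
    have "integral {real j * a..real n * a + a} (\<lambda>x. S x * \<psi>n n x) \<le>
        - (\<mu> n / 2 * (monotone_part (real j * a) (real n * a + a / 2) - monotone_part (real j * a) (real n * a - a / 2)))
        + integral {real j * a..real n * a + a} (\<lambda>x. \<rho> x * \<bar>\<psi>n n x\<bar>)"
    proof (rule window_estimate[where \<phi> = "\<lambda>x. \<phi> x * cell_cut a n x"])
      show "\<phi> (real j * a) * cell_cut a n (real j * a) = 0"
        using cell_cut_ends(2)[OF a(1), of n] nj by simp
      show "\<phi> (real n * a + a) * cell_cut a n (real n * a + a) = 0"
        using cell_cut_ends(1)[OF a(1), of n] by simp
      show "0 \<le> \<phi> x * cell_cut a n x" if "x \<in> {real j * a..real n * a + a}" for x
        using nonneg[of x] cell_cut_bounds[of a n x] that ka[of j] by simp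
      fix x assume x: "x \<in> {real n * a - a / 2..real n * a + a / 2}"
      then have "real n * a - a / 2 \<le> x" "x \<le> real n * a + a / 2" by (simp_all only: atLeastAtMost_iff)
      then have xa: "\<bar>x - n * a\<bar> \<le> a / 2" by linarith
      have "\<mu> n * (1 / 2) \<le> \<phi> x * cell_cut a n x"
        using \<mu>[OF _ xa] \<mu>0[of n] False cell_cut_ge_half[OF a(1) xa] by (intro mult_mono) (auto intro: order_trans)
      then show "\<mu> n / 2 \<le> \<phi> x * cell_cut a n x" by simp
    qed (use a nj ka primn L2n in auto)
    also have "integral {real j * a..real n * a + a} (\<lambda>x. \<rho> x * \<bar>\<psi>n n x\<bar>) \<le> integral {real j * a..real n * a + a} \<kappa>"
      by (rule integral_le) (use \<rho>i \<kappa>i \<psi>n_le ka[of j] in auto)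
    finally have "integral {real j * a..real (Suc n) * a} (\<lambda>x. S x * \<psi>n n x) \<le> - (1/2) * (\<mu> n * rise a n)
        + integral {real j * a..real (Suc n) * a} \<kappa>"
      unfolding nj(2) rise_def nj(1) by simp
    moreover have "c n j + c n n = integral {real j * a..real (Suc n) * a} (\<lambda>x. S x * \<psi>n n x)"
      unfolding c_def n by (rule combine) (use Si ka in auto)
    moreover have "e j + e n = integral {real j * a..real (Suc n) * a} \<kappa>"
      unfolding e_def n by (rule combine) (use \<kappa>i ka in auto)
    ultimately show ?thesis by (simp add: W_def E_def n)
  qed
  have extend: "integral {0..real (Suc k) * a} h = integral {0..real k * a} h + integral {real k * a..real (Suc k) * a} h"
    if "h integrable_on {0..real (Suc k) * a}" for k and h :: "real \<Rightarrow> real"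
    by (rule Henstock_Kurzweil_Integration.integral_combine[symmetric]) (use that a in \<open>auto intro: mult_right_mono\<close>)
  have cell: "c k k + c (Suc k) k = integral {real k * a..real (Suc k) * a} (\<lambda>x. S x * \<psi> x)" for k
  proof -
    have "c k k + c (Suc k) k = integral {real k * a..real (Suc k) * a} (\<lambda>x. S x * \<psi>n k x + S x * \<psi>n (Suc k) x)"
      unfolding c_def by (rule Henstock_Kurzweil_Integration.integral_add[symmetric]) (use Si ka in auto)
    also have "(\<lambda>x. S x * \<psi>n k x + S x * \<psi>n (Suc k) x) = (\<lambda>x. S x * \<psi> x)"
    proof
      fix x
      have "S x * \<psi>n k x + S x * \<psi>n (Suc k) x = S x * (\<psi> x * (cell_cut a k x + cell_cut a (Suc k) x) + \<phi> x * (cell_cut' a k x + cell_cut' a (Suc k) x))"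
        by (simp add: \<psi>n_def algebra_simps)
      then show "S x * \<psi>n k x + S x * \<psi>n (Suc k) x = S x * \<psi> x" by (simp only: cell_cut_sum[OF a(1)]) simp
    qed
    finally show ?thesis .
  qed
  have sumW: "(\<Sum>n\<le>k. W n) = integral {0..real k * a} (\<lambda>x. S x * \<psi> x) + c k k" for k
  proof (induction k)
    case (Suc k)
    then show ?case using extend[of "\<lambda>x. S x * \<psi> x" k] S\<psi>i cell[of k] by (simp add: W_def)
  qed (simp add: W_def)
  have sumE: "(\<Sum>n\<le>k. E n) = 2 * integral {0..real k * a} \<kappa> + e k" for k
  proof (induction k)
    case (Suc k)
    then show ?case using extend[of \<kappa> k] \<kappa>i by (simp add: E_def e_def)
  qed (simp add: E_def)
  have zero: "integral {real N * a..real (Suc N) * a} h = 0" if "\<And>x. x \<ge> N * a \<Longrightarrow> h x = 0" for h :: "real \<Rightarrow> real"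
    using integral_cong[of "{real N * a..real (Suc N) * a}" h "\<lambda>x. 0"] that by simp
  have cN: "c N N = 0" unfolding c_def by (rule zero) (use supp in \<open>simp add: \<psi>n_def\<close>)
  have eN: "e N = 0" unfolding e_def by (rule zero) (use supp in \<open>simp add: \<kappa>_def\<close>)
  have "(\<Sum>n\<le>N. W n) \<le> (\<Sum>n\<le>N. - (1/2) * (if n = 0 then 0 else \<mu> n * rise a n) + E n)"
    by (rule sum_mono) (rule window)
  also have "\<dots> = - (1/2) * (\<Sum>n\<le>N. if n = 0 then 0 else \<mu> n * rise a n) + (\<Sum>n\<le>N. E n)"
    by (simp only: sum.distrib sum_distrib_left)
  also have "(\<Sum>n\<le>N. if n = 0 then 0 else \<mu> n * rise a n) = (\<Sum>n=1..N. \<mu> n * rise a n)"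
    by (rule sum.mono_neutral_cong_right) auto
  finally show ?thesis unfolding sumW sumE cN eN \<kappa>_def by simp
qed

text \<open>On a cell of length \<open>a\<close> the factor \<open>|y|\<^sup>2\<close> is replaced by its bound from \<open>cell_sup_bound\<close>, and the integral of
  \<open>\<rho>\<^sup>2\<close> by \<open>P\<close>. The factor \<open>a\<close> in front of \<open>\<integral>|g|\<^sup>2\<close> is what makes the errors small for fine cells.\<close>

lemma weighted_bound:
  assumes a: "0 < a" "a \<le> 1"
    and prim: "\<And>b. primitive_on 0 b g y" and g: "\<And>b. L2_on {0..b} g"
  shows "integral {0..real N * a} (\<lambda>x. (\<rho> x)\<^sup>2 * (cmod (y x))\<^sup>2) \<le>
    P * (2 / a * integral {0..real N * a} (\<lambda>x. (cmod (y x))\<^sup>2) + 2 * a * integral {0..real N * a} (\<lambda>x. (cmod (g x))\<^sup>2))"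
    and "(\<lambda>x. (\<rho> x)\<^sup>2 * (cmod (y x))\<^sup>2) integrable_on {0..b}"
proof -
  have yc: "continuous_on {0..b} y" for b by (rule primitive_on_continuous[OF prim])
  have i1: "(\<lambda>x. (\<rho> x)\<^sup>2 * (cmod (y x))\<^sup>2) integrable_on {0..b}" for b
    using L2_on_square_integrable_on[OF L2_on_mult_continuous[OF L2_sub(2)[of 0 b] yc]]
    by (simp add: norm_mult power_mult_distrib)
  then show "(\<lambda>x. (\<rho> x)\<^sup>2 * (cmod (y x))\<^sup>2) integrable_on {0..b}" .
  have i2: "(\<lambda>x. (cmod (y x))\<^sup>2) integrable_on {0..b}" for b
    by (intro L2_on_square_integrable_on L2_on_continuous yc)
  have i3: "(\<lambda>x. (cmod (g x))\<^sup>2) integrable_on {0..b}" for b by (intro L2_on_square_integrable_on g)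
  have extend: "integral {0..real (Suc k) * a} h = integral {0..real k * a} h + integral {real k * a..real (Suc k) * a} h"
    if "h integrable_on {0..real (Suc k) * a}" for k and h :: "real \<Rightarrow> real"
    by (rule Henstock_Kurzweil_Integration.integral_combine[symmetric]) (use that a in \<open>auto intro: mult_right_mono\<close>)
  show "integral {0..real N * a} (\<lambda>x. (\<rho> x)\<^sup>2 * (cmod (y x))\<^sup>2) \<le>
    P * (2 / a * integral {0..real N * a} (\<lambda>x. (cmod (y x))\<^sup>2) + 2 * a * integral {0..real N * a} (\<lambda>x. (cmod (g x))\<^sup>2))"
  proof (induction N)
    case (Suc k)
    define c where "c = real k * a"
    have c: "0 \<le> c" "real (Suc k) * a = c + a" using a by (auto simp: c_def algebra_simps)
    have p: "primitive_on c (c + a) g y" by (rule primitive_on_subinterval[OF prim[of "c + a"]]) (use c in auto)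
    have gl: "L2_on {c..c + a} g" by (rule L2_on_subset[OF g[of "c + a"]]) (use c in auto)
    define B where "B = 2 / a * integral {c..c + a} (\<lambda>x. (cmod (y x))\<^sup>2) + 2 * a * integral {c..c + a} (\<lambda>x. (cmod (g x))\<^sup>2)"
    have B: "(cmod (y x))\<^sup>2 \<le> B" if "x \<in> {c..c + a}" for x
      using cell_sup_bound[OF p gl that] a by (simp add: B_def)
    have B0: "0 \<le> B" using B[of c] a by (auto intro: order_trans[OF zero_le_power2])
    have i4: "(\<lambda>x. (\<rho> x)\<^sup>2) integrable_on {c..q}" for q
      using L2_on_square_integrable_on[OF L2_sub(2)[OF c(1)]] by (simp only: norm_of_real power2_abs)
    have "integral {c..c + a} (\<lambda>x. (\<rho> x)\<^sup>2 * (cmod (y x))\<^sup>2) \<le> integral {c..c + a} (\<lambda>x. (\<rho> x)\<^sup>2 * B)"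
      by (intro integral_le integrable_on_mult_left i4 mult_left_mono B integrable_on_subinterval[OF i1[of "c + a"]])
         (use c in auto)
    also have "\<dots> = integral {c..c + a} (\<lambda>x. (\<rho> x)\<^sup>2) * B" by simp
    also have "\<dots> \<le> P * B"
    proof (rule mult_right_mono[OF _ B0])
      have "integral {c..c + a} (\<lambda>x. (\<rho> x)\<^sup>2) \<le> integral {c..c + 1} (\<lambda>x. (\<rho> x)\<^sup>2)"
        by (intro integral_subset_le i4) (use a in auto)
      also have "\<dots> \<le> P" unfolding \<rho>_def by (rule P[OF c(1)])
      finally show "integral {c..c + a} (\<lambda>x. (\<rho> x)\<^sup>2) \<le> P" .
    qed
    finally have step: "integral {c..c + a} (\<lambda>x. (\<rho> x)\<^sup>2 * (cmod (y x))\<^sup>2) \<le> P * B" .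
    show ?case
      unfolding extend[OF i1] extend[OF i2] extend[OF i3] unfolding c(2) c_def[symmetric]
      using add_mono[OF Suc.IH[folded c_def] step] by (simp add: B_def algebra_simps)
  qed simp
qed

text \<open>Young's inequality: \<open>2 \<rho> |y| |g| \<le> \<delta> |g|\<^sup>2 + \<rho>\<^sup>2 |y|\<^sup>2 / \<delta>\<close> and \<open>4 \<rho> / a \<le> \<rho>\<^sup>2 + 4 / a\<^sup>2\<close>.\<close>

lemma error_bound:
  assumes a: "0 < a" "a \<le> 1" and \<delta>: "\<delta> > 0"
    and prim: "\<And>b. primitive_on 0 b g y" and g: "\<And>b. L2_on {0..b} g"
    and \<psi>: "\<And>b. L2_on {0..b} (\<lambda>x. complex_of_real (\<psi> x))"
    and \<psi>_le: "\<And>x. \<bar>\<psi> x\<bar> \<le> 2 * cmod (y x) * cmod (g x)"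
  shows "integral {0..real N * a} (\<lambda>x. \<rho> x * (\<bar>\<psi> x\<bar> + 4 / a * (cmod (y x))\<^sup>2)) \<le>
    (\<delta> + 2 * a * P * (1 / \<delta> + 1)) * integral {0..real N * a} (\<lambda>x. (cmod (g x))\<^sup>2) +
    ((1 / \<delta> + 1) * 2 * P / a + 4 / a\<^sup>2) * integral {0..real N * a} (\<lambda>x. (cmod (y x))\<^sup>2)"
proof -
  let ?b = "real N * a"
  let ?D = "integral {0..?b} (\<lambda>x. (cmod (g x))\<^sup>2)" and ?N = "integral {0..?b} (\<lambda>x. (cmod (y x))\<^sup>2)"
  have yc: "continuous_on {0..b} y" for b by (rule primitive_on_continuous[OF prim])
  note i1 = weighted_bound(2)[OF a prim g]
  have i2: "(\<lambda>x. (cmod (y x))\<^sup>2) integrable_on {0..b}" for b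
    by (intro L2_on_square_integrable_on L2_on_continuous yc)
  have i3: "(\<lambda>x. (cmod (g x))\<^sup>2) integrable_on {0..b}" for b by (intro L2_on_square_integrable_on g)
  have \<phi>: "L2_on {0..b} (\<lambda>x. complex_of_real ((cmod (y x))\<^sup>2))" for b
    by (intro L2_on_continuous continuous_intros yc)
  have i0: "(\<lambda>x. \<rho> x * (\<bar>\<psi> x\<bar> + 4 / a * (cmod (y x))\<^sup>2)) integrable_on {0..?b}"
  proof -
    have "(\<lambda>x. \<rho> x * \<bar>\<psi> x\<bar> + 4 / a * (\<rho> x * (cmod (y x))\<^sup>2)) integrable_on {0..?b}"
      using real_L2_mult_integrable_on(2)[OF L2_sub(2)[OF order_refl] \<psi>[of ?b]] \<rho>_nonneg
        real_L2_mult_integrable_on(1)[OF L2_sub(2)[OF order_refl] \<phi>[of ?b]]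
      by (intro integrable_add integrable_on_mult_right) auto
    then show ?thesis by (simp add: algebra_simps)
  qed
  have "integral {0..?b} (\<lambda>x. \<rho> x * (\<bar>\<psi> x\<bar> + 4 / a * (cmod (y x))\<^sup>2)) \<le>
    integral {0..?b} (\<lambda>x. (\<delta> * (cmod (g x))\<^sup>2 + (1 / \<delta> + 1) * ((\<rho> x)\<^sup>2 * (cmod (y x))\<^sup>2)) + 4 / a\<^sup>2 * (cmod (y x))\<^sup>2)"
  proof (rule integral_le[OF i0])
    show "(\<lambda>x. (\<delta> * (cmod (g x))\<^sup>2 + (1 / \<delta> + 1) * ((\<rho> x)\<^sup>2 * (cmod (y x))\<^sup>2)) + 4 / a\<^sup>2 * (cmod (y x))\<^sup>2) integrable_on {0..?b}"
      by (intro integrable_add integrable_on_mult_right i1 i2 i3)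
    fix x
    define r Y Z where "r = \<rho> x" "Y = cmod (y x)" "Z = cmod (g x)"
    have pos: "r \<ge> 0" "Y \<ge> 0" "Z \<ge> 0" by (auto simp: r_Y_Z_def \<rho>_nonneg)
    have "r * \<bar>\<psi> x\<bar> \<le> r * (2 * Y * Z)" using \<psi>_le[of x] pos by (intro mult_left_mono) (auto simp: r_Y_Z_def)
    also have "\<dots> \<le> \<delta> * Z\<^sup>2 + 1 / \<delta> * (r\<^sup>2 * Y\<^sup>2)"
    proof -
      have "0 \<le> 1 / \<delta> * (\<delta> * Z - r * Y)\<^sup>2" using \<delta> by simp
      also have "\<dots> = \<delta> * Z\<^sup>2 + 1 / \<delta> * (r\<^sup>2 * Y\<^sup>2) - r * (2 * Y * Z)"
        using \<delta> by (simp add: power2_eq_square field_simps)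
      finally show ?thesis by simp
    qed
    finally have 1: "r * \<bar>\<psi> x\<bar> \<le> \<delta> * Z\<^sup>2 + 1 / \<delta> * (r\<^sup>2 * Y\<^sup>2)" .
    have "4 / a * r \<le> r\<^sup>2 + 4 / a\<^sup>2"
      using zero_le_power2[of "r - 2 / a"] a by (simp add: power2_eq_square field_simps)
    then have "4 / a * r * Y\<^sup>2 \<le> (r\<^sup>2 + 4 / a\<^sup>2) * Y\<^sup>2" by (rule mult_right_mono) simp
    then have 2: "r * (4 / a * Y\<^sup>2) \<le> r\<^sup>2 * Y\<^sup>2 + 4 / a\<^sup>2 * Y\<^sup>2" by (simp add: algebra_simps)
    have "r * (\<bar>\<psi> x\<bar> + 4 / a * Y\<^sup>2) \<le> (\<delta> * Z\<^sup>2 + (1 / \<delta> + 1) * (r\<^sup>2 * Y\<^sup>2)) + 4 / a\<^sup>2 * Y\<^sup>2"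
      using add_mono[OF 1 2] by (simp add: algebra_simps)
    then show "\<rho> x * (\<bar>\<psi> x\<bar> + 4 / a * (cmod (y x))\<^sup>2) \<le>
        (\<delta> * (cmod (g x))\<^sup>2 + (1 / \<delta> + 1) * ((\<rho> x)\<^sup>2 * (cmod (y x))\<^sup>2)) + 4 / a\<^sup>2 * (cmod (y x))\<^sup>2"
      by (simp add: r_Y_Z_def)
  qed
  also have "\<dots> = \<delta> * ?D + (1 / \<delta> + 1) * integral {0..?b} (\<lambda>x. (\<rho> x)\<^sup>2 * (cmod (y x))\<^sup>2) + 4 / a\<^sup>2 * ?N"
    by (subst Henstock_Kurzweil_Integration.integral_add, intro integrable_add integrable_on_mult_right i1 i3,
        intro integrable_on_mult_right i2, subst Henstock_Kurzweil_Integration.integral_add,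
        intro integrable_on_mult_right i3, intro integrable_on_mult_right i1) simp
  also have "\<dots> \<le> \<delta> * ?D + (1 / \<delta> + 1) * (P * (2 / a * ?N + 2 * a * ?D)) + 4 / a\<^sup>2 * ?N"
    using weighted_bound(1)[OF a prim g, of N] \<delta> by (intro add_mono mult_left_mono) auto
  also have "\<dots> = (\<delta> + 2 * a * P * (1 / \<delta> + 1)) * ?D + ((1 / \<delta> + 1) * 2 * P / a + 4 / a\<^sup>2) * ?N"
    by (simp add: algebra_simps add_divide_distrib)
  finally show ?thesis .
qed

text \<open>\<open>patched_estimate\<close> for \<open>\<phi> = |y|\<^sup>2\<close>: first \<open>\<delta>\<close> and then the mesh \<open>a\<close> are taken so small that the errors
  contain at most \<open>\<epsilon> \<integral>|g|\<^sup>2\<close>. The lower bounds \<open>\<mu> n\<close> of \<open>|y|\<^sup>2\<close> on the cells remain free: \<open>\<mu> = 0\<close> yields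
  sectoriality, the minima of \<open>|y|\<^sup>2\<close> yield compactness.\<close>

lemma form_estimate:
  assumes \<epsilon>: "\<epsilon> > 0"
  obtains a0 where "a0 > 0" "a0 \<le> 1" "2 * a0 \<le> d"
    "\<forall>a. 0 < a \<and> a \<le> a0 \<longrightarrow> (\<exists>C\<ge>0. \<forall>y g N \<mu>.
       (\<forall>b. primitive_on 0 b g y) \<and> (\<forall>b. L2_on {0..b} g) \<and> y 0 = 0 \<and>
       (\<forall>x\<ge>real N * a. y x = 0 \<and> g x = 0) \<and> (\<forall>n::nat. 0 \<le> \<mu> n) \<and>
       (\<forall>n\<ge>1. \<forall>x. \<bar>x - real n * a\<bar> \<le> a / 2 \<longrightarrow> \<mu> n \<le> (cmod (y x))\<^sup>2) \<longrightarrow>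
       integral {0..real N * a} (\<lambda>x. S x * (2 * Re (g x * cnj (y x)))) \<le>
         - (1/2) * (\<Sum>n=1..N. \<mu> n * rise a n) +
         \<epsilon> * integral {0..real N * a} (\<lambda>x. (cmod (g x))\<^sup>2) + C * integral {0..real N * a} (\<lambda>x. (cmod (y x))\<^sup>2))"
proof -
  define \<delta> where "\<delta> = \<epsilon> / 4"
  define K where "K = 1 / \<delta> + 1"
  have \<delta>: "\<delta> > 0" and K: "K > 0" using \<epsilon> by (auto simp: \<delta>_def K_def intro!: add_pos_pos)
  define a0 where "a0 = min (min 1 (d / 2)) (\<epsilon> / (8 * (P + 1) * K))"
  show ?thesis
  proof (rule that[of a0])
    show "a0 > 0" using d \<epsilon> K P_nonneg by (auto simp: a0_def)
    show "a0 \<le> 1" "2 * a0 \<le> d" by (auto simp: a0_def)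
    show "\<forall>a. 0 < a \<and> a \<le> a0 \<longrightarrow> (\<exists>C\<ge>0. \<forall>y g N \<mu>.
       (\<forall>b. primitive_on 0 b g y) \<and> (\<forall>b. L2_on {0..b} g) \<and> y 0 = 0 \<and>
       (\<forall>x\<ge>real N * a. y x = 0 \<and> g x = 0) \<and> (\<forall>n::nat. 0 \<le> \<mu> n) \<and>
       (\<forall>n\<ge>1. \<forall>x. \<bar>x - real n * a\<bar> \<le> a / 2 \<longrightarrow> \<mu> n \<le> (cmod (y x))\<^sup>2) \<longrightarrow>
       integral {0..real N * a} (\<lambda>x. S x * (2 * Re (g x * cnj (y x)))) \<le>
         - (1/2) * (\<Sum>n=1..N. \<mu> n * rise a n) +
         \<epsilon> * integral {0..real N * a} (\<lambda>x. (cmod (g x))\<^sup>2) + C * integral {0..real N * a} (\<lambda>x. (cmod (y x))\<^sup>2))"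
    proof (intro allI impI)
      fix a assume "0 < a \<and> a \<le> a0"
      then have a: "0 < a" "a \<le> 1" "2 * a \<le> d" and a': "a \<le> \<epsilon> / (8 * (P + 1) * K)" by (auto simp: a0_def)
      define C where "C = 2 * (K * 2 * P / a + 4 / a\<^sup>2)"
      have C: "C \<ge> 0" using a K P_nonneg by (simp add: C_def)
      have "4 * a * P * K \<le> 4 * a * (P + 1) * K" using a K P_nonneg by (intro mult_right_mono mult_left_mono) auto
      also have "\<dots> \<le> \<epsilon> / 2"
      proof -
        have "0 < 8 * (P + 1) * K" using K P_nonneg by simp
        then have "a * (8 * (P + 1) * K) \<le> \<epsilon>" using a' by (simp only: pos_le_divide_eq)
        then show ?thesis by (simp add: algebra_simps)
      qed
      finally have small: "2 * (\<delta> + 2 * a * P * K) \<le> \<epsilon>" by (simp add: \<delta>_def)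
      show "\<exists>C\<ge>0. \<forall>y g N \<mu>.
       (\<forall>b. primitive_on 0 b g y) \<and> (\<forall>b. L2_on {0..b} g) \<and> y 0 = 0 \<and>
       (\<forall>x\<ge>real N * a. y x = 0 \<and> g x = 0) \<and> (\<forall>n::nat. 0 \<le> \<mu> n) \<and>
       (\<forall>n\<ge>1. \<forall>x. \<bar>x - real n * a\<bar> \<le> a / 2 \<longrightarrow> \<mu> n \<le> (cmod (y x))\<^sup>2) \<longrightarrow>
       integral {0..real N * a} (\<lambda>x. S x * (2 * Re (g x * cnj (y x)))) \<le>
         - (1/2) * (\<Sum>n=1..N. \<mu> n * rise a n) +
         \<epsilon> * integral {0..real N * a} (\<lambda>x. (cmod (g x))\<^sup>2) + C * integral {0..real N * a} (\<lambda>x. (cmod (y x))\<^sup>2)"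
      proof (rule exI[of _ C], intro conjI C allI impI, elim conjE)
        fix y g :: "real \<Rightarrow> complex" and N and \<mu> :: "nat \<Rightarrow> real"
        assume prim: "\<forall>b. primitive_on 0 b g y" and g: "\<forall>b. L2_on {0..b} g" and y0: "y 0 = 0"
          and supp: "\<forall>x\<ge>real N * a. y x = 0 \<and> g x = 0" and \<mu>0: "\<forall>n. 0 \<le> \<mu> n"
          and \<mu>: "\<forall>n\<ge>1. \<forall>x. \<bar>x - real n * a\<bar> \<le> a / 2 \<longrightarrow> \<mu> n \<le> (cmod (y x))\<^sup>2"
        define \<psi> where "\<psi> = (\<lambda>x. 2 * Re (g x * cnj (y x)))"
        define \<phi> where "\<phi> = (\<lambda>x. (cmod (y x))\<^sup>2)"
        have \<phi>: "complex_of_real (\<phi> x) = y x * cnj (y x)" for x by (simp add: \<phi>_def complex_norm_square[symmetric] flip: of_real_power)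
        have \<psi>: "complex_of_real (\<psi> x) = g x * cnj (y x) + y x * cnj (g x)" for x
          by (simp add: \<psi>_def complex_eq_iff)
        have yc: "continuous_on {0..b} y" for b by (rule primitive_on_continuous) (use prim in blast)
        have p\<phi>: "primitive_on 0 b (\<lambda>x. complex_of_real (\<psi> x)) (\<lambda>x. complex_of_real (\<phi> x))" for b
          unfolding \<phi> \<psi> by (intro primitive_on_mult primitive_on_cnj) (use prim in auto)
        have L\<psi>: "L2_on {0..b} (\<lambda>x. complex_of_real (\<psi> x))" for b
        proof -
          have "L2_on {0..b} (\<lambda>x. g x * cnj (y x))" "L2_on {0..b} (\<lambda>x. cnj (g x) * y x)"
            by (intro L2_on_mult_continuous L2_on_cnj continuous_intros yc g[rule_format])+
          then show ?thesis unfolding \<psi> using L2_on_add by (fastforce simp: mult.commute)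
        qed
        have "\<bar>\<psi> x\<bar> \<le> 2 * cmod (y x) * cmod (g x)" for x
          using abs_Re_le_cmod[of "g x * cnj (y x)"] by (simp add: \<psi>_def norm_mult mult.commute)
        then have err: "integral {0..real N * a} (\<lambda>x. \<rho> x * (\<bar>\<psi> x\<bar> + 4 / a * \<phi> x)) \<le>
            (\<delta> + 2 * a * P * K) * integral {0..real N * a} (\<lambda>x. (cmod (g x))\<^sup>2) +
            (K * 2 * P / a + 4 / a\<^sup>2) * integral {0..real N * a} (\<lambda>x. (cmod (y x))\<^sup>2)"
          unfolding K_def \<phi>_def using prim g L\<psi> by (intro error_bound[OF a(1,2) \<delta>]) auto
        have D0: "0 \<le> integral {0..real N * a} (\<lambda>x. (cmod (g x))\<^sup>2)"
          by (intro Henstock_Kurzweil_Integration.integral_nonneg L2_on_square_integrable_on g[rule_format]) simp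
        have "integral {0..real N * a} (\<lambda>x. S x * \<psi> x) \<le>
          - (1/2) * (\<Sum>n=1..N. \<mu> n * rise a n) + 2 * integral {0..real N * a} (\<lambda>x. \<rho> x * (\<bar>\<psi> x\<bar> + 4 / a * \<phi> x))"
          by (rule patched_estimate[OF a(1,3) p\<phi> L\<psi>]) (use y0 supp \<mu> \<mu>0 in \<open>auto simp: \<phi>_def \<psi>_def\<close>)
        also have "\<dots> \<le> - (1/2) * (\<Sum>n=1..N. \<mu> n * rise a n) + 2 * ((\<delta> + 2 * a * P * K) * integral {0..real N * a} (\<lambda>x. (cmod (g x))\<^sup>2) +
            (K * 2 * P / a + 4 / a\<^sup>2) * integral {0..real N * a} (\<lambda>x. (cmod (y x))\<^sup>2))"
          using err by simp
        also have "\<dots> = - (1/2) * (\<Sum>n=1..N. \<mu> n * rise a n) + (2 * (\<delta> + 2 * a * P * K)) * integral {0..real N * a} (\<lambda>x. (cmod (g x))\<^sup>2) +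
            C * integral {0..real N * a} (\<lambda>x. (cmod (y x))\<^sup>2)"
          unfolding C_def by (simp add: algebra_simps)
        also have "\<dots> \<le> - (1/2) * (\<Sum>n=1..N. \<mu> n * rise a n) + \<epsilon> * integral {0..real N * a} (\<lambda>x. (cmod (g x))\<^sup>2) +
            C * integral {0..real N * a} (\<lambda>x. (cmod (y x))\<^sup>2)"
          by (intro add_mono mult_right_mono small D0 order_refl)
        finally show "integral {0..real N * a} (\<lambda>x. S x * (2 * Re (g x * cnj (y x)))) \<le>
         - (1/2) * (\<Sum>n=1..N. \<mu> n * rise a n) +
         \<epsilon> * integral {0..real N * a} (\<lambda>x. (cmod (g x))\<^sup>2) + C * integral {0..real N * a} (\<lambda>x. (cmod (y x))\<^sup>2)"
          unfolding \<psi>_def .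
      qed
    qed
  qed
qed

end

section \<open>The quadratic form\<close>

lemma halfline_integral:
  fixes f :: "real \<Rightarrow> 'a::euclidean_space"
  assumes R: "0 \<le> R" and zero: "\<And>x. x > R \<Longrightarrow> f x = 0" and i: "integrable (lebesgue_on {0..R}) f"
  shows "integrable (lebesgue_on {0..}) f" "integral\<^sup>L (lebesgue_on {0..}) f = integral {0..R} f"
proof -
  have eq: "(\<lambda>x. indicator {0..} x *\<^sub>R f x) = (\<lambda>x. indicator {0..R} x *\<^sub>R f x)"
  proof
    show "indicator {0..} x *\<^sub>R f x = indicator {0..R} x *\<^sub>R f x" for x
      using zero[of x] by (cases "x > R") (auto simp: indicator_def)
  qed
  show "integrable (lebesgue_on {0..}) f" using i by (simp add: integrable_restrict_space eq)
  have "integral\<^sup>L (lebesgue_on {0..}) f = integral\<^sup>L (lebesgue_on {0..R}) f"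
    by (simp add: integral_restrict_space eq)
  also have "\<dots> = integral {0..R} f" by (rule lebesgue_integral_eq_integral[OF i]) auto
  finally show "integral\<^sup>L (lebesgue_on {0..}) f = integral {0..R} f" .
qed

lemma L2_on_halflineI:
  assumes "\<And>b. L2_on {0..b} f" "0 \<le> R" "\<And>x. x > R \<Longrightarrow> f x = 0"
  shows "L2_on {0..} f"
  unfolding L2_on_def
proof
  show "f \<in> borel_measurable (lebesgue_on {0..})"
    by (rule measurable_halfline) (use assms in \<open>simp add: L2_on_def\<close>)
  show "integrable (lebesgue_on {0..}) (\<lambda>x. (cmod (f x))\<^sup>2)"
    by (rule halfline_integral(1)[OF assms(2)]) (use assms in \<open>auto simp: L2_on_def\<close>)
qed

text \<open>The domain of the form. The second argument represents \<open>y'\<close>; it has to vanish outside of a bounded set everywhere,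
  not just almost everywhere, which spares null sets in later splittings of integrals.\<close>

definition test_function :: "(real \<Rightarrow> complex) \<Rightarrow> (real \<Rightarrow> complex) \<Rightarrow> bool" where
  "test_function y g \<longleftrightarrow> y 0 = 0 \<and> (\<forall>b. primitive_on 0 b g y) \<and> (\<forall>b. L2_on {0..b} g) \<and>
     (\<exists>R\<ge>0. \<forall>x\<ge>R. y x = 0 \<and> g x = 0)"

lemma test_functionD:
  assumes "test_function y g"
  shows "y 0 = 0" "primitive_on 0 b g y" "L2_on {0..b} g" "L2_on {0..b} y" "L2_on {0..} y" "L2_on {0..} g"
    "continuous_on {0..b} y"
proof -
  show "y 0 = 0" and p: "primitive_on 0 b g y" and g: "L2_on {0..b} g" for b
    using assms by (auto simp: test_function_def)
  show c: "continuous_on {0..b} y" for b by (rule primitive_on_continuous[OF p])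
  show y: "L2_on {0..b} y" for b by (rule L2_on_continuous[OF c])
  obtain R where R: "R \<ge> 0" "\<forall>x\<ge>R. y x = 0 \<and> g x = 0" using assms by (auto simp: test_function_def)
  show "L2_on {0..} y" by (rule L2_on_halflineI[OF y R(1)]) (use R in auto)
  show "L2_on {0..} g" by (rule L2_on_halflineI[OF g R(1)]) (use R in auto)
qed

lemma test_function_support:
  assumes "test_function y g"
  obtains R where "R \<ge> 0" "\<And>x. x \<ge> R \<Longrightarrow> y x = 0" "\<And>x. x \<ge> R \<Longrightarrow> g x = 0"
  using assms by (auto simp: test_function_def)

lemma test_function_add:
  assumes "test_function y g" "test_function v h"
  shows "test_function (\<lambda>x. y x + v x) (\<lambda>x. g x + h x)"
proof -
  obtain R1 where R1: "R1 \<ge> 0" "\<And>x. x \<ge> R1 \<Longrightarrow> y x = 0" "\<And>x. x \<ge> R1 \<Longrightarrow> g x = 0"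
    using test_function_support[OF assms(1)] by metis
  obtain R2 where R2: "R2 \<ge> 0" "\<And>x. x \<ge> R2 \<Longrightarrow> v x = 0" "\<And>x. x \<ge> R2 \<Longrightarrow> h x = 0"
    using test_function_support[OF assms(2)] by metis
  have "\<exists>R\<ge>0. \<forall>x\<ge>R. y x + v x = 0 \<and> g x + h x = 0"
    by (rule exI[of _ "max R1 R2"]) (use R1 R2 in auto)
  then show ?thesis
    using assms by (auto simp: test_function_def intro: primitive_on_add L2_on_add)
qed

lemma test_function_cmult:
  assumes "test_function y g"
  shows "test_function (\<lambda>x. c * y x) (\<lambda>x. c * g x)"
proof -
  obtain R where R: "R \<ge> 0" "\<And>x. x \<ge> R \<Longrightarrow> y x = 0" "\<And>x. x \<ge> R \<Longrightarrow> g x = 0"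
    using test_function_support[OF assms(1)] by metis
  have "\<exists>R\<ge>0. \<forall>x\<ge>R. c * y x = 0 \<and> c * g x = 0"
    by (rule exI[of _ R]) (use R in auto)
  then show ?thesis
    using assms by (auto simp: test_function_def intro: primitive_on_cmult L2_on_cmult)
qed

text \<open>The sesquilinear form \<open>\<integral>y' v'\<^sup>* - \<integral>s (y v\<^sup>*)'\<close> of \<open>-y'' + s' y\<close>, with \<open>s'\<close> integrated by
  parts.\<close>

definition form :: "(real \<Rightarrow> complex) \<Rightarrow> (real \<Rightarrow> complex) \<Rightarrow> (real \<Rightarrow> complex) \<Rightarrow> (real \<Rightarrow> complex) \<Rightarrow> (real \<Rightarrow> complex) \<Rightarrow> complex" where
  "form s y g v h = (\<integral>x. g x * cnj (h x) - s x * (g x * cnj (v x) + y x * cnj (h x)) \<partial>lebesgue_on {0..})"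

lemma form_integrable:
  assumes s: "L2_loc s" and y: "test_function y g" and v: "test_function v h"
  shows "integrable (lebesgue_on {0..}) (\<lambda>x. g x * cnj (h x))"
    "integrable (lebesgue_on {0..}) (\<lambda>x. s x * (g x * cnj (v x)))"
    "integrable (lebesgue_on {0..}) (\<lambda>x. s x * (y x * cnj (h x)))"
    "integrable (lebesgue_on {0..}) (\<lambda>x. s x * (g x * cnj (v x) + y x * cnj (h x)))"
proof -
  obtain R where R: "R \<ge> 0" "\<And>x. x \<ge> R \<Longrightarrow> y x = 0" "\<And>x. x \<ge> R \<Longrightarrow> g x = 0"
    using test_function_support[OF y] by metis
  have s': "L2_on {0..R} s" using s R by (simp add: L2_loc_def)
  show "integrable (lebesgue_on {0..}) (\<lambda>x. g x * cnj (h x))"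
    by (rule integrable_L2_product) (use test_functionD[OF y] test_functionD[OF v] in auto)
  have "L2_on {0..R} (\<lambda>x. g x * cnj (v x))"
    by (intro L2_on_mult_continuous continuous_intros test_functionD(3)[OF y] test_functionD(7)[OF v])
  from L2_on_mult_integrable[OF s' this]
  show 1: "integrable (lebesgue_on {0..}) (\<lambda>x. s x * (g x * cnj (v x)))"
    by (intro halfline_integral(1)[OF R(1)]) (use R in auto)
  have "L2_on {0..R} (\<lambda>x. cnj (h x) * y x)"
    by (intro L2_on_mult_continuous L2_on_cnj test_functionD(3)[OF v] test_functionD(7)[OF y])
  from L2_on_mult_integrable[OF s' this]
  show 2: "integrable (lebesgue_on {0..}) (\<lambda>x. s x * (y x * cnj (h x)))"
    by (intro halfline_integral(1)[OF R(1)]) (use R in \<open>auto simp: mult.commute\<close>)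
  show "integrable (lebesgue_on {0..}) (\<lambda>x. s x * (g x * cnj (v x) + y x * cnj (h x)))"
    using Bochner_Integration.integrable_add[OF 1 2] by (simp add: distrib_left)
qed

lemma form_diagonal:
  assumes s: "L2_loc s" and y: "test_function y g"
  shows "form s y g y g = of_real (\<integral>x. (cmod (g x))\<^sup>2 \<partial>lebesgue_on {0..})
     - (\<integral>x. s x * of_real (2 * Re (g x * cnj (y x))) \<partial>lebesgue_on {0..})"
    "integrable (lebesgue_on {0..}) (\<lambda>x. s x * of_real (2 * Re (g x * cnj (y x))))"
proof -
  have eq: "complex_of_real (2 * Re (g x * cnj (y x))) = g x * cnj (y x) + y x * cnj (g x)" for x
    by (simp add: complex_eq_iff)
  show "integrable (lebesgue_on {0..}) (\<lambda>x. s x * of_real (2 * Re (g x * cnj (y x))))"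
    unfolding eq by (rule form_integrable(4)[OF s y y])
  have "form s y g y g = (\<integral>x. g x * cnj (g x) \<partial>lebesgue_on {0..}) - (\<integral>x. s x * (g x * cnj (y x) + y x * cnj (g x)) \<partial>lebesgue_on {0..})"
    unfolding form_def by (rule Bochner_Integration.integral_diff[OF form_integrable(1)[OF s y y] form_integrable(4)[OF s y y]])
  then show "form s y g y g = of_real (\<integral>x. (cmod (g x))\<^sup>2 \<partial>lebesgue_on {0..})
     - (\<integral>x. s x * of_real (2 * Re (g x * cnj (y x))) \<partial>lebesgue_on {0..})"
    unfolding eq by (simp only: complex_norm_square [symmetric] integral_complex_of_real)
qed

section \<open>Oscillation integrals\<close>

definition oscillation :: "(real \<Rightarrow> complex) \<Rightarrow> real \<Rightarrow> real \<Rightarrow> real" where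
  "oscillation s x a = (\<integral>\<eta>. (\<integral>\<xi>. (cmod (s \<xi> - s \<eta>))\<^sup>2 \<partial>lebesgue_on {x..x+a}) \<partial>lebesgue_on {x..x+a})"

text \<open>The variance formula: expand the square and integrate in both variables.\<close>

lemma oscillation_eq:
  assumes s: "L2_on {x..x+a} s" and a: "a > 0"
  shows "oscillation s x a = 2 * a * (\<integral>\<xi>. (cmod (s \<xi>))\<^sup>2 \<partial>lebesgue_on {x..x+a})
     - 2 * (cmod (\<integral>\<xi>. s \<xi> \<partial>lebesgue_on {x..x+a}))\<^sup>2"
proof -
  let ?M = "lebesgue_on {x..x+a}"
  define A where "A = (\<integral>\<xi>. (cmod (s \<xi>))\<^sup>2 \<partial>?M)"
  define B where "B = (\<integral>\<xi>. s \<xi> \<partial>?M)"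
  have si: "integrable ?M s" using L2_on_interval_integrable[OF s] by (intro absolutely_integrable_imp_integrable) auto
  have s2: "integrable ?M (\<lambda>\<xi>. (cmod (s \<xi>))\<^sup>2)" by (rule L2_on_integrable[OF s])
  have one: "integrable ?M (\<lambda>\<xi>. c)" "(\<integral>\<xi>. c \<partial>?M) = a * c" for c :: real
    using a by (simp_all add: finite_measure.integrable_const finite_measure_lebesgue_on measure_restrict_space)
  have sq: "(cmod (z - w))\<^sup>2 = (cmod z)\<^sup>2 - 2 * Re (cnj w * z) + (cmod w)\<^sup>2" for z w
    by (simp only: cmod_power2) (simp add: power2_eq_square algebra_simps)
  have bl: "bounded_linear (\<lambda>z. 2 * Re (w * z))" for w
    by (intro bounded_linear_const_mult bounded_linear_compose[OF bounded_linear_Re] bounded_linear_mult_right)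
  note wi = integrable_bounded_linear[OF bl si] and wv = integral_bounded_linear[OF bl si, folded B_def]
  have inner: "(\<integral>\<xi>. (cmod (s \<xi> - w))\<^sup>2 \<partial>?M) = A - 2 * Re (cnj w * B) + a * (cmod w)\<^sup>2" for w
    unfolding sq A_def
    by (simp only: Bochner_Integration.integral_add[OF Bochner_Integration.integrable_diff[OF s2 wi] one(1)]
        Bochner_Integration.integral_diff[OF s2 wi] wv one(2))
  have s2v: "(\<integral>\<eta>. a * (cmod (s \<eta>))\<^sup>2 \<partial>?M) = a * A" by (simp add: A_def)
  have comm: "Re (cnj w * z) = Re (cnj z * w)" for w z by simp
  have "oscillation s x a = (\<integral>\<eta>. A - 2 * Re (cnj B * s \<eta>) + a * (cmod (s \<eta>))\<^sup>2 \<partial>?M)"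
    unfolding oscillation_def inner by (simp only: comm[of _ B])
  also have "\<dots> = a * A - 2 * Re (cnj B * B) + a * A"
    by (simp only: Bochner_Integration.integral_add[OF Bochner_Integration.integrable_diff[OF one(1) wi] integrable_mult_right[OF s2]]
        Bochner_Integration.integral_diff[OF one(1) wi] wv one(2) s2v)
  also have "Re (cnj B * B) = (cmod B)\<^sup>2" unfolding cmod_power2 by (simp add: power2_eq_square)
  finally show ?thesis by (simp add: A_def B_def)
qed

lemma oscillation_shift: "oscillation (\<lambda>x. s x - c) x a = oscillation s x a"
  by (simp add: oscillation_def)

lemma oscillation_le:
  assumes s: "L2_on {x..x+a} s" and a: "a > 0"
  shows "oscillation s x a \<le> 2 * a * integral {x..x+a} (\<lambda>\<xi>. (cmod (s \<xi> - c))\<^sup>2)"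
proof -
  have sc: "L2_on {x..x+a} (\<lambda>\<xi>. s \<xi> - c)" by (intro L2_on_diff s L2_on_continuous) auto
  have "oscillation s x a = oscillation (\<lambda>\<xi>. s \<xi> - c) x a" by (simp add: oscillation_shift)
  also have "\<dots> \<le> 2 * a * (\<integral>\<xi>. (cmod (s \<xi> - c))\<^sup>2 \<partial>lebesgue_on {x..x+a})"
    by (simp add: oscillation_eq[OF sc a])
  also have "(\<integral>\<xi>. (cmod (s \<xi> - c))\<^sup>2 \<partial>lebesgue_on {x..x+a}) = integral {x..x+a} (\<lambda>\<xi>. (cmod (s \<xi> - c))\<^sup>2)"
    by (rule lebesgue_integral_eq_integral[OF L2_on_integrable[OF sc]]) auto
  finally show ?thesis .
qed

text \<open>The constant \<open>c\<close> is the mean of \<open>s\<close>, for which the subtracted square in \<open>oscillation_eq\<close> vanishes.\<close>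

lemma oscillation_mean:
  assumes s: "L2_on {x..x+a} s" and a: "a > 0"
  obtains c where "oscillation s x a = 2 * a * integral {x..x+a} (\<lambda>\<xi>. (cmod (s \<xi> - c))\<^sup>2)"
proof -
  let ?M = "lebesgue_on {x..x+a}"
  define c where "c = (\<integral>\<xi>. s \<xi> \<partial>?M) / a"
  have sc: "L2_on {x..x+a} (\<lambda>\<xi>. s \<xi> - c)" by (intro L2_on_diff s L2_on_continuous) auto
  have si: "integrable ?M s" using L2_on_interval_integrable[OF s] by (intro absolutely_integrable_imp_integrable) auto
  have "(\<integral>\<xi>. s \<xi> - c \<partial>?M) = (\<integral>\<xi>. s \<xi> \<partial>?M) - a * c"
    using a si by (subst Bochner_Integration.integral_diff)
      (auto simp: finite_measure.integrable_const finite_measure_lebesgue_on measure_restrict_space scaleR_conv_of_real)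
  then have z: "(\<integral>\<xi>. s \<xi> - c \<partial>?M) = 0" using a by (simp add: c_def)
  have "oscillation s x a = oscillation (\<lambda>\<xi>. s \<xi> - c) x a" by (simp add: oscillation_shift)
  also have "\<dots> = 2 * a * (\<integral>\<xi>. (cmod (s \<xi> - c))\<^sup>2 \<partial>?M)" by (simp add: oscillation_eq[OF sc a] z)
  also have "(\<integral>\<xi>. (cmod (s \<xi> - c))\<^sup>2 \<partial>?M) = integral {x..x+a} (\<lambda>\<xi>. (cmod (s \<xi> - c))\<^sup>2)"
    by (rule lebesgue_integral_eq_integral[OF L2_on_integrable[OF sc]]) auto
  finally show ?thesis by (rule that)
qed

section \<open>Coefficients with increments in a sector\<close>

lemma sin_le_tan_cos:
  assumes "\<omega> < pi / 2" "\<bar>\<theta>\<bar> \<le> \<omega>"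
  shows "\<bar>sin \<theta>\<bar> \<le> tan \<omega> * cos \<theta>"
proof -
  have w: "0 \<le> \<omega>" using assms by linarith
  have c: "cos \<omega> > 0" using assms w by (intro cos_gt_zero_pi) auto
  have "0 \<le> sin (\<omega> - \<theta>)" "0 \<le> sin (\<omega> + \<theta>)" using assms w by (auto intro!: sin_ge_zero)
  then have "\<bar>cos \<omega> * sin \<theta>\<bar> \<le> sin \<omega> * cos \<theta>" by (simp add: sin_diff sin_add abs_le_iff)
  then have "cos \<omega> * \<bar>sin \<theta>\<bar> \<le> sin \<omega> * cos \<theta>" using c by (simp add: abs_mult)
  then show ?thesis using c by (simp add: tan_def field_simps)
qed

text \<open>The sector is enlarged to contain the direction \<open>0\<close>, because the form also contains the positive term
  \<open>\<integral>|y'|\<^sup>2\<close>: \<open>\<gamma>\<close> is the bisector and \<open>\<omega>\<close> the half-angle of the enlarged sector, and multiplication by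
  \<open>e\<close> turns the bisector into the positive half-axis. The functionals \<open>L 1\<close> and \<open>L (-1)\<close> are nonnegative on the
  rotated sector. The summand \<open>1\<close> in \<open>T\<close> makes them at least \<open>cos \<theta>\<close> at angle \<open>\<theta>\<close>, hence at least
  \<open>\<kappa> > 0\<close> at \<open>e\<close>; this is what keeps a multiple of \<open>\<integral>|y'|\<^sup>2\<close> in the estimates.\<close>

locale sector_condition =
  fixes s f g :: "real \<Rightarrow> complex" and d \<alpha> \<beta> :: real
  assumes s: "L2_loc s" and f: "L2_unif f" and g: "L2_unif g" and d: "d > 0"
    and ab: "0 \<le> \<beta> - \<alpha>" "\<beta> - \<alpha> < pi" "\<bar>\<alpha>\<bar> < pi" "\<bar>\<beta>\<bar> < pi"
    and sector: "\<And>x t. x \<ge> 0 \<Longrightarrow> t \<ge> 0 \<Longrightarrow> 0 \<le> x - t \<Longrightarrow> x - t \<le> d \<Longrightarrow>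
           arg_in (s x + f x - s t - g t) \<alpha> \<beta>"
begin

definition \<gamma> :: real where "\<gamma> = (min \<alpha> 0 + max \<beta> 0) / 2"
definition \<omega> :: real where "\<omega> = (max \<beta> 0 - min \<alpha> 0) / 2"
definition T :: real where "T = tan \<omega> + 1"
definition e :: complex where "e = cis (- \<gamma>)"

lemma \<omega>: "0 \<le> \<omega>" "\<omega> < pi / 2" "\<bar>\<gamma>\<bar> \<le> \<omega>"
  using ab by (auto simp: \<omega>_def \<gamma>_def min_def max_def abs_le_iff field_simps split: if_splits)

lemma T: "T \<ge> 1" "T > 0"
proof -
  show "T \<ge> 1" using \<omega> by (cases "\<omega> = 0") (auto simp: T_def intro!: less_imp_le tan_gt_zero)
  then show "T > 0" by simp
qed

lemma norm_e: "cmod e = 1" by (simp add: e_def)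

definition L :: "real \<Rightarrow> complex \<Rightarrow> real" where "L \<sigma> z = T * Re z + \<sigma> * Im z"

lemma L_add: "L \<sigma> (z + w) = L \<sigma> z + L \<sigma> w" and L_diff: "L \<sigma> (z - w) = L \<sigma> z - L \<sigma> w"
  and L_of_real: "L \<sigma> (z * of_real r) = r * L \<sigma> z"
  by (simp_all add: L_def algebra_simps)

lemma L_le: "\<bar>\<sigma>\<bar> = 1 \<Longrightarrow> \<bar>L \<sigma> z\<bar> \<le> (T + 1) * cmod z"
proof -
  assume \<sigma>: "\<bar>\<sigma>\<bar> = 1"
  have "\<bar>L \<sigma> z\<bar> \<le> T * \<bar>Re z\<bar> + \<bar>\<sigma>\<bar> * \<bar>Im z\<bar>"
    unfolding L_def using abs_triangle_ineq[of "T * Re z" "\<sigma> * Im z"] T by (simp add: abs_mult)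
  also have "\<dots> \<le> T * cmod z + 1 * cmod z"
    unfolding \<sigma> using abs_Re_le_cmod[of z] abs_Im_le_cmod[of z] T by (intro add_mono mult_left_mono) auto
  finally show ?thesis by (simp add: algebra_simps)
qed

lemma L_cis:
  assumes "\<bar>\<theta>\<bar> \<le> \<omega>" "\<bar>\<sigma>\<bar> = 1"
  shows "cos \<theta> \<le> L \<sigma> (cis \<theta>)"
proof -
  have "- \<bar>sin \<theta>\<bar> \<le> \<sigma> * sin \<theta>"
    using assms(2) by (metis abs_ge_minus_self abs_mult minus_le_iff mult_1 neg_le_iff_le)
  then show ?thesis using sin_le_tan_cos[OF \<omega>(2) assms(1)] by (simp add: L_def T_def algebra_simps)
qed

definition \<kappa> :: real where "\<kappa> = cos \<gamma>"

lemma \<kappa>: "\<kappa> > 0" "\<bar>\<sigma>\<bar> = 1 \<Longrightarrow> \<kappa> \<le> L \<sigma> e"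
proof -
  show "\<kappa> > 0" unfolding \<kappa>_def using \<omega> by (intro cos_gt_zero_pi) auto
  show "\<bar>\<sigma>\<bar> = 1 \<Longrightarrow> \<kappa> \<le> L \<sigma> e" using L_cis[of "- \<gamma>" \<sigma>] \<omega>(3) by (simp add: \<kappa>_def e_def)
qed

lemma L_arg_in:
  assumes "arg_in z \<alpha> \<beta>" "\<bar>\<sigma>\<bar> = 1"
  shows "0 \<le> L \<sigma> (e * z)"
proof -
  obtain r \<phi> where z: "0 \<le> r" "\<alpha> \<le> \<phi>" "\<phi> \<le> \<beta>" "z = rcis r \<phi>" using assms(1) by (auto simp: arg_in_def)
  have \<theta>: "\<bar>\<phi> - \<gamma>\<bar> \<le> \<omega>" using z by (auto simp: \<omega>_def \<gamma>_def min_def max_def abs_le_iff field_simps)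
  have "e * z = cis (\<phi> - \<gamma>) * of_real r"
    by (simp add: e_def z rcis_def mult.left_commute cis_mult mult.commute)
  then have "L \<sigma> (e * z) = r * L \<sigma> (cis (\<phi> - \<gamma>))" by (simp add: L_of_real)
  moreover have "0 \<le> cos (\<phi> - \<gamma>)" using \<theta> \<omega> by (intro cos_ge_zero) auto
  then have "0 \<le> L \<sigma> (cis (\<phi> - \<gamma>))" using L_cis[OF \<theta> assms(2)] by linarith
  ultimately show ?thesis using z by simp
qed

lemma L2_on_real_part:
  assumes "L2_on A h" "\<bar>\<sigma>\<bar> = 1"
  shows "L2_on A (\<lambda>x. complex_of_real (L \<sigma> (e * h x)))"
proof (rule L2_on_bound)
  have [measurable]: "h \<in> borel_measurable (lebesgue_on A)" using assms by (simp add: L2_on_def)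
  show "(\<lambda>x. complex_of_real (L \<sigma> (e * h x))) \<in> borel_measurable (lebesgue_on A)" unfolding L_def by measurable
  show "integrable (lebesgue_on A) (\<lambda>x. (T + 1)\<^sup>2 * (cmod (h x))\<^sup>2)" using assms by (simp add: L2_on_def)
  show "(cmod (complex_of_real (L \<sigma> (e * h x))))\<^sup>2 \<le> (T + 1)\<^sup>2 * (cmod (h x))\<^sup>2" for x
    unfolding power_mult_distrib[symmetric] norm_of_real
    using L_le[OF assms(2), of "e * h x"] by (intro power_mono) (auto simp: norm_mult norm_e)
qed

lemma L2_on_abs:
  assumes "L2_on A (\<lambda>x. complex_of_real (h x))"
  shows "L2_on A (\<lambda>x. complex_of_real \<bar>h x\<bar>)"
proof (rule L2_on_bound)
  have "(\<lambda>x. complex_of_real (h x)) \<in> borel_measurable (lebesgue_on A)" using assms by (simp add: L2_on_def)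
  then have [measurable]: "h \<in> borel_measurable (lebesgue_on A)" by (simp add: borel_measurable_complex_iff)
  show "(\<lambda>x. complex_of_real \<bar>h x\<bar>) \<in> borel_measurable (lebesgue_on A)" by measurable
  show "integrable (lebesgue_on A) (\<lambda>x. (cmod (complex_of_real (h x)))\<^sup>2)" using assms by (simp add: L2_on_def)
qed simp

lemma L2_unif_bound:
  assumes "L2_unif h"
  obtains P where "P \<ge> 0" "\<And>x. x \<ge> 0 \<Longrightarrow> integral {x..x+1} (\<lambda>x. (cmod (h x))\<^sup>2) \<le> P"
    "\<And>b. L2_on {0..b} h" "\<And>x b. x \<ge> 0 \<Longrightarrow> L2_on {x..b} h"
proof -
  have l: "L2_on {0..b} h" for b
  proof (cases "b \<ge> 0")
    case False
    then have "L2_on {0..b} h" using L2_on_continuous[of 0 b h] by simp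
    then show ?thesis .
  qed (use assms in \<open>simp add: L2_unif_def L2_loc_def\<close>)
  have l': "L2_on {x..b} h" if "x \<ge> 0" for x b by (rule L2_on_subset[OF l[of b]]) (use that in auto)
  obtain P where P: "\<forall>x\<in>{0..}. (\<integral>t. (cmod (h t))\<^sup>2 \<partial>lebesgue_on {x..x+1}) \<le> P"
    using assms by (auto simp: L2_unif_def bdd_above_def)
  show ?thesis
  proof (rule that[of "\<bar>P\<bar>", OF _ _ l l'])
    fix x :: real assume x: "x \<ge> 0"
    have "integral {x..x+1} (\<lambda>x. (cmod (h x))\<^sup>2) = (\<integral>t. (cmod (h t))\<^sup>2 \<partial>lebesgue_on {x..x+1})"
      by (rule lebesgue_integral_eq_integral[OF L2_on_integrable[OF l'[OF x]], symmetric]) auto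
    also have "\<dots> \<le> P" using P x by auto
    finally show "integral {x..x+1} (\<lambda>x. (cmod (h x))\<^sup>2) \<le> \<bar>P\<bar>" by linarith
  next
    show "0 \<le> \<bar>P\<bar>" by simp
  qed
qed

definition S where "S \<sigma> x = L \<sigma> (e * s x)"
definition F where "F \<sigma> x = L \<sigma> (e * f x)"
definition G where "G \<sigma> x = L \<sigma> (e * g x)"

text \<open>Apply the nonnegative functional \<open>L \<sigma>\<close> to \<open>e\<close> times the difference in the hypothesis.\<close>

lemma components_almost_increasing:
  obtains P where "\<And>\<sigma>. \<bar>\<sigma>\<bar> = 1 \<Longrightarrow> almost_increasing (S \<sigma>) (F \<sigma>) (G \<sigma>) d P"
proof -
  obtain Pf where Pf: "Pf \<ge> 0" "\<And>x. x \<ge> 0 \<Longrightarrow> integral {x..x+1} (\<lambda>x. (cmod (f x))\<^sup>2) \<le> Pf"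
    and fl: "\<And>b. L2_on {0..b} f" "\<And>x b. x \<ge> 0 \<Longrightarrow> L2_on {x..b} f"
    by (rule L2_unif_bound[OF f]) blast
  obtain Pg where Pg: "Pg \<ge> 0" "\<And>x. x \<ge> 0 \<Longrightarrow> integral {x..x+1} (\<lambda>x. (cmod (g x))\<^sup>2) \<le> Pg"
    and gl: "\<And>b. L2_on {0..b} g" "\<And>x b. x \<ge> 0 \<Longrightarrow> L2_on {x..b} g"
    by (rule L2_unif_bound[OF g]) blast
  have sl: "L2_on {0..b} s" for b
    using s L2_on_continuous[of 0 b s] by (cases "b \<ge> 0") (auto simp: L2_loc_def)
  show ?thesis
  proof (rule that[of "2 * (T + 1)\<^sup>2 * (Pf + Pg)"])
    fix \<sigma> :: real assume \<sigma>: "\<bar>\<sigma>\<bar> = 1"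
    have L2\<rho>: "L2_on A (\<lambda>x. complex_of_real (\<bar>F \<sigma> x\<bar> + \<bar>G \<sigma> x\<bar>))" if "L2_on A f" "L2_on A g" for A
      unfolding of_real_add F_def G_def
      by (intro L2_on_add L2_on_abs L2_on_real_part \<sigma> that)
    show "almost_increasing (S \<sigma>) (F \<sigma>) (G \<sigma>) d (2 * (T + 1)\<^sup>2 * (Pf + Pg))"
    proof
      show "d > 0" by (rule d)
      fix x t :: real assume xt: "0 \<le> t" "t \<le> x" "x - t \<le> d"
      have "0 \<le> L \<sigma> (e * (s x + f x - s t - g t))" by (rule L_arg_in[OF sector \<sigma>]) (use xt in auto)
      then show "S \<sigma> t + G \<sigma> t \<le> S \<sigma> x + F \<sigma> x"
        by (simp add: S_def F_def G_def right_diff_distrib distrib_left L_add L_diff)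
    next
      show "L2_on {0..R} (\<lambda>x. complex_of_real (S \<sigma> x))" for R
        unfolding S_def by (intro L2_on_real_part sl \<sigma>)
      show "L2_on {0..R} (\<lambda>x. complex_of_real (\<bar>F \<sigma> x\<bar> + \<bar>G \<sigma> x\<bar>))" for R
        by (intro L2\<rho> fl gl)
      fix x :: real assume x: "x \<ge> 0"
      have i: "(\<lambda>x. (cmod (f x))\<^sup>2) integrable_on {x..x+1}" "(\<lambda>x. (cmod (g x))\<^sup>2) integrable_on {x..x+1}"
        by (intro L2_on_square_integrable_on fl gl x)+
      have "integral {x..x+1} (\<lambda>x. (\<bar>F \<sigma> x\<bar> + \<bar>G \<sigma> x\<bar>)\<^sup>2) \<le>
          integral {x..x+1} (\<lambda>x. 2 * (T + 1)\<^sup>2 * ((cmod (f x))\<^sup>2 + (cmod (g x))\<^sup>2))"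
      proof (rule integral_le)
        show "(\<lambda>x. (\<bar>F \<sigma> x\<bar> + \<bar>G \<sigma> x\<bar>)\<^sup>2) integrable_on {x..x+1}"
          using L2_on_square_integrable_on[OF L2\<rho>[OF fl(2)[OF x] gl(2)[OF x]]] by (simp only: norm_of_real power2_abs)
        show "(\<lambda>x. 2 * (T + 1)\<^sup>2 * ((cmod (f x))\<^sup>2 + (cmod (g x))\<^sup>2)) integrable_on {x..x+1}"
          by (intro integrable_on_mult_right integrable_add i)
        fix y
        have "\<bar>F \<sigma> y\<bar> + \<bar>G \<sigma> y\<bar> \<le> (T + 1) * (cmod (f y) + cmod (g y))"
          using L_le[OF \<sigma>, of "e * f y"] L_le[OF \<sigma>, of "e * g y"]
          by (simp add: F_def G_def norm_mult norm_e algebra_simps)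
        then have "(\<bar>F \<sigma> y\<bar> + \<bar>G \<sigma> y\<bar>)\<^sup>2 \<le> (T + 1)\<^sup>2 * (cmod (f y) + cmod (g y))\<^sup>2"
          unfolding power_mult_distrib[symmetric] by (intro power_mono) auto
        also have "\<dots> \<le> (T + 1)\<^sup>2 * (2 * ((cmod (f y))\<^sup>2 + (cmod (g y))\<^sup>2))"
          using zero_le_power2[of "cmod (f y) - cmod (g y)"]
          by (intro mult_left_mono[OF _ zero_le_power2]) (simp add: power2_eq_square algebra_simps)
        also have "\<dots> = 2 * (T + 1)\<^sup>2 * ((cmod (f y))\<^sup>2 + (cmod (g y))\<^sup>2)" by (simp only: ac_simps)
        finally show "(\<bar>F \<sigma> y\<bar> + \<bar>G \<sigma> y\<bar>)\<^sup>2 \<le> 2 * (T + 1)\<^sup>2 * ((cmod (f y))\<^sup>2 + (cmod (g y))\<^sup>2)" .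
      qed
      also have "\<dots> = 2 * (T + 1)\<^sup>2 * (integral {x..x+1} (\<lambda>x. (cmod (f x))\<^sup>2) + integral {x..x+1} (\<lambda>x. (cmod (g x))\<^sup>2))"
        by (simp only: Henstock_Kurzweil_Integration.integral_mult_right Henstock_Kurzweil_Integration.integral_add[OF i])
      also have "\<dots> \<le> 2 * (T + 1)\<^sup>2 * (Pf + Pg)"
        using Pf(2)[OF x] Pg(2)[OF x] by (intro mult_left_mono add_mono) auto
      finally show "integral {x..x+1} (\<lambda>x. (\<bar>F \<sigma> x\<bar> + \<bar>G \<sigma> x\<bar>)\<^sup>2) \<le> 2 * (T + 1)\<^sup>2 * (Pf + Pg)" .
    qed
  qed
qed

text \<open>The common measure of growth on window \<open>n\<close>: the form bounds it from above where \<open>|y|\<close> is not small, and the oscillation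
  of \<open>s\<close> bounds it from below.\<close>

definition W :: "real \<Rightarrow> nat \<Rightarrow> real" where
  "W a n = (almost_increasing.rise (S 1) (G 1) a n + almost_increasing.rise (S (-1)) (G (-1)) a n) / 2"

text \<open>Applying \<open>L \<sigma>\<close> to \<open>e q(y)\<close> gives \<open>L \<sigma> e \<ge> \<kappa>\<close> times \<open>\<integral>|y'|\<^sup>2\<close> minus the integral in \<open>form_estimate\<close>
  for the component \<open>S \<sigma>\<close>. With \<open>\<epsilon> = \<kappa> / 2\<close> half of the first term survives.\<close>

lemma component_form_estimate:
  obtains a0 where "a0 > 0" "a0 \<le> 1" "2 * a0 \<le> d"
    "\<forall>a. 0 < a \<and> a \<le> a0 \<longrightarrow> (\<exists>C\<ge>0. \<forall>y h N \<mu> \<sigma>. \<bar>\<sigma>\<bar> = 1 \<longrightarrow>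
       test_function y h \<longrightarrow> (\<forall>x\<ge>real N * a. y x = 0 \<and> h x = 0) \<longrightarrow> (\<forall>n::nat. 0 \<le> \<mu> n) \<longrightarrow>
       (\<forall>n\<ge>1. \<forall>x. \<bar>x - real n * a\<bar> \<le> a / 2 \<longrightarrow> \<mu> n \<le> (cmod (y x))\<^sup>2) \<longrightarrow>
       \<kappa> / 2 * (norm (abs_l2 h))\<^sup>2 + (1/2) * (\<Sum>n=1..N. \<mu> n * almost_increasing.rise (S \<sigma>) (G \<sigma>) a n)
         \<le> L \<sigma> (e * form s y h y h) + C * (norm (abs_l2 y))\<^sup>2)"
proof -
  obtain P where P: "\<And>\<sigma>. \<bar>\<sigma>\<bar> = 1 \<Longrightarrow> almost_increasing (S \<sigma>) (F \<sigma>) (G \<sigma>) d P"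
    by (rule components_almost_increasing) blast
  define Q where "Q = (\<lambda>a C (\<sigma>::real). \<forall>y g N \<mu>.
       (\<forall>b. primitive_on 0 b g y) \<and> (\<forall>b. L2_on {0..b} g) \<and> y 0 = 0 \<and>
       (\<forall>x\<ge>real N * a. y x = 0 \<and> g x = 0) \<and> (\<forall>n::nat. 0 \<le> \<mu> n) \<and>
       (\<forall>n\<ge>1. \<forall>x. \<bar>x - real n * a\<bar> \<le> a / 2 \<longrightarrow> \<mu> n \<le> (cmod (y x))\<^sup>2) \<longrightarrow>
       integral {0..real N * a} (\<lambda>x. S \<sigma> x * (2 * Re (g x * cnj (y x)))) \<le>
         - (1/2) * (\<Sum>n=1..N. \<mu> n * almost_increasing.rise (S \<sigma>) (G \<sigma>) a n) +
         \<kappa> / 2 * integral {0..real N * a} (\<lambda>x. (cmod (g x))\<^sup>2) + C * integral {0..real N * a} (\<lambda>x. (cmod (y x))\<^sup>2))"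
  have k2: "\<kappa> / 2 > 0" using \<kappa> by simp
  have "\<exists>a0>0. a0 \<le> 1 \<and> 2 * a0 \<le> d \<and> (\<forall>a. 0 < a \<and> a \<le> a0 \<longrightarrow> (\<exists>C\<ge>0. Q a C \<sigma>))" if "\<bar>\<sigma>\<bar> = 1" for \<sigma>
    by (rule almost_increasing.form_estimate[OF P[OF that] k2]) (auto simp: Q_def)
  from this[of 1] this[of "-1"] obtain a1 a2 where
    a1: "a1 > 0" "a1 \<le> 1" "2 * a1 \<le> d" "\<And>a. 0 < a \<Longrightarrow> a \<le> a1 \<Longrightarrow> \<exists>C\<ge>0. Q a C 1" and
    a2: "a2 > 0" "a2 \<le> 1" "2 * a2 \<le> d" "\<And>a. 0 < a \<Longrightarrow> a \<le> a2 \<Longrightarrow> \<exists>C\<ge>0. Q a C (-1)" by auto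
  have m: "min a1 a2 > 0" "min a1 a2 \<le> 1" "2 * min a1 a2 \<le> d" using a1 a2 by linarith+
  show ?thesis
  proof (rule that[OF m], intro allI impI)
    fix a assume "0 < a \<and> a \<le> min a1 a2"
    then have a: "0 < a" "a \<le> a1" "a \<le> a2" by auto
    obtain C1 where C1: "C1 \<ge> 0" "Q a C1 1" using a1(4)[OF a(1,2)] by auto
    obtain C2 where C2: "C2 \<ge> 0" "Q a C2 (-1)" using a2(4)[OF a(1,3)] by auto
    show "\<exists>C\<ge>0. \<forall>y h N \<mu> \<sigma>. \<bar>\<sigma>\<bar> = 1 \<longrightarrow>
       test_function y h \<longrightarrow> (\<forall>x\<ge>real N * a. y x = 0 \<and> h x = 0) \<longrightarrow> (\<forall>n::nat. 0 \<le> \<mu> n) \<longrightarrow>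
       (\<forall>n\<ge>1. \<forall>x. \<bar>x - real n * a\<bar> \<le> a / 2 \<longrightarrow> \<mu> n \<le> (cmod (y x))\<^sup>2) \<longrightarrow>
       \<kappa> / 2 * (norm (abs_l2 h))\<^sup>2 + (1/2) * (\<Sum>n=1..N. \<mu> n * almost_increasing.rise (S \<sigma>) (G \<sigma>) a n)
         \<le> L \<sigma> (e * form s y h y h) + C * (norm (abs_l2 y))\<^sup>2"
    proof (rule exI[of _ "max C1 C2"], intro conjI allI impI)
      show "0 \<le> max C1 C2" using C1 by simp
      fix y h :: "real \<Rightarrow> complex" and N and \<mu> :: "nat \<Rightarrow> real" and \<sigma> :: real
      assume \<sigma>: "\<bar>\<sigma>\<bar> = 1" and y: "test_function y h" and supp: "\<forall>x\<ge>real N * a. y x = 0 \<and> h x = 0"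
        and \<mu>0: "\<forall>n. 0 \<le> \<mu> n" and \<mu>: "\<forall>n\<ge>1. \<forall>x. \<bar>x - real n * a\<bar> \<le> a / 2 \<longrightarrow> \<mu> n \<le> (cmod (y x))\<^sup>2"
      let ?b = "real N * a"
      have b: "0 \<le> ?b" using a by simp
      obtain C where C: "Q a C \<sigma>" "C \<le> max C1 C2"
      proof (cases "\<sigma> = 1")
        case True then show ?thesis using that C1 by auto
      next
        case False
        then have "\<sigma> = -1" using \<sigma> by linarith
        then show ?thesis using that C2 by auto
      qed
      have nh: "(norm (abs_l2 h))\<^sup>2 = integral {0..?b} (\<lambda>x. (cmod (h x))\<^sup>2)"
        unfolding norm_abs_l2_square[OF test_functionD(6)[OF y]]
        by (rule halfline_integral(2)[OF b _ L2_on_integrable[OF test_functionD(3)[OF y]]]) (use supp in auto)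
      have ny: "(norm (abs_l2 y))\<^sup>2 = integral {0..?b} (\<lambda>x. (cmod (y x))\<^sup>2)"
        unfolding norm_abs_l2_square[OF test_functionD(5)[OF y]]
        by (rule halfline_integral(2)[OF b _ L2_on_integrable[OF test_functionD(4)[OF y]]]) (use supp in auto)
      define \<psi> where "\<psi> = (\<lambda>x. 2 * Re (h x * cnj (y x)))"
      have si: "integrable (lebesgue_on {0..}) (\<lambda>x. s x * of_real (\<psi> x))"
        unfolding \<psi>_def by (rule form_diagonal(2)[OF s y])
      have bl: "bounded_linear (\<lambda>z. L \<sigma> (e * z))"
        unfolding L_def
        by (intro bounded_linear_add bounded_linear_const_mult bounded_linear_compose[OF bounded_linear_Re]
            bounded_linear_compose[OF bounded_linear_Im] bounded_linear_mult_right)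
      have Leq: "L \<sigma> (e * (s x * of_real (\<psi> x))) = S \<sigma> x * \<psi> x" for x
        by (simp add: S_def L_of_real mult.assoc[symmetric])
      have "L \<sigma> (e * (\<integral>x. s x * of_real (\<psi> x) \<partial>lebesgue_on {0..})) = (\<integral>x. S \<sigma> x * \<psi> x \<partial>lebesgue_on {0..})"
        using integral_bounded_linear[OF bl si] by (simp add: Leq)
      also have "\<dots> = integral {0..?b} (\<lambda>x. S \<sigma> x * \<psi> x)"
      proof (rule halfline_integral(2)[OF b])
        show "S \<sigma> x * \<psi> x = 0" if "x > ?b" for x using supp that by (simp add: \<psi>_def)
        have "set_integrable lebesgue {0..} (\<lambda>x. S \<sigma> x * \<psi> x)"
          using integrable_bounded_linear[OF bl si] by (simp add: Leq set_integrable_def integrable_restrict_space)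
        then have "set_integrable lebesgue {0..?b} (\<lambda>x. S \<sigma> x * \<psi> x)" by (rule set_integrable_subset) auto
        then show "integrable (lebesgue_on {0..?b}) (\<lambda>x. S \<sigma> x * \<psi> x)"
          by (simp add: set_integrable_def integrable_restrict_space)
      qed
      finally have int: "L \<sigma> (e * (\<integral>x. s x * of_real (\<psi> x) \<partial>lebesgue_on {0..})) = integral {0..?b} (\<lambda>x. S \<sigma> x * \<psi> x)" .
      have "L \<sigma> (e * form s y h y h) = L \<sigma> (e * of_real ((norm (abs_l2 h))\<^sup>2)) - integral {0..?b} (\<lambda>x. S \<sigma> x * \<psi> x)"
        unfolding form_diagonal(1)[OF s y] norm_abs_l2_square[OF test_functionD(6)[OF y]]
        by (simp only: right_diff_distrib L_diff int[unfolded \<psi>_def] \<psi>_def)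
      also have "L \<sigma> (e * of_real ((norm (abs_l2 h))\<^sup>2)) = (norm (abs_l2 h))\<^sup>2 * L \<sigma> e" by (rule L_of_real)
      finally have eq: "L \<sigma> (e * form s y h y h) = (norm (abs_l2 h))\<^sup>2 * L \<sigma> e - integral {0..?b} (\<lambda>x. S \<sigma> x * \<psi> x)" .
      have "integral {0..?b} (\<lambda>x. S \<sigma> x * \<psi> x) \<le>
         - (1/2) * (\<Sum>n=1..N. \<mu> n * almost_increasing.rise (S \<sigma>) (G \<sigma>) a n) +
         \<kappa> / 2 * (norm (abs_l2 h))\<^sup>2 + C * (norm (abs_l2 y))\<^sup>2"
        unfolding nh ny \<psi>_def
        by (rule C(1)[unfolded Q_def, rule_format]) (use supp \<mu>0 \<mu> test_functionD[OF y] in auto)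
      moreover have "(norm (abs_l2 h))\<^sup>2 * \<kappa> \<le> (norm (abs_l2 h))\<^sup>2 * L \<sigma> e"
        using \<kappa>(2)[OF \<sigma>] by (intro mult_left_mono) auto
      moreover have "C * (norm (abs_l2 y))\<^sup>2 \<le> max C1 C2 * (norm (abs_l2 y))\<^sup>2"
        using C(2) by (rule mult_right_mono) simp
      ultimately show "\<kappa> / 2 * (norm (abs_l2 h))\<^sup>2 + (1/2) * (\<Sum>n=1..N. \<mu> n * almost_increasing.rise (S \<sigma>) (G \<sigma>) a n)
         \<le> L \<sigma> (e * form s y h y h) + max C1 C2 * (norm (abs_l2 y))\<^sup>2"
        unfolding eq by (simp add: algebra_simps)
    qed
  qed
qed

text \<open>The inequalities for \<open>\<sigma> = 1\<close> and \<open>\<sigma> = -1\<close>, without the rises, are the two cases of the absolute value.\<close>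

lemma form_sectorial:
  obtains C where "C \<ge> 0" "\<forall>y h. test_function y h \<longrightarrow>
    \<bar>Im (e * form s y h y h)\<bar> + \<kappa> / 2 * (norm (abs_l2 h))\<^sup>2 \<le> T * Re (e * form s y h y h) + C * (norm (abs_l2 y))\<^sup>2"
proof -
  obtain a0 where a0: "a0 > 0" and est: "\<forall>a. 0 < a \<and> a \<le> a0 \<longrightarrow> (\<exists>C\<ge>0. \<forall>y h N \<mu> \<sigma>. \<bar>\<sigma>\<bar> = 1 \<longrightarrow>
       test_function y h \<longrightarrow> (\<forall>x\<ge>real N * a. y x = 0 \<and> h x = 0) \<longrightarrow> (\<forall>n::nat. 0 \<le> \<mu> n) \<longrightarrow>
       (\<forall>n\<ge>1. \<forall>x. \<bar>x - real n * a\<bar> \<le> a / 2 \<longrightarrow> \<mu> n \<le> (cmod (y x))\<^sup>2) \<longrightarrow>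
       \<kappa> / 2 * (norm (abs_l2 h))\<^sup>2 + (1/2) * (\<Sum>n=1..N. \<mu> n * almost_increasing.rise (S \<sigma>) (G \<sigma>) a n)
         \<le> L \<sigma> (e * form s y h y h) + C * (norm (abs_l2 y))\<^sup>2)"
    by (rule component_form_estimate) blast
  obtain C where C: "C \<ge> 0" "\<forall>y h N \<mu> \<sigma>. \<bar>\<sigma>\<bar> = 1 \<longrightarrow>
       test_function y h \<longrightarrow> (\<forall>x\<ge>real N * a0. y x = 0 \<and> h x = 0) \<longrightarrow> (\<forall>n::nat. 0 \<le> \<mu> n) \<longrightarrow>
       (\<forall>n\<ge>1. \<forall>x. \<bar>x - real n * a0\<bar> \<le> a0 / 2 \<longrightarrow> \<mu> n \<le> (cmod (y x))\<^sup>2) \<longrightarrow>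
       \<kappa> / 2 * (norm (abs_l2 h))\<^sup>2 + (1/2) * (\<Sum>n=1..N. \<mu> n * almost_increasing.rise (S \<sigma>) (G \<sigma>) a0 n)
         \<le> L \<sigma> (e * form s y h y h) + C * (norm (abs_l2 y))\<^sup>2"
    using est[rule_format, of a0] a0 by auto
  show ?thesis
  proof (rule that[OF C(1)], intro allI impI)
    fix y h assume y: "test_function y h"
    obtain R where R: "R \<ge> 0" "\<And>x. x \<ge> R \<Longrightarrow> y x = 0" "\<And>x. x \<ge> R \<Longrightarrow> h x = 0"
      using test_function_support[OF y] by metis
    obtain N :: nat where N: "R \<le> real N * a0"
      using real_arch_simple[of "R / a0"] a0 by (auto simp: field_simps)
    have "\<kappa> / 2 * (norm (abs_l2 h))\<^sup>2 \<le> L \<sigma> (e * form s y h y h) + C * (norm (abs_l2 y))\<^sup>2" if "\<bar>\<sigma>\<bar> = 1" for \<sigma>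
      using C(2)[rule_format, OF that y, of N "\<lambda>_. 0"] R N by simp
    from this[of 1] this[of "-1"]
    show "\<bar>Im (e * form s y h y h)\<bar> + \<kappa> / 2 * (norm (abs_l2 h))\<^sup>2 \<le> T * Re (e * form s y h y h) + C * (norm (abs_l2 y))\<^sup>2"
      unfolding L_def by linarith
  qed
qed

text \<open>Adding the inequalities for \<open>\<sigma> = 1\<close> and \<open>\<sigma> = -1\<close> cancels the imaginary part and keeps the rises of both
  components.\<close>

lemma form_controls_rise:
  obtains a0 where "a0 > 0" "a0 \<le> 1" "2 * a0 \<le> d"
    "\<forall>a. 0 < a \<and> a \<le> a0 \<longrightarrow> (\<exists>C\<ge>0. \<forall>y h N \<mu>.
       test_function y h \<longrightarrow> (\<forall>x\<ge>real N * a. y x = 0 \<and> h x = 0) \<longrightarrow> (\<forall>n::nat. 0 \<le> \<mu> n) \<longrightarrow>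
       (\<forall>n\<ge>1. \<forall>x. \<bar>x - real n * a\<bar> \<le> a / 2 \<longrightarrow> \<mu> n \<le> (cmod (y x))\<^sup>2) \<longrightarrow>
       (\<Sum>n=1..N. \<mu> n * W a n) \<le> 2 * T * Re (e * form s y h y h) + C * (norm (abs_l2 y))\<^sup>2)"
proof -
  obtain a0 where a0: "a0 > 0" "a0 \<le> 1" "2 * a0 \<le> d" and est: "\<forall>a. 0 < a \<and> a \<le> a0 \<longrightarrow> (\<exists>C\<ge>0. \<forall>y h N \<mu> \<sigma>. \<bar>\<sigma>\<bar> = 1 \<longrightarrow>
       test_function y h \<longrightarrow> (\<forall>x\<ge>real N * a. y x = 0 \<and> h x = 0) \<longrightarrow> (\<forall>n::nat. 0 \<le> \<mu> n) \<longrightarrow>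
       (\<forall>n\<ge>1. \<forall>x. \<bar>x - real n * a\<bar> \<le> a / 2 \<longrightarrow> \<mu> n \<le> (cmod (y x))\<^sup>2) \<longrightarrow>
       \<kappa> / 2 * (norm (abs_l2 h))\<^sup>2 + (1/2) * (\<Sum>n=1..N. \<mu> n * almost_increasing.rise (S \<sigma>) (G \<sigma>) a n)
         \<le> L \<sigma> (e * form s y h y h) + C * (norm (abs_l2 y))\<^sup>2)"
    by (rule component_form_estimate) blast
  show ?thesis
  proof (rule that[OF a0], intro allI impI)
    fix a assume "0 < a \<and> a \<le> a0"
    then obtain C where C: "C \<ge> 0" "\<forall>y h N \<mu> \<sigma>. \<bar>\<sigma>\<bar> = 1 \<longrightarrow>
       test_function y h \<longrightarrow> (\<forall>x\<ge>real N * a. y x = 0 \<and> h x = 0) \<longrightarrow> (\<forall>n::nat. 0 \<le> \<mu> n) \<longrightarrow>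
       (\<forall>n\<ge>1. \<forall>x. \<bar>x - real n * a\<bar> \<le> a / 2 \<longrightarrow> \<mu> n \<le> (cmod (y x))\<^sup>2) \<longrightarrow>
       \<kappa> / 2 * (norm (abs_l2 h))\<^sup>2 + (1/2) * (\<Sum>n=1..N. \<mu> n * almost_increasing.rise (S \<sigma>) (G \<sigma>) a n)
         \<le> L \<sigma> (e * form s y h y h) + C * (norm (abs_l2 y))\<^sup>2"
      using est by blast
    show "\<exists>C\<ge>0. \<forall>y h N \<mu>.
       test_function y h \<longrightarrow> (\<forall>x\<ge>real N * a. y x = 0 \<and> h x = 0) \<longrightarrow> (\<forall>n::nat. 0 \<le> \<mu> n) \<longrightarrow>
       (\<forall>n\<ge>1. \<forall>x. \<bar>x - real n * a\<bar> \<le> a / 2 \<longrightarrow> \<mu> n \<le> (cmod (y x))\<^sup>2) \<longrightarrow>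
       (\<Sum>n=1..N. \<mu> n * W a n) \<le> 2 * T * Re (e * form s y h y h) + C * (norm (abs_l2 y))\<^sup>2"
    proof (rule exI[of _ "2 * C"], intro conjI allI impI)
      show "0 \<le> 2 * C" using C by simp
      fix y h :: "real \<Rightarrow> complex" and N and \<mu> :: "nat \<Rightarrow> real"
      assume H: "test_function y h" "\<forall>x\<ge>real N * a. y x = 0 \<and> h x = 0" "\<forall>n. 0 \<le> \<mu> n"
        "\<forall>n\<ge>1. \<forall>x. \<bar>x - real n * a\<bar> \<le> a / 2 \<longrightarrow> \<mu> n \<le> (cmod (y x))\<^sup>2"
      define A where "A = (\<lambda>\<sigma>. \<Sum>n=1..N. \<mu> n * almost_increasing.rise (S \<sigma>) (G \<sigma>) a n)"
      have k: "0 \<le> \<kappa> / 2 * (norm (abs_l2 h))\<^sup>2" using \<kappa> by simp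
      have est: "(1/2) * A \<sigma> \<le> L \<sigma> (e * form s y h y h) + C * (norm (abs_l2 y))\<^sup>2" if "\<bar>\<sigma>\<bar> = 1" for \<sigma>
        using C(2)[rule_format, OF that H(1), of N \<mu>] H k unfolding A_def by fastforce
      have "(\<Sum>n=1..N. \<mu> n * W a n) = (1/2) * A 1 + (1/2) * A (-1)"
        by (simp add: W_def A_def sum_divide_distrib sum.distrib[symmetric] distrib_left add_divide_distrib)
      also have "\<dots> \<le> 2 * T * Re (e * form s y h y h) + 2 * C * (norm (abs_l2 y))\<^sup>2"
        using est[of 1] est[of "-1"] unfolding L_def by simp
      finally show "(\<Sum>n=1..N. \<mu> n * W a n) \<le> 2 * T * Re (e * form s y h y h) + 2 * C * (norm (abs_l2 y))\<^sup>2" .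
    qed
  qed
qed

text \<open>On the middle half of a window each component differs from the value of its monotone part at
  the left end by at most its rise plus the error \<open>\<rho>\<close>. Since \<open>L 1\<close> and \<open>L (-1)\<close> are
  coordinates on the plane, \<open>s\<close> differs from a constant by at most the sum of the two.\<close>

lemma oscillation_le_rise:
  assumes a: "0 < a" "a \<le> 1" "2 * a \<le> d"
  obtains K where "K \<ge> 0" "\<forall>n\<ge>1. 0 \<le> W a n \<and> oscillation s (real n * a - a / 2) a \<le> K * ((W a n)\<^sup>2 + 1)"
proof -
  obtain P where P: "\<And>\<sigma>. \<bar>\<sigma>\<bar> = 1 \<Longrightarrow> almost_increasing (S \<sigma>) (F \<sigma>) (G \<sigma>) d P"
    by (rule components_almost_increasing) blast
  interpret p: almost_increasing "S 1" "F 1" "G 1" d P by (rule P) simp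
  interpret m: almost_increasing "S (-1)" "F (-1)" "G (-1)" d P by (rule P) simp
  define K where "K = 2 * a * (3 * (4 * a + 2 * P))"
  have K: "K \<ge> 0" unfolding K_def using a p.P_nonneg by simp
  have WK: "0 \<le> W a n \<and> oscillation s (real n * a - a / 2) a \<le> K * ((W a n)\<^sup>2 + 1)" if n: "n \<ge> 1" for n
  proof
    have r: "0 \<le> p.rise a n" "0 \<le> m.rise a n" using p.rise_nonneg m.rise_nonneg a n by auto
    then show "0 \<le> W a n" by (simp add: W_def)
    define x0 where "x0 = real n * a - a / 2"
    define q where "q = real n * a - a"
    have q: "q \<ge> 0" using a n mult_right_mono[of 1 "real n" a] by (simp add: q_def)
    have x0: "x0 = q + a / 2" by (simp add: x0_def q_def)
    (* The complex number with L 1 M and L (-1) M equal to the two monotone parts at x0. *)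
    define M where "M = complex_of_real ((p.monotone_part q x0 + m.monotone_part q x0) / (2 * T)) +
       \<i> * complex_of_real ((p.monotone_part q x0 - m.monotone_part q x0) / 2)"
    define c where "c = cnj e * M"
    have ec: "e * c = M"
    proof -
      have "e * cnj e = 1" using complex_norm_square[of e] by (simp add: norm_e)
      then show ?thesis by (simp add: c_def mult.assoc[symmetric])
    qed
    have LM: "L 1 M = p.monotone_part q x0" "L (-1) M = m.monotone_part q x0"
      using T by (auto simp: L_def M_def field_simps)
    have comp: "\<bar>L 1 z\<bar> + \<bar>L (-1) z\<bar> \<ge> cmod z" for z
    proof -
      have "2 * \<bar>Im z\<bar> \<le> \<bar>L 1 z\<bar> + \<bar>L (-1) z\<bar>" "2 * \<bar>T * Re z\<bar> \<le> \<bar>L 1 z\<bar> + \<bar>L (-1) z\<bar>"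
        unfolding L_def by linarith+
      moreover have "\<bar>Re z\<bar> \<le> \<bar>T * Re z\<bar>" using T by (simp add: abs_mult mult_le_cancel_right1)
      ultimately show ?thesis using cmod_le[of z] by linarith
    qed
    have pt: "cmod (s x - c) \<le> 2 * W a n + p.\<rho> x + m.\<rho> x" if x: "x \<in> {x0..x0 + a}" for x
    proof -
      have xb: "q \<le> x" "x \<le> q + d" "q \<le> x0" "x0 \<le> x" using x q a by (auto simp: x0)
      have xe: "x \<le> q + 3 * a / 2" "q + 3 * a / 2 \<le> q + d" using x a by (auto simp: x0)
      have eqs: "real n * a - a = q" "real n * a + a / 2 = q + 3 * a / 2" "real n * a - a / 2 = x0"
        by (auto simp: q_def x0_def)
      have pp: "\<bar>S 1 x - p.monotone_part q x0\<bar> \<le> p.rise a n + p.\<rho> x"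
        using p.monotone_part_bounds[OF q xb(1,2)] p.monotone_part_mono[OF q xb(3,4,2)]
          p.monotone_part_mono[OF q xb(1) xe]
        unfolding p.rise_def eqs p.\<rho>_def by linarith
      have mm: "\<bar>S (-1) x - m.monotone_part q x0\<bar> \<le> m.rise a n + m.\<rho> x"
        using m.monotone_part_bounds[OF q xb(1,2)] m.monotone_part_mono[OF q xb(3,4,2)]
          m.monotone_part_mono[OF q xb(1) xe]
        unfolding m.rise_def eqs m.\<rho>_def by linarith
      have "cmod (s x - c) = cmod (e * (s x - c))" by (simp add: norm_mult norm_e)
      also have "\<dots> = cmod (e * s x - M)" by (simp add: right_diff_distrib ec)
      also have "\<dots> \<le> \<bar>L 1 (e * s x - M)\<bar> + \<bar>L (-1) (e * s x - M)\<bar>" by (rule comp)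
      also have "\<dots> = \<bar>S 1 x - p.monotone_part q x0\<bar> + \<bar>S (-1) x - m.monotone_part q x0\<bar>"
        by (simp only: L_diff LM S_def)
      also have "\<dots> \<le> (p.rise a n + p.\<rho> x) + (m.rise a n + m.\<rho> x)" by (rule add_mono[OF pp mm])
      also have "\<dots> = 2 * W a n + p.\<rho> x + m.\<rho> x" by (simp add: W_def)
      finally show ?thesis .
    qed
    have x0': "0 \<le> x0" using q a by (simp add: x0)
    have sl: "L2_on {x0..x0 + a} s"
      by (rule L2_on_subset[of "{0..x0 + a}"]) (use s x0' a in \<open>auto simp: L2_loc_def\<close>)
    have sc: "L2_on {x0..x0 + a} (\<lambda>\<xi>. s \<xi> - c)" by (intro L2_on_diff sl L2_on_continuous) auto
    have i\<rho>: "(\<lambda>x. (p.\<rho> x)\<^sup>2) integrable_on {x0..b}" "(\<lambda>x. (m.\<rho> x)\<^sup>2) integrable_on {x0..b}" for b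
      using L2_on_square_integrable_on[OF p.L2_sub(2)[OF x0']] L2_on_square_integrable_on[OF m.L2_sub(2)[OF x0']]
      by (simp_all only: norm_of_real power2_abs)
    have ic: "(\<lambda>x. (2 * W a n)\<^sup>2) integrable_on {x0..x0 + a}" by (rule integrable_on_const) simp
    have icv: "integral {x0..x0 + a} (\<lambda>x. (2 * W a n)\<^sup>2) = a * (2 * W a n)\<^sup>2" using a by simp
    have sq3: "(u + v + w)\<^sup>2 \<le> 3 * (u\<^sup>2 + v\<^sup>2 + w\<^sup>2)" for u v w :: real
      using zero_le_power2[of "u - v"] zero_le_power2[of "v - w"] zero_le_power2[of "u - w"]
      by (simp add: power2_eq_square algebra_simps)
    have "integral {x0..x0 + a} (\<lambda>x. (cmod (s x - c))\<^sup>2) \<le>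
        integral {x0..x0 + a} (\<lambda>x. 3 * ((2 * W a n)\<^sup>2 + (p.\<rho> x)\<^sup>2 + (m.\<rho> x)\<^sup>2))"
    proof (rule integral_le)
      show "(\<lambda>x. (cmod (s x - c))\<^sup>2) integrable_on {x0..x0 + a}" by (rule L2_on_square_integrable_on[OF sc])
      show "(\<lambda>x. 3 * ((2 * W a n)\<^sup>2 + (p.\<rho> x)\<^sup>2 + (m.\<rho> x)\<^sup>2)) integrable_on {x0..x0 + a}"
        by (intro integrable_on_mult_right integrable_add i\<rho> ic)
      fix x assume x: "x \<in> {x0..x0 + a}"
      have "(cmod (s x - c))\<^sup>2 \<le> (2 * W a n + p.\<rho> x + m.\<rho> x)\<^sup>2" using pt[OF x] by (intro power_mono) auto
      also have "\<dots> \<le> 3 * ((2 * W a n)\<^sup>2 + (p.\<rho> x)\<^sup>2 + (m.\<rho> x)\<^sup>2)" by (rule sq3)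
      finally show "(cmod (s x - c))\<^sup>2 \<le> 3 * ((2 * W a n)\<^sup>2 + (p.\<rho> x)\<^sup>2 + (m.\<rho> x)\<^sup>2)" .
    qed
    also have "\<dots> = 3 * (a * (2 * W a n)\<^sup>2 + integral {x0..x0 + a} (\<lambda>x. (p.\<rho> x)\<^sup>2) + integral {x0..x0 + a} (\<lambda>x. (m.\<rho> x)\<^sup>2))"
      by (simp only: Henstock_Kurzweil_Integration.integral_mult_right icv
        Henstock_Kurzweil_Integration.integral_add[OF integrable_add[OF ic i\<rho>(1)] i\<rho>(2)]
        Henstock_Kurzweil_Integration.integral_add[OF ic i\<rho>(1)])
    also have "\<dots> \<le> 3 * (a * (2 * W a n)\<^sup>2 + P + P)"
    proof -
      have "integral {x0..x0 + a} (\<lambda>x. (p.\<rho> x)\<^sup>2) \<le> integral {x0..x0 + 1} (\<lambda>x. (p.\<rho> x)\<^sup>2)"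
        by (intro integral_subset_le i\<rho>) (use a in auto)
      also have "\<dots> \<le> P" unfolding p.\<rho>_def by (rule p.P[OF x0'])
      finally have 1: "integral {x0..x0 + a} (\<lambda>x. (p.\<rho> x)\<^sup>2) \<le> P" .
      have "integral {x0..x0 + a} (\<lambda>x. (m.\<rho> x)\<^sup>2) \<le> integral {x0..x0 + 1} (\<lambda>x. (m.\<rho> x)\<^sup>2)"
        by (intro integral_subset_le i\<rho>) (use a in auto)
      also have "\<dots> \<le> P" unfolding m.\<rho>_def by (rule m.P[OF x0'])
      finally have 2: "integral {x0..x0 + a} (\<lambda>x. (m.\<rho> x)\<^sup>2) \<le> P" .
      show ?thesis by (intro mult_left_mono add_mono order_refl 1 2) simp
    qed
    also have "\<dots> \<le> 3 * (4 * a + 2 * P) * ((W a n)\<^sup>2 + 1)"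
      using a p.P_nonneg by (simp add: power2_eq_square algebra_simps)
    finally have "2 * a * integral {x0..x0 + a} (\<lambda>x. (cmod (s x - c))\<^sup>2) \<le> 2 * a * (3 * (4 * a + 2 * P) * ((W a n)\<^sup>2 + 1))"
      using a by (intro mult_left_mono) auto
    then have "oscillation s x0 a \<le> K * ((W a n)\<^sup>2 + 1)"
      using oscillation_le[OF sl a(1), of c] by (simp add: K_def mult.assoc)
    then show "oscillation s (real n * a - a / 2) a \<le> K * ((W a n)\<^sup>2 + 1)" by (simp add: x0_def)
  qed
  show ?thesis by (rule that[OF K]) (use WK in blast)
qed

end

section \<open>Approximate solvability for coercive forms on an incomplete space\<close>

lemma quadratic_nonneg_discriminant:
  fixes A E Q :: real
  assumes "\<And>t. 0 \<le> A + 2 * t * E + t\<^sup>2 * Q" and Q: "Q \<ge> 0"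
  shows "E\<^sup>2 \<le> A * Q"
proof (cases "Q = 0")
  case True
  have "E = 0"
  proof (rule ccontr)
    assume "E \<noteq> 0"
    then show False using assms(1)[of "- (A + 1) / (2 * E)"] True by (simp add: field_simps)
  qed
  then show ?thesis using True by simp
next
  case False
  then have Q: "Q > 0" using Q by simp
  have "0 \<le> Q * (A + 2 * (- E / Q) * E + (- E / Q)\<^sup>2 * Q)"
    using assms(1)[of "- E / Q"] Q by (intro mult_nonneg_nonneg) auto
  also have "\<dots> = A * Q - E\<^sup>2" using Q by (simp add: power2_eq_square field_simps)
  finally show ?thesis by simp
qed

text \<open>A coercive form on a subspace that need not be complete for the norm \<open>p\<close> of the form, which is why only solutions
  up to a small residual can be expected. The bound \<open>K\<close> refers to \<open>p\<close> itself; it expresses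
  sectoriality.\<close>

locale bounded_form =
  fixes D :: "'a::real_vector set" and B :: "'a \<Rightarrow> 'a \<Rightarrow> real" and K :: real
  assumes sub: "subspace D"
    and add_left: "\<And>x y z. x \<in> D \<Longrightarrow> y \<in> D \<Longrightarrow> z \<in> D \<Longrightarrow> B (x + y) z = B x z + B y z"
    and add_right: "\<And>x y z. x \<in> D \<Longrightarrow> y \<in> D \<Longrightarrow> z \<in> D \<Longrightarrow> B z (x + y) = B z x + B z y"
    and scale_left: "\<And>r x y. x \<in> D \<Longrightarrow> y \<in> D \<Longrightarrow> B (r *\<^sub>R x) y = r * B x y"
    and scale_right: "\<And>r x y. x \<in> D \<Longrightarrow> y \<in> D \<Longrightarrow> B x (r *\<^sub>R y) = r * B x y"
    and nonneg: "\<And>x. x \<in> D \<Longrightarrow> 0 \<le> B x x"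
    and bound: "\<And>x y. x \<in> D \<Longrightarrow> y \<in> D \<Longrightarrow> \<bar>B x y\<bar> \<le> K * sqrt (B x x) * sqrt (B y y)"
    and K: "K \<ge> 1"
begin

definition p where "p x = sqrt (B x x)"
definition symm where "symm x y = (B x y + B y x) / 2"

lemma D_add: "x \<in> D \<Longrightarrow> y \<in> D \<Longrightarrow> x + y \<in> D" and D_scale: "x \<in> D \<Longrightarrow> r *\<^sub>R x \<in> D" and D_zero: "0 \<in> D"
  using sub by (auto simp: subspace_def)

lemma D_diff: "x \<in> D \<Longrightarrow> y \<in> D \<Longrightarrow> x - y \<in> D"
  using sub by (rule subspace_diff)

lemma diff_left: "x \<in> D \<Longrightarrow> y \<in> D \<Longrightarrow> z \<in> D \<Longrightarrow> B (x - y) z = B x z - B y z"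
  using add_left[of "x" "(-1) *\<^sub>R y" z] scale_left[of y z "-1"] D_scale[of y "-1"] by simp

lemma p_nonneg: "0 \<le> p x" if "x \<in> D" using nonneg[OF that] by (simp add: p_def)

lemma p_square: "x \<in> D \<Longrightarrow> (p x)\<^sup>2 = B x x" using nonneg by (simp add: p_def)

lemma p_line:
  assumes "x \<in> D" "y \<in> D"
  shows "(p (x + t *\<^sub>R y))\<^sup>2 = (p x)\<^sup>2 + 2 * t * symm x y + t\<^sup>2 * (p y)\<^sup>2"
proof -
  have ty: "t *\<^sub>R y \<in> D" using assms D_scale by blast
  show ?thesis
    unfolding p_square[OF assms(1)] p_square[OF assms(2)] p_square[OF D_add[OF assms(1) ty]]
    using assms ty
    by (simp add: D_add add_left add_right scale_left scale_right symm_def power2_eq_square field_simps)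
qed

lemma symm_bound:
  assumes "x \<in> D" "y \<in> D" shows "\<bar>symm x y\<bar> \<le> p x * p y"
proof -
  have "(symm x y)\<^sup>2 \<le> (p x)\<^sup>2 * (p y)\<^sup>2"
    by (rule quadratic_nonneg_discriminant) (use p_line[OF assms] in \<open>simp_all flip: p_line[OF assms]\<close>)
  also have "\<dots> = (p x * p y)\<^sup>2" by (simp add: power_mult_distrib)
  finally have "\<bar>symm x y\<bar> \<le> \<bar>p x * p y\<bar>" by (simp only: abs_le_square_iff)
  then show ?thesis using p_nonneg assms by simp
qed

definition functional :: "('a \<Rightarrow> real) \<Rightarrow> real \<Rightarrow> bool" where
  "functional F c \<longleftrightarrow> (\<forall>x\<in>D. \<forall>y\<in>D. F (x + y) = F x + F y) \<and> (\<forall>x\<in>D. \<forall>r. F (r *\<^sub>R x) = r * F x) \<and>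
     (\<forall>x\<in>D. \<bar>F x\<bar> \<le> c * p x)"

text \<open>Dirichlet's principle: \<open>v\<close> almost minimises \<open>p(v)\<^sup>2 / 2 - F v\<close>, and the first variation of an almost
  minimiser is small.\<close>

lemma approximate_Riesz:
  assumes F: "functional F c" and \<epsilon>: "\<epsilon> > 0"
  obtains v where "v \<in> D" "\<forall>x\<in>D. \<bar>F x - symm v x\<bar> \<le> \<epsilon> * p x"
proof -
  define J where "J = (\<lambda>v. (p v)\<^sup>2 / 2 - F v)"
  have lb: "- c\<^sup>2 / 2 \<le> J v" if "v \<in> D" for v
  proof -
    have "F v \<le> c * p v" using F that unfolding functional_def by (meson abs_le_D1)
    moreover have "0 \<le> (p v - c)\<^sup>2" by simp
    ultimately show ?thesis by (simp add: J_def power2_eq_square algebra_simps)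
  qed
  have bdd: "bdd_below (J ` D)" unfolding bdd_below_def using lb by (intro exI[of _ "- c\<^sup>2 / 2"]) auto
  define \<delta> where "\<delta> = \<epsilon>\<^sup>2 / 2"
  have "Inf (J ` D) < Inf (J ` D) + \<delta>" using \<epsilon> by (simp add: \<delta>_def)
  then obtain v where v: "v \<in> D" "J v < Inf (J ` D) + \<delta>"
    using cInf_lessD[of "J ` D"] D_zero by (metis (no_types, lifting) empty_iff imageE image_is_empty)
  have "\<bar>F x - symm v x\<bar> \<le> \<epsilon> * p x" if x: "x \<in> D" for x
  proof -
    have "(symm v x - F x)\<^sup>2 \<le> 2 * \<delta> * (p x)\<^sup>2"
    proof (rule quadratic_nonneg_discriminant)
      fix t
      have "Inf (J ` D) \<le> J (v + t *\<^sub>R x)" using bdd v x D_add D_scale by (intro cINF_lower) auto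
      moreover have "J (v + t *\<^sub>R x) = J v + t * (symm v x - F x) + t\<^sup>2 * (p x)\<^sup>2 / 2"
        using F v x D_scale unfolding functional_def J_def by (simp add: p_line field_simps)
      ultimately show "0 \<le> 2 * \<delta> + 2 * t * (symm v x - F x) + t\<^sup>2 * (p x)\<^sup>2" using v by (simp add: field_simps)
    qed simp
    also have "\<dots> = (\<epsilon> * p x)\<^sup>2" by (simp add: \<delta>_def power_mult_distrib)
    finally have "\<bar>symm v x - F x\<bar> \<le> \<bar>\<epsilon> * p x\<bar>" by (simp only: abs_le_square_iff)
    then show ?thesis using \<epsilon> p_nonneg[OF x] by (simp add: abs_minus_commute abs_mult)
  qed
  then show ?thesis using that v by blast
qed

lemma functional_B: "v \<in> D \<Longrightarrow> functional (B v) (K * p v)"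
  unfolding functional_def p_def using add_right scale_right bound by auto

lemma p_le_of_residual:
  assumes F: "functional F c" and v: "v \<in> D" and r: "\<bar>F v - symm v v\<bar> \<le> \<epsilon> * p v" and "c \<ge> 0" "\<epsilon> \<ge> 0"
  shows "p v \<le> c + \<epsilon>"
proof (cases "p v = 0")
  case False
  then have pv: "p v > 0" using p_nonneg[OF v] by simp
  have "(p v)\<^sup>2 = symm v v" using p_square[OF v] by (simp add: symm_def)
  also have "\<dots> \<le> \<bar>F v\<bar> + \<epsilon> * p v" using r by linarith
  also have "\<dots> \<le> c * p v + \<epsilon> * p v" using F v by (simp add: functional_def)
  finally have "p v * p v \<le> (c + \<epsilon>) * p v" by (simp add: power2_eq_square algebra_simps)
  then show ?thesis using pv by simp
qed (use assms in simp)

text \<open>The contraction of the Lax--Milgram theorem. With \<open>F \<approx> symm v\<close> and \<open>B v \<approx> symm w\<close> the residual of \<open>\<tau> v\<close> is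
  represented by \<open>u = v - \<tau> w\<close>. Now \<open>symm v w \<approx> p(v)\<^sup>2\<close> and \<open>p w \<lesssim> K p(v)\<close>, so with
  \<open>\<tau> = 1 / K\<^sup>2\<close> one has \<open>p(u)\<^sup>2 \<lesssim> (1 - \<tau>) p(v)\<^sup>2\<close>, and \<open>\<eta>\<close> is the relative accuracy that leaves a factor
  \<open>1 - \<tau> / 4\<close>.\<close>

lemma residual_step:
  obtains \<theta> where "0 < \<theta>" "\<theta> < 1"
    "\<forall>F c. functional F c \<longrightarrow> c > 0 \<longrightarrow> (\<exists>y\<in>D. \<forall>x\<in>D. \<bar>F x - B y x\<bar> \<le> \<theta> * c * p x)"
proof -
  define \<tau> where "\<tau> = 1 / K\<^sup>2"
  define \<eta> where "\<eta> = \<tau> / 32"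
  have K2: "1 \<le> K\<^sup>2" using K by simp
  have \<tau>: "0 < \<tau>" "\<tau> \<le> 1" using K2 K by (auto simp: \<tau>_def field_simps)
  have \<tau>K: "\<tau> * K \<le> 1" "\<tau> * K\<^sup>2 = 1" using K by (auto simp: \<tau>_def power2_eq_square field_simps)
  have \<eta>: "0 < \<eta>" "\<eta> \<le> 1" "\<eta>\<^sup>2 \<le> \<eta>" using \<tau> by (auto simp: \<eta>_def power2_eq_square intro: mult_left_le_one_le)
  show ?thesis
  proof (rule that[of "1 - \<tau> / 4"])
    show "0 < 1 - \<tau> / 4" "1 - \<tau> / 4 < 1" using \<tau> by auto
    show "\<forall>F c. functional F c \<longrightarrow> c > 0 \<longrightarrow> (\<exists>y\<in>D. \<forall>x\<in>D. \<bar>F x - B y x\<bar> \<le> (1 - \<tau> / 4) * c * p x)"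
    proof (intro allI impI)
      fix F c assume F: "functional F c" and c: "(c::real) > 0"
      have \<eta>c: "\<eta> * c > 0" using \<eta> c by simp
      obtain v where v: "v \<in> D" "\<forall>x\<in>D. \<bar>F x - symm v x\<bar> \<le> \<eta> * c * p x"
        by (rule approximate_Riesz[OF F \<eta>c]) blast
      obtain w where w: "w \<in> D" "\<forall>x\<in>D. \<bar>B v x - symm w x\<bar> \<le> \<eta> * c * p x"
        by (rule approximate_Riesz[OF functional_B[OF v(1)] \<eta>c]) blast
      define P where "P = p v"
      have P: "0 \<le> P" "P \<le> (1 + \<eta>) * c"
        using p_nonneg[OF v(1)] p_le_of_residual[OF F v(1) v(2)[rule_format, OF v(1)]] c \<eta>c
        by (auto simp: P_def algebra_simps)
      have pw: "0 \<le> p w" "p w \<le> K * P + \<eta> * c"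
        using p_nonneg[OF w(1)] p_le_of_residual[OF functional_B[OF v(1)] w(1) w(2)[rule_format, OF w(1)]] K P \<eta>c
        by (auto simp: P_def)
      have Swv: "P\<^sup>2 - \<eta> * c * P \<le> symm v w"
      proof -
        have "\<bar>P\<^sup>2 - symm v w\<bar> \<le> \<eta> * c * P"
          using w(2)[rule_format, OF v(1)] p_square[OF v(1)] by (simp add: P_def symm_def add.commute)
        then show ?thesis using abs_le_D1 by force
      qed
      define u where "u = v + (- \<tau>) *\<^sub>R w"
      have u: "u \<in> D" unfolding u_def using v w D_add D_scale by blast
      have "(p u)\<^sup>2 = P\<^sup>2 - 2 * \<tau> * symm v w + \<tau>\<^sup>2 * (p w)\<^sup>2"
        using p_line[OF v(1) w(1), of "- \<tau>"] by (simp add: u_def P_def)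
      also have "\<dots> \<le> P\<^sup>2 - 2 * \<tau> * (P\<^sup>2 - \<eta> * c * P) + \<tau>\<^sup>2 * (K * P + \<eta> * c)\<^sup>2"
      proof -
        have "2 * \<tau> * (P\<^sup>2 - \<eta> * c * P) \<le> 2 * \<tau> * symm v w" using Swv \<tau> by (intro mult_left_mono) auto
        moreover have "\<tau>\<^sup>2 * (p w)\<^sup>2 \<le> \<tau>\<^sup>2 * (K * P + \<eta> * c)\<^sup>2" using pw by (intro mult_left_mono power_mono) auto
        ultimately show ?thesis by linarith
      qed
      also have "\<dots> = P\<^sup>2 - 2 * \<tau> * P\<^sup>2 + \<tau> * (\<tau> * K\<^sup>2) * P\<^sup>2 + 2 * \<tau> * (\<eta> * c * P) + 2 * \<tau> * ((\<tau> * K) * (\<eta> * c * P)) + \<tau>\<^sup>2 * (\<eta>\<^sup>2 * c\<^sup>2)"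
        by (simp add: power2_eq_square algebra_simps)
      also have "\<dots> \<le> P\<^sup>2 - 2 * \<tau> * P\<^sup>2 + \<tau> * 1 * P\<^sup>2 + 2 * 1 * (\<eta> * c * P) + 2 * 1 * (1 * (\<eta> * c * P)) + 1 * (\<eta> * c\<^sup>2)"
        using \<tau> \<tau>K \<eta> c P K
        by (intro add_mono mult_mono mult_right_mono mult_left_mono order_refl) (auto simp: power_le_one)
      also have "\<dots> = (1 - \<tau>) * P\<^sup>2 + 4 * (\<eta> * c * P) + \<eta> * c\<^sup>2" by (simp add: algebra_simps)
      also have "\<dots> \<le> (1 - \<tau>) * ((1 + \<eta>) * c)\<^sup>2 + 4 * (\<eta> * c * ((1 + \<eta>) * c)) + \<eta> * c\<^sup>2"
        using P \<tau> \<eta> c by (intro add_mono mult_left_mono power_mono) auto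
      also have "\<dots> \<le> (1 - \<tau> + 12 * \<eta>) * c\<^sup>2"
      proof -
        have "(1 - \<tau>) * (1 + \<eta>)\<^sup>2 \<le> (1 - \<tau>) * (1 + 3 * \<eta>)"
          using \<tau> \<eta> by (intro mult_left_mono) (auto simp: power2_eq_square algebra_simps)
        also have "\<dots> \<le> 1 - \<tau> + 3 * \<eta>" using \<tau> \<eta> by (simp add: algebra_simps)
        finally have 1: "(1 - \<tau>) * (1 + \<eta>)\<^sup>2 \<le> 1 - \<tau> + 3 * \<eta>" .
        have 2: "4 * (\<eta> * (1 + \<eta>)) \<le> 8 * \<eta>" using \<eta> by (simp add: algebra_simps power2_eq_square)
        have "((1 - \<tau>) * (1 + \<eta>)\<^sup>2 + 4 * (\<eta> * (1 + \<eta>)) + \<eta>) * c\<^sup>2 \<le> (1 - \<tau> + 12 * \<eta>) * c\<^sup>2"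
          using 1 2 by (intro mult_right_mono) auto
        then show ?thesis by (simp add: power_mult_distrib algebra_simps power2_eq_square)
      qed
      also have "\<dots> \<le> (1 - \<tau> / 2 + 6 * \<eta>)\<^sup>2 * c\<^sup>2"
      proof (rule mult_right_mono)
        have "0 \<le> (- \<tau> / 2 + 6 * \<eta>)\<^sup>2" by simp
        then show "1 - \<tau> + 12 * \<eta> \<le> (1 - \<tau> / 2 + 6 * \<eta>)\<^sup>2" by (simp add: power2_eq_square algebra_simps)
      qed simp
      finally have "(p u)\<^sup>2 \<le> ((1 - \<tau> / 2 + 6 * \<eta>) * c)\<^sup>2" by (simp add: power_mult_distrib)
      then have pu: "p u \<le> (1 - \<tau> / 2 + 6 * \<eta>) * c"
        by (rule power2_le_imp_le) (use \<tau> \<eta> c in auto)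
      show "\<exists>y\<in>D. \<forall>x\<in>D. \<bar>F x - B y x\<bar> \<le> (1 - \<tau> / 4) * c * p x"
      proof (rule bexI[of _ "\<tau> *\<^sub>R v"], rule ballI)
        fix x assume x: "x \<in> D"
        have Su: "symm u x = symm v x - \<tau> * symm w x"
          unfolding u_def symm_def using v w x D_scale[OF w(1), of "-\<tau>"]
          by (simp only: add_left add_right scale_left scale_right D_scale) (simp add: field_simps)
        have "F x - B (\<tau> *\<^sub>R v) x = (F x - symm v x) + symm u x - \<tau> * (B v x - symm w x)"
          using v x by (simp add: Su scale_left algebra_simps)
        also have "\<bar>\<dots>\<bar> \<le> \<bar>F x - symm v x\<bar> + \<bar>symm u x\<bar> + \<tau> * \<bar>B v x - symm w x\<bar>"
          using \<tau> abs_triangle_ineq4[of "(F x - symm v x) + symm u x" "\<tau> * (B v x - symm w x)"] abs_triangle_ineq[of "F x - symm v x" "symm u x"]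
          by (simp add: abs_mult)
        also have "\<dots> \<le> \<eta> * c * p x + (1 - \<tau> / 2 + 6 * \<eta>) * c * p x + 1 * (\<eta> * c * p x)"
        proof (intro add_mono mult_mono)
          show "\<bar>symm u x\<bar> \<le> (1 - \<tau> / 2 + 6 * \<eta>) * c * p x"
            using symm_bound[OF u x] mult_right_mono[OF pu p_nonneg[OF x]] by linarith
        qed (use v w x \<tau> in auto)
        also have "\<dots> = (1 - \<tau> / 4) * c * p x" by (simp add: \<eta>_def algebra_simps)
        finally show "\<bar>F x - B (\<tau> *\<^sub>R v) x\<bar> \<le> (1 - \<tau> / 4) * c * p x" .
      qed (use v D_scale in auto)
    qed
  qed
qed

text \<open>The residual is again a bounded functional, so \<open>residual_step\<close> can be repeated.\<close>

lemma approximate_solution: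
  assumes F: "functional F c" and \<epsilon>: "\<epsilon> > 0"
  shows "\<exists>y\<in>D. \<forall>x\<in>D. \<bar>F x - B y x\<bar> \<le> \<epsilon> * p x"
proof -
  obtain \<theta> where \<theta>: "0 < \<theta>" "\<theta> < 1"
    and step: "\<forall>F c. functional F c \<longrightarrow> c > 0 \<longrightarrow> (\<exists>y\<in>D. \<forall>x\<in>D. \<bar>F x - B y x\<bar> \<le> \<theta> * c * p x)"
    by (rule residual_step) blast
  define C where "C = max c 1"
  have iter: "\<exists>y\<in>D. \<forall>x\<in>D. \<bar>F x - B y x\<bar> \<le> \<theta> ^ n * C * p x" for n
  proof (induction n)
    case 0
    have "\<bar>F x - B 0 x\<bar> \<le> C * p x" if x: "x \<in> D" for x
    proof -
      have "B 0 x = 0" using scale_left[OF D_zero x, of 0] by simp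
      moreover have "\<bar>F x\<bar> \<le> c * p x" using F x by (simp add: functional_def)
      moreover have "c * p x \<le> C * p x" using p_nonneg[OF x] by (intro mult_right_mono) (auto simp: C_def)
      ultimately show ?thesis by simp
    qed
    then show ?case using D_zero by auto
  next
    case (Suc n)
    then obtain y where y: "y \<in> D" "\<forall>x\<in>D. \<bar>F x - B y x\<bar> \<le> \<theta> ^ n * C * p x" by blast
    show ?case
    proof -
      have res: "functional (\<lambda>x. F x - B y x) (\<theta> ^ n * C)"
        using F y add_right scale_right unfolding functional_def by (auto simp: algebra_simps)
      have "\<theta> ^ n * C > 0" using \<theta> by (auto simp: C_def)
      then obtain z where z: "z \<in> D" "\<forall>x\<in>D. \<bar>F x - B y x - B z x\<bar> \<le> \<theta> * (\<theta> ^ n * C) * p x"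
        using step[rule_format, OF res] by blast
      show ?thesis
        by (rule bexI[of _ "y + z"]) (use y z add_left D_add in \<open>auto simp: diff_diff_eq mult.assoc\<close>)
    qed
  qed
  have "(\<lambda>n. \<theta> ^ n * C) \<longlonglongrightarrow> 0 * C" using \<theta> by (intro tendsto_mult LIMSEQ_power_zero tendsto_const) auto
  then have "\<forall>\<^sub>F n in sequentially. \<theta> ^ n * C < \<epsilon>" using \<epsilon> by (intro order_tendstoD) auto
  then obtain n where n: "\<theta> ^ n * C < \<epsilon>" by (auto simp: eventually_sequentially)
  obtain y where y: "y \<in> D" "\<forall>x\<in>D. \<bar>F x - B y x\<bar> \<le> \<theta> ^ n * C * p x" using iter[of n] by blast
  show ?thesis
  proof (rule bexI[OF _ y(1)], rule ballI)
    fix x assume x: "x \<in> D"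
    have "\<bar>F x - B y x\<bar> \<le> \<theta> ^ n * C * p x" using y x by blast
    also have "\<dots> \<le> \<epsilon> * p x" using n p_nonneg[OF x] by (intro mult_right_mono) auto
    finally show "\<bar>F x - B y x\<bar> \<le> \<epsilon> * p x" .
  qed
qed

lemma residual_unique:
  assumes y: "y \<in> D" "y' \<in> D" and r: "\<forall>x\<in>D. \<bar>F x - B y x\<bar> \<le> \<epsilon> * p x" "\<forall>x\<in>D. \<bar>F x - B y' x\<bar> \<le> \<epsilon>' * p x"
    and \<epsilon>: "\<epsilon> \<ge> 0" "\<epsilon>' \<ge> 0"
  shows "p (y - y') \<le> \<epsilon> + \<epsilon>'"
proof (cases "p (y - y') = 0")
  case False
  have d: "y - y' \<in> D" using y D_diff by blast
  then have pos: "p (y - y') > 0" using False p_nonneg[OF d] by simp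
  have "(p (y - y'))\<^sup>2 = B y (y - y') - B y' (y - y')" using p_square[OF d] diff_left[OF y d] by simp
  also have "\<dots> \<le> \<bar>F (y - y') - B y (y - y')\<bar> + \<bar>F (y - y') - B y' (y - y')\<bar>" by linarith
  also have "\<dots> \<le> \<epsilon> * p (y - y') + \<epsilon>' * p (y - y')" using r d by (intro add_mono) auto
  finally have "p (y - y') * p (y - y') \<le> (\<epsilon> + \<epsilon>') * p (y - y')" by (simp add: power2_eq_square algebra_simps)
  then show ?thesis using pos by simp
qed (use \<epsilon> in simp)

end

section \<open>The form on \<open>L\<^sub>2 \<times> L\<^sub>2\<close>\<close>

text \<open>The pairs \<open>(y, y')\<close> in \<open>L\<^sub>2 \<times> L\<^sub>2\<close>. Keeping \<open>y'\<close> as a separate component turns the form domain into a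
  subspace of a Banach space, in which limits of \<open>y'\<close> can be taken.\<close>

definition test_pairs :: "(l2 \<times> l2) set" where
  "test_pairs = {(abs_l2 y, abs_l2 g) | y g. test_function y g}"

text \<open>Multiplication by a complex number; the product type carries only its real vector space
  structure.\<close>

definition cscale :: "complex \<Rightarrow> l2 \<times> l2 \<Rightarrow> l2 \<times> l2" where
  "cscale c Y = (scaleC_l2 c (fst Y), scaleC_l2 c (snd Y))"

definition pair_form :: "(real \<Rightarrow> complex) \<Rightarrow> l2 \<times> l2 \<Rightarrow> l2 \<times> l2 \<Rightarrow> complex" where
  "pair_form s Y V = form s (rep_l2 (fst Y)) (rep_l2 (snd Y)) (rep_l2 (fst V)) (rep_l2 (snd V))"

lemma test_pairsE:
  assumes "Y \<in> test_pairs"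
  obtains y g where "test_function y g" "Y = (abs_l2 y, abs_l2 g)"
  using assms by (auto simp: test_pairs_def)

lemma test_pairs_add: "Y \<in> test_pairs \<Longrightarrow> V \<in> test_pairs \<Longrightarrow> Y + V \<in> test_pairs"
proof -
  assume "Y \<in> test_pairs" "V \<in> test_pairs"
  then obtain y g v h where y: "test_function y g" "Y = (abs_l2 y, abs_l2 g)"
    and v: "test_function v h" "V = (abs_l2 v, abs_l2 h)" by (metis test_pairsE)
  have "Y + V = (abs_l2 (\<lambda>x. y x + v x), abs_l2 (\<lambda>x. g x + h x))"
    using y v test_functionD by (simp add: plus_abs_l2)
  then show ?thesis using test_function_add[OF y(1) v(1)] by (auto simp: test_pairs_def)
qed

lemma test_pairs_cscale: "Y \<in> test_pairs \<Longrightarrow> cscale c Y \<in> test_pairs"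
proof -
  assume "Y \<in> test_pairs"
  then obtain y g where y: "test_function y g" "Y = (abs_l2 y, abs_l2 g)" by (metis test_pairsE)
  have "cscale c Y = (abs_l2 (\<lambda>x. c * y x), abs_l2 (\<lambda>x. c * g x))"
    using y test_functionD by (simp add: cscale_def scaleC_abs_l2)
  then show ?thesis using test_function_cmult[OF y(1)] by (auto simp: test_pairs_def)
qed

lemma scaleR_eq_cscale: "r *\<^sub>R Y = cscale (of_real r) Y"
  by (cases Y) (simp add: cscale_def scaleC_l2_of_real)

lemma zero_test_pairs: "0 \<in> test_pairs"
proof -
  have "test_function (\<lambda>x. 0) (\<lambda>x. 0)"
    by (auto simp: test_function_def primitive_on_def L2_on_zero intro!: exI[of _ 0])
  then show ?thesis unfolding test_pairs_def zero_prod_def zero_l2_def by blast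
qed

lemma subspace_test_pairs: "subspace test_pairs"
  unfolding subspace_def using test_pairs_add test_pairs_cscale zero_test_pairs by (auto simp: scaleR_eq_cscale)

lemma pair_form_abs:
  assumes "L2_on {0..} y" "L2_on {0..} g" "L2_on {0..} v" "L2_on {0..} h" and s: "s \<in> borel_measurable (lebesgue_on {0..})"
  shows "pair_form s (abs_l2 y, abs_l2 g) (abs_l2 v, abs_l2 h) = form s y g v h"
  unfolding pair_form_def form_def fst_conv snd_conv
proof (rule integral_cong_AE)
  have [measurable]: "cnj \<in> borel_measurable borel"
    by (intro borel_measurable_continuous_onI continuous_intros)
  note [measurable] = L2_on_measurable[OF assms(1)] L2_on_measurable[OF assms(2)] L2_on_measurable[OF assms(3)]
    L2_on_measurable[OF assms(4)] s L2_on_measurable[OF rep_abs_l2(1)[OF assms(1)]] L2_on_measurable[OF rep_abs_l2(1)[OF assms(2)]]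
    L2_on_measurable[OF rep_abs_l2(1)[OF assms(3)]] L2_on_measurable[OF rep_abs_l2(1)[OF assms(4)]]
  show "(\<lambda>x. rep_l2 (abs_l2 g) x * cnj (rep_l2 (abs_l2 h) x) - s x * (rep_l2 (abs_l2 g) x * cnj (rep_l2 (abs_l2 v) x) +
      rep_l2 (abs_l2 y) x * cnj (rep_l2 (abs_l2 h) x))) \<in> borel_measurable (lebesgue_on {0..})" by measurable
  show "(\<lambda>x. g x * cnj (h x) - s x * (g x * cnj (v x) + y x * cnj (h x))) \<in> borel_measurable (lebesgue_on {0..})" by measurable
  show "AE x in lebesgue_on {0..}. rep_l2 (abs_l2 g) x * cnj (rep_l2 (abs_l2 h) x) - s x * (rep_l2 (abs_l2 g) x * cnj (rep_l2 (abs_l2 v) x) +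
      rep_l2 (abs_l2 y) x * cnj (rep_l2 (abs_l2 h) x)) = g x * cnj (h x) - s x * (g x * cnj (v x) + y x * cnj (h x))"
    using rep_abs_l2(2)[OF assms(1)] rep_abs_l2(2)[OF assms(2)] rep_abs_l2(2)[OF assms(3)] rep_abs_l2(2)[OF assms(4)]
    by eventually_elim simp
qed

lemma L2_loc_measurable: "L2_loc s \<Longrightarrow> s \<in> borel_measurable (lebesgue_on {0..})"
  by (rule measurable_halfline) (simp add: L2_loc_def L2_on_def)

lemma pair_form_test:
  assumes "L2_loc s" "test_function y g" "test_function v h"
  shows "pair_form s (abs_l2 y, abs_l2 g) (abs_l2 v, abs_l2 h) = form s y g v h"
  by (rule pair_form_abs) (use assms test_functionD L2_loc_measurable in auto)

lemma form_add_left: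
  assumes "L2_loc s" "test_function y g" "test_function y' g'" "test_function v h"
  shows "form s (\<lambda>x. y x + y' x) (\<lambda>x. g x + g' x) v h = form s y g v h + form s y' g' v h"
proof -
  note i = form_integrable[OF assms(1,2,4)] and j = form_integrable[OF assms(1,3,4)]
  show ?thesis
    unfolding form_def
    by (subst Bochner_Integration.integral_add[symmetric])
       (use i j in \<open>auto intro!: Bochner_Integration.integral_cong simp: algebra_simps\<close>)
qed

lemma form_cmult_left: "form s (\<lambda>x. c * y x) (\<lambda>x. c * g x) v h = c * form s y g v h"
  unfolding form_def by (subst integral_mult_right_zero[symmetric])
    (auto intro!: Bochner_Integration.integral_cong simp: algebra_simps)

lemma form_add_right:
  assumes "L2_loc s" "test_function y g" "test_function v h" "test_function v' h'"
  shows "form s y g (\<lambda>x. v x + v' x) (\<lambda>x. h x + h' x) = form s y g v h + form s y g v' h'"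
proof -
  note i = form_integrable[OF assms(1,2,3)] and j = form_integrable[OF assms(1,2,4)]
  show ?thesis
    unfolding form_def
    by (subst Bochner_Integration.integral_add[symmetric])
       (use i j in \<open>auto intro!: Bochner_Integration.integral_cong simp: algebra_simps\<close>)
qed

lemma form_cmult_right: "form s y g (\<lambda>x. c * v x) (\<lambda>x. c * h x) = cnj c * form s y g v h"
  unfolding form_def by (subst integral_mult_right_zero[symmetric])
    (auto intro!: Bochner_Integration.integral_cong simp: algebra_simps)

lemma pair_form_sesquilinear:
  assumes s: "L2_loc s" and Y: "Y \<in> test_pairs" "Y' \<in> test_pairs" and V: "V \<in> test_pairs" "V' \<in> test_pairs"
  shows "pair_form s (Y + Y') V = pair_form s Y V + pair_form s Y' V"
    "pair_form s Y (V + V') = pair_form s Y V + pair_form s Y V'"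
    "pair_form s (cscale c Y) V = c * pair_form s Y V"
    "pair_form s Y (cscale c V) = cnj c * pair_form s Y V"
proof -
  obtain y g where y: "test_function y g" "Y = (abs_l2 y, abs_l2 g)" using Y(1) by (metis test_pairsE)
  obtain y' g' where y': "test_function y' g'" "Y' = (abs_l2 y', abs_l2 g')" using Y(2) by (metis test_pairsE)
  obtain v h where v: "test_function v h" "V = (abs_l2 v, abs_l2 h)" using V(1) by (metis test_pairsE)
  obtain v' h' where v': "test_function v' h'" "V' = (abs_l2 v', abs_l2 h')" using V(2) by (metis test_pairsE)
  note T = test_functionD(5,6)
  have e: "Y + Y' = (abs_l2 (\<lambda>x. y x + y' x), abs_l2 (\<lambda>x. g x + g' x))"
    "V + V' = (abs_l2 (\<lambda>x. v x + v' x), abs_l2 (\<lambda>x. h x + h' x))"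
    "cscale c Y = (abs_l2 (\<lambda>x. c * y x), abs_l2 (\<lambda>x. c * g x))"
    "cscale c V = (abs_l2 (\<lambda>x. c * v x), abs_l2 (\<lambda>x. c * h x))"
    using T[OF y(1)] T[OF y'(1)] T[OF v(1)] T[OF v'(1)] y(2) y'(2) v(2) v'(2)
    by (simp_all add: plus_abs_l2 cscale_def scaleC_abs_l2)
  show "pair_form s (Y + Y') V = pair_form s Y V + pair_form s Y' V"
    unfolding e unfolding y(2) y'(2) v(2) pair_form_test[OF s y(1) v(1)] pair_form_test[OF s y'(1) v(1)]
      pair_form_test[OF s test_function_add[OF y(1) y'(1)] v(1)]
    by (rule form_add_left[OF s y(1) y'(1) v(1)])
  show "pair_form s Y (V + V') = pair_form s Y V + pair_form s Y V'"
    unfolding e unfolding y(2) v'(2) v(2) pair_form_test[OF s y(1) v(1)] pair_form_test[OF s y(1) v'(1)]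
      pair_form_test[OF s y(1) test_function_add[OF v(1) v'(1)]]
    by (rule form_add_right[OF s y(1) v(1) v'(1)])
  show "pair_form s (cscale c Y) V = c * pair_form s Y V"
    unfolding e unfolding y(2) v(2) pair_form_test[OF s y(1) v(1)] pair_form_test[OF s test_function_cmult[OF y(1)] v(1)]
    by (rule form_cmult_left)
  show "pair_form s Y (cscale c V) = cnj c * pair_form s Y V"
    unfolding e unfolding y(2) v(2) pair_form_test[OF s y(1) v(1)] pair_form_test[OF s y(1) test_function_cmult[OF v(1)]]
    by (rule form_cmult_right)
qed

section \<open>Density of test functions\<close>

lemma sets_lebesgue_on_less:
  "{t \<in> space (lebesgue_on {0..b}). t < x} \<in> sets (lebesgue_on {0..b})"
  "{t \<in> space (lebesgue_on {0..b}). t \<le> x} \<in> sets (lebesgue_on {0..b})" for x :: real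
proof -
  have id: "(\<lambda>t. t) \<in> borel_measurable (lebesgue_on {0..b})"
    by (rule continuous_imp_measurable_on_sets_lebesgue) auto
  show "{t \<in> space (lebesgue_on {0..b}). t < x} \<in> sets (lebesgue_on {0..b})"
    by (rule borel_measurable_less[OF id borel_measurable_const])
  show "{t \<in> space (lebesgue_on {0..b}). t \<le> x} \<in> sets (lebesgue_on {0..b})"
    by (rule borel_measurable_le[OF id borel_measurable_const])
qed

lemma L2_on_indicator: "L2_on {0..} (\<lambda>t. if t \<le> x then 1 else 0)"
proof (rule L2_on_halflineI[of _ "\<bar>x\<bar>"])
  show "L2_on {0..b} (\<lambda>t. if t \<le> x then 1 else 0)" for b
  proof (rule L2_on_bound)
    show "(\<lambda>t. if t \<le> x then 1 else 0 :: complex) \<in> borel_measurable (lebesgue_on {0..b})"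
      by (intro measurable_If sets_lebesgue_on_less) auto
    show "integrable (lebesgue_on {0..b}) (\<lambda>t. 1 :: real)"
      by (simp add: finite_measure.integrable_const finite_measure_lebesgue_on)
  qed auto
qed auto

definition step_class :: "real \<Rightarrow> l2" where
  "step_class x = abs_l2 (\<lambda>t. if t \<le> x then 1 else 0)"

lemma cinner_step_class:
  assumes f: "L2_on {0..} f" and x: "0 \<le> x"
  shows "cinner_l2 (abs_l2 f) (step_class x) = integral {0..x} f"
proof -
  have fx: "integrable (lebesgue_on {0..x}) f"
    by (intro absolutely_integrable_imp_integrable L2_on_interval_integrable L2_on_subset[OF f]) auto
  have "cinner_l2 (abs_l2 f) (step_class x) = (\<integral>t. f t * cnj (if t \<le> x then 1 else 0) \<partial>lebesgue_on {0..})"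
    unfolding step_class_def by (rule cinner_abs_l2[OF f L2_on_indicator])
  also have "\<dots> = integral {0..x} (\<lambda>t. f t * cnj (if t \<le> x then 1 else 0))"
  proof (rule halfline_integral(2)[OF x])
    show "integrable (lebesgue_on {0..x}) (\<lambda>t. f t * cnj (if t \<le> x then 1 else 0))"
      using fx by (rule Bochner_Integration.integrable_cong[THEN iffD1, rotated -1]) (auto simp: space_restrict_space)
  qed auto
  also have "\<dots> = integral {0..x} f" by (rule integral_cong) auto
  finally show ?thesis .
qed

lemma primitive_on_indefinite:
  assumes "g absolutely_integrable_on {0..b}"
  shows "primitive_on 0 b g (\<lambda>x. integral {0..x} g)"
  unfolding primitive_on_def
proof (intro conjI ballI assms)
  fix x assume x: "x \<in> {0..b}"
  have "g integrable_on {0..b}" using assms by (simp add: absolutely_integrable_on_def)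
  then have "g integrable_on {0..x}" by (rule integrable_on_subinterval) (use x in auto)
  then show "(g has_integral integral {0..x} g - integral {0..0} g) {0..x}" by (simp add: has_integral_integral)
qed

text \<open>A function with vanishing indefinite integral vanishes almost everywhere.\<close>

lemma l2_eq_zero_if_orthogonal_steps:
  assumes z: "\<And>x. 0 \<le> x \<Longrightarrow> cinner_l2 f (step_class x) = 0"
  shows "f = 0"
proof -
  obtain f0 where f0: "L2_on {0..} f0" "f = abs_l2 f0" by (rule l2_cases)
  have i: "integral {0..x} f0 = 0" if "0 \<le> x" for x using z[OF that] cinner_step_class[OF f0(1) that] f0 by simp
  have "\<exists>N. negligible N \<and> (\<forall>x\<in>{0..real n} - N. f0 x = 0)" for n :: nat
  proof -
    have ai: "f0 absolutely_integrable_on {0..real n}"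
      by (intro L2_on_interval_integrable L2_on_subset[OF f0(1)]) auto
    obtain N where "negligible N" "\<forall>x\<in>{0..real n} - N. f0 x = 0"
    proof (rule primitive_on_zero[OF primitive_on_indefinite[OF ai]])
      show "integral {0..x} f0 = 0" if "x \<in> {0..real n}" for x using i that by simp
    qed blast
    then show ?thesis by blast
  qed
  then obtain N where N: "\<And>n. negligible (N n)" "\<And>n. \<forall>x\<in>{0..real n} - N n. f0 x = 0" by metis
  have neg: "negligible (\<Union>n. N n)" using N(1) by (intro negligible_countable_Union) auto
  have "f0 x = 0" if "x \<in> {0..} - (\<Union>n. N n)" for x
  proof -
    obtain n :: nat where "x \<le> real n" using real_arch_simple by blast
    then show ?thesis using N(2)[of n] that by auto
  qed
  then have "AE x in lebesgue. x \<in> {0..} \<longrightarrow> f0 x = 0"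
    using neg by (intro AE_I'[of "\<Union>n. N n"]) (auto simp: negligible_iff_null_sets)
  then have "AE x in lebesgue_on {0..}. f0 x = 0" by (simp add: AE_restrict_space_iff)
  then show ?thesis
    using f0 by (simp add: zero_l2_def abs_l2_eq_iff L2_on_zero)
qed

text \<open>The lemma of du Bois-Reymond. If \<open>f\<close> is orthogonal to all test functions, its primitive \<open>\<Phi>\<close> is orthogonal to
  all \<open>h\<close> with mean zero on \<open>[0, R]\<close>. The choice \<open>h = \<Phi> - m\<close> with the mean \<open>m\<close> of \<open>\<Phi>\<close> shows that \<open>\<Phi>\<close> is
  constant.\<close>

lemma test_functions_dense:
  assumes z: "\<And>V. V \<in> test_pairs \<Longrightarrow> cinner_l2 f (fst V) = 0"
  shows "f = 0"
proof (rule l2_eq_zero_if_orthogonal_steps)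
  obtain f0 where f0: "L2_on {0..} f0" "f = abs_l2 f0" by (rule l2_cases)
  have f0b: "L2_on {0..b} f0" for b by (rule L2_on_subset[OF f0(1)]) auto
  define \<Phi> where "\<Phi> = (\<lambda>x. integral {0..x} f0)"
  have p\<Phi>: "primitive_on 0 b f0 \<Phi>" for b
    unfolding \<Phi>_def by (intro primitive_on_indefinite L2_on_interval_integrable f0b)
  have c\<Phi>: "continuous_on {0..b} \<Phi>" for b by (rule primitive_on_continuous[OF p\<Phi>])
  have \<Phi>0: "\<Phi> 0 = 0" by (simp add: \<Phi>_def)
  fix R :: real assume "0 \<le> R"
  show "cinner_l2 f (step_class R) = 0"
  proof (cases "R = 0")
    case True
    then show ?thesis using cinner_step_class[OF f0(1), of 0] f0 by simp
  next
    case False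
    then have R: "R > 0" using \<open>0 \<le> R\<close> by simp
    define m where "m = integral {0..R} \<Phi> / R"
    define h where "h = (\<lambda>x. if x < R then \<Phi> x - m else 0)"
    define v where "v = (\<lambda>x. integral {0..x} h)"
    have h1: "L2_on {0..R} (\<lambda>x. \<Phi> x - m)" by (intro L2_on_continuous continuous_intros c\<Phi>)
    have hl: "L2_on {0..b} h" for b
    proof (rule L2_on_bound)
      have [measurable]: "(\<lambda>x. \<Phi> x - m) \<in> borel_measurable (lebesgue_on {0..b})"
        by (intro L2_on_measurable L2_on_continuous continuous_intros c\<Phi>)
      show "h \<in> borel_measurable (lebesgue_on {0..b})" unfolding h_def by (intro measurable_If sets_lebesgue_on_less) auto
      show "integrable (lebesgue_on {0..b}) (\<lambda>x. (cmod (\<Phi> x - m))\<^sup>2)"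
        by (intro L2_on_integrable L2_on_continuous continuous_intros c\<Phi>)
    qed (simp add: h_def)
    have pv: "primitive_on 0 b h v" for b
      unfolding v_def by (intro primitive_on_indefinite L2_on_interval_integrable hl)
    have i\<Phi>: "\<Phi> integrable_on {0..R}" by (intro integrable_continuous_real c\<Phi>)
    have "integral {0..R} h = integral {0..R} (\<lambda>x. \<Phi> x - m)"
      by (rule integral_spike[of "{R}"]) (auto simp: h_def)
    also have "\<dots> = integral {0..R} \<Phi> - integral {0..R} (\<lambda>x. m)"
      by (rule Henstock_Kurzweil_Integration.integral_diff[OF i\<Phi>]) auto
    also have "\<dots> = 0" using R by (simp add: m_def scaleR_conv_of_real)
    finally have ih: "integral {0..R} h = 0" .
    have v0: "v x = 0" if x: "x \<ge> R" for x
    proof -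
      have "h integrable_on {0..x}"
        using L2_on_interval_integrable[OF hl] by (simp add: absolutely_integrable_on_def)
      then have "v x = integral {0..R} h + integral {R..x} h"
        unfolding v_def using x R by (intro Henstock_Kurzweil_Integration.integral_combine[symmetric]) auto
      also have "integral {R..x} h = integral {R..x} (\<lambda>x. 0)" by (rule integral_cong) (auto simp: h_def)
      finally show ?thesis using ih by simp
    qed
    have tv: "test_function v h"
      unfolding test_function_def using pv hl v0 R by (auto simp: v_def h_def intro!: exI[of _ R])
    have vR: "v R = 0" by (rule v0) simp
    have vc: "continuous_on {0..R} v" by (rule primitive_on_continuous[OF pv])
    have pcv: "primitive_on 0 R (\<lambda>x. cnj (h x)) (\<lambda>x. cnj (v x))" by (rule primitive_on_cnj[OF pv])
    have "(\<lambda>x. f0 x * cnj (v x)) integrable_on {0..R}"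
      using absolutely_integrable_mult_continuous[OF L2_on_interval_integrable[OF f0b] continuous_on_cnj[OF vc]]
      by (simp add: absolutely_integrable_on_def)
    moreover have i2: "(\<lambda>x. \<Phi> x * cnj (h x)) integrable_on {0..R}"
      using absolutely_integrable_mult_continuous[OF L2_on_interval_integrable[OF L2_on_cnj[OF hl]] c\<Phi>]
      by (simp add: absolutely_integrable_on_def mult.commute)
    ultimately have "integral {0..R} (\<lambda>x. f0 x * cnj (v x)) + integral {0..R} (\<lambda>x. \<Phi> x * cnj (h x)) = 
        integral {0..R} (\<lambda>x. f0 x * cnj (v x) + \<Phi> x * cnj (h x))"
      by (simp add: Henstock_Kurzweil_Integration.integral_add)
    also have "\<dots> = 0"
      using primitive_on_diff[OF primitive_on_mult[OF p\<Phi> pcv] order_refl _ order_refl] R \<Phi>0 vR by (simp add: integral_unique)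
    finally have sum0: "integral {0..R} (\<lambda>x. f0 x * cnj (v x)) + integral {0..R} (\<lambda>x. \<Phi> x * cnj (h x)) = 0" .
    have "cinner_l2 f (abs_l2 v) = (\<integral>x. f0 x * cnj (v x) \<partial>lebesgue_on {0..})"
      unfolding f0(2) by (rule cinner_abs_l2[OF f0(1) test_functionD(5)[OF tv]])
    also have "\<dots> = integral {0..R} (\<lambda>x. f0 x * cnj (v x))"
    proof (rule halfline_integral(2))
      show "integrable (lebesgue_on {0..R}) (\<lambda>x. f0 x * cnj (v x))"
        by (rule integrable_L2_product[OF f0b test_functionD(4)[OF tv]])
    qed (use R v0 in auto)
    finally have "integral {0..R} (\<lambda>x. f0 x * cnj (v x)) = 0"
      using z[of "(abs_l2 v, abs_l2 h)"] tv by (auto simp: test_pairs_def)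
    then have 1: "integral {0..R} (\<lambda>x. \<Phi> x * cnj (h x)) = 0" using sum0 by simp
    have i3: "(\<lambda>x. cnj (h x)) integrable_on {0..R}"
      using L2_on_interval_integrable[OF L2_on_cnj[OF hl]] by (simp add: absolutely_integrable_on_def)
    have "integral {0..R} (\<lambda>x. cnj (h x)) = cnj (v R) - cnj (v 0)"
      using primitive_on_diff[OF pcv order_refl _ order_refl] R by (simp add: integral_unique)
    then have 2: "integral {0..R} (\<lambda>x. m * cnj (h x)) = 0" using vR by (simp add: v_def)
    have "integral {0..R} (\<lambda>x. complex_of_real ((cmod (\<Phi> x - m))\<^sup>2)) = integral {0..R} (\<lambda>x. \<Phi> x * cnj (h x) - m * cnj (h x))"
      by (rule integral_spike[of "{R}"]) (auto simp: h_def complex_norm_square algebra_simps simp del: of_real_power)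
    also have "\<dots> = 0"
      unfolding Henstock_Kurzweil_Integration.integral_diff[OF i2 integrable_on_mult_right[OF i3]] 1 2 by simp
    finally have "integral {0..R} (\<lambda>x. complex_of_real ((cmod (\<Phi> x - m))\<^sup>2)) = 0" .
    moreover have "((\<lambda>x. complex_of_real ((cmod (\<Phi> x - m))\<^sup>2)) has_integral
        complex_of_real (integral {0..R} (\<lambda>x. (cmod (\<Phi> x - m))\<^sup>2))) {0..R}"
      using has_integral_linear[OF integrable_integral[OF L2_on_square_integrable_on[OF h1]] bounded_linear_of_real[where 'a=complex]]
      unfolding o_def .
    ultimately have "complex_of_real (integral {0..R} (\<lambda>x. (cmod (\<Phi> x - m))\<^sup>2)) = 0"
      using integral_unique by metis
    then have "integral {0..R} (\<lambda>x. (cmod (\<Phi> x - m))\<^sup>2) = 0" by (simp only: of_real_eq_0_iff)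
    then have "((\<lambda>x. (cmod (\<Phi> x - m))\<^sup>2) has_integral 0) (cbox 0 R)"
      using L2_on_square_integrable_on[OF h1] by (simp add: has_integral_iff)
    then have eq: "(cmod (\<Phi> x - m))\<^sup>2 = 0" if "x \<in> cbox 0 R" for x
      by (rule has_integral_0_cbox_imp_0[rotated 2]) (use that R c\<Phi> in \<open>auto intro!: continuous_intros\<close>)
    have "\<Phi> 0 = m" "\<Phi> R = m" using eq[of 0] eq[of R] R by auto
    then have "\<Phi> R = 0" using \<Phi>0 by simp
    then show ?thesis using cinner_step_class[OF f0(1), of R] R f0 by (simp add: \<Phi>_def)
  qed
qed

lemma test_function_sup:
  assumes y: "test_function y g" and x: "0 \<le> x" and h: "h > 0"
  shows "(cmod (y x))\<^sup>2 \<le> 2 / h * (norm (abs_l2 y))\<^sup>2 + 2 * h * (norm (abs_l2 g))\<^sup>2"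
proof -
  have le: "integral {x..x+h} (\<lambda>t. (cmod (k t))\<^sup>2) \<le> (norm (abs_l2 k))\<^sup>2" if k: "L2_on {0..} k" for k
  proof -
    have i: "integrable (lebesgue_on {0..}) (\<lambda>t. (cmod (k t))\<^sup>2)" by (rule L2_on_integrable[OF k])
    have i1: "(\<lambda>t. (cmod (k t))\<^sup>2) integrable_on {0..}" using i by (rule integrable_on_lebesgue_on) auto
    have "integral {x..x+h} (\<lambda>t. (cmod (k t))\<^sup>2) \<le> integral {0..} (\<lambda>t. (cmod (k t))\<^sup>2)"
      by (rule integral_subset_le[OF _ integrable_on_subinterval[OF i1] i1]) (use x in auto)
    also have "\<dots> = (norm (abs_l2 k))\<^sup>2"
      unfolding norm_abs_l2_square[OF k] by (rule lebesgue_integral_eq_integral[OF i, symmetric]) auto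
    finally show ?thesis .
  qed
  have "(cmod (y x))\<^sup>2 \<le> 2 / (x + h - x) * integral {x..x+h} (\<lambda>x. (cmod (y x))\<^sup>2) +
           2 * (x + h - x) * integral {x..x+h} (\<lambda>x. (cmod (g x))\<^sup>2)"
    by (rule cell_sup_bound[OF primitive_on_subinterval[OF test_functionD(2)[OF y, of "x+h"]] L2_on_subset[OF test_functionD(3)[OF y, of "x+h"]]])
       (use x h in auto)
  also have "\<dots> \<le> 2 / h * (norm (abs_l2 y))\<^sup>2 + 2 * h * (norm (abs_l2 g))\<^sup>2"
  proof -
    have "2 / h * integral {x..x+h} (\<lambda>x. (cmod (y x))\<^sup>2) \<le> 2 / h * (norm (abs_l2 y))\<^sup>2"
      using h by (intro mult_left_mono le test_functionD(5)[OF y]) simp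
    moreover have "2 * h * integral {x..x+h} (\<lambda>x. (cmod (g x))\<^sup>2) \<le> 2 * h * (norm (abs_l2 g))\<^sup>2"
      using h by (intro mult_left_mono le test_functionD(6)[OF y]) simp
    ultimately show ?thesis by simp
  qed
  finally show ?thesis .
qed

section \<open>Generalised solutions of the resolvent equation\<close>

text \<open>The constant \<open>C\<close> of \<open>form_sectorial\<close>. Adding \<open>C1\<close> times the inner product to the rotated form makes its
  real part \<open>B\<close> dominate \<open>\<parallel>y\<parallel>\<^sup>2\<close>, a multiple of \<open>\<parallel>y'\<parallel>\<^sup>2\<close>, and its own
  imaginary part, up to constants.\<close>

locale sectorial_form = sector_condition +
  fixes C :: real
  assumes C: "C \<ge> 0"
    and est: "\<And>y h. test_function y h \<Longrightarrow>
      \<bar>Im (e * form s y h y h)\<bar> + \<kappa> / 2 * (norm (abs_l2 h))\<^sup>2 \<le> T * Re (e * form s y h y h) + C * (norm (abs_l2 y))\<^sup>2"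
begin

definition C1 where "C1 = C / T + 1"

definition hform :: "l2 \<times> l2 \<Rightarrow> l2 \<times> l2 \<Rightarrow> complex" where
  "hform Y V = e * pair_form s Y V + of_real C1 * cinner_l2 (fst Y) (fst V)"

definition B :: "l2 \<times> l2 \<Rightarrow> l2 \<times> l2 \<Rightarrow> real" where "B Y V = Re (hform Y V)"

lemma hform_sesquilinear:
  assumes Y: "Y \<in> test_pairs" "Y' \<in> test_pairs" and V: "V \<in> test_pairs" "V' \<in> test_pairs"
  shows "hform (Y + Y') V = hform Y V + hform Y' V"
    "hform Y (V + V') = hform Y V + hform Y V'"
    "hform (cscale c Y) V = c * hform Y V"
    "hform Y (cscale c V) = cnj c * hform Y V"
  using pair_form_sesquilinear[OF s Y V]
  by (simp_all add: hform_def cinner_l2_add_left cinner_l2_add_right cscale_def cinner_l2_scaleC_left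
      cinner_l2_scaleC_right algebra_simps)

lemma hform_diagonal:
  assumes Y: "Y \<in> test_pairs"
  shows "\<bar>Im (hform Y Y)\<bar> + \<kappa> / 2 * (norm (snd Y))\<^sup>2 + T * (norm (fst Y))\<^sup>2 \<le> T * B Y Y"
    "hform Y Y = e * pair_form s Y Y + of_real (C1 * (norm (fst Y))\<^sup>2)"
proof -
  obtain y h where y: "test_function y h" "Y = (abs_l2 y, abs_l2 h)" using Y by (metis test_pairsE)
  have pf: "pair_form s Y Y = form s y h y h" unfolding y(2) by (rule pair_form_test[OF s y(1) y(1)])
  show eq: "hform Y Y = e * pair_form s Y Y + of_real (C1 * (norm (fst Y))\<^sup>2)"
    by (simp add: hform_def cinner_self_norm)
  have TC: "T * C1 = C + T" using T by (simp add: C1_def field_simps)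
  have "T * B Y Y = T * Re (e * form s y h y h) + (T * C1) * (norm (fst Y))\<^sup>2"
    unfolding B_def eq pf by (simp add: algebra_simps)
  moreover have "Im (hform Y Y) = Im (e * form s y h y h)" unfolding eq pf by simp
  ultimately show "\<bar>Im (hform Y Y)\<bar> + \<kappa> / 2 * (norm (snd Y))\<^sup>2 + T * (norm (fst Y))\<^sup>2 \<le> T * B Y Y"
    using est[OF y(1)] y(2) unfolding TC by (simp add: algebra_simps)
qed

lemma B_bounds:
  assumes Y: "Y \<in> test_pairs"
  shows "(norm (fst Y))\<^sup>2 \<le> B Y Y" "(norm (snd Y))\<^sup>2 \<le> 2 * T / \<kappa> * B Y Y" "\<bar>Im (hform Y Y)\<bar> \<le> T * B Y Y" "0 \<le> B Y Y"
proof -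
  have pos: "0 \<le> \<bar>Im (hform Y Y)\<bar>" "0 \<le> \<kappa> / 2 * (norm (snd Y))\<^sup>2" "0 \<le> T * (norm (fst Y))\<^sup>2" using \<kappa> T by auto
  have "T * (norm (fst Y))\<^sup>2 \<le> T * B Y Y" using hform_diagonal(1)[OF Y] pos by linarith
  then show 1: "(norm (fst Y))\<^sup>2 \<le> B Y Y" using T by simp
  show "\<bar>Im (hform Y Y)\<bar> \<le> T * B Y Y" using hform_diagonal(1)[OF Y] pos by linarith
  have "\<kappa> / 2 * (norm (snd Y))\<^sup>2 \<le> T * B Y Y" using hform_diagonal(1)[OF Y] pos by linarith
  then show "(norm (snd Y))\<^sup>2 \<le> 2 * T / \<kappa> * B Y Y" using \<kappa>(1) by (simp add: field_simps)
  show "0 \<le> B Y Y" using 1 zero_le_power2[of "norm (fst Y)"] by linarith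
qed

text \<open>The symmetric part of \<open>B\<close> obeys the Cauchy--Schwarz inequality. The antisymmetric part is the polarisation of the
  imaginary part of the form at \<open>Y \<plusminus> i t V\<close>, which sectoriality bounds by \<open>T\<close> times the real part.\<close>

lemma B_bounded:
  assumes Y: "Y \<in> test_pairs" and V: "V \<in> test_pairs"
  shows "\<bar>B Y V\<bar> \<le> (1 + T) * sqrt (B Y Y) * sqrt (B V V)"
proof -
  note sl = hform_sesquilinear
  have mem: "cscale c Y \<in> test_pairs" "cscale c V \<in> test_pairs" for c using Y V test_pairs_cscale by auto
  have exp: "hform (Y + cscale c V) (Y + cscale c V) = hform Y Y + c * hform V Y + cnj c * hform Y V + c * cnj c * hform V V" for c
    using Y V mem[of c] test_pairs_add[OF Y mem(2)[of c]]
    by (simp add: sl(1)[OF Y mem(2) _ _] sl(2)[OF _ _ Y mem(2)] sl(3)[OF V V] sl(4)[OF _ _ V V] algebra_simps)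
  define s0 where "s0 = (B Y V + B V Y) / 2"
  define a0 where "a0 = (B Y V - B V Y) / 2"
  have nn: "0 \<le> B Y Y" "0 \<le> B V V" using B_bounds(4) Y V by auto
  have "s0\<^sup>2 \<le> B Y Y * B V V"
  proof (rule quadratic_nonneg_discriminant[OF _ nn(2)])
    fix t :: real
    have "0 \<le> B (Y + cscale (of_real t) V) (Y + cscale (of_real t) V)" by (intro B_bounds(4) test_pairs_add Y mem)
    also have "\<dots> = B Y Y + 2 * t * s0 + t\<^sup>2 * B V V"
      unfolding B_def exp by (simp add: s0_def B_def power2_eq_square algebra_simps)
    finally show "0 \<le> B Y Y + 2 * t * s0 + t\<^sup>2 * B V V" .
  qed
  then have s0: "\<bar>s0\<bar> \<le> sqrt (B Y Y) * sqrt (B V V)"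
    by (metis real_sqrt_abs real_sqrt_le_iff real_sqrt_mult)
  have "a0\<^sup>2 \<le> (T * B Y Y) * (T * B V V)"
  proof (rule quadratic_nonneg_discriminant)
    show "0 \<le> T * B V V" using T nn by simp
    fix t :: real
    define U1 where "U1 = Y + cscale (\<i> * of_real t) V"
    define U2 where "U2 = Y + cscale (- \<i> * of_real t) V"
    have U: "U1 \<in> test_pairs" "U2 \<in> test_pairs" unfolding U1_def U2_def by (intro test_pairs_add Y mem)+
    have "Im (hform U1 U1) - Im (hform U2 U2) = - (4 * t * a0)"
      unfolding U1_def U2_def exp by (simp add: a0_def B_def field_simps)
    moreover have "T * B U1 U1 + T * B U2 U2 = 2 * (T * B Y Y) + 2 * t\<^sup>2 * (T * B V V)"
      unfolding U1_def U2_def B_def exp by (simp add: power2_eq_square algebra_simps)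
    moreover have "Im (hform U1 U1) - Im (hform U2 U2) \<le> T * B U1 U1 + T * B U2 U2"
      using B_bounds(3)[OF U(1)] B_bounds(3)[OF U(2)] by linarith
    ultimately have "0 \<le> 2 * (T * B Y Y) + 2 * t\<^sup>2 * (T * B V V) + 4 * t * a0" by linarith
    then show "0 \<le> T * B Y Y + 2 * t * a0 + t\<^sup>2 * (T * B V V)" by (simp add: algebra_simps)
  qed
  also have "\<dots> = (T * (sqrt (B Y Y) * sqrt (B V V)))\<^sup>2" using nn by (simp add: power_mult_distrib) (simp add: power2_eq_square)
  finally have "\<bar>a0\<bar> \<le> \<bar>T * (sqrt (B Y Y) * sqrt (B V V))\<bar>" by (simp only: abs_le_square_iff)
  then have a0: "\<bar>a0\<bar> \<le> T * (sqrt (B Y Y) * sqrt (B V V))" using T nn by simp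
  have "B Y V = s0 + a0" by (simp add: s0_def a0_def field_simps)
  then have "\<bar>B Y V\<bar> \<le> \<bar>s0\<bar> + \<bar>a0\<bar>" by linarith
  then show ?thesis using s0 a0 by (simp add: algebra_simps)
qed

sublocale bounded_form test_pairs B "1 + T"
proof
  show "subspace test_pairs" by (rule subspace_test_pairs)
  show "1 \<le> 1 + T" using T by simp
  show "\<bar>B x y\<bar> \<le> (1 + T) * sqrt (B x x) * sqrt (B y y)" if "x \<in> test_pairs" "y \<in> test_pairs" for x y
    by (rule B_bounded[OF that])
  show "0 \<le> B x x" if "x \<in> test_pairs" for x by (rule B_bounds(4)[OF that])
  fix x y z assume D: "x \<in> test_pairs" "y \<in> test_pairs"
  show "B (r *\<^sub>R x) y = r * B x y" "B x (r *\<^sub>R y) = r * B x y" for r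
    unfolding scaleR_eq_cscale B_def hform_sesquilinear(3,4)[OF D(1) D(1) D(2) D(2)] by simp_all
  assume z: "z \<in> test_pairs"
  show "B (x + y) z = B x z + B y z" "B z (x + y) = B z x + B z y"
    unfolding B_def hform_sesquilinear(1)[OF D z z] hform_sesquilinear(2)[OF z z D] by simp_all
qed

lemma norm_fst_le: "Y \<in> test_pairs \<Longrightarrow> norm (fst Y) \<le> p Y"
  unfolding p_def using B_bounds(1) by (simp add: real_le_rsqrt)

definition rhs :: "l2 \<Rightarrow> l2 \<times> l2 \<Rightarrow> real" where "rhs k V = Re (e * cinner_l2 k (fst V))"

lemma rhs_functional: "functional (rhs k) (norm k)"
  unfolding functional_def
proof (intro conjI ballI allI)
  show "rhs k (x + y) = rhs k x + rhs k y" for x y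
    by (simp add: rhs_def cinner_l2_add_right distrib_left)
  show "rhs k (r *\<^sub>R x) = r * rhs k x" for x r
    by (simp add: rhs_def scaleR_eq_cscale cscale_def cinner_l2_scaleC_right mult.left_commute)
  fix V assume V: "V \<in> test_pairs"
  have "\<bar>rhs k V\<bar> \<le> cmod (e * cinner_l2 k (fst V))" unfolding rhs_def by (rule abs_Re_le_cmod)
  also have "\<dots> \<le> norm k * norm (fst V)" using cinner_l2_bound[of k "fst V"] by (simp add: norm_mult norm_e)
  also have "\<dots> \<le> norm k * p V" using norm_fst_le[OF V] by (intro mult_left_mono) auto
  finally show "\<bar>rhs k V\<bar> \<le> norm k * p V" .
qed

text \<open>\<open>Y\<close> solves the equation \<open>B Y V = rhs k V\<close> with residual at most \<open>\<epsilon>\<close> in the dual of the form norm. Test pairs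
  form a complex space, so the real parts carry the whole complex equation.\<close>

definition approx :: "l2 \<Rightarrow> l2 \<times> l2 \<Rightarrow> real \<Rightarrow> bool" where
  "approx k Y \<epsilon> \<longleftrightarrow> Y \<in> test_pairs \<and> (\<forall>V\<in>test_pairs. \<bar>rhs k V - B Y V\<bar> \<le> \<epsilon> * p V)"

text \<open>\<open>\<eta>\<close> is the \<open>L\<^sub>2\<close> limit of approximate solutions. This generalised solution replaces an element of the completed
  form domain.\<close>

definition resolves :: "l2 \<Rightarrow> l2 \<Rightarrow> bool" where
  "resolves k \<eta> \<longleftrightarrow> (\<forall>\<epsilon>>0. \<exists>Y. approx k Y \<epsilon> \<and> norm (\<eta> - fst Y) \<le> \<epsilon>)"

lemma approx_close:
  assumes "approx k Y \<epsilon>" "approx k Y' \<epsilon>'" "\<epsilon> \<ge> 0" "\<epsilon>' \<ge> 0"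
  shows "p (Y - Y') \<le> \<epsilon> + \<epsilon>'" "norm (fst Y - fst Y') \<le> \<epsilon> + \<epsilon>'"
proof -
  show 1: "p (Y - Y') \<le> \<epsilon> + \<epsilon>'" using assms unfolding approx_def by (intro residual_unique[of Y Y' "rhs k"]) auto
  have "Y - Y' \<in> test_pairs" using assms D_diff by (auto simp: approx_def)
  from norm_fst_le[OF this] 1 show "norm (fst Y - fst Y') \<le> \<epsilon> + \<epsilon>'" by simp
qed

lemma approx_p_le:
  assumes "approx k Y \<epsilon>" "\<epsilon> \<ge> 0"
  shows "p Y \<le> norm k + \<epsilon>"
proof (cases "p Y = 0")
  case False
  have Y: "Y \<in> test_pairs" using assms by (simp add: approx_def)
  then have pos: "p Y > 0" using False p_nonneg by (simp add: order_less_le)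
  have "(p Y)\<^sup>2 = B Y Y" by (rule p_square[OF Y])
  also have "\<dots> \<le> \<bar>rhs k Y\<bar> + \<bar>rhs k Y - B Y Y\<bar>" by linarith
  also have "\<dots> \<le> norm k * p Y + \<epsilon> * p Y"
    using rhs_functional[of k] assms Y unfolding functional_def approx_def by (intro add_mono) auto
  finally have "p Y * p Y \<le> (norm k + \<epsilon>) * p Y" by (simp add: power2_eq_square algebra_simps)
  then show ?thesis using pos by simp
qed (use assms in simp)

text \<open>Approximate solutions with residuals tending to zero are Cauchy in the form norm, which dominates the norm of \<open>L\<^sub>2\<close>.\<close>

lemma resolves_exists: "\<exists>\<eta>. resolves k \<eta>"
proof -
  have "\<exists>Y. approx k Y (inverse (real (Suc n)))" for n
    using approximate_solution[OF rhs_functional, of "inverse (real (Suc n))" k] unfolding approx_def by auto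
  then obtain Y where Y: "\<And>n. approx k (Y n) (inverse (real (Suc n)))" by metis
  have "Cauchy (\<lambda>n. fst (Y n))"
  proof (rule CauchyI)
    fix \<epsilon> :: real assume "0 < \<epsilon>"
    then obtain N where N: "inverse (real (Suc N)) < \<epsilon> / 2" using reals_Archimedean[of "\<epsilon> / 2"] by auto
    show "\<exists>M. \<forall>m\<ge>M. \<forall>n\<ge>M. norm (fst (Y m) - fst (Y n)) < \<epsilon>"
    proof (intro exI[of _ N] allI impI)
      fix m n assume "m \<ge> N" "n \<ge> N"
      then have "inverse (real (Suc m)) \<le> inverse (real (Suc N))" "inverse (real (Suc n)) \<le> inverse (real (Suc N))"
        by (auto intro!: le_imp_inverse_le)
      moreover have "norm (fst (Y m) - fst (Y n)) \<le> inverse (real (Suc m)) + inverse (real (Suc n))"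
        by (rule approx_close(2)[OF Y[of m] Y[of n]]) auto
      ultimately show "norm (fst (Y m) - fst (Y n)) < \<epsilon>" using N by linarith
    qed
  qed
  then obtain \<eta> where \<eta>: "(\<lambda>n. fst (Y n)) \<longlonglongrightarrow> \<eta>" using Cauchy_convergent_iff convergent_def by blast
  have "resolves k \<eta>" unfolding resolves_def
  proof (intro allI impI)
    fix \<epsilon> :: real assume \<epsilon>: "0 < \<epsilon>"
    obtain N where N: "inverse (real (Suc N)) < \<epsilon>" using reals_Archimedean[OF \<epsilon>] by auto
    obtain M where M: "\<forall>n\<ge>M. norm (fst (Y n) - \<eta>) < \<epsilon>" using LIMSEQ_D[OF \<eta> \<epsilon>] by auto
    define n where "n = max M N"
    have "inverse (real (Suc n)) \<le> inverse (real (Suc N))" by (auto simp: n_def intro!: le_imp_inverse_le)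
    then have n: "inverse (real (Suc n)) \<le> \<epsilon>" using N by linarith
    have "approx k (Y n) \<epsilon>" unfolding approx_def
    proof (intro conjI ballI)
      show "Y n \<in> test_pairs" using Y[of n] by (simp add: approx_def)
      fix V assume V: "V \<in> test_pairs"
      have "\<bar>rhs k V - B (Y n) V\<bar> \<le> inverse (real (Suc n)) * p V" using Y[of n] V unfolding approx_def by blast
      also have "\<dots> \<le> \<epsilon> * p V" using n p_nonneg[OF V] by (rule mult_right_mono)
      finally show "\<bar>rhs k V - B (Y n) V\<bar> \<le> \<epsilon> * p V" .
    qed
    moreover have "norm (\<eta> - fst (Y n)) \<le> \<epsilon>" using M by (simp add: n_def norm_minus_commute less_imp_le)
    ultimately show "\<exists>Y. approx k Y \<epsilon> \<and> norm (\<eta> - fst Y) \<le> \<epsilon>" by blast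
  qed
  then show ?thesis by blast
qed

lemma le_zero_if_small:
  fixes x k :: real
  assumes "\<And>\<epsilon>. \<epsilon> > 0 \<Longrightarrow> x \<le> k * \<epsilon>" "k > 0"
  shows "x \<le> 0"
proof (rule ccontr)
  assume "\<not> x \<le> 0"
  then show False using assms(1)[of "x / (2 * k)"] assms(2) by (simp add: field_simps)
qed

lemma resolves_unique:
  assumes "resolves k \<eta>" "resolves k \<eta>'"
  shows "\<eta> = \<eta>'"
proof -
  have "norm (\<eta> - \<eta>') \<le> 4 * \<epsilon>" if \<epsilon>: "\<epsilon> > 0" for \<epsilon>
  proof -
    obtain Y where Y: "approx k Y \<epsilon>" "norm (\<eta> - fst Y) \<le> \<epsilon>" using assms(1) \<epsilon> unfolding resolves_def by blast
    obtain Y' where Y': "approx k Y' \<epsilon>" "norm (\<eta>' - fst Y') \<le> \<epsilon>" using assms(2) \<epsilon> unfolding resolves_def by blast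
    have "\<eta> - \<eta>' = (\<eta> - fst Y) + (fst Y - fst Y') - (\<eta>' - fst Y')" by simp
    also have "norm \<dots> \<le> norm (\<eta> - fst Y) + norm (fst Y - fst Y') + norm (\<eta>' - fst Y')"
      by (rule order_trans[OF norm_triangle_ineq4 add_right_mono[OF norm_triangle_ineq]])
    also have "\<dots> \<le> \<epsilon> + (\<epsilon> + \<epsilon>) + \<epsilon>" using Y Y' approx_close(2)[OF Y(1) Y'(1)] \<epsilon> by (intro add_mono) auto
    finally show ?thesis by simp
  qed
  then have "norm (\<eta> - \<eta>') \<le> 0" by (rule le_zero_if_small) auto
  then show ?thesis by simp
qed

lemma B_cscale: 
  assumes "Y \<in> test_pairs" "V \<in> test_pairs"
  shows "B (cscale c Y) V = B Y (cscale (cnj c) V)"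
  unfolding B_def using hform_sesquilinear(3,4)[OF assms(1) assms(1) assms(2) assms(2)] by simp

lemma p_cscale:
  assumes V: "V \<in> test_pairs"
  shows "p (cscale c V) = cmod c * p V"
proof -
  have "hform (cscale c V) (cscale c V) = (c * cnj c) * hform V V"
    using hform_sesquilinear(3)[OF V V test_pairs_cscale[OF V] V, of c] hform_sesquilinear(4)[OF V V V V, of c] by simp
  also have "c * cnj c = of_real ((cmod c)\<^sup>2)" by (rule complex_norm_square[symmetric])
  finally have "B (cscale c V) (cscale c V) = (cmod c)\<^sup>2 * B V V" by (simp add: B_def)
  then show ?thesis by (simp add: p_def real_sqrt_mult)
qed

lemma rhs_cscale: "rhs (scaleC_l2 c k) V = rhs k (cscale (cnj c) V)"
  by (simp add: rhs_def cscale_def cinner_l2_scaleC_left cinner_l2_scaleC_right)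

lemma approx_cscale:
  assumes "approx k Y \<epsilon>"
  shows "approx (scaleC_l2 c k) (cscale c Y) (cmod c * \<epsilon>)"
  unfolding approx_def
proof (intro conjI ballI)
  have Y: "Y \<in> test_pairs" using assms by (simp add: approx_def)
  then show "cscale c Y \<in> test_pairs" by (rule test_pairs_cscale)
  fix V assume V: "V \<in> test_pairs"
  have "\<bar>rhs k (cscale (cnj c) V) - B Y (cscale (cnj c) V)\<bar> \<le> \<epsilon> * p (cscale (cnj c) V)"
    using assms test_pairs_cscale[OF V] unfolding approx_def by blast
  then show "\<bar>rhs (scaleC_l2 c k) V - B (cscale c Y) V\<bar> \<le> cmod c * \<epsilon> * p V"
    by (simp add: rhs_cscale B_cscale[OF Y V] p_cscale[OF V] mult.left_commute mult.commute)
qed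

lemma approx_add:
  assumes "approx k Y \<epsilon>" "approx k' Y' \<epsilon>'"
  shows "approx (k + k') (Y + Y') (\<epsilon> + \<epsilon>')"
  unfolding approx_def
proof (intro conjI ballI)
  have Y: "Y \<in> test_pairs" "Y' \<in> test_pairs" using assms by (simp_all add: approx_def)
  then show "Y + Y' \<in> test_pairs" by (rule test_pairs_add)
  fix V assume V: "V \<in> test_pairs"
  have "rhs (k + k') V - B (Y + Y') V = (rhs k V - B Y V) + (rhs k' V - B Y' V)"
    by (simp add: rhs_def cinner_l2_add_left distrib_left add_left[OF Y V])
  also have "\<bar>\<dots>\<bar> \<le> \<bar>rhs k V - B Y V\<bar> + \<bar>rhs k' V - B Y' V\<bar>" by (rule abs_triangle_ineq)
  also have "\<dots> \<le> \<epsilon> * p V + \<epsilon>' * p V" using assms V unfolding approx_def by (intro add_mono) auto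
  finally show "\<bar>rhs (k + k') V - B (Y + Y') V\<bar> \<le> (\<epsilon> + \<epsilon>') * p V" by (simp add: algebra_simps)
qed

lemma resolves_add:
  assumes "resolves k \<eta>" "resolves k' \<eta>'"
  shows "resolves (k + k') (\<eta> + \<eta>')"
  unfolding resolves_def
proof (intro allI impI)
  fix \<epsilon> :: real assume "\<epsilon> > 0"
  then have \<epsilon>: "\<epsilon> / 2 > 0" by simp
  obtain Y where Y: "approx k Y (\<epsilon> / 2)" "norm (\<eta> - fst Y) \<le> \<epsilon> / 2" using assms(1) \<epsilon> unfolding resolves_def by blast
  obtain Y' where Y': "approx k' Y' (\<epsilon> / 2)" "norm (\<eta>' - fst Y') \<le> \<epsilon> / 2" using assms(2) \<epsilon> unfolding resolves_def by blast
  have "norm (\<eta> + \<eta>' - fst (Y + Y')) \<le> \<epsilon>"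
    using norm_triangle_mono[OF Y(2) Y'(2)] by (simp add: add_diff_add)
  moreover have "approx (k + k') (Y + Y') \<epsilon>" using approx_add[OF Y(1) Y'(1)] by simp
  ultimately show "\<exists>Z. approx (k + k') Z \<epsilon> \<and> norm (\<eta> + \<eta>' - fst Z) \<le> \<epsilon>" by blast
qed

lemma resolves_scaleC:
  assumes "resolves k \<eta>"
  shows "resolves (scaleC_l2 c k) (scaleC_l2 c \<eta>)"
  unfolding resolves_def
proof (intro allI impI)
  fix \<epsilon> :: real assume "\<epsilon> > 0"
  define \<delta> where "\<delta> = \<epsilon> / (cmod c + 1)"
  have c: "cmod c + 1 > 0" using norm_ge_zero[of c] by linarith
  have \<delta>: "\<delta> > 0" using \<open>\<epsilon> > 0\<close> c by (simp add: \<delta>_def)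
  have "cmod c * \<delta> \<le> (cmod c + 1) * \<delta>" using \<delta> by (intro mult_right_mono) auto
  also have "\<dots> = \<epsilon>" using c by (simp add: \<delta>_def)
  finally have le: "cmod c * \<delta> \<le> \<epsilon>" .
  obtain Y where Y: "approx k Y \<delta>" "norm (\<eta> - fst Y) \<le> \<delta>" using assms(1) \<delta> unfolding resolves_def by blast
  have A: "approx (scaleC_l2 c k) (cscale c Y) (cmod c * \<delta>)" by (rule approx_cscale[OF Y(1)])
  have "approx (scaleC_l2 c k) (cscale c Y) \<epsilon>"
    unfolding approx_def
  proof (intro conjI ballI)
    show "cscale c Y \<in> test_pairs" using A by (simp add: approx_def)
    fix V assume V: "V \<in> test_pairs"
    have "\<bar>rhs (scaleC_l2 c k) V - B (cscale c Y) V\<bar> \<le> cmod c * \<delta> * p V" using A V by (simp add: approx_def)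
    also have "\<dots> \<le> \<epsilon> * p V" using le p_nonneg[OF V] by (rule mult_right_mono)
    finally show "\<bar>rhs (scaleC_l2 c k) V - B (cscale c Y) V\<bar> \<le> \<epsilon> * p V" .
  qed
  moreover have "norm (scaleC_l2 c \<eta> - fst (cscale c Y)) \<le> \<epsilon>"
  proof -
    have "norm (scaleC_l2 c \<eta> - fst (cscale c Y)) = cmod c * norm (\<eta> - fst Y)"
      by (simp add: cscale_def scaleC_l2_diff[symmetric] norm_scaleC_l2)
    also have "\<dots> \<le> cmod c * \<delta>" using Y by (intro mult_left_mono) auto
    finally show ?thesis using le by simp
  qed
  ultimately show "\<exists>Z. approx (scaleC_l2 c k) Z \<epsilon> \<and> norm (scaleC_l2 c \<eta> - fst Z) \<le> \<epsilon>" by blast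
qed

lemma resolves_norm:
  assumes "resolves k \<eta>"
  shows "norm \<eta> \<le> norm k"
proof -
  have "norm \<eta> - norm k \<le> 2 * \<epsilon>" if \<epsilon>: "\<epsilon> > 0" for \<epsilon>
  proof -
    obtain Y where Y: "approx k Y \<epsilon>" "norm (\<eta> - fst Y) \<le> \<epsilon>" using assms(1) \<epsilon> unfolding resolves_def by blast
    have "norm \<eta> \<le> norm (\<eta> - fst Y) + norm (fst Y)" using norm_triangle_ineq[of "\<eta> - fst Y" "fst Y"] by simp
    also have "\<dots> \<le> \<epsilon> + (norm k + \<epsilon>)"
      using Y approx_p_le[OF Y(1)] norm_fst_le[of Y] \<epsilon> by (intro add_mono) (auto simp: approx_def)
    finally show ?thesis by simp
  qed
  then have "norm \<eta> - norm k \<le> 0" by (rule le_zero_if_small) auto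
  then show ?thesis by simp
qed

end

section \<open>The minimal operator and the form\<close>

lemma AE_halfline_negligible:
  assumes "AE x in lebesgue_on {0..}. Q x"
  obtains N :: "real set" where "negligible N" "\<forall>x\<in>{0..} - N. Q x"
proof -
  have "AE x in lebesgue. x \<in> {0..} \<longrightarrow> Q x"
    using assms by (simp add: AE_restrict_space_iff)
  then obtain N where "N \<in> null_sets lebesgue" "{x. \<not> (x \<in> {0..} \<longrightarrow> Q x)} \<subseteq> N"
    by (auto simp: eventually_ae_filter)
  then show ?thesis using that[of N] by (auto simp: negligible_iff_null_sets)
qed

lemma continuous_zero_from_left:
  fixes u :: "real \<Rightarrow> complex"
  assumes c: "continuous_on {0..t} u" and l0: "0 \<le> l0" "l0 < t" and N: "negligible N"
    and z: "\<forall>x\<in>{l0<..<t} - N. u x = 0"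
  shows "u t = 0"
proof (rule ccontr)
  assume "u t \<noteq> 0"
  then have e: "0 < cmod (u t)" by simp
  have t: "t \<in> {0..t}" using l0 by auto
  obtain d where d: "d > 0" "\<And>x'. x' \<in> {0..t} \<Longrightarrow> dist x' t \<le> d \<Longrightarrow> dist (u x') (u t) < cmod (u t)"
    by (rule continuous_onE[OF c t e]) auto
  define l where "l = max l0 (t - d)"
  have l: "l < t" using d l0 by (auto simp: l_def)
  have "\<not> {l<..<t} \<subseteq> N"
  proof
    assume "{l<..<t} \<subseteq> N"
    then have "negligible {l<..<t}" by (rule negligible_subset[OF N])
    then show False using open_not_negligible[of "{l<..<t}"] l by auto
  qed
  then obtain x where x: "x \<in> {l<..<t}" "x \<notin> N" by blast
  then have "u x = 0" using z by (auto simp: l_def)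
  moreover have "dist (u x) (u t) < cmod (u t)"
    by (rule d(2)) (use x l0 in \<open>auto simp: l_def dist_real_def\<close>)
  ultimately show False by (simp add: dist_norm)
qed

text \<open>Integrate \<open>u v\<^sup>*\<close> by parts, where \<open>u\<close> is the quasi-derivative of \<open>y\<close>. The boundary terms vanish at \<open>0\<close>
  and beyond the support, where \<open>y = 0\<close> forces \<open>u = 0\<close> almost everywhere and, by continuity, everywhere. Substituting
  \<open>y' = u + s y\<close> gives the form; the terms containing \<open>s\<^sup>2\<close> cancel.\<close>

lemma minimal_operator_test_function:
  assumes s: "L2_loc s" and yL: "L2_on {0..} y" and wL: "L2_on {0..} w" and q: "quasi_differential_expression s y u w"
    and y0: "y 0 = 0" and u0: "u 0 = 0" and supp: "compact (closure {x \<in> {0..}. y x \<noteq> 0})"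
  obtains g where "test_function y g"
    "\<forall>v h. test_function v h \<longrightarrow> (\<integral>x. w x * cnj (v x) \<partial>lebesgue_on {0..}) = form s y g v h"
proof -
  have yAC: "AC_loc y" and uAC: "AC_loc u"
    and d1: "AE x in lebesgue_on {0..}. \<exists>y'. (y has_vector_derivative y') (at x) \<and> u x = y' - s x * y x"
    and d2: "AE x in lebesgue_on {0..}. \<exists>u'. (u has_vector_derivative u') (at x) \<and> w x = - u' - s x * u x - (s x)\<^sup>2 * y x"
    using q by (auto simp: quasi_differential_expression_def quasi_derivative_def)
  obtain N1 where N1: "negligible N1" "\<forall>x\<in>{0..} - N1. \<exists>y'. (y has_vector_derivative y') (at x) \<and> u x = y' - s x * y x"
    by (rule AE_halfline_negligible[OF d1]) blast
  obtain N2 where N2: "negligible N2" "\<forall>x\<in>{0..} - N2. \<exists>u'. (u has_vector_derivative u') (at x) \<and> w x = - u' - s x * u x - (s x)\<^sup>2 * y x"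
    by (rule AE_halfline_negligible[OF d2]) blast
  have "bounded (closure {x \<in> {0..}. y x \<noteq> 0})" using supp by (rule compact_imp_bounded)
  then obtain R0 where R0: "\<forall>x\<in>closure {x \<in> {0..}. y x \<noteq> 0}. norm x \<le> R0" by (auto simp: bounded_iff)
  define R where "R = max R0 0 + 1"
  have yz: "y x = 0" if x: "x > max R0 0" for x
  proof (rule ccontr)
    assume "y x \<noteq> 0"
    then have "x \<in> {x \<in> {0..}. y x \<noteq> 0}" using x by auto
    then have "x \<in> closure {x \<in> {0..}. y x \<noteq> 0}" by (rule subsetD[OF closure_subset])
    then have "norm x \<le> R0" using R0 by blast
    then show False using x by auto
  qed
  have R: "R \<ge> 0" "\<And>x. x \<ge> R \<Longrightarrow> y x = 0"
  proof -
    show "R \<ge> 0" by (simp add: R_def)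
    show "y x = 0" if x: "x \<ge> R" for x
    proof (rule yz)
      have "max R0 0 + 1 \<le> x" using x by (simp only: R_def)
      then show "max R0 0 < x" by linarith
    qed
  qed
  have sl: "L2_on {0..b} s" for b
    using s L2_on_continuous[of 0 b s] by (cases "b \<ge> 0") (auto simp: L2_loc_def)
  have AC0: "AC_on 0 b z" if "AC_loc z" for z b
  proof (cases "b \<ge> 0")
    case False
    then show ?thesis by (rule_tac AC_on_mono[of 0 0 z]) (use that in \<open>auto simp: AC_loc_def\<close>)
  qed (use that in \<open>auto simp: AC_loc_def\<close>)
  have cont: "continuous_on {0..b} z" if z: "AC_loc z" for z b
    unfolding continuous_on_iff
  proof (intro ballI allI impI)
    fix x e :: real assume x: "x \<in> {0..b}" and e: "e > 0"
    obtain d where d: "d > 0" "\<And>D. nonoverlapping 0 b D \<Longrightarrow> (\<Sum>(u, v)\<in>D. v - u) < d \<Longrightarrow> (\<Sum>(u, v)\<in>D. cmod (z v - z u)) < e"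
      using AC0[OF z, of b, unfolded AC_on_nonoverlapping, rule_format, OF e] by auto
    show "\<exists>d>0. \<forall>x'\<in>{0..b}. dist x' x < d \<longrightarrow> dist (z x') (z x) < e"
    proof (intro exI[of _ d] conjI d(1) ballI impI)
      fix x' assume x': "x' \<in> {0..b}" "dist x' x < d"
      show "dist (z x') (z x) < e"
      proof (cases "x \<le> x'")
        case True
        then show ?thesis
          using d(2)[of "{(x, x')}"] x x' by (simp add: nonoverlapping_def dist_norm)
      next
        case False
        then show ?thesis
          using d(2)[of "{(x', x)}"] x x' by (simp add: nonoverlapping_def dist_norm norm_minus_commute)
      qed
    qed
  qed
  (* The derivative of y off a null set, cut off so that it vanishes identically beyond R. *)
  define g where "g = (\<lambda>x. if x < R then u x + s x * y x else 0)"
  have gl: "L2_on {0..b} g" for b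
  proof (rule L2_on_bound)
    have 1: "L2_on {0..b} (\<lambda>x. u x + s x * y x)"
      by (intro L2_on_add L2_on_mult_continuous sl cont yAC L2_on_continuous uAC)
    then have [measurable]: "(\<lambda>x. u x + s x * y x) \<in> borel_measurable (lebesgue_on {0..b})" by (rule L2_on_measurable)
    show "g \<in> borel_measurable (lebesgue_on {0..b})" unfolding g_def by (intro measurable_If sets_lebesgue_on_less) auto
    show "integrable (lebesgue_on {0..b}) (\<lambda>x. (cmod (u x + s x * y x))\<^sup>2)" by (rule L2_on_integrable[OF 1])
  qed (simp add: g_def)
  have der: "(y has_vector_derivative g x) (at x)" if x: "x \<in> {0..b} - (N1 \<union> {R, 0})" for x b
  proof (cases "x < R")
    case True
    have "x \<in> {0..} - N1" using x by auto
    then obtain y' where "(y has_vector_derivative y') (at x)" "u x = y' - s x * y x" using N1(2) by blast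
    then show ?thesis using True by (simp add: g_def)
  next
    case False
    then have xR: "x > R" using x by auto
    have "(y has_vector_derivative 0) (at x)"
      by (rule has_vector_derivative_transform_within_open[of "\<lambda>_. 0" _ x "{R<..}"]) (use xR R in \<open>auto\<close>)
    then show ?thesis using xR by (simp add: g_def)
  qed
  have N3: "negligible (N1 \<union> {R, 0})" using N1(1) negligible_finite[of "{R, 0}"] by (intro negligible_Un) auto
  have prim: "primitive_on 0 b g y" for b
    by (rule primitive_onI_AC[OF AC0[OF yAC] N3 L2_on_interval_integrable[OF gl] der])
  have y: "test_function y g"
    unfolding test_function_def using y0 prim gl R by (auto simp: g_def intro!: exI[of _ R])
  have uR: "u R = 0"
  proof -
    have yc: "\<And>x. x \<in> {max R0 0<..<R} \<Longrightarrow> y x = 0" using yz by auto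
    have uz: "u x = 0" if x: "x \<in> {max R0 0<..<R} - N1" for x
    proof -
      have x': "x \<in> {0..} - N1" using x by auto
      obtain y' where y': "(y has_vector_derivative y') (at x)" "u x = y' - s x * y x" using bspec[OF N1(2) x'] by blast
      have "((\<lambda>x. 0) has_vector_derivative y') (at x)"
        by (rule has_vector_derivative_transform_within_open[of y _ x "{max R0 0<..<R}"]) (use y' x yc in auto)
      then have "y' = 0" by (rule vector_derivative_unique_at[OF _ has_vector_derivative_const])
      then show ?thesis using y' x yc by auto
    qed
    show ?thesis
      by (rule continuous_zero_from_left[OF cont[OF uAC], of "max R0 0", OF _ _ N1(1) ballI[OF uz]]) (auto simp: R_def)
  qed
  show ?thesis
  proof (rule that[OF y], intro allI impI)
    fix v h assume v: "test_function v h"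
    define u' where "u' = (\<lambda>x. - w x - s x * u x - (s x)\<^sup>2 * y x)"
    have wl: "L2_on {0..R} w" by (rule L2_on_subset[OF wL]) auto
    have ssy: "(\<lambda>x. (s x)\<^sup>2 * y x) absolutely_integrable_on {0..R}"
    proof -
      have "L2_on {0..R} (\<lambda>x. s x * y x)" by (intro L2_on_mult_continuous sl cont yAC)
      from integrable_imp_absolutely_integrable[OF L2_on_mult_integrable[OF sl this]]
      show ?thesis by (simp add: power2_eq_square mult.assoc)
    qed
    have u'i: "u' absolutely_integrable_on {0..R}"
    proof -
      have 1: "(\<lambda>x. (-1) * w x) absolutely_integrable_on {0..R}"
        by (intro L2_on_interval_integrable L2_on_cmult wl)
      have 2: "(\<lambda>x. s x * u x) absolutely_integrable_on {0..R}"
        by (intro L2_on_interval_integrable L2_on_mult_continuous sl cont uAC)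
      have "u' = (\<lambda>x. ((-1) * w x - s x * u x) - (s x)\<^sup>2 * y x)" by (simp add: u'_def)
      then show ?thesis by (simp only:) (intro set_integral_diff(1) 1 2 ssy)
    qed
    have pu: "primitive_on 0 R u' u"
    proof (rule primitive_onI_AC[OF AC0[OF uAC] N2(1) u'i])
      fix x assume "x \<in> {0..R} - N2"
      then have "x \<in> {0..} - N2" by auto
      then obtain u1 where "(u has_vector_derivative u1) (at x)" "w x = - u1 - s x * u x - (s x)\<^sup>2 * y x" using N2(2) by blast
      then show "(u has_vector_derivative u' x) (at x)" by (simp add: u'_def)
    qed
    have pv: "primitive_on 0 R (\<lambda>x. cnj (h x)) (\<lambda>x. cnj (v x))" by (rule primitive_on_cnj[OF test_functionD(2)[OF v]])
    have puv: "primitive_on 0 R (\<lambda>x. u' x * cnj (v x) + u x * cnj (h x)) (\<lambda>x. u x * cnj (v x))"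
      by (rule primitive_on_mult[OF pu pv])
    have zero: "integral {0..R} (\<lambda>x. u' x * cnj (v x) + u x * cnj (h x)) = 0"
      using primitive_on_diff[OF puv order_refl R(1) order_refl] uR u0 by (simp add: integral_unique)
    have vc: "continuous_on {0..R} (\<lambda>x. cnj (v x))" by (rule primitive_on_continuous[OF pv])
    have i1: "(\<lambda>x. u' x * cnj (v x)) absolutely_integrable_on {0..R}" by (rule absolutely_integrable_mult_continuous[OF u'i vc])
    have wz: "w x = 0" if "x > R" "x \<notin> N2 \<union> N1" for x
    proof -
      have yy: "y t = 0" if "t > R" for t using R that by auto
      have uu: "u t = 0" if "t \<in> {R<..} - N1" for t
      proof -
        have t: "t \<in> {0..} - N1" "t > R" using that R by auto
        obtain y' where y': "(y has_vector_derivative y') (at t)" "u t = y' - s t * y t" using N1(2) t by blast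
        have "((\<lambda>x. 0) has_vector_derivative y') (at t)"
          by (rule has_vector_derivative_transform_within_open[of y _ t "{R<..}"]) (use y' t yy in auto)
        then have "y' = 0" by (rule vector_derivative_unique_at[OF _ has_vector_derivative_const])
        then show ?thesis using y' t yy by auto
      qed
      have ut: "u t = 0" if t: "t > R" for t
        by (rule continuous_zero_from_left[OF cont[OF uAC] R(1) t N1(1) ballI[OF uu]]) auto
      have x0: "x \<in> {0..} - N2" using that R by auto
      obtain u1 where u1: "(u has_vector_derivative u1) (at x)" "w x = - u1 - s x * u x - (s x)\<^sup>2 * y x" using N2(2) x0 by blast
      have "((\<lambda>x. 0) has_vector_derivative u1) (at x)"
        by (rule has_vector_derivative_transform_within_open[of u _ x "{R<..}"]) (use u1 that ut in auto)
      then have "u1 = 0" by (rule vector_derivative_unique_at[OF _ has_vector_derivative_const])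
      then show ?thesis using u1 yy ut that by simp
    qed
    have "(\<integral>x. w x * cnj (v x) \<partial>lebesgue_on {0..}) = integral {0..} (\<lambda>x. w x * cnj (v x))"
      by (rule lebesgue_integral_eq_integral[OF integrable_L2_product[OF wL test_functionD(5)[OF v]]]) auto
    also have "\<dots> = integral {0..R} (\<lambda>x. w x * cnj (v x))"
    proof -
      have "integral {0..} (\<lambda>x. w x * cnj (v x)) = integral {0..} (\<lambda>x. if x \<in> {0..R} then w x * cnj (v x) else 0)"
        by (rule integral_spike[of "N1 \<union> N2"]) (use N1 N2 wz in \<open>auto intro: negligible_Un\<close>)
      also have "\<dots> = integral ({0..R} \<inter> {0..}) (\<lambda>x. w x * cnj (v x))" by (rule integral_restrict_Int)
      also have "{0..R} \<inter> {0..} = {0..R}" by auto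
      finally show ?thesis .
    qed
    also have "\<dots> = integral {0..R} (\<lambda>x. (g x * cnj (h x) - s x * (g x * cnj (v x) + y x * cnj (h x))) - (u' x * cnj (v x) + u x * cnj (h x)))"
    proof (rule integral_spike[of "{R}"])
      fix x assume x: "x \<in> {0..R} - {R}"
      then have "g x = u x + s x * y x" by (simp add: g_def)
      then show "(g x * cnj (h x) - s x * (g x * cnj (v x) + y x * cnj (h x))) - (u' x * cnj (v x) + u x * cnj (h x)) = w x * cnj (v x)"
        by (simp add: u'_def algebra_simps power2_eq_square)
    qed simp
    also have "\<dots> = integral {0..R} (\<lambda>x. g x * cnj (h x) - s x * (g x * cnj (v x) + y x * cnj (h x))) - 0"
    proof -
      have fi: "integrable (lebesgue_on {0..}) (\<lambda>x. g x * cnj (h x) - s x * (g x * cnj (v x) + y x * cnj (h x)))"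
        using form_integrable(1,4)[OF s y v] by (rule Bochner_Integration.integrable_diff)
      have "(\<lambda>x. g x * cnj (h x) - s x * (g x * cnj (v x) + y x * cnj (h x))) integrable_on {0..}"
        by (rule integrable_on_lebesgue_on[OF fi]) auto
      then have "(\<lambda>x. g x * cnj (h x) - s x * (g x * cnj (v x) + y x * cnj (h x))) integrable_on {0..R}"
        by (rule integrable_on_subinterval) auto
      moreover have "(\<lambda>x. u' x * cnj (v x) + u x * cnj (h x)) integrable_on {0..R}"
        using primitive_on_diff[OF puv order_refl R(1) order_refl] by blast
      ultimately show ?thesis unfolding zero[symmetric] by (rule Henstock_Kurzweil_Integration.integral_diff)
    qed
    also have "\<dots> = integral {0..} (\<lambda>x. g x * cnj (h x) - s x * (g x * cnj (v x) + y x * cnj (h x)))"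
    proof -
      have "integral {0..} (\<lambda>x. if x \<in> {0..R} then g x * cnj (h x) - s x * (g x * cnj (v x) + y x * cnj (h x)) else 0) =
        integral ({0..R} \<inter> {0..}) (\<lambda>x. g x * cnj (h x) - s x * (g x * cnj (v x) + y x * cnj (h x)))" by (rule integral_restrict_Int)
      also have "{0..R} \<inter> {0..} = {0..R}" by auto
      also have "integral {0..} (\<lambda>x. if x \<in> {0..R} then g x * cnj (h x) - s x * (g x * cnj (v x) + y x * cnj (h x)) else 0) =
        integral {0..} (\<lambda>x. g x * cnj (h x) - s x * (g x * cnj (v x) + y x * cnj (h x)))"
        by (rule integral_cong) (use R in \<open>auto simp: g_def\<close>)
      finally show ?thesis by simp
    qed
    also have "\<dots> = form s y g v h" unfolding form_def
      by (rule lebesgue_integral_eq_integral[symmetric, OF Bochner_Integration.integrable_diff[OF form_integrable(1,4)[OF s y v]]]) auto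
    finally show "(\<integral>x. w x * cnj (v x) \<partial>lebesgue_on {0..}) = form s y g v h" .
  qed
qed

lemma tendsto_cinner_left:
  assumes "X \<longlonglongrightarrow> \<eta>"
  shows "(\<lambda>n. cinner_l2 (X n) z) \<longlonglongrightarrow> cinner_l2 \<eta> z"
proof -
  have "(\<lambda>n. norm (X n - \<eta>) * norm z) \<longlonglongrightarrow> 0 * norm z"
    by (intro tendsto_mult tendsto_const tendsto_norm_zero) (use assms in \<open>simp add: LIM_zero\<close>)
  then have l: "(\<lambda>n. norm (X n - \<eta>) * norm z) \<longlonglongrightarrow> 0" by simp
  have "cmod (cinner_l2 (X n) z - cinner_l2 \<eta> z) \<le> norm (X n - \<eta>) * norm z" for n
  proof -
    have "cinner_l2 (X n) z = cinner_l2 (X n - \<eta>) z + cinner_l2 \<eta> z"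
      using cinner_l2_add_left[of "X n - \<eta>" \<eta> z] by simp
    then show ?thesis using cinner_l2_bound[of "X n - \<eta>" z] by simp
  qed
  then have "(\<lambda>n. cinner_l2 (X n) z - cinner_l2 \<eta> z) \<longlonglongrightarrow> 0"
    by (intro Lim_null_comparison[OF _ l]) simp
  then show ?thesis by (simp add: LIM_zero_iff)
qed

text \<open>For a fixed second argument the form is continuous in the norms of \<open>y\<close> and \<open>y'\<close>, although \<open>s\<close> is only locally square
  integrable: \<open>v\<close> has bounded support, and \<open>y\<close> is bounded by \<open>test_function_sup\<close>.\<close>

lemma form_bound_fixed_test:
  assumes s: "L2_loc s" and v: "test_function v h"
  obtains K where "\<And>y g. test_function y g \<Longrightarrow> cmod (form s y g v h) \<le> K * (norm (abs_l2 y) + norm (abs_l2 g))"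
proof -
  obtain R where R: "R \<ge> 0" "\<And>x. x \<ge> R \<Longrightarrow> v x = 0" "\<And>x. x \<ge> R \<Longrightarrow> h x = 0"
    using test_function_support[OF v] by metis
  have sR: "L2_on {0..b} s" for b
    using s L2_on_continuous[of 0 b s] by (cases "b \<ge> 0") (auto simp: L2_loc_def)
  have sv: "L2_on {0..} (\<lambda>x. cnj (s x) * v x)"
  proof (rule L2_on_halflineI[OF _ R(1)])
    show "L2_on {0..b} (\<lambda>x. cnj (s x) * v x)" for b
      by (intro L2_on_mult_continuous L2_on_cnj sR test_functionD(7)[OF v])
  qed (use R in auto)
  have sh: "integrable (lebesgue_on {0..}) (\<lambda>x. cmod (s x) * cmod (h x))"
  proof (rule halfline_integral(1)[OF R(1)])
    show "integrable (lebesgue_on {0..R}) (\<lambda>x. cmod (s x) * cmod (h x))"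
      using integrable_norm[OF L2_on_mult_integrable[OF sR test_functionD(3)[OF v]]] by (simp add: norm_mult)
  qed (use R in auto)
  define A where "A = (\<integral>x. cmod (s x) * cmod (h x) \<partial>lebesgue_on {0..})"
  have A: "0 \<le> A" by (simp add: A_def)
  define K where "K = norm (abs_l2 h) + norm (abs_l2 (\<lambda>x. cnj (s x) * v x)) + 2 * A"
  show ?thesis
  proof (rule that[of K])
    fix y g assume y: "test_function y g"
    note i = form_integrable[OF s y v]
    let ?n = "norm (abs_l2 y) + norm (abs_l2 g)"
    have "form s y g v h = (\<integral>x. g x * cnj (h x) \<partial>lebesgue_on {0..}) - (\<integral>x. s x * (g x * cnj (v x)) + s x * (y x * cnj (h x)) \<partial>lebesgue_on {0..})"
      unfolding form_def distrib_left by (rule Bochner_Integration.integral_diff[OF i(1) Bochner_Integration.integrable_add[OF i(2,3)]])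
    also have "(\<integral>x. s x * (g x * cnj (v x)) + s x * (y x * cnj (h x)) \<partial>lebesgue_on {0..}) =
        (\<integral>x. s x * (g x * cnj (v x)) \<partial>lebesgue_on {0..}) + (\<integral>x. s x * (y x * cnj (h x)) \<partial>lebesgue_on {0..})"
      by (rule Bochner_Integration.integral_add[OF i(2,3)])
    also have "(\<integral>x. g x * cnj (h x) \<partial>lebesgue_on {0..}) = cinner_l2 (abs_l2 g) (abs_l2 h)"
      by (rule cinner_abs_l2[OF test_functionD(6)[OF y] test_functionD(6)[OF v], symmetric])
    also have "(\<integral>x. s x * (g x * cnj (v x)) \<partial>lebesgue_on {0..}) = cinner_l2 (abs_l2 g) (abs_l2 (\<lambda>x. cnj (s x) * v x))"
      unfolding cinner_abs_l2[OF test_functionD(6)[OF y] sv] by (simp add: mult.left_commute mult.commute)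
    finally have eq: "form s y g v h = cinner_l2 (abs_l2 g) (abs_l2 h) - (cinner_l2 (abs_l2 g) (abs_l2 (\<lambda>x. cnj (s x) * v x)) +
        (\<integral>x. s x * (y x * cnj (h x)) \<partial>lebesgue_on {0..}))" .
    have yb: "cmod (y x) \<le> 2 * ?n" if "x \<ge> 0" for x
    proof -
      have "(cmod (y x))\<^sup>2 \<le> 2 * (norm (abs_l2 y))\<^sup>2 + 2 * (norm (abs_l2 g))\<^sup>2"
        using test_function_sup[OF y that, of 1] by simp
      also have "\<dots> \<le> (2 * ?n)\<^sup>2"
        using norm_ge_zero[of "abs_l2 y"] norm_ge_zero[of "abs_l2 g"]
        by (simp add: power2_eq_square algebra_simps)
      finally show ?thesis by (rule power2_le_imp_le) simp
    qed
    have "cmod (\<integral>x. s x * (y x * cnj (h x)) \<partial>lebesgue_on {0..}) \<le> (\<integral>x. cmod (s x * (y x * cnj (h x))) \<partial>lebesgue_on {0..})"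
      by (rule integral_norm_bound)
    also have "\<dots> \<le> (\<integral>x. 2 * ?n * (cmod (s x) * cmod (h x)) \<partial>lebesgue_on {0..})"
    proof (rule integral_mono)
      show "integrable (lebesgue_on {0..}) (\<lambda>x. cmod (s x * (y x * cnj (h x))))" by (rule integrable_norm[OF i(3)])
      show "integrable (lebesgue_on {0..}) (\<lambda>x. 2 * ?n * (cmod (s x) * cmod (h x)))" by (rule integrable_mult_right[OF sh])
      fix x :: real assume "x \<in> space (lebesgue_on {0..})"
      then have "x \<ge> 0" by (simp add: space_restrict_space)
      then have "cmod (y x) * (cmod (s x) * cmod (h x)) \<le> 2 * ?n * (cmod (s x) * cmod (h x))"
        by (intro mult_right_mono yb) auto
      then show "cmod (s x * (y x * cnj (h x))) \<le> 2 * ?n * (cmod (s x) * cmod (h x))"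
        by (simp add: norm_mult mult.left_commute)
    qed
    also have "\<dots> = 2 * ?n * A" by (simp add: A_def)
    finally have 3: "cmod (\<integral>x. s x * (y x * cnj (h x)) \<partial>lebesgue_on {0..}) \<le> 2 * ?n * A" .
    have "cmod (form s y g v h) \<le> cmod (cinner_l2 (abs_l2 g) (abs_l2 h)) + (cmod (cinner_l2 (abs_l2 g) (abs_l2 (\<lambda>x. cnj (s x) * v x))) +
        cmod (\<integral>x. s x * (y x * cnj (h x)) \<partial>lebesgue_on {0..}))"
      unfolding eq by (rule order_trans[OF norm_triangle_ineq4 add_left_mono[OF norm_triangle_ineq]])
    also have "\<dots> \<le> norm (abs_l2 g) * norm (abs_l2 h) + (norm (abs_l2 g) * norm (abs_l2 (\<lambda>x. cnj (s x) * v x)) + 2 * ?n * A)"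
      by (intro add_mono cinner_l2_bound 3)
    also have "\<dots> \<le> ?n * norm (abs_l2 h) + (?n * norm (abs_l2 (\<lambda>x. cnj (s x) * v x)) + 2 * ?n * A)"
      by (intro add_mono mult_right_mono) (use A in auto)
    also have "\<dots> = K * ?n" by (simp add: K_def algebra_simps)
    finally show "cmod (form s y g v h) \<le> K * ?n" .
  qed
qed

section \<open>The extension with resolvent \<open>R\<close>\<close>

context sectorial_form
begin

text \<open>Closability of the form. If approximate solutions tend to \<open>0\<close> in \<open>L\<^sub>2\<close>, they tend to \<open>0\<close> pointwise by the Sobolev
  inequality, so the \<open>L\<^sub>2\<close> limit of their derivatives has vanishing integrals and is \<open>0\<close>. Then
  the form against each fixed test function tends to \<open>0\<close>, so \<open>k\<close> is orthogonal to the dense set of test functions.\<close>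

lemma resolves_injective:
  assumes "resolves k 0"
  shows "k = 0"
proof -
  define \<delta> where "\<delta> = (\<lambda>n::nat. inverse (real (Suc n)))"
  have \<delta>: "\<delta> n > 0" for n by (simp add: \<delta>_def)
  have \<delta>0: "\<delta> \<longlonglongrightarrow> 0" unfolding \<delta>_def by (rule LIMSEQ_inverse_real_of_nat)
  have "\<exists>Y. approx k Y (\<delta> n) \<and> norm (0 - fst Y) \<le> \<delta> n" for n
    using assms \<delta> unfolding resolves_def by blast
  then obtain Y where Y: "\<And>n. approx k (Y n) (\<delta> n)" "\<And>n. norm (0 - fst (Y n)) \<le> \<delta> n" by metis
  have Yt: "Y n \<in> test_pairs" for n using Y(1)[of n] by (simp add: approx_def)
  have "\<exists>y g. test_function y g \<and> Y n = (abs_l2 y, abs_l2 g)" for n using Yt[of n] by (auto simp: test_pairs_def)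
  then obtain y g where yg: "\<And>n. test_function (y n) (g n)" "\<And>n. Y n = (abs_l2 (y n), abs_l2 (g n))" by metis
  have fst0: "(\<lambda>n. fst (Y n)) \<longlonglongrightarrow> 0"
    by (rule Lim_null_comparison[OF _ \<delta>0]) (use Y(2) in simp)
  define K where "K = sqrt (2 * T / \<kappa>)"
  have K: "K > 0" using T \<kappa> by (simp add: K_def)
  have close: "norm (snd (Y m) - snd (Y n)) \<le> K * (\<delta> m + \<delta> n)" for m n
  proof -
    have d: "Y m - Y n \<in> test_pairs" by (rule D_diff[OF Yt Yt])
    have "(norm (snd (Y m - Y n)))\<^sup>2 \<le> 2 * T / \<kappa> * (p (Y m - Y n))\<^sup>2"
      unfolding p_square[OF d] by (rule B_bounds(2)[OF d])
    also have "\<dots> \<le> 2 * T / \<kappa> * (\<delta> m + \<delta> n)\<^sup>2"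
      using approx_close(1)[OF Y(1)[of m] Y(1)[of n]] \<delta>[of m] \<delta>[of n] p_nonneg[OF d] T \<kappa>
      by (intro mult_left_mono power_mono) auto
    also have "\<dots> = (K * (\<delta> m + \<delta> n))\<^sup>2" using T \<kappa> by (simp add: K_def power_mult_distrib)
    finally have "norm (snd (Y m - Y n)) \<le> K * (\<delta> m + \<delta> n)"
      by (rule power2_le_imp_le) (use K \<delta>[of m] \<delta>[of n] in simp)
    then show ?thesis by simp
  qed
  have "Cauchy (\<lambda>n. snd (Y n))"
  proof (rule CauchyI)
    fix \<epsilon> :: real assume "0 < \<epsilon>"
    then have "\<epsilon> / (2 * K) > 0" using K by simp
    then have "\<forall>\<^sub>F n in sequentially. \<delta> n < \<epsilon> / (2 * K)" using \<delta>0 by (intro order_tendstoD) auto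
    then obtain N where N: "\<forall>n\<ge>N. \<delta> n < \<epsilon> / (2 * K)" by (auto simp: eventually_sequentially)
    show "\<exists>M. \<forall>m\<ge>M. \<forall>n\<ge>M. norm (snd (Y m) - snd (Y n)) < \<epsilon>"
    proof (intro exI[of _ N] allI impI)
      fix m n assume "m \<ge> N" "n \<ge> N"
      then have "\<delta> m + \<delta> n < \<epsilon> / K" using N[rule_format, of m] N[rule_format, of n] by (simp add: field_simps)
      then have "K * (\<delta> m + \<delta> n) < K * (\<epsilon> / K)" using K by (intro mult_strict_left_mono) auto
      then show "norm (snd (Y m) - snd (Y n)) < \<epsilon>" using close[of m n] K by simp
    qed
  qed
  then obtain \<gamma>' where lim: "(\<lambda>n. snd (Y n)) \<longlonglongrightarrow> \<gamma>'" using Cauchy_convergent_iff convergent_def by blast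
  then have "Bseq (\<lambda>n. snd (Y n))" by (intro convergent_imp_Bseq) (auto simp: convergent_def)
  then obtain M where M: "M > 0" "\<And>n. norm (snd (Y n)) \<le> M" by (auto simp: Bseq_def)
  have pt: "(\<lambda>n. y n x) \<longlonglongrightarrow> 0" if x: "x \<ge> 0" for x
  proof -
    have "(\<lambda>n. (cmod (y n x))\<^sup>2) \<longlonglongrightarrow> 0"
    proof (rule LIMSEQ_I)
      fix r :: real assume r: "0 < r"
      define h where "h = r / (4 * M\<^sup>2)"
      have h: "h > 0" using r M by (simp add: h_def)
      have "(\<lambda>n. 2 / h * (\<delta> n)\<^sup>2) \<longlonglongrightarrow> 2 / h * 0\<^sup>2" by (intro tendsto_intros \<delta>0)
      then have "\<forall>\<^sub>F n in sequentially. 2 / h * (\<delta> n)\<^sup>2 < r / 2" using r by (intro order_tendstoD) auto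
      then obtain N where N: "\<forall>n\<ge>N. 2 / h * (\<delta> n)\<^sup>2 < r / 2" by (auto simp: eventually_sequentially)
      show "\<exists>no. \<forall>n\<ge>no. norm ((cmod (y n x))\<^sup>2 - 0) < r"
      proof (intro exI[of _ N] allI impI)
        fix n assume n: "n \<ge> N"
        have "(cmod (y n x))\<^sup>2 \<le> 2 / h * (norm (abs_l2 (y n)))\<^sup>2 + 2 * h * (norm (abs_l2 (g n)))\<^sup>2"
          by (rule test_function_sup[OF yg(1) x h])
        also have "\<dots> \<le> 2 / h * (\<delta> n)\<^sup>2 + 2 * h * M\<^sup>2"
          using Y(2)[of n] M(2)[of n] yg(2)[of n] h by (intro add_mono mult_left_mono power_mono) auto
        also have "2 * h * M\<^sup>2 = r / 2" using M by (simp add: h_def)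
        finally show "norm ((cmod (y n x))\<^sup>2 - 0) < r" using N n by fastforce
      qed
    qed
    from tendsto_real_sqrt[OF this] show ?thesis by (simp add: tendsto_norm_zero_iff)
  qed
  have "cinner_l2 \<gamma>' (step_class x) = 0" if x: "0 \<le> x" for x
  proof -
    have "cinner_l2 (snd (Y n)) (step_class x) = y n x" for n
    proof -
      have "cinner_l2 (snd (Y n)) (step_class x) = integral {0..x} (g n)"
        unfolding yg(2) snd_conv by (rule cinner_step_class[OF test_functionD(6)[OF yg(1)] x])
      also have "\<dots> = y n x - y n 0"
        using primitive_on_diff[OF test_functionD(2)[OF yg(1)[of n], of x] order_refl x order_refl] by (rule integral_unique)
      finally show ?thesis using test_functionD(1)[OF yg(1)] by simp
    qed
    then have "(\<lambda>n. cinner_l2 (snd (Y n)) (step_class x)) \<longlonglongrightarrow> 0" using pt[OF x] by simp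
    moreover have "(\<lambda>n. cinner_l2 (snd (Y n)) (step_class x)) \<longlonglongrightarrow> cinner_l2 \<gamma>' (step_class x)" by (rule tendsto_cinner_left[OF lim])
    ultimately show ?thesis by (rule LIMSEQ_unique[symmetric])
  qed
  then have "\<gamma>' = 0" by (rule l2_eq_zero_if_orthogonal_steps)
  then have snd0: "(\<lambda>n. snd (Y n)) \<longlonglongrightarrow> 0" using lim by simp
  have rhs0: "rhs k V = 0" if V: "V \<in> test_pairs" for V
  proof -
    obtain v h where v: "test_function v h" "V = (abs_l2 v, abs_l2 h)" using V by (metis test_pairsE)
    obtain KV where KV: "\<And>y g. test_function y g \<Longrightarrow> cmod (form s y g v h) \<le> KV * (norm (abs_l2 y) + norm (abs_l2 g))"
      by (rule form_bound_fixed_test[OF s v(1)]) blast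
    have "(\<lambda>n. KV * (norm (fst (Y n)) + norm (snd (Y n)))) \<longlonglongrightarrow> KV * (0 + 0)"
      by (intro tendsto_intros tendsto_norm_zero fst0 snd0)
    then have "(\<lambda>n. KV * (norm (fst (Y n)) + norm (snd (Y n)))) \<longlonglongrightarrow> 0" by simp
    moreover have "cmod (pair_form s (Y n) V) \<le> KV * (norm (fst (Y n)) + norm (snd (Y n)))" for n
      using KV[OF yg(1)[of n]] unfolding v(2) yg(2) pair_form_test[OF s yg(1) v(1)] by simp
    then have "\<forall>\<^sub>F n in sequentially. cmod (pair_form s (Y n) V) \<le> KV * (norm (fst (Y n)) + norm (snd (Y n)))" by simp
    ultimately have pf: "(\<lambda>n. pair_form s (Y n) V) \<longlonglongrightarrow> 0" by (rule Lim_null_comparison[rotated])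
    have "(\<lambda>n. Re (e * pair_form s (Y n) V + of_real C1 * cinner_l2 (fst (Y n)) (fst V))) \<longlonglongrightarrow>
        Re (e * 0 + of_real C1 * cinner_l2 0 (fst V))"
      by (intro tendsto_intros pf tendsto_cinner_left[OF fst0])
    moreover have "cinner_l2 0 (fst V) = 0" using cinner_l2_scaleC_left[of 0 0 "fst V"] by (simp add: scaleC_l2_zero)
    ultimately have Blim: "(\<lambda>n. B (Y n) V) \<longlonglongrightarrow> 0" by (simp add: B_def hform_def)
    have "(\<lambda>n. \<delta> n * p V) \<longlonglongrightarrow> 0 * p V" by (intro tendsto_intros \<delta>0)
    then have "(\<lambda>n. \<delta> n * p V) \<longlonglongrightarrow> 0" by simp
    moreover have "\<bar>rhs k V - B (Y n) V\<bar> \<le> \<delta> n * p V" for n using Y(1)[of n] V unfolding approx_def by blast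
    then have "\<forall>\<^sub>F n in sequentially. norm (rhs k V - B (Y n) V) \<le> \<delta> n * p V" by simp
    ultimately have "(\<lambda>n. rhs k V - B (Y n) V) \<longlonglongrightarrow> 0" by (rule Lim_null_comparison[rotated])
    from tendsto_add[OF this Blim] have "(\<lambda>n::nat. rhs k V) \<longlonglongrightarrow> 0" by simp
    then show ?thesis by (simp add: LIMSEQ_const_iff)
  qed
  show "k = 0"
  proof (rule test_functions_dense)
    fix V assume V: "V \<in> test_pairs"
    define z where "z = e * cinner_l2 k (fst V)"
    have "rhs k (cscale z V) = 0" by (rule rhs0[OF test_pairs_cscale[OF V]])
    then have "Re (z * cnj z) = 0" by (simp add: rhs_def cscale_def cinner_l2_scaleC_right z_def mult.left_commute mult.commute)
    then have "z = 0" by (simp add: complex_eq_iff sum_squares_eq_zero_iff flip: power2_eq_square)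
    moreover have "e \<noteq> 0" using norm_e by auto
    ultimately show "cinner_l2 k (fst V) = 0" by (simp add: z_def)
  qed
qed

text \<open>The resolvent at \<open>z0\<close> of the operator constructed below.\<close>

definition R where "R k = (THE \<eta>. resolves k \<eta>)"

lemma R: "resolves k (R k)"
  unfolding R_def using resolves_exists[of k] resolves_unique by (metis (mono_tags, lifting) theI)

lemma R_eqI: "resolves k \<eta> \<Longrightarrow> R k = \<eta>"
  using R resolves_unique by blast

lemma R_add: "R (k + k') = R k + R k'"
  by (rule R_eqI[OF resolves_add[OF R R]])

lemma R_scaleC: "R (scaleC_l2 c k) = scaleC_l2 c (R k)"
  by (rule R_eqI[OF resolves_scaleC[OF R]])

lemma R_linear: "bounded_linear R"
proof (rule bounded_linear_intro[of _ 1])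
  show "R (x + y) = R x + R y" for x y by (rule R_add)
  show "R (r *\<^sub>R x) = r *\<^sub>R R x" for r x using R_scaleC[of "of_real r" x] by (simp add: scaleC_l2_of_real)
  show "norm (R x) \<le> norm x * 1" for x using resolves_norm[OF R[of x]] by simp
qed

lemma R_inj: "R k = R k' \<Longrightarrow> k = k'"
proof -
  assume "R k = R k'"
  then have "R (k - k') = 0" using R_linear by (simp add: bounded_linear.linear linear_diff)
  then have "resolves (k - k') 0" using R[of "k - k'"] by simp
  then have "k - k' = 0" by (rule resolves_injective)
  then show ?thesis by simp
qed

definition z0 :: complex where "z0 = - of_real C1 * cnj e"

text \<open>The operator \<open>z0 + R\<^sup>-\<^sup>1\<close>, given by its graph. The value of \<open>z0\<close> comes from dividing the equation for the
  rotated form by \<open>e\<close>.\<close>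

definition extension :: "(l2 \<times> l2) set" where
  "extension = {(R v, v + scaleC_l2 z0 (R v)) | v. True}"

lemma extension_linear: "linear_operator extension"
  unfolding linear_operator_def
proof (intro conjI)
  show "single_valued extension" unfolding extension_def single_valued_def using R_inj by blast
  have "R 0 = 0" using R_linear by (simp add: bounded_linear.linear linear_0)
  then have "(0, 0) = (R 0, 0 + scaleC_l2 z0 (R 0))" using scaleC_l2_diff[of z0 0 0] by simp
  then show "(0, 0) \<in> extension" unfolding extension_def by blast
  show "\<forall>(x, u)\<in>extension. \<forall>(y, v)\<in>extension. (x + y, u + v) \<in> extension"
  proof (clarsimp simp: extension_def)
    fix v v'
    have "R v + R v' = R (v + v') \<and> v + scaleC_l2 z0 (R v) + (v' + scaleC_l2 z0 (R v')) = v + v' + scaleC_l2 z0 (R (v + v'))"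
      by (simp add: R_add scaleC_l2_add)
    then show "\<exists>va. R v + R v' = R va \<and> v + scaleC_l2 z0 (R v) + (v' + scaleC_l2 z0 (R v')) = va + scaleC_l2 z0 (R va)" by blast
  qed
  show "\<forall>c. \<forall>(x, u)\<in>extension. (scaleC_l2 c x, scaleC_l2 c u) \<in> extension"
  proof (clarsimp simp: extension_def)
    fix c v
    have "scaleC_l2 c (R v) = R (scaleC_l2 c v) \<and> scaleC_l2 c (v + scaleC_l2 z0 (R v)) = scaleC_l2 c v + scaleC_l2 z0 (R (scaleC_l2 c v))"
      by (simp add: R_scaleC scaleC_l2_add scaleC_l2_scaleC mult.commute)
    then show "\<exists>va. scaleC_l2 c (R v) = R va \<and> scaleC_l2 c (v + scaleC_l2 z0 (R v)) = va + scaleC_l2 z0 (R va)" by blast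
  qed
qed

lemma extension_resolvent: "is_resolvent extension z0 R"
  unfolding is_resolvent_def
proof (intro conjI R_linear)
  have "shift_operator extension z0 = {(R v, v) | v. True}"
    unfolding shift_operator_def extension_def by force
  then show "(shift_operator extension z0)\<inverse> = {(v, R v) | v. True}" by auto
qed

text \<open>For \<open>y\<close> in the minimal domain the identity of \<open>minimal_operator_test_function\<close> says that \<open>y\<close> solves the equation
  for \<open>k = L\<^sub>0 y - z0 y\<close> with residual zero.\<close>

lemma minimal_operator_subset_extension: "minimal_operator s \<subseteq> extension"
proof
  fix P assume "P \<in> minimal_operator s"
  then obtain y u w where P: "P = (abs_l2 y, abs_l2 w)" and H: "L2_on {0..} y" "L2_on {0..} w"
    "quasi_differential_expression s y u w" "y 0 = 0" "u 0 = 0" "compact (closure {x \<in> {0..}. y x \<noteq> 0})"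
    unfolding minimal_operator_def by blast
  obtain h where h: "test_function y h"
    and eq: "\<forall>v k. test_function v k \<longrightarrow> (\<integral>x. w x * cnj (v x) \<partial>lebesgue_on {0..}) = form s y h v k"
    by (rule minimal_operator_test_function[OF s H]) blast
  define k where "k = abs_l2 w - scaleC_l2 z0 (abs_l2 y)"
  define Y where "Y = (abs_l2 y, abs_l2 h)"
  have Y: "Y \<in> test_pairs" using h by (auto simp: Y_def test_pairs_def)
  have ez: "e * z0 = - of_real C1"
  proof -
    have "e * cnj e = 1" using complex_norm_square[of e] by (simp add: norm_e)
    then show ?thesis by (simp add: z0_def mult.left_commute)
  qed
  have res: "rhs k V = B Y V" if V: "V \<in> test_pairs" for V
  proof -
    obtain v q where v: "test_function v q" "V = (abs_l2 v, abs_l2 q)" using V by (metis test_pairsE)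
    have "cinner_l2 (abs_l2 w) (abs_l2 v) = form s y h v q"
      using eq v(1) cinner_abs_l2[OF H(2) test_functionD(5)[OF v(1)]] by simp
    moreover have "cinner_l2 k (abs_l2 v) = cinner_l2 (abs_l2 w) (abs_l2 v) - z0 * cinner_l2 (abs_l2 y) (abs_l2 v)"
      unfolding k_def minus_l2_def by (simp add: cinner_l2_add_left cinner_l2_scaleC_left)
    ultimately have kV: "cinner_l2 k (fst V) = form s y h v q - z0 * cinner_l2 (abs_l2 y) (abs_l2 v)"
      by (simp add: v(2))
    have "e * cinner_l2 k (fst V) = e * form s y h v q - (e * z0) * cinner_l2 (abs_l2 y) (abs_l2 v)"
      unfolding kV by (simp only: right_diff_distrib mult.assoc)
    also have "\<dots> = hform Y V" unfolding ez by (simp add: hform_def Y_def v(2) pair_form_test[OF s h v(1)])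
    finally show ?thesis by (simp add: rhs_def B_def)
  qed
  have "resolves k (abs_l2 y)" unfolding resolves_def
  proof (intro allI impI)
    fix \<epsilon> :: real assume "\<epsilon> > 0"
    then have "approx k Y \<epsilon>" unfolding approx_def using Y res p_nonneg by auto
    moreover have "norm (abs_l2 y - fst Y) \<le> \<epsilon>" using \<open>\<epsilon> > 0\<close> by (simp add: Y_def)
    ultimately show "\<exists>Y. approx k Y \<epsilon> \<and> norm (abs_l2 y - fst Y) \<le> \<epsilon>" by blast
  qed
  then have "R k = abs_l2 y" by (rule R_eqI)
  then have "P = (R k, k + scaleC_l2 z0 (R k))" by (simp add: P k_def)
  then show "P \<in> extension" unfolding extension_def by blast
qed

text \<open>The resolvent identity writes any resolvent as \<open>R\<close> applied to a bounded set, and \<open>R\<close> maps bounded sets into limits of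
  test functions of bounded form norm.\<close>

lemma extension_compact_resolvent:
  assumes comp: "\<And>r. compact (closure (fst ` {Y \<in> test_pairs. p Y \<le> r}))"
  shows "has_compact_resolvent extension"
  unfolding has_compact_resolvent_def
proof (intro conjI ballI allI impI)
  show "resolvent_set extension \<noteq> {}" unfolding resolvent_set_def using extension_resolvent by blast
  fix z R' assume R': "is_resolvent extension z R'"
  have bl: "bounded_linear R'" using R' by (simp add: is_resolvent_def)
  have rel: "R' v = R (v + scaleC_l2 (z - z0) (R' v))" for v
  proof -
    have "(v, R' v) \<in> (shift_operator extension z)\<inverse>" using R' unfolding is_resolvent_def by blast
    then obtain w where w: "(R' v, w) \<in> extension" "v = w - scaleC_l2 z (R' v)" unfolding shift_operator_def by auto
    obtain u where u: "R' v = R u" "w = u + scaleC_l2 z0 (R u)" using w(1) unfolding extension_def by auto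
    have "scaleC_l2 (z - z0) (R' v) = scaleC_l2 z (R' v) - scaleC_l2 z0 (R' v)"
      using scaleC_l2_add_left[of "z - z0" z0 "R' v"] by simp
    then have "v + scaleC_l2 (z - z0) (R' v) = u" using w(2) u by simp
    then show ?thesis using u by simp
  qed
  show "compact_map R'" unfolding compact_map_def
  proof (intro allI impI)
    fix A :: "l2 set" assume "bounded A"
    then obtain c where c: "c > 0" "\<And>v. v \<in> A \<Longrightarrow> norm v \<le> c" unfolding bounded_pos by auto
    obtain K where K: "\<And>v. norm (R' v) \<le> norm v * K" "K > 0"
      using bounded_linear.pos_bounded[OF bl] by blast
    define r where "r = c + cmod (z - z0) * (c * K) + 1"
    have sub: "R' ` A \<subseteq> closure (fst ` {Y \<in> test_pairs. p Y \<le> r})"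
    proof
      fix x assume "x \<in> R' ` A"
      then obtain v where v: "v \<in> A" "x = R' v" by blast
      define u where "u = v + scaleC_l2 (z - z0) (R' v)"
      have "norm u \<le> norm v + cmod (z - z0) * norm (R' v)"
        unfolding u_def using norm_triangle_ineq[of v "scaleC_l2 (z - z0) (R' v)"] by (simp add: norm_scaleC_l2)
      also have "\<dots> \<le> c + cmod (z - z0) * (c * K)"
      proof (intro add_mono mult_left_mono c(2) v)
        have "norm (R' v) \<le> norm v * K" by (rule K)
        also have "\<dots> \<le> c * K" using c(2)[OF v(1)] K by (intro mult_right_mono) auto
        finally show "norm (R' v) \<le> c * K" .
      qed auto
      finally have u: "norm u + 1 \<le> r" by (simp add: r_def)
      have x: "resolves u x" using R[of u] rel[of v] by (simp add: u_def v)
      show "x \<in> closure (fst ` {Y \<in> test_pairs. p Y \<le> r})"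
        unfolding closure_approachable
      proof (intro allI impI)
        fix \<epsilon> :: real assume "\<epsilon> > 0"
        define \<delta> where "\<delta> = min (\<epsilon> / 2) 1"
        have \<delta>: "\<delta> > 0" "\<delta> < \<epsilon>" "\<delta> \<le> 1" using \<open>\<epsilon> > 0\<close> by (auto simp: \<delta>_def)
        obtain Y where Y: "approx u Y \<delta>" "norm (x - fst Y) \<le> \<delta>" using x \<delta>(1) unfolding resolves_def by blast
        have "p Y \<le> norm u + \<delta>" by (rule approx_p_le[OF Y(1)]) (use \<delta> in simp)
        then have "p Y \<le> r" using u \<delta> by simp
        moreover have "Y \<in> test_pairs" using Y(1) by (simp add: approx_def)
        moreover have "dist (fst Y) x < \<epsilon>" using Y(2) \<delta> by (simp add: dist_norm norm_minus_commute)
        ultimately show "\<exists>y\<in>fst ` {Y \<in> test_pairs. p Y \<le> r}. dist y x < \<epsilon>" by blast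
      qed
    qed
    then have "closure (R' ` A) \<subseteq> closure (fst ` {Y \<in> test_pairs. p Y \<le> r})" by (rule closure_minimal) simp
    then show "compact (closure (R' ` A))" using comp[of r] by (metis closed_closure compact_Int_closed inf.absorb_iff2)
  qed
qed

end

section \<open>Strict sectoriality\<close>

context sectorial_form
begin

text \<open>With \<open>q = (L\<^sub>0 y, y)\<close> and \<open>\<parallel>y\<parallel> = 1\<close>, the number \<open>e q + C / T = X + i Y\<close> satisfies \<open>|Y| \<le> T X\<close>. Undoing the
  rotation, \<open>q\<close> lies in the sector with bisector \<open>\<gamma>\<close>, half-angle \<open>arctan T < pi / 2\<close> and vertex
  \<open>- C / T\<close> times the conjugate of \<open>e\<close>.\<close>

lemma minimal_operator_strictly_sectorial: "strictly_sectorial (minimal_operator s)"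
  unfolding strictly_sectorial_def
proof (intro exI conjI ballI)
  let ?z = "- of_real (C / T) * cnj e"
  show "0 \<le> (\<gamma> + arctan T) - (\<gamma> - arctan T)" using T by (simp add: zero_le_arctan_iff)
  show "(\<gamma> + arctan T) - (\<gamma> - arctan T) < pi" using arctan_ubound[of T] by simp
  fix P assume "P \<in> minimal_operator s"
  then obtain y u w where P: "P = (abs_l2 y, abs_l2 w)" and H: "L2_on {0..} y" "L2_on {0..} w"
    "quasi_differential_expression s y u w" "y 0 = 0" "u 0 = 0" "compact (closure {x \<in> {0..}. y x \<noteq> 0})"
    unfolding minimal_operator_def by blast
  obtain h where h: "test_function y h"
    and eq: "\<forall>v k. test_function v k \<longrightarrow> (\<integral>x. w x * cnj (v x) \<partial>lebesgue_on {0..}) = form s y h v k"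
    by (rule minimal_operator_test_function[OF s H]) blast
  define q where "q = form s y h y h"
  have wy: "cinner_l2 (abs_l2 w) (abs_l2 y) = q"
    using eq h cinner_abs_l2[OF H(2,1)] by (simp add: q_def)
  have "q \<in> sector (\<gamma> - arctan T) (\<gamma> + arctan T) ?z" if n: "norm (abs_l2 y) = 1"
  proof -
    define X where "X = Re (e * q) + C / T"
    define Y where "Y = Im (e * q)"
    have "\<bar>Y\<bar> + \<kappa> / 2 * (norm (abs_l2 h))\<^sup>2 \<le> T * Re (e * q) + C"
      using est[OF h] n by (simp add: q_def Y_def)
    moreover have "0 \<le> \<kappa> / 2 * (norm (abs_l2 h))\<^sup>2" using \<kappa> by simp
    moreover have "T * Re (e * q) + C = T * X" using T by (simp add: X_def field_simps)
    ultimately have YX: "\<bar>Y\<bar> \<le> T * X" by linarith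
    then have "0 \<le> T * X" by linarith
    then have X: "0 \<le> X" using T(2) by (simp add: zero_le_mult_iff)
    have ee: "cnj e * e = 1" using complex_norm_square[of e] by (simp add: norm_e mult.commute)
    have "q - ?z = cnj e * (e * q + of_real (C / T))" using ee by (simp add: distrib_left flip: mult.assoc)
    also have "e * q + of_real (C / T) = Complex X Y" by (simp add: complex_eq_iff X_def Y_def)
    finally have qz: "q - ?z = cis \<gamma> * Complex X Y" by (simp add: e_def cis_cnj)
    have "arg_in (cis \<gamma> * Complex X Y) (\<gamma> - arctan T) (\<gamma> + arctan T)"
    proof (cases "X = 0")
      case True
      then have "Complex X Y = 0" using YX by (simp add: complex_eq_iff)
      then have "cis \<gamma> * Complex X Y = rcis 0 \<gamma>" by simp
      moreover have "\<gamma> \<in> {\<gamma> - arctan T..\<gamma> + arctan T}" using T by (simp add: zero_le_arctan_iff)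
      ultimately show ?thesis unfolding arg_in_def by blast
    next
      case False
      then have X: "X > 0" using X by simp
      define \<theta> where "\<theta> = arctan (Y / X)"
      have "Y / X \<le> T" "- T \<le> Y / X" using YX X by (auto simp: field_simps abs_le_iff)
      then have "\<theta> \<le> arctan T" "arctan (- T) \<le> \<theta>" unfolding \<theta>_def by (auto simp: arctan_le_iff)
      then have \<theta>: "\<gamma> + \<theta> \<in> {\<gamma> - arctan T..\<gamma> + arctan T}" by (simp add: arctan_minus)
      have co: "cos \<theta> > 0" unfolding \<theta>_def using arctan_bounded[of "Y / X"] by (intro cos_gt_zero_pi) auto
      have "tan \<theta> = Y / X" by (simp add: \<theta>_def tan_arctan)
      then have si: "X / cos \<theta> * sin \<theta> = Y" using X co by (simp add: tan_def field_simps)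
      have "Complex X Y = rcis (X / cos \<theta>) \<theta>" using si co by (simp add: complex_eq_iff)
      then have "cis \<gamma> * Complex X Y = rcis (X / cos \<theta>) (\<gamma> + \<theta>)"
        by (simp add: rcis_def mult.left_commute cis_mult)
      moreover have "0 \<le> X / cos \<theta>" using X co by simp
      ultimately show ?thesis unfolding arg_in_def using \<theta> by blast
    qed
    then have "arg_in (q - ?z) (\<gamma> - arctan T) (\<gamma> + arctan T)" unfolding qz .
    moreover have "q = ?z + (q - ?z)" by simp
    ultimately show ?thesis unfolding sector_def by blast
  qed
  then show "case P of (y, w) \<Rightarrow> norm y = 1 \<longrightarrow> cinner_l2 w y \<in> sector (\<gamma> - arctan T) (\<gamma> + arctan T) ?z"
    unfolding P using wy by simp
qed

end

section \<open>Compactness of form-bounded sets\<close>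

lemma L2_on_sum:
  assumes "finite I" "\<And>i. i \<in> I \<Longrightarrow> L2_on A (f i)"
  shows "L2_on A (\<lambda>x. \<Sum>i\<in>I. f i x)"
  using assms by (induction I rule: finite_induct) (auto simp: L2_on_zero intro!: L2_on_add)

text \<open>The function with value \<open>\<phi> j\<close> on \<open>(j h, (j + 1) h]\<close> for \<open>j < J\<close> and \<open>0\<close> elsewhere on the
  half-line, written as a sum of differences of the indicators of \<open>L2_on_indicator\<close>.\<close>

definition step_function :: "nat \<Rightarrow> real \<Rightarrow> (nat \<Rightarrow> complex) \<Rightarrow> real \<Rightarrow> complex" where
  "step_function J h \<phi> t = (\<Sum>j<J. \<phi> j * ((if t \<le> real (Suc j) * h then 1 else 0) - (if t \<le> real j * h then 1 else 0)))"

lemma step_function_L2: "L2_on {0..} (step_function J h \<phi>)"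
  unfolding step_function_def
  by (intro L2_on_sum L2_on_cmult L2_on_diff L2_on_indicator) auto

lemma step_function_value:
  assumes h: "h > 0" and j: "j < J" and t: "real j * h < t" "t \<le> real (Suc j) * h"
  shows "step_function J h \<phi> t = \<phi> j"
proof -
  have z: "\<phi> i * ((if t \<le> real (Suc i) * h then 1 else 0) - (if t \<le> real i * h then 1 else 0)) = 0" if "i \<in> {..<J} - {j}" for i
  proof (cases "i < j")
    case True
    then have "real (Suc i) * h \<le> real j * h" using h by (intro mult_right_mono) auto
    moreover have "real i * h \<le> real (Suc i) * h" using h by (intro mult_right_mono) auto
    ultimately show ?thesis using t by simp
  next
    case False
    then have "i > j" using that by auto
    then have "real (Suc j) * h \<le> real i * h" using h by (intro mult_right_mono) auto
    moreover have "real i * h \<le> real (Suc i) * h" using h by (intro mult_right_mono) auto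
    ultimately show ?thesis using t by simp
  qed
  have "step_function J h \<phi> t = \<phi> j * ((if t \<le> real (Suc j) * h then 1 else 0) - (if t \<le> real j * h then 1 else 0)) +
      (\<Sum>i\<in>{..<J} - {j}. \<phi> i * ((if t \<le> real (Suc i) * h then 1 else 0) - (if t \<le> real i * h then 1 else 0)))"
    unfolding step_function_def by (rule sum.remove) (use j in auto)
  also have "(\<Sum>i\<in>{..<J} - {j}. \<phi> i * ((if t \<le> real (Suc i) * h then 1 else 0) - (if t \<le> real i * h then 1 else 0))) = 0"
    by (rule sum.neutral) (use z in blast)
  finally show ?thesis using t by simp
qed

lemma step_function_zero:
  assumes h: "h > 0" and t: "t > real J * h"
  shows "step_function J h \<phi> t = 0"
  unfolding step_function_def
proof (rule sum.neutral, rule ballI)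
  fix j assume "j \<in> {..<J}"
  then have "real (Suc j) * h \<le> real J * h" using h by (intro mult_right_mono) auto
  moreover have "real j * h \<le> real (Suc j) * h" using h by (intro mult_right_mono) auto
  ultimately show "\<phi> j * ((if t \<le> real (Suc j) * h then 1 else 0) - (if t \<le> real j * h then 1 else 0)) = 0" using t by simp
qed

lemma step_function_approximation:
  assumes y: "test_function y g" and h: "h > 0" and \<phi>: "\<And>j. j < J \<Longrightarrow> cmod (y (real j * h) - \<phi> j) \<le> \<eta>"
  shows "integral {0..real J * h} (\<lambda>t. (cmod (y t - step_function J h \<phi> t))\<^sup>2) \<le>
    real J * (2 * h * \<eta>\<^sup>2) + 4 * h\<^sup>2 * integral {0..real J * h} (\<lambda>t. (cmod (g t))\<^sup>2)"
proof -
  define f where "f = (\<lambda>t. (cmod (y t - step_function J h \<phi> t))\<^sup>2)"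
  have fi: "f integrable_on {0..b}" for b
    unfolding f_def
    by (intro L2_on_square_integrable_on L2_on_diff test_functionD(4)[OF y] L2_on_subset[OF step_function_L2]) auto
  have gi: "(\<lambda>t. (cmod (g t))\<^sup>2) integrable_on {0..b}" for b by (intro L2_on_square_integrable_on test_functionD(3)[OF y])
  have "integral {0..real m * h} f \<le> real m * (2 * h * \<eta>\<^sup>2) + 4 * h\<^sup>2 * integral {0..real m * h} (\<lambda>t. (cmod (g t))\<^sup>2)" if "m \<le> J" for m
    using that
  proof (induction m)
    case (Suc m)
    define c where "c = real m * h"
    have c: "0 \<le> c" "real (Suc m) * h = c + h" using h by (auto simp: c_def algebra_simps)
    define I where "I = integral {c..c+h} (\<lambda>t. (cmod (g t))\<^sup>2)"
    have pc: "primitive_on c (c+h) g (\<lambda>t. y t - y c)"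
      using primitive_on_subinterval[OF test_functionD(2)[OF y, of "c+h"] c(1) order_refl] by (simp add: primitive_on_def)
    have gc: "L2_on {c..c+h} g" by (rule L2_on_subset[OF test_functionD(3)[OF y, of "c+h"]]) (use c in auto)
    have fic: "f integrable_on {c..c+h}" by (rule integrable_on_subinterval[OF fi[of "c+h"]]) (use c in auto)
    define f' where "f' = (\<lambda>t. if t = c then 0 else f t)"
    have ff: "integral {c..c+h} f = integral {c..c+h} f'"
      by (rule integral_spike[of "{c}"]) (auto simp: f'_def)
    have f'i: "f' integrable_on {c..c+h}"
      by (rule integrable_spike[OF fic, of "{c}"]) (auto simp: f'_def)
    have "integral {c..c+h} f' \<le> integral {c..c+h} (\<lambda>t. 4 * h * I + 2 * \<eta>\<^sup>2)"
    proof (rule integral_le[OF f'i integrable_const_ivl])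
      fix t assume t: "t \<in> {c..c+h}"
      have I0: "0 \<le> I" unfolding I_def
        by (intro Henstock_Kurzweil_Integration.integral_nonneg L2_on_square_integrable_on gc) simp
      show "f' t \<le> 4 * h * I + 2 * \<eta>\<^sup>2"
      proof (cases "t = c")
        case True
        then show ?thesis using I0 h by (simp add: f'_def)
      next
        case False
        then have tc: "real m * h < t" "t \<le> real (Suc m) * h" using t c by (auto simp: c_def)
        have st: "step_function J h \<phi> t = \<phi> m" by (rule step_function_value[OF h _ tc]) (use Suc in simp)
        have 1: "(cmod (y t - y c))\<^sup>2 \<le> 2 * h * I"
          using cell_pointwise_bound[OF pc gc t, of c] h by (simp add: I_def)
        have 2: "(cmod (y c - \<phi> m))\<^sup>2 \<le> \<eta>\<^sup>2" using \<phi>[of m] Suc.prems by (intro power_mono) (auto simp: c_def)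
        have "f' t = (cmod ((y t - y c) + (y c - \<phi> m)))\<^sup>2" using False by (simp add: f'_def f_def st)
        also have "\<dots> \<le> (cmod (y t - y c) + cmod (y c - \<phi> m))\<^sup>2" by (intro power_mono norm_triangle_ineq) simp
        also have "\<dots> \<le> 2 * (cmod (y t - y c))\<^sup>2 + 2 * (cmod (y c - \<phi> m))\<^sup>2"
          using zero_le_power2[of "cmod (y t - y c) - cmod (y c - \<phi> m)"] by (simp add: power2_eq_square algebra_simps)
        also have "\<dots> \<le> 2 * (2 * h * I) + 2 * \<eta>\<^sup>2" using 1 2 by (intro add_mono mult_left_mono) auto
        finally show ?thesis by simp
      qed
    qed
    also have "\<dots> = 2 * h * \<eta>\<^sup>2 + 4 * h\<^sup>2 * I" using h by (simp add: power2_eq_square algebra_simps)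
    finally have cell: "integral {c..c+h} f \<le> 2 * h * \<eta>\<^sup>2 + 4 * h\<^sup>2 * I" unfolding ff .
    have e1: "integral {0..c+h} f = integral {0..c} f + integral {c..c+h} f"
      by (rule Henstock_Kurzweil_Integration.integral_combine[symmetric]) (use c h fi in auto)
    have e2: "integral {0..c+h} (\<lambda>t. (cmod (g t))\<^sup>2) = integral {0..c} (\<lambda>t. (cmod (g t))\<^sup>2) + I"
      unfolding I_def by (rule Henstock_Kurzweil_Integration.integral_combine[symmetric]) (use c h gi in auto)
    have IH: "integral {0..c} f \<le> real m * (2 * h * \<eta>\<^sup>2) + 4 * h\<^sup>2 * integral {0..c} (\<lambda>t. (cmod (g t))\<^sup>2)"
      unfolding c_def using Suc by simp
    show ?case unfolding c(2) e1 e2 using add_mono[OF IH cell] by (simp add: algebra_simps)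
  qed simp
  from this[of J] show ?thesis by (simp add: f_def)
qed

context sectorial_form
begin

lemma form_ball_bounds:
  assumes y: "test_function y h" and p: "p (abs_l2 y, abs_l2 h) \<le> r"
  shows "(norm (abs_l2 y))\<^sup>2 \<le> r\<^sup>2" "(norm (abs_l2 h))\<^sup>2 \<le> 2 * T / \<kappa> * r\<^sup>2"
    "Re (e * form s y h y h) \<le> r\<^sup>2"
proof -
  let ?Y = "(abs_l2 y, abs_l2 h)"
  have Y: "?Y \<in> test_pairs" using y by (auto simp: test_pairs_def)
  have pr: "B ?Y ?Y \<le> r\<^sup>2" unfolding p_square[OF Y, symmetric] using p p_nonneg[OF Y] by (intro power_mono) auto
  show "(norm (abs_l2 y))\<^sup>2 \<le> r\<^sup>2" using B_bounds(1)[OF Y] pr by simp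
  have "(norm (abs_l2 h))\<^sup>2 \<le> 2 * T / \<kappa> * B ?Y ?Y" using B_bounds(2)[OF Y] by simp
  also have "\<dots> \<le> 2 * T / \<kappa> * r\<^sup>2" using pr T \<kappa> by (intro mult_left_mono) auto
  finally show "(norm (abs_l2 h))\<^sup>2 \<le> 2 * T / \<kappa> * r\<^sup>2" .
  have "0 \<le> C1" using C T by (simp add: C1_def)
  then have "Re (e * form s y h y h) \<le> B ?Y ?Y"
    unfolding B_def hform_diagonal(2)[OF Y] pair_form_test[OF s y y] by simp
  then show "Re (e * form s y h y h) \<le> r\<^sup>2" using pr by linarith
qed

lemma interval_integral_le_norm:
  assumes k: "L2_on {0..} k" and x: "0 \<le> x"
  shows "integral {x..b} (\<lambda>t. (cmod (k t))\<^sup>2) \<le> (norm (abs_l2 k))\<^sup>2"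
proof -
  have i: "integrable (lebesgue_on {0..}) (\<lambda>t. (cmod (k t))\<^sup>2)" by (rule L2_on_integrable[OF k])
  have i1: "(\<lambda>t. (cmod (k t))\<^sup>2) integrable_on {0..}" using i by (rule integrable_on_lebesgue_on) auto
  have "integral {x..b} (\<lambda>t. (cmod (k t))\<^sup>2) \<le> integral {0..} (\<lambda>t. (cmod (k t))\<^sup>2)"
    by (rule integral_subset_le[OF _ integrable_on_subinterval[OF i1] i1]) (use x in auto)
  also have "\<dots> = (norm (abs_l2 k))\<^sup>2"
    unfolding norm_abs_l2_square[OF k] by (rule lebesgue_integral_eq_integral[OF i, symmetric]) auto
  finally show ?thesis .
qed

text \<open>Beyond some point every cell has rise at least \<open>w\<close>, since otherwise the oscillation there would be bounded by
  \<open>oscillation_le_rise\<close>. By \<open>form_controls_rise\<close> the sum of the cell minima of \<open>|y|\<^sup>2\<close> is then at most \<open>\<Gamma> / w\<close>. On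
  each cell \<open>|y|\<^sup>2\<close> exceeds twice its minimum by at most \<open>2 a \<integral>|y'|\<^sup>2\<close>, so the tail integral is small once
  the mesh \<open>a\<close> is small and \<open>w\<close> is large.\<close>

lemma uniform_tail:
  assumes osc: "\<forall>a>0. filterlim (\<lambda>x. oscillation s x a) at_top at_top" and \<epsilon>: "\<epsilon> > 0"
  obtains X where "X > 0" "\<forall>y h b. test_function y h \<longrightarrow> p (abs_l2 y, abs_l2 h) \<le> r \<longrightarrow>
    integral {X..b} (\<lambda>x. (cmod (y x))\<^sup>2) \<le> \<epsilon>"
proof -
  obtain a0 where a0: "a0 > 0" "a0 \<le> 1" "2 * a0 \<le> d"
    and ctl: "\<forall>a. 0 < a \<and> a \<le> a0 \<longrightarrow> (\<exists>C\<ge>0. \<forall>y h N \<mu>.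
       test_function y h \<longrightarrow> (\<forall>x\<ge>real N * a. y x = 0 \<and> h x = 0) \<longrightarrow> (\<forall>n::nat. 0 \<le> \<mu> n) \<longrightarrow>
       (\<forall>n\<ge>1. \<forall>x. \<bar>x - real n * a\<bar> \<le> a / 2 \<longrightarrow> \<mu> n \<le> (cmod (y x))\<^sup>2) \<longrightarrow>
       (\<Sum>n=1..N. \<mu> n * W a n) \<le> 2 * T * Re (e * form s y h y h) + C * (norm (abs_l2 y))\<^sup>2)"
    by (rule form_controls_rise) blast
  define Dm where "Dm = 2 * T / \<kappa> * r\<^sup>2"
  have Dm: "Dm \<ge> 0" using T \<kappa> by (simp add: Dm_def)
  define a where "a = min a0 (\<epsilon> / (4 * (Dm + 1)))"
  have a: "0 < a" "a \<le> a0" "a \<le> 1" "2 * a \<le> d" using a0 \<epsilon> Dm by (auto simp: a_def)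
  have aD: "2 * a\<^sup>2 * Dm \<le> \<epsilon> / 2"
  proof -
    have "a \<le> \<epsilon> / (4 * (Dm + 1))" by (simp add: a_def)
    then have "a * (4 * (Dm + 1)) \<le> \<epsilon>" using Dm by (subst (asm) pos_le_divide_eq) auto
    moreover have "a\<^sup>2 \<le> a" using a by (simp add: power2_eq_square mult_left_le_one_le)
    then have "2 * a\<^sup>2 * Dm \<le> 2 * a * Dm" using Dm by (intro mult_right_mono) auto
    ultimately show ?thesis using a by (simp add: algebra_simps)
  qed
  obtain C' where C': "C' \<ge> 0" "\<forall>y h N \<mu>.
       test_function y h \<longrightarrow> (\<forall>x\<ge>real N * a. y x = 0 \<and> h x = 0) \<longrightarrow> (\<forall>n::nat. 0 \<le> \<mu> n) \<longrightarrow>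
       (\<forall>n\<ge>1. \<forall>x. \<bar>x - real n * a\<bar> \<le> a / 2 \<longrightarrow> \<mu> n \<le> (cmod (y x))\<^sup>2) \<longrightarrow>
       (\<Sum>n=1..N. \<mu> n * W a n) \<le> 2 * T * Re (e * form s y h y h) + C' * (norm (abs_l2 y))\<^sup>2"
    using ctl[rule_format, of a] a by blast
  define \<Gamma> where "\<Gamma> = 2 * T * r\<^sup>2 + C' * r\<^sup>2"
  have \<Gamma>: "\<Gamma> \<ge> 0" using T C' by (simp add: \<Gamma>_def)
  define w where "w = 4 * a * \<Gamma> / \<epsilon> + 1"
  have w: "w > 0" using a \<Gamma> \<epsilon> by (simp add: w_def add_nonneg_pos)
  have w\<Gamma>: "2 * a * (\<Gamma> / w) \<le> \<epsilon> / 2"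
  proof -
    have "4 * a * \<Gamma> / \<epsilon> \<le> w" by (simp add: w_def)
    then have "4 * a * \<Gamma> \<le> w * \<epsilon>" using \<epsilon> by (simp add: pos_divide_le_eq)
    then show ?thesis using w by (simp add: field_simps)
  qed
  obtain K where K: "K \<ge> 0" "\<forall>n\<ge>1. 0 \<le> W a n \<and> oscillation s (real n * a - a / 2) a \<le> K * ((W a n)\<^sup>2 + 1)"
    by (rule oscillation_le_rise[OF a(1,3,4)]) blast
  have "eventually (\<lambda>x. oscillation s x a > K * (w\<^sup>2 + 1)) at_top"
    using osc a unfolding filterlim_at_top_dense by blast
  then obtain x0 where x0: "\<And>x. x \<ge> x0 \<Longrightarrow> oscillation s x a > K * (w\<^sup>2 + 1)" by (auto simp: eventually_at_top_linorder)
  obtain n1 :: nat where n1: "\<bar>x0\<bar> / a + 1 \<le> real n1" using real_arch_simple by blast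
  define n0 where "n0 = max n1 1"
  have Ww: "w \<le> W a n" if n: "n \<ge> n0" for n
  proof (rule ccontr)
    assume "\<not> w \<le> W a n"
    then have Wn: "W a n < w" by simp
    have n': "n \<ge> 1" "real n \<ge> real n1" using n by (auto simp: n0_def)
    have "\<bar>x0\<bar> / a + 1 \<le> real n" using n1 n' by linarith
    then have "(\<bar>x0\<bar> / a + 1) * a \<le> real n * a" using a by (intro mult_right_mono) auto
    then have "x0 \<le> real n * a - a / 2" using a by (simp add: algebra_simps)
    then have "K * (w\<^sup>2 + 1) < oscillation s (real n * a - a / 2) a" by (rule x0)
    also have "\<dots> \<le> K * ((W a n)\<^sup>2 + 1)" using K(2) n' by blast
    also have "\<dots> \<le> K * (w\<^sup>2 + 1)" using K n' Wn by (intro mult_left_mono add_mono power_mono) auto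
    finally show False by simp
  qed
  define X where "X = real n0 * a - a / 2"
  have n0: "n0 \<ge> 1" by (simp add: n0_def)
  have X: "X > 0"
  proof -
    have "1 * a \<le> real n0 * a" using n0 a by (intro mult_right_mono) auto
    then show ?thesis using a by (simp add: X_def)
  qed
  show ?thesis
  proof (rule that[OF X], intro allI impI)
    fix y h b assume y: "test_function y h" and pr: "p (abs_l2 y, abs_l2 h) \<le> r"
    note bounds = form_ball_bounds[OF y pr]
    obtain R where R: "R \<ge> 0" "\<And>x. x \<ge> R \<Longrightarrow> y x = 0" "\<And>x. x \<ge> R \<Longrightarrow> h x = 0"
      using test_function_support[OF y] by metis
    obtain M :: nat where M: "(max R \<bar>b\<bar>) / a + 1 \<le> real M" using real_arch_simple by blast
    have Ma: "max R \<bar>b\<bar> \<le> real M * a"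
    proof -
      have "(max R \<bar>b\<bar> / a + 1) * a \<le> real M * a" using M a by (intro mult_right_mono) auto
      moreover have "(max R \<bar>b\<bar> / a + 1) * a = max R \<bar>b\<bar> + a" using a by (simp add: distrib_right)
      ultimately show ?thesis using a by linarith
    qed
    have yi: "(\<lambda>x. (cmod (y x))\<^sup>2) integrable_on {u..v}" if "0 \<le> u" for u v
      by (intro L2_on_square_integrable_on L2_on_subset[OF test_functionD(5)[OF y]]) (use that in auto)
    have hi: "(\<lambda>x. (cmod (h x))\<^sup>2) integrable_on {u..v}" if "0 \<le> u" for u v
      by (intro L2_on_square_integrable_on L2_on_subset[OF test_functionD(6)[OF y]]) (use that in auto)
    define c where "c = (\<lambda>k::nat. X + real k * a)"
    have c: "0 \<le> c k" "c (Suc k) = c k + a" for k using X a by (auto simp: c_def algebra_simps)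
    have "\<exists>t\<in>{c k..c k + a}. \<forall>x\<in>{c k..c k + a}. (cmod (y t))\<^sup>2 \<le> (cmod (y x))\<^sup>2" for k
    proof (rule continuous_attains_inf)
      have "continuous_on {c k..c k + a} y"
        by (rule continuous_on_subset[OF test_functionD(7)[OF y, of "c k + a"]]) (use c in auto)
      then show "continuous_on {c k..c k + a} (\<lambda>x. (cmod (y x))\<^sup>2)" by (intro continuous_intros)
    qed (use a in auto)
    then obtain t where t: "\<And>k. t k \<in> {c k..c k + a}" "\<And>k x. x \<in> {c k..c k + a} \<Longrightarrow> (cmod (y (t k)))\<^sup>2 \<le> (cmod (y x))\<^sup>2"
      by metis
    define \<mu> where "\<mu> = (\<lambda>n. if n < n0 then 0 else (cmod (y (t (n - n0))))\<^sup>2)"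
    define N where "N = n0 + M"
    have "(\<Sum>n=1..N. \<mu> n * W a n) \<le> 2 * T * Re (e * form s y h y h) + C' * (norm (abs_l2 y))\<^sup>2"
    proof (rule C'(2)[rule_format, OF y])
      show "y x = 0 \<and> h x = 0" if x: "real N * a \<le> x" for x
      proof -
        have "real M * a \<le> real N * a" using a by (intro mult_right_mono) (auto simp: N_def)
        then have "R \<le> x" using Ma x by linarith
        then show ?thesis using R by blast
      qed
      show "0 \<le> \<mu> n" for n by (simp add: \<mu>_def)
      fix n x assume "1 \<le> n" and x: "\<bar>x - real n * a\<bar> \<le> a / 2"
      show "\<mu> n \<le> (cmod (y x))\<^sup>2"
      proof (cases "n < n0")
        case False
        then have "c (n - n0) = real n * a - a / 2" by (simp add: c_def X_def of_nat_diff algebra_simps)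
        moreover have "real n * a - a / 2 \<le> x" "x \<le> real n * a - a / 2 + a" using x by linarith+
        ultimately have "x \<in> {c (n - n0)..c (n - n0) + a}" by simp
        then show ?thesis using t(2) False by (simp add: \<mu>_def)
      qed (simp add: \<mu>_def)
    qed
    also have "\<dots> \<le> 2 * T * r\<^sup>2 + C' * r\<^sup>2"
      using bounds T C' by (intro add_mono mult_left_mono) auto
    finally have tot: "(\<Sum>n=1..N. \<mu> n * W a n) \<le> \<Gamma>" by (simp add: \<Gamma>_def)
    have "w * (\<Sum>k<M. \<mu> (n0 + k)) = (\<Sum>k<M. \<mu> (n0 + k) * w)" by (simp add: sum_distrib_left mult.commute)
    also have "\<dots> \<le> (\<Sum>k<M. \<mu> (n0 + k) * W a (n0 + k))"
      using Ww by (intro sum_mono mult_left_mono) (auto simp: \<mu>_def)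
    also have "\<dots> = (\<Sum>n\<in>(\<lambda>k. n0 + k) ` {..<M}. \<mu> n * W a n)" by (subst sum.reindex) (auto simp: inj_on_def)
    also have "\<dots> \<le> (\<Sum>n=1..N. \<mu> n * W a n)"
      using n0 K by (intro sum_mono2) (auto simp: N_def \<mu>_def)
    finally have "w * (\<Sum>k<M. \<mu> (n0 + k)) \<le> \<Gamma>" using tot by simp
    then have sum\<mu>: "(\<Sum>k<M. \<mu> (n0 + k)) \<le> \<Gamma> / w" using w by (simp add: field_simps)
    have "integral {X..c m} (\<lambda>x. (cmod (y x))\<^sup>2) \<le> 2 * a * (\<Sum>k<m. \<mu> (n0 + k)) + 2 * a\<^sup>2 * integral {X..c m} (\<lambda>x. (cmod (h x))\<^sup>2)" for m
    proof (induction m)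
      case 0
      then show ?case by (simp add: c_def)
    next
      case (Suc m)
      define I where "I = integral {c m..c m + a} (\<lambda>x. (cmod (h x))\<^sup>2)"
      have pc: "primitive_on (c m) (c m + a) h y" by (rule primitive_on_subinterval[OF test_functionD(2)[OF y, of "c m + a"]]) (use c in auto)
      have hc: "L2_on {c m..c m + a} h" by (rule L2_on_subset[OF test_functionD(3)[OF y, of "c m + a"]]) (use c in auto)
      have "integral {c m..c m + a} (\<lambda>x. (cmod (y x))\<^sup>2) \<le> integral {c m..c m + a} (\<lambda>x. 2 * \<mu> (n0 + m) + 2 * a * I)"
      proof (rule integral_le[OF yi[OF c(1)] integrable_const_ivl])
        show "(cmod (y x))\<^sup>2 \<le> 2 * \<mu> (n0 + m) + 2 * a * I" if "x \<in> {c m..c m + a}" for x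
          using cell_pointwise_bound[OF pc hc that t(1)[of m]] by (simp add: \<mu>_def I_def)
      qed
      also have "\<dots> = 2 * a * \<mu> (n0 + m) + 2 * a\<^sup>2 * I" using a by (simp add: power2_eq_square algebra_simps)
      finally have cell: "integral {c m..c m + a} (\<lambda>x. (cmod (y x))\<^sup>2) \<le> 2 * a * \<mu> (n0 + m) + 2 * a\<^sup>2 * I" .
      have Xc: "X \<le> c m" using a by (simp add: c_def)
      have e1: "integral {X..c (Suc m)} (\<lambda>x. (cmod (y x))\<^sup>2) = integral {X..c m} (\<lambda>x. (cmod (y x))\<^sup>2) + integral {c m..c m + a} (\<lambda>x. (cmod (y x))\<^sup>2)"
        unfolding c(2) by (rule Henstock_Kurzweil_Integration.integral_combine[symmetric]) (use Xc a yi X in auto)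
      have e2: "integral {X..c (Suc m)} (\<lambda>x. (cmod (h x))\<^sup>2) = integral {X..c m} (\<lambda>x. (cmod (h x))\<^sup>2) + I"
        unfolding c(2) I_def by (rule Henstock_Kurzweil_Integration.integral_combine[symmetric]) (use Xc a hi X in auto)
      show ?case unfolding e1 e2 using add_mono[OF Suc.IH cell] by (simp add: algebra_simps)
    qed
    from this[of M] have "integral {X..c M} (\<lambda>x. (cmod (y x))\<^sup>2) \<le> 2 * a * (\<Sum>k<M. \<mu> (n0 + k)) + 2 * a\<^sup>2 * integral {X..c M} (\<lambda>x. (cmod (h x))\<^sup>2)" .
    also have "\<dots> \<le> 2 * a * (\<Gamma> / w) + 2 * a\<^sup>2 * Dm"
    proof (intro add_mono mult_left_mono sum\<mu>)
      show "integral {X..c M} (\<lambda>x. (cmod (h x))\<^sup>2) \<le> Dm"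
        using interval_integral_le_norm[OF test_functionD(6)[OF y], of X "c M"] X bounds(2) by (simp add: Dm_def)
    qed (use a in auto)
    also have "\<dots> \<le> \<epsilon>" using w\<Gamma> aD by linarith
    finally have main: "integral {X..c M} (\<lambda>x. (cmod (y x))\<^sup>2) \<le> \<epsilon>" .
    have "integral {X..b} (\<lambda>x. (cmod (y x))\<^sup>2) \<le> integral {X..c M} (\<lambda>x. (cmod (y x))\<^sup>2)"
      by (intro integral_subset_le yi) (use Ma X in \<open>auto simp: c_def\<close>)
    then show "integral {X..b} (\<lambda>x. (cmod (y x))\<^sup>2) \<le> \<epsilon>" using main by linarith
  qed
qed

text \<open>Total boundedness: up to a small tail each function in the form ball is approximated by a step function on \<open>[0, X]\<close>, and the
  values of the latter can be taken from a finite net of a disc because the functions are uniformly bounded.\<close>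

lemma form_balls_compact:
  assumes osc: "\<forall>a>0. filterlim (\<lambda>x. oscillation s x a) at_top at_top"
  shows "compact (closure (fst ` {Y \<in> test_pairs. p Y \<le> r}))"
proof -
  let ?Z = "fst ` {Y \<in> test_pairs. p Y \<le> r}"
  have "\<exists>k. finite k \<and> closure ?Z \<subseteq> (\<Union>x\<in>k. ball x \<epsilon>)" if \<epsilon>: "\<epsilon> > 0" for \<epsilon>
  proof -
    define E where "E = (\<epsilon> / 2)\<^sup>2"
    have E: "E > 0" using \<epsilon> by (simp add: E_def)
    have E4: "E / 4 > 0" using E by simp
    obtain X where X: "X > 0" and tail: "\<forall>y h b. test_function y h \<longrightarrow> p (abs_l2 y, abs_l2 h) \<le> r \<longrightarrow>
        integral {X..b} (\<lambda>x. (cmod (y x))\<^sup>2) \<le> E / 4"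
      by (rule uniform_tail[OF osc E4]) blast
    define Dm where "Dm = 2 * T / \<kappa> * r\<^sup>2"
    have Dm: "Dm \<ge> 0" using T \<kappa> by (simp add: Dm_def)
    define \<eta> where "\<eta> = sqrt (E / (8 * X))"
    have \<eta>: "\<eta> > 0" "2 * X * \<eta>\<^sup>2 \<le> E / 4" using E X by (auto simp: \<eta>_def)
    obtain J :: nat where J: "4 * X * sqrt (Dm + 1) / sqrt E + 1 \<le> real J" using real_arch_simple by blast
    have pos: "0 \<le> 4 * X * sqrt (Dm + 1) / sqrt E" using X Dm E by simp
    have J0: "real J > 0" using J pos by linarith
    define \<tau> where "\<tau> = X / real J"
    have \<tau>: "\<tau> > 0" "real J * \<tau> = X" using X J0 by (auto simp: \<tau>_def)
    have "4 * X * sqrt (Dm + 1) / sqrt E \<le> real J" using J by linarith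
    then have "4 * \<tau> * sqrt (Dm + 1) \<le> sqrt E" using E J0 by (simp add: \<tau>_def field_simps)
    then have "(4 * \<tau> * sqrt (Dm + 1))\<^sup>2 \<le> (sqrt E)\<^sup>2" using \<tau> Dm by (intro power_mono) auto
    then have t1: "16 * \<tau>\<^sup>2 * (Dm + 1) \<le> E" using Dm E by (simp add: power_mult_distrib)
    have \<tau>D: "4 * \<tau>\<^sup>2 * Dm \<le> E / 4"
    proof -
      have "16 * \<tau>\<^sup>2 * (Dm + 1) = 4 * (4 * \<tau>\<^sup>2 * Dm) + 16 * \<tau>\<^sup>2" by (simp add: distrib_left)
      then show ?thesis using t1 zero_le_power2[of \<tau>] by linarith
    qed
    define M where "M = sqrt (2 * r\<^sup>2 + 2 * Dm)"
    have "compact (cball (0::complex) M)" by simp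
    then have "\<exists>k. finite k \<and> cball (0::complex) M \<subseteq> (\<Union>x\<in>k. ball x \<eta>)"
      using \<eta>(1) unfolding compact_eq_totally_bounded[of "cball (0::complex) M"] by simp
    then obtain G :: "complex set" where G: "finite G" "cball 0 M \<subseteq> (\<Union>x\<in>G. ball x \<eta>)"
      by (elim exE conjE)
    define k where "k = (\<lambda>\<phi>. abs_l2 (step_function J \<tau> \<phi>)) ` (PiE {..<J} (\<lambda>_. G))"
    have k: "finite k" unfolding k_def by (intro finite_imageI finite_PiE G) auto
    have "?Z \<subseteq> (\<Union>x\<in>k. cball x (\<epsilon> / 2))"
    proof
      fix z assume "z \<in> ?Z"
      then obtain Y where Y: "Y \<in> test_pairs" "p Y \<le> r" "z = fst Y" by blast
      obtain y h where y: "test_function y h" "Y = (abs_l2 y, abs_l2 h)" using Y(1) by (metis test_pairsE)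
      have pr: "p (abs_l2 y, abs_l2 h) \<le> r" using Y y by simp
      note bounds = form_ball_bounds[OF y(1) pr, folded Dm_def]
      have "\<exists>c\<in>G. cmod (y (real j * \<tau>) - c) \<le> \<eta>" for j
      proof -
        have "(cmod (y (real j * \<tau>)))\<^sup>2 \<le> 2 * r\<^sup>2 + 2 * Dm"
          using test_function_sup[OF y(1), of "real j * \<tau>" 1] bounds \<tau> by simp
        then have "y (real j * \<tau>) \<in> cball 0 M" by (simp add: M_def real_le_rsqrt)
        then obtain c where "c \<in> G" "y (real j * \<tau>) \<in> ball c \<eta>" using G(2) by blast
        then show ?thesis by (auto simp: dist_norm norm_minus_commute intro!: bexI[of _ c])
      qed
      then obtain \<phi>0 where \<phi>0: "\<And>j. \<phi>0 j \<in> G" "\<And>j. cmod (y (real j * \<tau>) - \<phi>0 j) \<le> \<eta>" by metis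
      define \<phi> where "\<phi> = restrict \<phi>0 {..<J}"
      have \<phi>: "\<phi> \<in> PiE {..<J} (\<lambda>_. G)" using \<phi>0 by (auto simp: \<phi>_def)
      define q where "q = step_function J \<tau> \<phi>"
      have qL: "L2_on {0..} q" unfolding q_def by (rule step_function_L2)
      obtain R0 where R0: "R0 \<ge> 0" "\<And>x. x \<ge> R0 \<Longrightarrow> y x = 0" using test_function_support[OF y(1)] by metis
      define b where "b = max R0 X"
      have b: "0 \<le> b" "X \<le> b" "\<And>x. x > b \<Longrightarrow> y x = 0" using R0 X by (auto simp: b_def)
      have dL: "L2_on {0..} (\<lambda>t. y t - q t)" by (intro L2_on_diff test_functionD(5)[OF y(1)] qL)
      have dLb: "L2_on {0..v} (\<lambda>t. y t - q t)" for v by (rule L2_on_subset[OF dL]) auto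
      define f where "f = (\<lambda>t. (cmod (y t - q t))\<^sup>2)"
      have fi: "f integrable_on {0..v}" for v unfolding f_def by (rule L2_on_square_integrable_on[OF dLb])
      have q0: "q t = 0" if "t > X" for t unfolding q_def by (rule step_function_zero) (use \<tau> that in auto)
      have "(norm (abs_l2 y - abs_l2 q))\<^sup>2 = (\<integral>t. f t \<partial>lebesgue_on {0..})"
        unfolding minus_abs_l2[OF test_functionD(5)[OF y(1)] qL] norm_abs_l2_square[OF dL] f_def ..
      also have "\<dots> = integral {0..b} f"
        unfolding f_def
        by (rule halfline_integral(2)[OF b(1) _ L2_on_integrable[OF dLb]]) (use b q0 in auto)
      also have "\<dots> = integral {0..X} f + integral {X..b} f"
        by (rule Henstock_Kurzweil_Integration.integral_combine[symmetric]) (use b X fi in auto)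
      also have "integral {X..b} f = integral {X..b} (\<lambda>t. (cmod (y t))\<^sup>2)"
        by (rule integral_spike[of "{X}"]) (use q0 in \<open>auto simp: f_def\<close>)
      also have "integral {0..X} f + integral {X..b} (\<lambda>t. (cmod (y t))\<^sup>2) \<le> (2 * X * \<eta>\<^sup>2 + 4 * \<tau>\<^sup>2 * Dm) + E / 4"
      proof (rule add_mono)
        show "integral {X..b} (\<lambda>t. (cmod (y t))\<^sup>2) \<le> E / 4" using tail y(1) pr by blast
        have "integral {0..real J * \<tau>} (\<lambda>t. (cmod (y t - step_function J \<tau> \<phi> t))\<^sup>2) \<le>
            real J * (2 * \<tau> * \<eta>\<^sup>2) + 4 * \<tau>\<^sup>2 * integral {0..real J * \<tau>} (\<lambda>t. (cmod (h t))\<^sup>2)"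
          by (rule step_function_approximation[OF y(1) \<tau>(1)]) (use \<phi>0 in \<open>simp add: \<phi>_def\<close>)
        moreover have JX: "real J * (2 * \<tau> * \<eta>\<^sup>2) = 2 * X * \<eta>\<^sup>2" by (simp flip: \<tau>(2))
        ultimately have "integral {0..X} f \<le> 2 * X * \<eta>\<^sup>2 + 4 * \<tau>\<^sup>2 * integral {0..X} (\<lambda>t. (cmod (h t))\<^sup>2)"
          unfolding \<tau>(2) f_def q_def using JX by simp
        also have "\<dots> \<le> 2 * X * \<eta>\<^sup>2 + 4 * \<tau>\<^sup>2 * Dm"
          using interval_integral_le_norm[OF test_functionD(6)[OF y(1)], of 0 X] bounds(2)
          by (intro add_left_mono mult_left_mono) auto
        finally show "integral {0..X} f \<le> 2 * X * \<eta>\<^sup>2 + 4 * \<tau>\<^sup>2 * Dm" .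
      qed
      also have "\<dots> \<le> E" using \<eta>(2) \<tau>D E by linarith
      finally have "norm (abs_l2 y - abs_l2 q) \<le> \<epsilon> / 2"
        unfolding E_def by (rule power2_le_imp_le) (use \<epsilon> in simp)
      then have "z \<in> cball (abs_l2 q) (\<epsilon> / 2)" using Y y by (simp add: dist_norm norm_minus_commute)
      moreover have "abs_l2 q \<in> k" unfolding k_def q_def using \<phi> by blast
      ultimately show "z \<in> (\<Union>x\<in>k. cball x (\<epsilon> / 2))" by blast
    qed
    moreover have "closed (\<Union>x\<in>k. cball x (\<epsilon> / 2))" using k by (intro closed_UN) auto
    ultimately have "closure ?Z \<subseteq> (\<Union>x\<in>k. cball x (\<epsilon> / 2))" by (rule closure_minimal)
    also have "\<dots> \<subseteq> (\<Union>x\<in>k. ball x \<epsilon>)" using \<epsilon> by (intro UN_mono) auto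
    finally show ?thesis using k by blast
  qed
  moreover have "complete (closure ?Z)" by (simp add: complete_eq_closed)
  ultimately show ?thesis unfolding compact_eq_totally_bounded[of "closure ?Z"] by simp
qed

end

section \<open>Slowly oscillating coefficients\<close>

lemma real_Cauchy_Schwarz_interval:
  assumes s: "L2_on {l..r} s" and lr: "l \<le> r"
  shows "integral {l..r} (\<lambda>x. cmod (s x)) \<le> sqrt ((r - l) * integral {l..r} (\<lambda>x. (cmod (s x))\<^sup>2))"
proof -
  have si: "(\<lambda>x. (cmod (s x))\<^sup>2) integrable_on {l..r}" by (rule L2_on_square_integrable_on[OF s])
  have ni: "(\<lambda>x. cmod (s x)) integrable_on {l..r}"
    using L2_on_interval_integrable[OF s] by (simp add: absolutely_integrable_on_def)
  define I where "I = integral {l..r} (\<lambda>x. cmod (s x))"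
  define A where "A = integral {l..r} (\<lambda>x. (cmod (s x))\<^sup>2)"
  have "I\<^sup>2 \<le> A * (r - l)"
  proof (rule quadratic_nonneg_discriminant)
    fix t :: real
    have qi: "(\<lambda>x. (cmod (s x))\<^sup>2 + (2 * t * cmod (s x) + t\<^sup>2)) integrable_on {l..r}"
      by (intro integrable_add si integrable_on_mult_right ni integrable_const_ivl)
    have "0 \<le> integral {l..r} (\<lambda>x. (cmod (s x))\<^sup>2 + (2 * t * cmod (s x) + t\<^sup>2))"
    proof (rule Henstock_Kurzweil_Integration.integral_nonneg[OF qi])
      show "0 \<le> (cmod (s x))\<^sup>2 + (2 * t * cmod (s x) + t\<^sup>2)" for x
        using zero_le_power2[of "cmod (s x) + t"] by (simp add: power2_eq_square algebra_simps)
    qed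
    also have "\<dots> = A + (2 * t * I + t\<^sup>2 * (r - l))"
      unfolding Henstock_Kurzweil_Integration.integral_add[OF si integrable_add[OF integrable_on_mult_right[OF ni] integrable_const_ivl]]
        Henstock_Kurzweil_Integration.integral_add[OF integrable_on_mult_right[OF ni] integrable_const_ivl]
      using lr by (simp add: A_def I_def mult.commute)
    finally show "0 \<le> A + 2 * t * I + t\<^sup>2 * (r - l)" by (simp add: add.assoc)
  qed (use lr in simp)
  then have "I \<le> sqrt ((r - l) * A)" by (intro real_le_rsqrt) (simp add: mult.commute)
  then show ?thesis by (simp add: I_def A_def)
qed

text \<open>The system \<open>\<phi>' = u + \<sigma> \<phi>\<close>, \<open>u' = -\<sigma> u - \<sigma>\<^sup>2 \<phi>\<close> is \<open>l(\<phi>) = 0\<close> for the coefficient \<open>\<sigma>\<close>. Its integral form with initial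
  value \<open>(1, 0)\<close> is a contraction with factor \<open>1 / 4\<close>, because the smallness assumption bounds the
  integral of \<open>1 + 2 |\<sigma>| + |\<sigma>|\<^sup>2\<close>.\<close>

lemma zero_energy_solution:
  fixes \<sigma> :: "real \<Rightarrow> complex"
  assumes \<sigma>: "L2_on {l..r} \<sigma>" and lr: "l < r"
    and small: "(r - l) + 2 * sqrt ((r - l) * integral {l..r} (\<lambda>x. (cmod (\<sigma> x))\<^sup>2)) + integral {l..r} (\<lambda>x. (cmod (\<sigma> x))\<^sup>2) \<le> 1/4"
  obtains \<phi> u where "primitive_on l r (\<lambda>x. u x + \<sigma> x * \<phi> x) \<phi>"
    "primitive_on l r (\<lambda>x. - (\<sigma> x * u x + (\<sigma> x)\<^sup>2 * \<phi> x)) u"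
    "\<And>x. x \<in> {l..r} \<Longrightarrow> cmod (\<phi> x - 1) \<le> 1/3" "\<And>x. x \<in> {l..r} \<Longrightarrow> cmod (u x) \<le> 1/3"
proof -
  (* Retraction onto the interval. It lets the fixed point be sought among bounded continuous functions on the whole
     line. *)
  define cl where "cl = (\<lambda>x. max l (min x r))"
  have cl: "cl x \<in> {l..r}" "x \<in> {l..r} \<Longrightarrow> cl x = x" for x using lr by (auto simp: cl_def)
  have clc: "continuous_on UNIV cl" unfolding cl_def by (intro continuous_intros)
  have s1: "\<sigma> absolutely_integrable_on {l..r}" by (rule L2_on_interval_integrable[OF \<sigma>])
  have s2: "(\<lambda>x. (\<sigma> x)\<^sup>2) absolutely_integrable_on {l..r}"
    using integrable_imp_absolutely_integrable[OF L2_on_mult_integrable[OF \<sigma> \<sigma>]] by (simp add: power2_eq_square)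
  define m where "m = (\<lambda>x. 1 + 2 * cmod (\<sigma> x) + (cmod (\<sigma> x))\<^sup>2)"
  have si: "(\<lambda>x. (cmod (\<sigma> x))\<^sup>2) integrable_on {l..r}" by (rule L2_on_square_integrable_on[OF \<sigma>])
  have ni: "(\<lambda>x. cmod (\<sigma> x)) integrable_on {l..r}" using s1 by (simp add: absolutely_integrable_on_def)
  have mi: "m integrable_on {l..r}" unfolding m_def
    by (intro integrable_add si integrable_on_mult_right ni integrable_const_ivl)
  have m0: "0 \<le> m x" for x by (simp add: m_def)
  have "integral {l..r} m = (r - l) + 2 * integral {l..r} (\<lambda>x. cmod (\<sigma> x)) + integral {l..r} (\<lambda>x. (cmod (\<sigma> x))\<^sup>2)"
    unfolding m_def
      Henstock_Kurzweil_Integration.integral_add[OF integrable_add[OF integrable_const_ivl integrable_on_mult_right[OF ni]] si]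
      Henstock_Kurzweil_Integration.integral_add[OF integrable_const_ivl integrable_on_mult_right[OF ni]]
    using lr by simp
  then have mle: "integral {l..r} m \<le> 1/4"
    using small real_Cauchy_Schwarz_interval[OF \<sigma>] lr by simp
  define A1 where "A1 = (\<lambda>(\<phi>::real \<Rightarrow> complex) (u::real \<Rightarrow> complex) x. u x + \<sigma> x * \<phi> x)"
  define A2 where "A2 = (\<lambda>(\<phi>::real \<Rightarrow> complex) (u::real \<Rightarrow> complex) x. - (\<sigma> x * u x + (\<sigma> x)\<^sup>2 * \<phi> x))"
  have A1i: "A1 \<phi> u absolutely_integrable_on {l..r}" and A2i: "A2 \<phi> u absolutely_integrable_on {l..r}"
    if c: "continuous_on {l..r} \<phi>" "continuous_on {l..r} u" for \<phi> u
  proof -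
    show "A1 \<phi> u absolutely_integrable_on {l..r}" unfolding A1_def
      by (intro set_integral_add(1) absolutely_integrable_mult_continuous s1 c absolutely_integrable_continuous_real)
    have "(\<lambda>x. (- 1) * (\<sigma> x * u x + (\<sigma> x)\<^sup>2 * \<phi> x)) absolutely_integrable_on {l..r}"
      by (intro set_integrable_mult_right set_integral_add(1) absolutely_integrable_mult_continuous s1 s2 c)
    then show "A2 \<phi> u absolutely_integrable_on {l..r}" by (simp add: A2_def)
  qed
  have A_le: "cmod (A1 \<phi> u x) + cmod (A2 \<phi> u x) \<le> m x * k" if "cmod (\<phi> x) \<le> k" "cmod (u x) \<le> k" for \<phi> u x k
  proof -
    have "cmod (A1 \<phi> u x) \<le> cmod (u x) + cmod (\<sigma> x) * cmod (\<phi> x)"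
      unfolding A1_def by (metis norm_mult norm_triangle_ineq)
    moreover have "cmod (A2 \<phi> u x) \<le> cmod (\<sigma> x) * cmod (u x) + (cmod (\<sigma> x))\<^sup>2 * cmod (\<phi> x)"
      unfolding A2_def norm_minus_cancel by (metis norm_mult norm_power norm_triangle_ineq)
    ultimately have "cmod (A1 \<phi> u x) + cmod (A2 \<phi> u x) \<le> cmod (u x) + cmod (\<sigma> x) * cmod (\<phi> x) + (cmod (\<sigma> x) * cmod (u x) + (cmod (\<sigma> x))\<^sup>2 * cmod (\<phi> x))"
      by (rule add_mono)
    also have "\<dots> \<le> k + cmod (\<sigma> x) * k + (cmod (\<sigma> x) * k + (cmod (\<sigma> x))\<^sup>2 * k)"
      using that by (intro add_mono mult_left_mono) auto
    also have "\<dots> = m x * k" by (simp add: m_def algebra_simps)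
    finally show ?thesis .
  qed
  define I1 where "I1 = (\<lambda>\<phi> u x. integral {l..x} (A1 \<phi> u))"
  define I2 where "I2 = (\<lambda>\<phi> u x. integral {l..x} (A2 \<phi> u))"
  have I_le: "cmod (I1 \<phi> u x) + cmod (I2 \<phi> u x) \<le> k / 4"
    if c: "continuous_on {l..r} \<phi>" "continuous_on {l..r} u" and x: "x \<in> {l..r}"
      and k: "\<And>x. x \<in> {l..r} \<Longrightarrow> cmod (\<phi> x) \<le> k \<and> cmod (u x) \<le> k" for \<phi> u x k
  proof -
    have k0: "0 \<le> k" using k[of l] lr by (auto intro: order_trans[OF norm_ge_zero])
    have sub: "A1 \<phi> u absolutely_integrable_on {l..x}" "A2 \<phi> u absolutely_integrable_on {l..x}"
      using absolutely_integrable_on_subinterval[OF A1i[OF c]] absolutely_integrable_on_subinterval[OF A2i[OF c]] x by auto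
    then have ii: "A1 \<phi> u integrable_on {l..x}" "A2 \<phi> u integrable_on {l..x}"
      "(\<lambda>x. cmod (A1 \<phi> u x)) integrable_on {l..x}" "(\<lambda>x. cmod (A2 \<phi> u x)) integrable_on {l..x}"
      by (auto simp: absolutely_integrable_on_def)
    have mx: "m integrable_on {l..x}" by (rule integrable_on_subinterval[OF mi]) (use x in auto)
    have "cmod (I1 \<phi> u x) + cmod (I2 \<phi> u x) \<le> integral {l..x} (\<lambda>x. cmod (A1 \<phi> u x)) + integral {l..x} (\<lambda>x. cmod (A2 \<phi> u x))"
      unfolding I1_def I2_def by (intro add_mono integral_norm_bound_integral ii) auto
    also have "\<dots> = integral {l..x} (\<lambda>x. cmod (A1 \<phi> u x) + cmod (A2 \<phi> u x))"
      by (rule Henstock_Kurzweil_Integration.integral_add[symmetric, OF ii(3,4)])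
    also have "\<dots> \<le> integral {l..x} (\<lambda>x. m x * k)"
      by (intro integral_le integrable_add ii integrable_on_mult_left mx A_le) (use k x in auto)
    also have "\<dots> = integral {l..x} m * k" by simp
    also have "\<dots> \<le> integral {l..r} m * k"
      using x k0 m0 by (intro mult_right_mono integral_subset_le mx mi) auto
    also have "\<dots> \<le> 1/4 * k" by (intro mult_right_mono mle k0)
    finally show ?thesis by simp
  qed
  have Ic: "continuous_on {l..r} (I1 \<phi> u)" "continuous_on {l..r} (I2 \<phi> u)"
    if c: "continuous_on {l..r} \<phi>" "continuous_on {l..r} u" for \<phi> u
    unfolding I1_def I2_def using A1i[OF c] A2i[OF c]
    by (auto intro!: indefinite_integral_continuous_1 simp: absolutely_integrable_on_def)
  have Id: "I1 (\<lambda>x. \<phi> x - \<phi>' x) (\<lambda>x. u x - u' x) x = I1 \<phi> u x - I1 \<phi>' u' x"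
    "I2 (\<lambda>x. \<phi> x - \<phi>' x) (\<lambda>x. u x - u' x) x = I2 \<phi> u x - I2 \<phi>' u' x"
    if c: "continuous_on {l..r} \<phi>" "continuous_on {l..r} u" "continuous_on {l..r} \<phi>'" "continuous_on {l..r} u'" and x: "x \<in> {l..r}" for \<phi> u \<phi>' u' x
  proof -
    have ii: "A1 \<phi> u integrable_on {l..x}" "A2 \<phi> u integrable_on {l..x}" "A1 \<phi>' u' integrable_on {l..x}" "A2 \<phi>' u' integrable_on {l..x}"
      using absolutely_integrable_on_subinterval[OF A1i[OF c(1,2)]] absolutely_integrable_on_subinterval[OF A2i[OF c(1,2)]]
        absolutely_integrable_on_subinterval[OF A1i[OF c(3,4)]] absolutely_integrable_on_subinterval[OF A2i[OF c(3,4)]] x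
      by (auto simp: absolutely_integrable_on_def)
    have e1: "A1 (\<lambda>x. \<phi> x - \<phi>' x) (\<lambda>x. u x - u' x) = (\<lambda>x. A1 \<phi> u x - A1 \<phi>' u' x)"
      and e2: "A2 (\<lambda>x. \<phi> x - \<phi>' x) (\<lambda>x. u x - u' x) = (\<lambda>x. A2 \<phi> u x - A2 \<phi>' u' x)"
      by (auto simp: A1_def A2_def algebra_simps)
    show "I1 (\<lambda>x. \<phi> x - \<phi>' x) (\<lambda>x. u x - u' x) x = I1 \<phi> u x - I1 \<phi>' u' x"
      unfolding I1_def e1 by (rule Henstock_Kurzweil_Integration.integral_diff[OF ii(1,3)])
    show "I2 (\<lambda>x. \<phi> x - \<phi>' x) (\<lambda>x. u x - u' x) x = I2 \<phi> u x - I2 \<phi>' u' x"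
      unfolding I2_def e2 by (rule Henstock_Kurzweil_Integration.integral_diff[OF ii(2,4)])
  qed
  define Tf where "Tf = (\<lambda>(Y :: real \<Rightarrow>\<^sub>C (complex \<times> complex)) x.
      (1 + I1 (\<lambda>t. fst (apply_bcontfun Y t)) (\<lambda>t. snd (apply_bcontfun Y t)) (cl x),
       I2 (\<lambda>t. fst (apply_bcontfun Y t)) (\<lambda>t. snd (apply_bcontfun Y t)) (cl x)))"
  have Yc: "continuous_on {l..r} (\<lambda>t. fst (apply_bcontfun Y t))" "continuous_on {l..r} (\<lambda>t. snd (apply_bcontfun Y t))"
    for Y :: "real \<Rightarrow>\<^sub>C (complex \<times> complex)"
    by (rule continuous_on_fst[OF continuous_on_apply_bcontfun]) (rule continuous_on_snd[OF continuous_on_apply_bcontfun])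
  have Ynorm: "cmod (fst (apply_bcontfun Y t)) \<le> norm Y" "cmod (snd (apply_bcontfun Y t)) \<le> norm Y"
    for Y :: "real \<Rightarrow>\<^sub>C (complex \<times> complex)" and t
    using norm_bounded[of Y t] norm_fst_le[of "fst (apply_bcontfun Y t)" "snd (apply_bcontfun Y t)"]
      norm_snd_le[of "snd (apply_bcontfun Y t)" "fst (apply_bcontfun Y t)"] by auto
  have pair_norm: "norm (a, b) \<le> cmod a + cmod b" for a b :: complex
    by (simp add: norm_Pair sqrt_sum_squares_le_sum)
  have Tb: "Tf Y \<in> bcontfun" for Y
  proof (rule bcontfun_normI)
    have "continuous_on UNIV (\<lambda>x. I1 (\<lambda>t. fst (apply_bcontfun Y t)) (\<lambda>t. snd (apply_bcontfun Y t)) (cl x))"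
      "continuous_on UNIV (\<lambda>x. I2 (\<lambda>t. fst (apply_bcontfun Y t)) (\<lambda>t. snd (apply_bcontfun Y t)) (cl x))"
      by (rule continuous_on_compose2[OF Ic(1)[OF Yc] clc], use cl in blast)
         (rule continuous_on_compose2[OF Ic(2)[OF Yc] clc], use cl in blast)
    then show "continuous_on UNIV (Tf Y)" unfolding Tf_def by (intro continuous_intros)
    fix x
    have "cmod (I1 (\<lambda>t. fst (apply_bcontfun Y t)) (\<lambda>t. snd (apply_bcontfun Y t)) (cl x)) +
        cmod (I2 (\<lambda>t. fst (apply_bcontfun Y t)) (\<lambda>t. snd (apply_bcontfun Y t)) (cl x)) \<le> norm Y / 4"
      by (rule I_le[OF Yc cl(1)]) (use Ynorm[of Y] in simp)
    moreover have "norm (Tf Y x) \<le> cmod (1 + I1 (\<lambda>t. fst (apply_bcontfun Y t)) (\<lambda>t. snd (apply_bcontfun Y t)) (cl x)) +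
        cmod (I2 (\<lambda>t. fst (apply_bcontfun Y t)) (\<lambda>t. snd (apply_bcontfun Y t)) (cl x))"
      unfolding Tf_def by (rule pair_norm)
    ultimately show "norm (Tf Y x) \<le> 1 + norm Y / 4"
      using norm_triangle_ineq[of 1 "I1 (\<lambda>t. fst (apply_bcontfun Y t)) (\<lambda>t. snd (apply_bcontfun Y t)) (cl x)"] by simp
  qed
  have Tapp: "apply_bcontfun (Bcontfun (Tf Y)) = Tf Y" for Y by (rule Bcontfun_inverse[OF Tb])
  have contr: "dist (Bcontfun (Tf Y)) (Bcontfun (Tf Z)) \<le> 1/4 * dist Y Z" for Y Z
  proof (rule dist_bound)
    fix x
    let ?f = "\<lambda>Y t. fst (apply_bcontfun Y t)" and ?s = "\<lambda>Y t. snd (apply_bcontfun Y t)"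
    have "dist (Tf Y x) (Tf Z x) = norm (I1 (?f Y) (?s Y) (cl x) - I1 (?f Z) (?s Z) (cl x), I2 (?f Y) (?s Y) (cl x) - I2 (?f Z) (?s Z) (cl x))"
      by (simp add: dist_norm Tf_def)
    also have "\<dots> \<le> cmod (I1 (?f Y) (?s Y) (cl x) - I1 (?f Z) (?s Z) (cl x)) + cmod (I2 (?f Y) (?s Y) (cl x) - I2 (?f Z) (?s Z) (cl x))"
      by (rule pair_norm)
    also have "\<dots> \<le> dist Y Z / 4"
      unfolding Id[OF Yc[of Y] Yc[of Z] cl(1), symmetric]
    proof (rule I_le[OF _ _ cl(1)])
      show "cmod (?f Y t - ?f Z t) \<le> dist Y Z \<and> cmod (?s Y t - ?s Z t) \<le> dist Y Z" for t
        using Ynorm[of "Y - Z" t] by (simp add: dist_norm)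
    qed (intro continuous_on_diff Yc)+
    finally show "dist (apply_bcontfun (Bcontfun (Tf Y)) x) (apply_bcontfun (Bcontfun (Tf Z)) x) \<le> 1/4 * dist Y Z"
      by (simp add: Tapp)
  qed
  have "\<exists>!Y. Bcontfun (Tf Y) = Y"
    by (rule banach_fix_type[of "1/4"]) (use contr in auto)
  then obtain Y where Y: "Bcontfun (Tf Y) = Y" by blast
  define \<phi> where "\<phi> = (\<lambda>t. fst (apply_bcontfun Y t))"
  define u where "u = (\<lambda>t. snd (apply_bcontfun Y t))"
  have TY: "Tf Y x = apply_bcontfun Y x" for x using Tapp[of Y] Y by simp
  have eq: "\<phi> x = 1 + I1 \<phi> u x" "u x = I2 \<phi> u x" if "x \<in> {l..r}" for x
    using TY[of x] cl(2)[OF that] unfolding Tf_def \<phi>_def u_def by (auto simp: prod_eq_iff)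
  have c\<phi>: "continuous_on {l..r} \<phi>" "continuous_on {l..r} u" unfolding \<phi>_def u_def by (rule Yc)+
  have Yn: "norm Y \<le> 4/3"
  proof -
    have "norm Y \<le> 1 + norm Y / 4"
    proof (rule norm_bound)
      fix x
      have "norm (apply_bcontfun Y x) = norm (Tf Y x)" by (simp add: TY)
      also have "\<dots> \<le> cmod (1 + I1 \<phi> u (cl x)) + cmod (I2 \<phi> u (cl x))" unfolding Tf_def \<phi>_def u_def by (rule pair_norm)
      also have "\<dots> \<le> 1 + norm Y / 4"
        using I_le[OF c\<phi> cl(1)[of x], of "norm Y"] Ynorm[of Y] norm_triangle_ineq[of 1 "I1 \<phi> u (cl x)"]
        by (simp add: \<phi>_def u_def)
      finally show "norm (apply_bcontfun Y x) \<le> 1 + norm Y / 4" .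
    qed
    then show ?thesis by simp
  qed
  have est: "cmod (I1 \<phi> u x) \<le> 1/3 \<and> cmod (I2 \<phi> u x) \<le> 1/3" if x: "x \<in> {l..r}" for x
  proof -
    have "cmod (I1 \<phi> u x) + cmod (I2 \<phi> u x) \<le> norm Y / 4"
      by (rule I_le[OF c\<phi> x]) (use Ynorm[of Y] in \<open>simp add: \<phi>_def u_def\<close>)
    moreover have "0 \<le> cmod (I1 \<phi> u x)" "0 \<le> cmod (I2 \<phi> u x)" by auto
    ultimately show ?thesis using Yn by linarith
  qed
  show ?thesis
  proof (rule that)
    have hi: "(A has_integral integral {l..x} A) {l..x}" if "A absolutely_integrable_on {l..r}" "x \<in> {l..r}" for A :: "real \<Rightarrow> complex" and x
    proof -
      have "A integrable_on {l..r}" using that by (simp add: absolutely_integrable_on_def)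
      then have "A integrable_on {l..x}" by (rule integrable_on_subinterval) (use that in auto)
      then show ?thesis by (simp add: has_integral_integral)
    qed
    have l: "l \<in> {l..r}" using lr by simp
    have "primitive_on l r (A1 \<phi> u) \<phi>" unfolding primitive_on_def
    proof (intro conjI ballI A1i[OF c\<phi>])
      fix x assume x: "x \<in> {l..r}"
      show "(A1 \<phi> u has_integral \<phi> x - \<phi> l) {l..x}"
        using hi[OF A1i[OF c\<phi>] x] eq(1)[OF x] eq(1)[OF l] by (simp add: I1_def)
    qed
    then show "primitive_on l r (\<lambda>x. u x + \<sigma> x * \<phi> x) \<phi>" unfolding A1_def .
    have "primitive_on l r (A2 \<phi> u) u" unfolding primitive_on_def
    proof (intro conjI ballI A2i[OF c\<phi>])
      fix x assume x: "x \<in> {l..r}"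
      show "(A2 \<phi> u has_integral u x - u l) {l..x}"
        using hi[OF A2i[OF c\<phi>] x] eq(2)[OF x] eq(2)[OF l] by (simp add: I2_def)
    qed
    then show "primitive_on l r (\<lambda>x. - (\<sigma> x * u x + (\<sigma> x)\<^sup>2 * \<phi> x)) u" unfolding A2_def .
    show "cmod (\<phi> x - 1) \<le> 1/3" "cmod (u x) \<le> 1/3" if "x \<in> {l..r}" for x
      using est[OF that] eq[OF that] by auto
  qed
qed

lemma primitive_on_extend_zero:
  assumes prim: "primitive_on l r g y" and ends: "y l = 0" "y r = 0" and l: "0 \<le> l" "l \<le> r"
  shows "primitive_on 0 b (\<lambda>x. if x \<in> {l..r} then g x else 0) (\<lambda>x. if x \<in> {l..r} then y x else 0)"
  unfolding primitive_on_def
proof (intro conjI ballI)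
  have "g absolutely_integrable_on {l..r}" using prim by (simp add: primitive_on_def)
  then have "(\<lambda>x. if x \<in> {l..r} then g x else 0) absolutely_integrable_on UNIV"
    using absolutely_integrable_restrict_UNIV by blast
  then show "(\<lambda>x. if x \<in> {l..r} then g x else 0) absolutely_integrable_on {0..b}"
    by (rule set_integrable_subset) auto
  fix x assume x: "x \<in> {0..b}"
  show "((\<lambda>x. if x \<in> {l..r} then g x else 0) has_integral (if x \<in> {l..r} then y x else 0) - (if 0 \<in> {l..r} then y 0 else 0)) {0..x}"
  proof -
    have z: "(if 0 \<in> {l..r} then y 0 else 0) = 0" using ends l by (cases "l = 0") auto
    have i: "((\<lambda>t. if t \<in> {l..min x r} then g t else 0) has_integral (y (min x r) - y l)) {0..x}" if "l \<le> x" for x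
    proof -
      have "(g has_integral (y (min x r) - y l)) {l..min x r}"
        by (rule primitive_on_diff[OF prim]) (use l that in auto)
      moreover have "{l..min x r} \<subseteq> {0..x}" using l by auto
      ultimately show ?thesis by (simp only: has_integral_restrict)
    qed
    show ?thesis
    proof (cases "l \<le> x")
      case True
      have "((\<lambda>t. if t \<in> {l..r} then g t else 0) has_integral (y (min x r) - y l)) {0..x}"
        by (rule has_integral_eq[OF _ i[OF True]]) auto
      moreover have "y (min x r) = (if x \<in> {l..r} then y x else 0)" using True ends by (auto simp: min_def)
      ultimately show ?thesis using z ends by simp
    next
      case False
      have "((\<lambda>t. if t \<in> {l..r} then g t else 0) has_integral 0) {0..x}"
        by (rule has_integral_eq[OF _ has_integral_0]) (use False in auto)
      then show ?thesis using z False by simp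
    qed
  qed
qed

lemma primitive_on_AE_derivative_halfline:
  assumes prim: "\<And>b. primitive_on 0 b g y"
  shows "AE x in lebesgue_on {0..}. (y has_vector_derivative g x) (at x)"
proof -
  have "\<exists>N. negligible N \<and> (\<forall>x\<in>{0..real n} - N. (y has_vector_derivative g x) (at x))" for n :: nat
    by (rule primitive_has_derivative_AE[OF prim[of "real n"]]) blast
  then obtain N where N: "\<And>n. negligible (N n)" "\<And>n. \<forall>x\<in>{0..real n} - N n. (y has_vector_derivative g x) (at x)" by metis
  have neg: "negligible (\<Union>n. N n)" using N(1) by (intro negligible_countable_Union) auto
  have d: "(y has_vector_derivative g x) (at x)" if "x \<in> {0..} - (\<Union>n. N n)" for x
  proof -
    obtain n :: nat where "x \<le> real n" using real_arch_simple by blast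
    then show ?thesis using N(2)[of n] that by auto
  qed
  then have "AE x in lebesgue. x \<in> {0..} \<longrightarrow> (y has_vector_derivative g x) (at x)"
    using neg by (intro AE_I'[of "\<Union>n. N n"]) (auto simp: negligible_iff_null_sets)
  then show ?thesis by (simp add: AE_restrict_space_iff)
qed

text \<open>Replacing \<open>s\<close> by \<open>\<sigma> = s - c\<close> does not change \<open>l\<close>; it only adds \<open>c y\<close> to the quasi-derivative. If
  \<open>l(\<phi>) = 0\<close> and \<open>P = sin\<^sup>2\<close> is scaled to the interval, then \<open>y = P \<phi>\<close> has \<open>l(y) = -P'' \<phi> - 2 P' \<phi>'\<close>,
  which contains no product worse than \<open>P' \<sigma> \<phi>\<close> and is therefore square integrable with a bound depending on
  \<open>b\<close> only. The double zeros of \<open>P\<close> at the ends permit the extension by zero.\<close>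

lemma bump_in_minimal_operator:
  assumes s: "L2_loc s" and l: "0 \<le> l" "0 < b"
    and small: "b + 2 * sqrt (b * integral {l..l+b} (\<lambda>x. (cmod (s x - c))\<^sup>2)) + integral {l..l+b} (\<lambda>x. (cmod (s x - c))\<^sup>2) \<le> 1/4"
  obtains y w where "L2_on {0..} y" "L2_on {0..} w" "(abs_l2 y, abs_l2 w) \<in> minimal_operator s"
    "\<And>x. x \<le> l \<or> l + b \<le> x \<Longrightarrow> y x = 0"
    "b / 18 \<le> (norm (abs_l2 y))\<^sup>2" "(norm (abs_l2 y))\<^sup>2 \<le> 4 * b"
    "(norm (abs_l2 w))\<^sup>2 \<le> (2 * (pi / b)\<^sup>2 + pi / b)\<^sup>2 * 13"
proof -
  define r where "r = l + b"
  have r: "l < r" "r - l = b" using l by (auto simp: r_def)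
  define \<sigma> where "\<sigma> = (\<lambda>x. s x - c)"
  have sl: "L2_on {l..r} s"
    by (rule L2_on_subset[of "{0..r}"]) (use s l in \<open>auto simp: L2_loc_def r_def\<close>)
  have \<sigma>l: "L2_on {l..r} \<sigma>" unfolding \<sigma>_def by (intro L2_on_diff sl L2_on_continuous) auto
  define Q where "Q = integral {l..r} (\<lambda>x. (cmod (\<sigma> x))\<^sup>2)"
  have sm: "b + 2 * sqrt (b * Q) + Q \<le> 1/4" using small by (simp add: Q_def \<sigma>_def r_def)
  have Q0: "0 \<le> Q" unfolding Q_def
    by (intro Henstock_Kurzweil_Integration.integral_nonneg L2_on_square_integrable_on \<sigma>l) simp
  have "0 \<le> sqrt (b * Q)" using Q0 l by simp
  then have bQ: "b \<le> 1/4" "Q \<le> 1/4" using sm Q0 l by linarith+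
  obtain \<phi> u where p\<phi>: "primitive_on l r (\<lambda>x. u x + \<sigma> x * \<phi> x) \<phi>"
    and pu: "primitive_on l r (\<lambda>x. - (\<sigma> x * u x + (\<sigma> x)\<^sup>2 * \<phi> x)) u"
    and \<phi>b: "\<And>x. x \<in> {l..r} \<Longrightarrow> cmod (\<phi> x - 1) \<le> 1/3" and ub: "\<And>x. x \<in> {l..r} \<Longrightarrow> cmod (u x) \<le> 1/3"
    by (rule zero_energy_solution[OF \<sigma>l r(1)]) (use sm in \<open>auto simp: r(2) Q_def\<close>)
  have c\<phi>: "continuous_on {l..r} \<phi>" "continuous_on {l..r} u" using primitive_on_continuous[OF p\<phi>] primitive_on_continuous[OF pu] .
  have \<phi>2: "cmod (\<phi> x) \<le> 4/3" "2/3 \<le> cmod (\<phi> x)" if "x \<in> {l..r}" for x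
    using \<phi>b[OF that] norm_triangle_ineq2[of "\<phi> x" 1] norm_triangle_ineq3[of "\<phi> x" 1] by auto
  define \<theta> where "\<theta> = (\<lambda>x. pi * (x - l) / b)"
  define P where "P = (\<lambda>x. complex_of_real ((sin (\<theta> x))\<^sup>2))"
  define P1 where "P1 = (\<lambda>x. complex_of_real (2 * (pi / b) * sin (\<theta> x) * cos (\<theta> x)))"
  define P2 where "P2 = (\<lambda>x. complex_of_real (2 * (pi / b)\<^sup>2 * ((cos (\<theta> x))\<^sup>2 - (sin (\<theta> x))\<^sup>2)))"
  have d\<theta>: "(\<theta> has_real_derivative pi / b) (at x)" for x
    unfolding \<theta>_def using l by (auto intro!: derivative_eq_intros)
  have c\<theta>: "continuous_on A \<theta>" for A unfolding \<theta>_def using l by (intro continuous_intros) auto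
  have pP: "primitive_on l r P1 P"
  proof (rule primitive_on_smooth)
    have "((\<lambda>x. (sin (\<theta> x))\<^sup>2) has_real_derivative 2 * (pi / b) * sin (\<theta> x) * cos (\<theta> x)) (at x)" for x
      by (auto intro!: derivative_eq_intros d\<theta>)
    then show "(P has_vector_derivative P1 x) (at x)" for x
      unfolding P_def P1_def by (rule has_vector_derivative_of_real)
    show "continuous_on {l..r} P1" unfolding P1_def by (intro continuous_intros c\<theta>)
  qed
  have pP1: "primitive_on l r P2 P1"
  proof (rule primitive_on_smooth)
    have "((\<lambda>x. k * sin (\<theta> x) * cos (\<theta> x)) has_real_derivative
        k * ((pi / b) * (cos (\<theta> x))\<^sup>2 - (pi / b) * (sin (\<theta> x))\<^sup>2)) (at x)" for x k
      by (auto intro!: derivative_eq_intros d\<theta> simp: power2_eq_square algebra_simps simp del: times_divide_eq_left times_divide_eq_right)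
    from this[of "2 * (pi / b)"]
    have "((\<lambda>x. 2 * (pi / b) * sin (\<theta> x) * cos (\<theta> x)) has_real_derivative 2 * (pi / b)\<^sup>2 * ((cos (\<theta> x))\<^sup>2 - (sin (\<theta> x))\<^sup>2)) (at x)" for x
      by (simp only: right_diff_distrib power2_eq_square mult.assoc)
    then show "(P1 has_vector_derivative P2 x) (at x)" for x
      unfolding P1_def P2_def by (rule has_vector_derivative_of_real)
    show "continuous_on {l..r} P2" unfolding P2_def by (intro continuous_intros c\<theta>)
  qed
  have Pends: "P l = 0" "P r = 0" "P1 l = 0" "P1 r = 0"
    using l by (auto simp: P_def P1_def \<theta>_def r_def)
  define y0 where "y0 = (\<lambda>x. P x * \<phi> x)"
  define g0 where "g0 = (\<lambda>x. P1 x * \<phi> x + P x * (u x + \<sigma> x * \<phi> x))"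
  define v0 where "v0 = (\<lambda>x. P1 x * \<phi> x + P x * u x)"
  define h0 where "h0 = (\<lambda>x. (P2 x * \<phi> x + P1 x * (u x + \<sigma> x * \<phi> x)) + (P1 x * u x + P x * (- (\<sigma> x * u x + (\<sigma> x)\<^sup>2 * \<phi> x))))"
  define w0 where "w0 = (\<lambda>x. - P2 x * \<phi> x - 2 * P1 x * (u x + \<sigma> x * \<phi> x))"
  have py: "primitive_on l r g0 y0" unfolding g0_def y0_def by (rule primitive_on_mult[OF pP p\<phi>])
  have pv: "primitive_on l r h0 v0" unfolding h0_def v0_def
    by (rule primitive_on_add[OF primitive_on_mult[OF pP1 p\<phi>] primitive_on_mult[OF pP pu]])
  have pus: "primitive_on l r (\<lambda>x. h0 x + (- c) * g0 x) (\<lambda>x. v0 x + (- c) * y0 x)"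
    by (rule primitive_on_add[OF pv primitive_on_cmult[OF py]])
  define y where "y = (\<lambda>x. if x \<in> {l..r} then y0 x else 0)"
  define us where "us = (\<lambda>x. if x \<in> {l..r} then v0 x + (- c) * y0 x else 0)"
  define w where "w = (\<lambda>x. if x \<in> {l..r} then w0 x else 0)"
  have ext1: "primitive_on 0 q (\<lambda>x. if x \<in> {l..r} then g0 x else 0) y" for q
    unfolding y_def by (rule primitive_on_extend_zero[OF py]) (use Pends l r in \<open>auto simp: y0_def\<close>)
  have ext2: "primitive_on 0 q (\<lambda>x. if x \<in> {l..r} then h0 x + (- c) * g0 x else 0) us" for q
    unfolding us_def by (rule primitive_on_extend_zero[OF pus]) (use Pends l r in \<open>auto simp: y0_def v0_def\<close>)
  have yL: "L2_on {0..} y"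
    by (rule L2_on_halflineI[of _ "r"]) (use primitive_on_continuous[OF ext1] l r in \<open>auto intro!: L2_on_continuous simp: y_def\<close>)
  have w0l: "L2_on {l..r} w0"
  proof -
    have "L2_on {l..r} (\<lambda>x. (-1) * (\<phi> x * P2 x) + (-2) * ((u x + \<sigma> x * \<phi> x) * P1 x))"
    proof (intro L2_on_add L2_on_cmult)
      have cP: "continuous_on {l..r} P2" "continuous_on {l..r} P1"
        unfolding P2_def by (intro continuous_intros c\<theta>) (rule primitive_on_continuous[OF pP1])
      show "L2_on {l..r} (\<lambda>x. \<phi> x * P2 x)"
        by (intro L2_on_continuous continuous_on_mult c\<phi> cP)
      have "L2_on {l..r} (\<lambda>x. u x + \<sigma> x * \<phi> x)"
        by (rule L2_on_add[OF L2_on_continuous[OF c\<phi>(2)] L2_on_mult_continuous[OF \<sigma>l c\<phi>(1)]])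
      then show "L2_on {l..r} (\<lambda>x. (u x + \<sigma> x * \<phi> x) * P1 x)"
        by (rule L2_on_mult_continuous) (rule cP)
    qed
    then show ?thesis by (rule L2_on_cong) (simp add: w0_def algebra_simps)
  qed
  have wb: "L2_on {0..q} w" for q
    unfolding L2_on_def
  proof
    have ind: "(\<lambda>x. if x \<in> {l..r} then w0 x else 0) \<in> borel_measurable lebesgue"
      by (rule borel_measurable_if_I[OF L2_on_measurable[OF w0l]]) auto
    then show "w \<in> borel_measurable (lebesgue_on {0..q})" unfolding w_def by (rule measurable_restrict_space1)
    have "set_integrable lebesgue {l..r} (\<lambda>x. (cmod (w0 x))\<^sup>2)"
      using L2_on_integrable[OF w0l] by (rule integrable_imp_absolutely_integrable)
    then have "integrable lebesgue (\<lambda>x. (cmod (w x))\<^sup>2)"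
      unfolding set_integrable_def by (rule Bochner_Integration.integrable_cong[THEN iffD1, rotated -1]) (auto simp: w_def indicator_def)
    then have "integrable lebesgue (\<lambda>x. indicat_real {0..q} x *\<^sub>R (cmod (w x))\<^sup>2)"
      by (rule integrable_mult_indicator[rotated]) simp
    then show "integrable (lebesgue_on {0..q}) (\<lambda>x. (cmod (w x))\<^sup>2)"
      by (simp add: integrable_restrict_space)
  qed
  have r0: "0 \<le> r" using l r by simp
  have wL: "L2_on {0..} w" by (rule L2_on_halflineI[OF wb r0]) (simp add: w_def)
  have q: "quasi_differential_expression s y us w"
    unfolding quasi_differential_expression_def quasi_derivative_def
  proof (intro conjI)
    show "AC_loc y" unfolding AC_loc_def using primitive_on_imp_AC_on[OF ext1] by blast
    show "AC_loc us" unfolding AC_loc_def using primitive_on_imp_AC_on[OF ext2] by blast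
    show "AE x in lebesgue_on {0..}. \<exists>y'. (y has_vector_derivative y') (at x) \<and> us x = y' - s x * y x"
      using primitive_on_AE_derivative_halfline[OF ext1]
    proof eventually_elim
      case (elim x)
      have "us x = (if x \<in> {l..r} then g0 x else 0) - s x * y x"
        by (simp add: us_def y_def g0_def v0_def y0_def \<sigma>_def algebra_simps)
      then show ?case using elim by blast
    qed
    show "AE x in lebesgue_on {0..}. \<exists>u'. (us has_vector_derivative u') (at x) \<and> w x = - u' - s x * us x - (s x)\<^sup>2 * y x"
      using primitive_on_AE_derivative_halfline[OF ext2]
    proof eventually_elim
      case (elim x)
      have "w x = - (if x \<in> {l..r} then h0 x + (- c) * g0 x else 0) - s x * us x - (s x)\<^sup>2 * y x"
        by (simp add: us_def y_def w_def w0_def h0_def g0_def v0_def y0_def \<sigma>_def power2_eq_square algebra_simps)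
      then show ?case using elim by blast
    qed
  qed
  have ends: "y x = 0" if "x \<le> l \<or> l + b \<le> x" for x
    using that Pends r by (auto simp: y_def y0_def r_def dest: antisym)
  have us0: "us 0 = 0"
    using l Pends by (cases "l = 0") (auto simp: us_def v0_def y0_def)
  have cpt: "compact (closure {x \<in> {0..}. y x \<noteq> 0})"
  proof -
    have "{x \<in> {0..}. y x \<noteq> 0} \<subseteq> {l..r}" by (auto simp: y_def)
    then have "bounded {x \<in> {0..}. y x \<noteq> 0}" by (rule bounded_subset[rotated]) simp
    then show ?thesis by (simp add: compact_closure)
  qed
  have mem: "(abs_l2 y, abs_l2 w) \<in> minimal_operator s"
    unfolding minimal_operator_def using yL wL q ends[of 0] l us0 cpt by blast
  have yn: "(norm (abs_l2 y))\<^sup>2 = integral {l..r} (\<lambda>x. (cmod (y0 x))\<^sup>2)"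
  proof -
    have "(norm (abs_l2 y))\<^sup>2 = integral {0..r} (\<lambda>x. (cmod (y x))\<^sup>2)"
      unfolding norm_abs_l2_square[OF yL]
      by (rule halfline_integral(2)[OF r0 _ L2_on_integrable[OF L2_on_subset[OF yL]]]) (auto simp: y_def)
    also have "\<dots> = integral {0..r} (\<lambda>x. if x \<in> {l..r} then (cmod (y0 x))\<^sup>2 else 0)"
      by (rule integral_cong) (simp add: y_def)
    also have "\<dots> = integral ({l..r} \<inter> {0..r}) (\<lambda>x. (cmod (y0 x))\<^sup>2)" by (rule integral_restrict_Int)
    also have "{l..r} \<inter> {0..r} = {l..r}" using l by auto
    finally show ?thesis .
  qed
  have wn: "(norm (abs_l2 w))\<^sup>2 = integral {l..r} (\<lambda>x. (cmod (w0 x))\<^sup>2)"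
  proof -
    have "(norm (abs_l2 w))\<^sup>2 = integral {0..r} (\<lambda>x. (cmod (w x))\<^sup>2)"
      unfolding norm_abs_l2_square[OF wL]
      by (rule halfline_integral(2)[OF r0 _ L2_on_integrable[OF wb]]) (auto simp: w_def)
    also have "\<dots> = integral {0..r} (\<lambda>x. if x \<in> {l..r} then (cmod (w0 x))\<^sup>2 else 0)"
      by (rule integral_cong) (simp add: w_def)
    also have "\<dots> = integral ({l..r} \<inter> {0..r}) (\<lambda>x. (cmod (w0 x))\<^sup>2)" by (rule integral_restrict_Int)
    also have "{l..r} \<inter> {0..r} = {l..r}" using l by auto
    finally show ?thesis .
  qed
  have y0i: "(\<lambda>x. (cmod (y0 x))\<^sup>2) integrable_on {u..v}" if "l \<le> u" "v \<le> r" for u v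
    by (rule integrable_on_subinterval[OF L2_on_square_integrable_on[OF L2_on_continuous[OF primitive_on_continuous[OF py]]]]) (use that in auto)
  have Pn: "cmod (P x) = (sin (\<theta> x))\<^sup>2" for x by (simp add: P_def norm_power)
  have lower: "b / 18 \<le> (norm (abs_l2 y))\<^sup>2"
  proof -
    have "b / 18 = integral {l + b/4..l + 3*b/4} (\<lambda>x. 1/9)" using l by simp
    also have "\<dots> \<le> integral {l + b/4..l + 3*b/4} (\<lambda>x. (cmod (y0 x))\<^sup>2)"
    proof (rule integral_le)
      show "(\<lambda>x. 1/9 :: real) integrable_on {l + b/4..l + 3*b/4}" by (rule integrable_const_ivl)
      show "(\<lambda>x. (cmod (y0 x))\<^sup>2) integrable_on {l + b/4..l + 3*b/4}" by (rule y0i) (use l in \<open>auto simp: r_def\<close>)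
      fix x assume x: "x \<in> {l + b/4..l + 3*b/4}"
      have xr: "x \<in> {l..r}" using x l by (auto simp: r_def)
      have "pi / 4 \<le> \<theta> x" "\<theta> x \<le> 3 * pi / 4"
      proof -
        have "pi / b * (b / 4) \<le> pi / b * (x - l)" "pi / b * (x - l) \<le> pi / b * (3 * b / 4)"
          using x l by (intro mult_left_mono; auto)+
        then show "pi / 4 \<le> \<theta> x" "\<theta> x \<le> 3 * pi / 4" using l by (auto simp: \<theta>_def)
      qed
      then have "0 \<le> cos (2 * \<theta> x - pi)" by (intro cos_ge_zero) auto
      then have "cos (2 * \<theta> x) \<le> 0" by simp
      then have "1/2 \<le> (sin (\<theta> x))\<^sup>2" by (simp add: cos_double_sin)
      then have "1/2 * (2/3) \<le> cmod (P x) * cmod (\<phi> x)" using \<phi>2(2)[OF xr] unfolding Pn by (intro mult_mono) auto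
      then have "(1/3)\<^sup>2 \<le> (cmod (y0 x))\<^sup>2" unfolding y0_def norm_mult by (intro power_mono) auto
      then show "1/9 \<le> (cmod (y0 x))\<^sup>2" by (simp add: power2_eq_square)
    qed
    also have "\<dots> \<le> integral {l..r} (\<lambda>x. (cmod (y0 x))\<^sup>2)"
      by (intro integral_subset_le y0i) (use l in \<open>auto simp: r_def\<close>)
    finally show ?thesis unfolding yn .
  qed
  have upper: "(norm (abs_l2 y))\<^sup>2 \<le> 4 * b"
  proof -
    have "integral {l..r} (\<lambda>x. (cmod (y0 x))\<^sup>2) \<le> integral {l..r} (\<lambda>x. 4)"
    proof (rule integral_le)
      show "(\<lambda>x. 4 :: real) integrable_on {l..r}" by (rule integrable_const_ivl)
      show "(\<lambda>x. (cmod (y0 x))\<^sup>2) integrable_on {l..r}" by (rule y0i) auto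
      fix x assume x: "x \<in> {l..r}"
      have "cmod (P x) \<le> 1" unfolding Pn by (simp add: abs_square_le_1)
      then have "cmod (y0 x) \<le> 1 * (4/3)" unfolding y0_def norm_mult using \<phi>2(1)[OF x] by (intro mult_mono) auto
      then have "(cmod (y0 x))\<^sup>2 \<le> 2\<^sup>2" by (intro power_mono) auto
      then show "(cmod (y0 x))\<^sup>2 \<le> 4" by simp
    qed
    then show ?thesis unfolding yn using r by simp
  qed
  define k where "k = 2 * (pi / b)\<^sup>2 + pi / b"
  have k: "k \<ge> 0" using l by (simp add: k_def)
  have wle: "(norm (abs_l2 w))\<^sup>2 \<le> k\<^sup>2 * 13"
  proof -
    have "integral {l..r} (\<lambda>x. (cmod (w0 x))\<^sup>2) \<le> integral {l..r} (\<lambda>x. k\<^sup>2 * (8 + 18 * (cmod (\<sigma> x))\<^sup>2))"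
    proof (rule integral_le)
      show "(\<lambda>x. (cmod (w0 x))\<^sup>2) integrable_on {l..r}" by (rule L2_on_square_integrable_on[OF w0l])
      show "(\<lambda>x. k\<^sup>2 * (8 + 18 * (cmod (\<sigma> x))\<^sup>2)) integrable_on {l..r}"
        by (intro integrable_on_mult_right integrable_add integrable_const_ivl L2_on_square_integrable_on \<sigma>l)
      fix x assume x: "x \<in> {l..r}"
      have P2b: "cmod (P2 x) \<le> 2 * (pi / b)\<^sup>2"
      proof -
        have "\<bar>(cos (\<theta> x))\<^sup>2 - (sin (\<theta> x))\<^sup>2\<bar> \<le> 1" using abs_cos_le_one[of "2 * \<theta> x"] by (simp only: cos_double)
        then have "2 * (pi / b)\<^sup>2 * \<bar>(cos (\<theta> x))\<^sup>2 - (sin (\<theta> x))\<^sup>2\<bar> \<le> 2 * (pi / b)\<^sup>2 * 1" by (intro mult_left_mono) auto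
        then show ?thesis unfolding P2_def norm_of_real by (simp add: abs_mult)
      qed
      have P1b: "cmod (P1 x) \<le> pi / b"
      proof -
        have "2 * (pi / b) * sin (\<theta> x) * cos (\<theta> x) = pi / b * sin (2 * \<theta> x)" by (simp add: sin_double)
        then have "cmod (P1 x) = pi / b * \<bar>sin (2 * \<theta> x)\<bar>" unfolding P1_def norm_of_real using l by (simp only:) (simp only: abs_mult, simp)
        also have "\<dots> \<le> pi / b * 1" using l by (intro mult_left_mono) auto
        finally show ?thesis by simp
      qed
      have "cmod (w0 x) \<le> cmod (P2 x) * cmod (\<phi> x) + 2 * cmod (P1 x) * (cmod (u x) + cmod (\<sigma> x) * cmod (\<phi> x))"
      proof -
        have "cmod (w0 x) \<le> cmod (- P2 x * \<phi> x) + cmod (2 * P1 x * (u x + \<sigma> x * \<phi> x))"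
          unfolding w0_def by (rule norm_triangle_ineq4)
        also have "\<dots> \<le> cmod (P2 x) * cmod (\<phi> x) + 2 * cmod (P1 x) * (cmod (u x) + cmod (\<sigma> x) * cmod (\<phi> x))"
          using norm_triangle_ineq[of "u x" "\<sigma> x * \<phi> x"] by (intro add_mono) (auto simp: norm_mult intro!: mult_left_mono)
        finally show ?thesis .
      qed
      also have "\<dots> \<le> k * (4/3) + 2 * k * (1/3 + cmod (\<sigma> x) * (4/3))"
        using P1b P2b \<phi>2(1)[OF x] ub[OF x] k l
        by (intro add_mono mult_mono) (auto simp: k_def intro: order_trans)
      also have "\<dots> \<le> k * (2 + 3 * cmod (\<sigma> x))"
        using k mult_nonneg_nonneg[OF k norm_ge_zero[of "\<sigma> x"]] by (simp add: algebra_simps)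
      finally have "(cmod (w0 x))\<^sup>2 \<le> (k * (2 + 3 * cmod (\<sigma> x)))\<^sup>2" by (intro power_mono) auto
      also have "\<dots> = k\<^sup>2 * (2 + 3 * cmod (\<sigma> x))\<^sup>2" by (simp add: power_mult_distrib)
      also have "\<dots> \<le> k\<^sup>2 * (8 + 18 * (cmod (\<sigma> x))\<^sup>2)"
        using zero_le_power2[of "2 - 3 * cmod (\<sigma> x)"] by (intro mult_left_mono) (auto simp: power2_eq_square algebra_simps)
      finally show "(cmod (w0 x))\<^sup>2 \<le> k\<^sup>2 * (8 + 18 * (cmod (\<sigma> x))\<^sup>2)" .
    qed
    also have "\<dots> = k\<^sup>2 * (8 * b + 18 * Q)"
      unfolding Q_def Henstock_Kurzweil_Integration.integral_mult_right
        Henstock_Kurzweil_Integration.integral_add[OF integrable_const_ivl integrable_on_mult_right[OF L2_on_square_integrable_on[OF \<sigma>l]]]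
      using r by simp
    also have "\<dots> \<le> k\<^sup>2 * 13" using bQ by (intro mult_left_mono) auto
    finally show ?thesis unfolding wn .
  qed
  show ?thesis
    by (rule that[OF yL wL mem ends lower upper wle[unfolded k_def]])
qed

lemma pigeonhole_interval:
  assumes f: "\<And>u v. 0 \<le> u \<Longrightarrow> f integrable_on {u..v}" and x: "0 \<le> x" and b: "0 < b"
    and le: "integral {x..x + real n * b} f \<le> C" and n: "n > 0"
  obtains j where "j < n" "integral {x + real j * b..x + real j * b + b} f \<le> C / real n"
proof -
  have "integral {x..x + real m * b} f = (\<Sum>j<m. integral {x + real j * b..x + real j * b + b} f)" for m
  proof (induction m)
    case (Suc m)
    have "integral {x..x + real (Suc m) * b} f = integral {x..x + real m * b} f + integral {x + real m * b..x + real (Suc m) * b} f"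
      by (rule Henstock_Kurzweil_Integration.integral_combine[symmetric]) (use b f x in \<open>auto simp: mult_right_mono\<close>)
    moreover have e: "x + real (Suc m) * b = x + real m * b + b" by (simp add: algebra_simps)
    ultimately show ?case using Suc unfolding e by simp
  qed simp
  then have sum: "(\<Sum>j<n. integral {x + real j * b..x + real j * b + b} f) \<le> C" using le by simp
  have "\<exists>j<n. integral {x + real j * b..x + real j * b + b} f \<le> C / real n"
  proof (rule ccontr)
    assume "\<not> ?thesis"
    then have "\<And>j. j \<in> {..<n} \<Longrightarrow> C / real n < integral {x + real j * b..x + real j * b + b} f" by auto
    then have "(\<Sum>j<n. C / real n) < (\<Sum>j<n. integral {x + real j * b..x + real j * b + b} f)"
      using n by (intro sum_strict_mono) auto
    then show False using sum n by simp
  qed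
  then show ?thesis using that by blast
qed

text \<open>If the oscillation does not tend to infinity, there are bumps of one fixed length \<open>b\<close> arbitrarily far out. Infinitely many of
  them with disjoint supports are orthogonal, have norms bounded below, and all lie in the image of one bounded set under the
  resolvent, so they have no convergent subsequence.\<close>

lemma compact_resolvent_imp_oscillation:
  assumes s: "L2_loc s" and ext: "has_extension_with_compact_resolvent (minimal_operator s)" and a: "a > 0"
  shows "filterlim (\<lambda>x. oscillation s x a) at_top at_top"
proof (rule ccontr)
  assume "\<not> ?thesis"
  then obtain C0 where C0: "\<not> eventually (\<lambda>x. C0 \<le> oscillation s x a) at_top"
    unfolding filterlim_at_top by blast
  define C where "C = \<bar>C0\<bar> / (2 * a)"
  have C: "C \<ge> 0" using a by (simp add: C_def)
  have far: "\<exists>x\<ge>x0. oscillation s x a \<le> \<bar>C0\<bar>" for x0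
    using C0 unfolding eventually_at_top_linorder by (metis abs_ge_self linorder_le_cases order_trans)
  (* Cutting an interval of length a into n pieces, one of them satisfies the smallness assumption of
     bump_in_minimal_operator with left-hand side at most q / n. *)
  define q where "q = a + 2 * sqrt (a * C) + C"
  have q: "q > 0" using a C by (simp add: q_def add_pos_nonneg)
  obtain n :: nat where n: "4 * q \<le> real n" using real_arch_simple by blast
  have n0: "n > 0" using n q by (cases n) auto
  define b where "b = a / real n"
  have b: "b > 0" "real n * b = a" using a n0 by (auto simp: b_def)
  define \<Lambda> where "\<Lambda> = sqrt ((2 * (pi / b)\<^sup>2 + pi / b)\<^sup>2 * 13)"
  have bumps: "\<exists>y w X. L2_on {0..} y \<and> (abs_l2 y, abs_l2 w) \<in> minimal_operator s \<and> x0 \<le> X \<and>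
      (\<forall>x. x \<le> x0 \<or> X \<le> x \<longrightarrow> y x = 0) \<and> b / 18 \<le> (norm (abs_l2 y))\<^sup>2 \<and> norm (abs_l2 y) \<le> sqrt (4 * b) \<and> norm (abs_l2 w) \<le> \<Lambda>" if x0: "x0 \<ge> 0" for x0
  proof -
    obtain x where x: "x \<ge> x0" "oscillation s x a \<le> \<bar>C0\<bar>" using far by blast
    have sl: "L2_on {u..v} s" if "0 \<le> u" for u v
    proof -
      have "L2_on {0..max v 0} s" using s by (simp add: L2_loc_def)
      then show ?thesis by (rule L2_on_subset) (use that in auto)
    qed
    have x0': "0 \<le> x" using x x0 by simp
    obtain c where c: "oscillation s x a = 2 * a * integral {x..x+a} (\<lambda>\<xi>. (cmod (s \<xi> - c))\<^sup>2)"
      by (rule oscillation_mean[OF sl[OF x0'] a]) blast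
    have Cle: "integral {x..x + real n * b} (\<lambda>\<xi>. (cmod (s \<xi> - c))\<^sup>2) \<le> C"
      using x(2) a unfolding c b(2) C_def by (simp add: field_simps)
    have sci: "(\<lambda>\<xi>. (cmod (s \<xi> - c))\<^sup>2) integrable_on {u..v}" if "0 \<le> u" for u v
      by (intro L2_on_square_integrable_on L2_on_diff sl that L2_on_continuous) auto
    obtain j where j: "j < n" "integral {x + real j * b..x + real j * b + b} (\<lambda>\<xi>. (cmod (s \<xi> - c))\<^sup>2) \<le> C / real n"
      by (rule pigeonhole_interval[OF sci x0' b(1) Cle n0])
    define l where "l = x + real j * b"
    have l: "0 \<le> l" "x0 \<le> l" using x x0 b by (auto simp: l_def add_increasing2)
    define Q where "Q = integral {l..l+b} (\<lambda>\<xi>. (cmod (s \<xi> - c))\<^sup>2)"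
    have Q: "0 \<le> Q" "Q \<le> C / real n" using j
      by (auto simp: Q_def l_def intro!: Henstock_Kurzweil_Integration.integral_nonneg sci[unfolded l_def] l[unfolded l_def])
    have "b + 2 * sqrt (b * Q) + Q \<le> b + 2 * sqrt (b * (C / real n)) + C / real n"
      using Q b by (intro add_mono mult_left_mono real_sqrt_le_mono) auto
    also have "b * (C / real n) = a * C / (real n)\<^sup>2" by (simp add: b_def power2_eq_square)
    also have "sqrt (a * C / (real n)\<^sup>2) = sqrt (a * C) / real n" by (simp add: real_sqrt_divide)
    also have "b + 2 * (sqrt (a * C) / real n) + C / real n = q / real n" by (simp add: b_def q_def add_divide_distrib)
    also have "\<dots> \<le> 1/4" using n n0 by (simp add: field_simps)
    finally have small: "b + 2 * sqrt (b * Q) + Q \<le> 1/4" .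
    obtain y w where yw: "L2_on {0..} y" "L2_on {0..} w" "(abs_l2 y, abs_l2 w) \<in> minimal_operator s"
      "\<And>x. x \<le> l \<or> l + b \<le> x \<Longrightarrow> y x = 0"
      "b / 18 \<le> (norm (abs_l2 y))\<^sup>2" "(norm (abs_l2 y))\<^sup>2 \<le> 4 * b"
      "(norm (abs_l2 w))\<^sup>2 \<le> (2 * (pi / b)\<^sup>2 + pi / b)\<^sup>2 * 13"
      by (rule bump_in_minimal_operator[OF s l(1) b(1) small[unfolded Q_def]]) blast
    show ?thesis
    proof (intro exI conjI)
      show "L2_on {0..} y" "(abs_l2 y, abs_l2 w) \<in> minimal_operator s" "b / 18 \<le> (norm (abs_l2 y))\<^sup>2" by (fact yw)+
      show "x0 \<le> l + b" using l b by simp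
      show "\<forall>x. x \<le> x0 \<or> l + b \<le> x \<longrightarrow> y x = 0" using yw(4) l by auto
      show "norm (abs_l2 y) \<le> sqrt (4 * b)" using yw(6) by (rule real_le_rsqrt)
      show "norm (abs_l2 w) \<le> \<Lambda>" unfolding \<Lambda>_def using yw(7) by (rule real_le_rsqrt)
    qed
  qed
  then have "\<forall>x0. \<exists>y w X. x0 \<ge> 0 \<longrightarrow> (L2_on {0..} y \<and> (abs_l2 y, abs_l2 w) \<in> minimal_operator s \<and> x0 \<le> X \<and>
      (\<forall>x. x \<le> x0 \<or> X \<le> x \<longrightarrow> y x = 0) \<and> b / 18 \<le> (norm (abs_l2 y))\<^sup>2 \<and>
      norm (abs_l2 y) \<le> sqrt (4 * b) \<and> norm (abs_l2 w) \<le> \<Lambda>)" by simp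
  then obtain ys ws Xs where YS: "\<forall>x0\<ge>0. L2_on {0..} (ys x0) \<and> (abs_l2 (ys x0), abs_l2 (ws x0)) \<in> minimal_operator s \<and> x0 \<le> Xs x0 \<and>
      (\<forall>x. x \<le> x0 \<or> Xs x0 \<le> x \<longrightarrow> ys x0 x = 0) \<and> b / 18 \<le> (norm (abs_l2 (ys x0)))\<^sup>2 \<and>
      norm (abs_l2 (ys x0)) \<le> sqrt (4 * b) \<and> norm (abs_l2 (ws x0)) \<le> \<Lambda>"
    by (auto simp only: choice_iff)
  then have ys: "\<And>x0. x0 \<ge> 0 \<Longrightarrow> L2_on {0..} (ys x0)" "\<And>x0. x0 \<ge> 0 \<Longrightarrow> (abs_l2 (ys x0), abs_l2 (ws x0)) \<in> minimal_operator s"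
    "\<And>x0. x0 \<ge> 0 \<Longrightarrow> x0 \<le> Xs x0" "\<And>x0 x. x0 \<ge> 0 \<Longrightarrow> x \<le> x0 \<or> Xs x0 \<le> x \<Longrightarrow> ys x0 x = 0"
    "\<And>x0. x0 \<ge> 0 \<Longrightarrow> b / 18 \<le> (norm (abs_l2 (ys x0)))\<^sup>2" "\<And>x0. x0 \<ge> 0 \<Longrightarrow> norm (abs_l2 (ys x0)) \<le> sqrt (4 * b)"
    "\<And>x0. x0 \<ge> 0 \<Longrightarrow> norm (abs_l2 (ws x0)) \<le> \<Lambda>" by blast+
  define x where "x = (\<lambda>k. (Xs ^^ k) 0)"
  have xS: "x (Suc k) = Xs (x k)" for k by (simp add: x_def)
  have x0: "x k \<ge> 0" for k
  proof (induction k)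
    case 0 then show ?case by (simp add: x_def)
  next
    case (Suc k) then show ?case using ys(3)[OF Suc] by (simp add: xS)
  qed
  have xmono: "x i \<le> x j" if "i \<le> j" for i j
    using that by (rule lift_Suc_mono_le[of x, rotated]) (use ys(3)[OF x0] in \<open>simp add: xS\<close>)
  define \<eta> where "\<eta> = (\<lambda>k. abs_l2 (ys (x k)))"
  have orth: "b / 9 \<le> (norm (\<eta> i - \<eta> j))\<^sup>2" if ij: "i < j" for i j
  proof -
    have z: "ys (x i) t * cnj (ys (x j) t) = 0" for t
    proof (cases "t \<le> x j")
      case True
      then show ?thesis using ys(4)[OF x0, of t j] by simp
    next
      case False
      moreover have "x (Suc i) \<le> x j" using ij by (intro xmono) auto
      ultimately have "Xs (x i) \<le> t" by (simp add: xS)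
      then show ?thesis using ys(4)[OF x0, of t i] by simp
    qed
    have "cinner_l2 (\<eta> i) (\<eta> j) = 0" unfolding \<eta>_def cinner_abs_l2[OF ys(1)[OF x0] ys(1)[OF x0]] z by simp
    then have "inner (\<eta> i) (\<eta> j) = 0" by (simp add: inner_l2_def)
    then have "(norm (\<eta> i - \<eta> j))\<^sup>2 = (norm (\<eta> i))\<^sup>2 + (norm (\<eta> j))\<^sup>2"
      by (simp add: power2_norm_eq_inner inner_diff_left inner_diff_right inner_commute)
    then show ?thesis using ys(5)[OF x0[of i]] ys(5)[OF x0[of j]] by (simp add: \<eta>_def)
  qed
  obtain M where M: "linear_operator M" "minimal_operator s \<subseteq> M" "has_compact_resolvent M"
    using ext unfolding has_extension_with_compact_resolvent_def by blast
  obtain z where "z \<in> resolvent_set M" using M(3) unfolding has_compact_resolvent_def by blast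
  then obtain Rz where Rz: "is_resolvent M z Rz" "compact_map Rz"
    using M(3) unfolding has_compact_resolvent_def resolvent_set_def by blast
  define B where "B = cball (0::l2) (\<Lambda> + cmod z * sqrt (4 * b))"
  have in_image: "\<eta> k \<in> closure (Rz ` B)" for k
  proof -
    define v where "v = abs_l2 (ws (x k)) - scaleC_l2 z (\<eta> k)"
    have "(\<eta> k, abs_l2 (ws (x k))) \<in> M" using M(2) ys(2)[OF x0[of k]] by (auto simp: \<eta>_def)
    then have "(v, \<eta> k) \<in> (shift_operator M z)\<inverse>" unfolding shift_operator_def v_def by blast
    then have "\<eta> k = Rz v" using Rz(1) unfolding is_resolvent_def by blast
    moreover have "norm v \<le> \<Lambda> + cmod z * sqrt (4 * b)"
    proof -
      have "norm v \<le> norm (abs_l2 (ws (x k))) + norm (scaleC_l2 z (\<eta> k))" unfolding v_def by (rule norm_triangle_ineq4)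
      also have "\<dots> \<le> \<Lambda> + cmod z * sqrt (4 * b)"
        unfolding norm_scaleC_l2 \<eta>_def by (intro add_mono mult_left_mono ys(6,7) x0) auto
      finally show ?thesis .
    qed
    then have "v \<in> B" by (simp add: B_def dist_norm)
    ultimately have "\<eta> k \<in> Rz ` B" by blast
    then show ?thesis by (rule subsetD[OF closure_subset])
  qed
  have "compact (closure (Rz ` B))" using Rz(2) unfolding compact_map_def B_def by blast
  then have "seq_compact (closure (Rz ` B))" by (simp add: compact_eq_seq_compact_metric)
  then obtain \<zeta> \<rho> where \<rho>: "strict_mono \<rho>" "(\<eta> \<circ> \<rho>) \<longlonglongrightarrow> \<zeta>"
    using in_image unfolding seq_compact_def by metis
  have "Cauchy (\<eta> \<circ> \<rho>)" using \<rho>(2) by (rule LIMSEQ_imp_Cauchy)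
  moreover have sb: "0 < sqrt (b / 9)" using b by simp
  ultimately obtain N where N: "\<forall>m\<ge>N. \<forall>n\<ge>N. norm ((\<eta> \<circ> \<rho>) m - (\<eta> \<circ> \<rho>) n) < sqrt (b / 9)"
    using CauchyD by blast
  have "\<rho> N < \<rho> (Suc N)" using \<rho>(1) by (simp add: strict_mono_less)
  then have "b / 9 \<le> (norm (\<eta> (\<rho> N) - \<eta> (\<rho> (Suc N))))\<^sup>2" by (rule orth)
  then have "sqrt (b / 9) \<le> norm (\<eta> (\<rho> N) - \<eta> (\<rho> (Suc N)))" by (rule real_le_lsqrt[rotated -1]) (use b in auto)
  moreover have "norm ((\<eta> \<circ> \<rho>) N - (\<eta> \<circ> \<rho>) (Suc N)) < sqrt (b / 9)" using N by (metis le_refl le_SucI)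
  ultimately show False by simp
qed

theorem theorem2:
  fixes s f g :: "real \<Rightarrow> complex" and d \<alpha> \<beta> :: real
  assumes "L2_loc s" and "L2_unif f" and "L2_unif g"
    and "d > 0"
    and "0 \<le> \<beta> - \<alpha>" and "\<beta> - \<alpha> < pi" and "\<bar>\<alpha>\<bar> < pi" and "\<bar>\<beta>\<bar> < pi"
    and "\<And>x t. x \<ge> 0 \<Longrightarrow> t \<ge> 0 \<Longrightarrow> 0 \<le> x - t \<Longrightarrow> x - t \<le> d \<Longrightarrow>
           arg_in (s x + f x - s t - g t) \<alpha> \<beta>"
  shows "strictly_sectorial (minimal_operator s) \<and>
    (has_extension_with_compact_resolvent (minimal_operator s) \<longleftrightarrow>
      (\<forall>a>0. filterlim
         (\<lambda>x. \<integral>\<eta>. (\<integral>\<xi>. (cmod (s \<xi> - s \<eta>))\<^sup>2 \<partial>lebesgue_on {x..x+a}) \<partial>lebesgue_on {x..x+a})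
         at_top at_top))"
proof -
  interpret sector_condition s f g d \<alpha> \<beta> by standard (use assms in auto)
  obtain C where C: "C \<ge> 0" "\<forall>y h. test_function y h \<longrightarrow>
    \<bar>Im (e * form s y h y h)\<bar> + \<kappa> / 2 * (norm (abs_l2 h))\<^sup>2 \<le> T * Re (e * form s y h y h) + C * (norm (abs_l2 y))\<^sup>2"
    by (rule form_sectorial) blast
  interpret sectorial_form s f g d \<alpha> \<beta> C by standard (use C in auto)
  have sectorial: "strictly_sectorial (minimal_operator s)"
    by (rule minimal_operator_strictly_sectorial)
  have osc: "oscillation s = (\<lambda>x a. \<integral>\<eta>. (\<integral>\<xi>. (cmod (s \<xi> - s \<eta>))\<^sup>2 \<partial>lebesgue_on {x..x+a}) \<partial>lebesgue_on {x..x+a})"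
    by (intro ext) (simp add: oscillation_def)
  have "has_extension_with_compact_resolvent (minimal_operator s) \<longleftrightarrow> (\<forall>a>0. filterlim (\<lambda>x. oscillation s x a) at_top at_top)"
  proof
    assume "has_extension_with_compact_resolvent (minimal_operator s)"
    then show "\<forall>a>0. filterlim (\<lambda>x. oscillation s x a) at_top at_top"
      using compact_resolvent_imp_oscillation[OF assms(1)] by blast
  next
    assume "\<forall>a>0. filterlim (\<lambda>x. oscillation s x a) at_top at_top"
    then have "has_compact_resolvent extension" by (intro extension_compact_resolvent form_balls_compact)
    then show "has_extension_with_compact_resolvent (minimal_operator s)"
      unfolding has_extension_with_compact_resolvent_def
      using extension_linear minimal_operator_subset_extension by blast
  qed
  then show ?thesis using sectorial unfolding osc by blast
qed

end
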